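(* Let $B$ be an (acyclic) exchange matrix of finite type $D$, let $\tilde B^{\mathrm{univ}}$ be the universal-coefficient extension of $B$, $X^{\mathrm{univ}}=X(\tilde B^{\mathrm{univ}})$ and $T^{\mathrm{univ}}=T(\tilde B^{\mathrm{univ}})$. Then $\mathcal{M}_D\cong\mathring X^{\mathrm{univ}}/T^{\mathrm{univ}}$ is isomorphic to the locus $X^{\mathrm{univ}}(1)\subset X^{\mathrm{univ}}$ where all mutable cluster variables have been set to $1$. The isomorphism $\mathbb{C}[\mathcal{M}_D]\cong\mathbb{C}[X^{\mathrm{univ}}(1)]$ is given by $u_\gamma\mapsto z_\gamma$, $\gamma\in\Pi$.
   Context: Cluster set-up. $D$ is a connected finite type Dynkin diagram with vertex set $I=\{1,\dots,n\}$ and Cartan matrix $(a_{ij})$. Fix an orientation of the underlying tree of $D$, with edges written $i\to j$; the associated exchange matrix $B$ (of type $D$) has $B_{ij}=-a_{ij}$ if $i\to j$, $B_{ij}=a_{ij}$ if $j\to i$, and $B_{ij}=0$ otherwise. An extended exchange matrix $\tilde B$ is an $(n+m)\times n$ integer matrix with top $n\times n$ block $B$. The cluster algebra $\mathcal{A}(\tilde B)$ is the $\mathbb{C}$-algebra generated by all mutable cluster variables, the frozen variables and the inverses of the frozen variables; the exchange relation at a seed with matrix $(b_{ij})$ is $x_kx_k'=\prod_{b_{ik}>0}x_i^{b_{ik}}+\prod_{b_{ik}<0}x_i^{-b_{ik}}$. Indexing. Put $x_{(0,i)}=x_i$ (initial cluster) and, for $t\ge1$, let the cluster $\{x_{(t,i)}\mid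 i\in I\}$ be obtained from $\{x_{(t-1,i)}\mid i\in I\}$ by mutating exactly once at each $i\in I$, always at a source of the current orientation ($i\to j$ iff $b_{ij}>0$). Let $r_i+1$ be the least positive $t$ such that $x_{(t,i)}$ is an initial variable and write $x_{(r_i+1,i)}=x_{(0,i^* )}$; $i\mapsto i^*$ is an involution of $I$. Set $\Pi=\{(s,i)\mid i\in I,\ 0\le s\le r_i\}$; then $\gamma\mapsto x_\gamma$ is a bijection from $\Pi$ to the set of mutable cluster variables. Put $(-1,i):=(r_{i^*},i^* )$ and let $\tau:\Pi\to\Pi$ be the bijection $\tau(t,j)=(t-1,j)$. Compatibility degree. $(\omega\|\gamma)\in\mathbb{Z}_{\ge0}$, for $\omega,\gamma\in\Pi$, is the unique function with $(\tau\omega\|\tau\gamma)=(\omega\|\gamma)$ and such that $((0,i)\|\gamma)$ is $\max(0,d_i)$, where $d_i$ is the exponent of $x_i$ in the denominator of the Laurent expansion of $x_\gamma$ in the initial cluster (so $(\gamma\|\gamma)=0$). Cluster configuration space. $\mathcal{M}_D=\operatorname{Spec}(\mathbb{C}[u_\gamma^{\pm1}\mid\gamma\in\Pi]/I_D)$, where $I_D$ is generated by $R_\gamma=u_\gamma+\prod_{\omega\in\Pi}u_\omega^{(\omega\|\gamma)}-1$, $\gamma\in\Pi$. Quotient. $X(\tilde B)=\operatorname{Spec}\mathcal{A}(\tilde B)$; $\mathring X$ is the open locus where all mutable cluster variables are non-vanishing. $T(\tilde B)$ is the group of algebra automorphisms of $\mathcal{A}(\tilde B)$ that multiply each mutable and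 each frozen variable by a nonzero scalar; $\mathring X/T:=\operatorname{Spec}(\mathbb{C}[\mathring X]^T)$. Universal coefficients. With $r=|\Pi|$, $\tilde B^{\mathrm{univ}}$ is the $(n+r)\times n$ matrix with top block $B$ and whose remaining $r$ rows are the $\mathbf{g}$-vectors of the cluster algebra with exchange matrix $B^T$ (the $\mathbf{g}$-vector of a cluster variable for an exchange matrix $C$ is its degree in the principal coefficient cluster algebra of $C$, with initial variables of degree $\deg x_i=e_i$ and principal frozen variables of degree $\deg y_i=-Ce_i$). These rows are indexed by $\Pi$, with corresponding frozen variables $z_\gamma$, in such a way that the primitive exchange relations of $\mathcal{A}(\tilde B^{\mathrm{univ}})$ are, for $\gamma=(t,j)\in\Pi$, $$x_{(t-1,j)}x_{(t,j)}=z_{(t,j)}\prod_{i\to j}x_{(t,i)}^{-a_{ij}}\prod_{j\to i}x_{(t-1,i)}^{-a_{ij}}+\prod_{\omega\in\Pi}z_\omega^{(\omega\|(t,j))}.$$ *)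

theory Defs
  imports
    Complex_Main
    "HOL-Library.Poly_Mapping"
    "HOL-Computational_Algebra.Fraction_Field"
    "HOL-Algebra.QuotRing"
begin

section \<open>Complex algebras\<close>

text \<open>
  A complex algebra is given by a ring \<open>R\<close> together with its structure map from the
  complex numbers. All schemes involved are affine, so isomorphisms of complex schemes are
  expressed as isomorphisms of complex algebras between the coordinate rings.
\<close>

definition calg_iso ::
    "('a, 'm) ring_scheme \<Rightarrow> (complex \<Rightarrow> 'a) \<Rightarrow> ('b, 'k) ring_scheme \<Rightarrow> (complex \<Rightarrow> 'b)
      \<Rightarrow> ('a \<Rightarrow> 'b) set" where
  "calg_iso R \<iota> S \<kappa> = {\<phi> \<in> ring_iso R S. \<forall>c. \<phi> (\<iota> c) = \<kappa> c}"

definition ring_on :: "'a::comm_ring_1 set \<Rightarrow> 'a ring" where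
  "ring_on A = \<lparr>carrier = A, mult = (*), one = 1, zero = 0, add = (+)\<rparr>"


section \<open>Dynkin diagrams and exchange matrices\<close>

text \<open>
  Matrices are functions on pairs of indices, with rows and columns numbered from \<open>1\<close>; only
  the entries inside the stated range are meaningful.
\<close>

definition finite_type_cartan :: "nat \<Rightarrow> (nat \<Rightarrow> nat \<Rightarrow> int) \<Rightarrow> bool" where
  "finite_type_cartan n a \<longleftrightarrow>
     (\<forall>i\<in>{1..n}. a i i = 2) \<and>
     (\<forall>i\<in>{1..n}. \<forall>j\<in>{1..n}. i \<noteq> j \<longrightarrow> a i j \<le> 0) \<and>
     (\<forall>i\<in>{1..n}. \<forall>j\<in>{1..n}. a i j = 0 \<longleftrightarrow> a j i = 0) \<and>
     (\<exists>d :: nat \<Rightarrow> real.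
        (\<forall>i\<in>{1..n}. d i > 0) \<and>
        (\<forall>i\<in>{1..n}. \<forall>j\<in>{1..n}. d i * of_int (a i j) = d j * of_int (a j i)) \<and>
        (\<forall>v. (\<exists>i\<in>{1..n}. v i \<noteq> 0) \<longrightarrow>
             (\<Sum>i\<in>{1..n}. \<Sum>j\<in>{1..n}. d i * of_int (a i j) * v i * v j) > 0))"

definition connected_diagram :: "nat \<Rightarrow> (nat \<Rightarrow> nat \<Rightarrow> int) \<Rightarrow> bool" where
  "connected_diagram n a \<longleftrightarrow> n \<ge> 1 \<and>
     (\<forall>i\<in>{1..n}. \<forall>j\<in>{1..n}.
        (i, j) \<in> {(k, l). k \<in> {1..n} \<and> l \<in> {1..n} \<and> a k l \<noteq> 0}\<^sup>*)"

definition orientation :: "nat \<Rightarrow> (nat \<Rightarrow> nat \<Rightarrow> int) \<Rightarrow> (nat \<Rightarrow> nat \<Rightarrow> bool) \<Rightarrow> bool" where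
  "orientation n a arr \<longleftrightarrow>
     (\<forall>i\<in>{1..n}. \<forall>j\<in>{1..n}.
        ((arr i j \<or> arr j i) \<longleftrightarrow> (i \<noteq> j \<and> a i j \<noteq> 0)) \<and> \<not> (arr i j \<and> arr j i))"

definition exchange_matrix ::
    "(nat \<Rightarrow> nat \<Rightarrow> int) \<Rightarrow> (nat \<Rightarrow> nat \<Rightarrow> bool) \<Rightarrow> nat \<Rightarrow> nat \<Rightarrow> int" where
  "exchange_matrix a arr i j = (if arr i j then - a i j else if arr j i then a i j else 0)"


section \<open>Seeds and cluster algebras of geometric type\<close>

text \<open>
  The ambient field is the field of rational functions in countably many variables
  \<open>var 1, var 2, \<dots>\<close>. For an extended exchange matrix of size \<open>(n + m) \<times> n\<close> the initial
  cluster is \<open>var 1, \<dots>, var n\<close> and the frozen variables are \<open>var (n + 1), \<dots>, var (n + m)\<close>;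
  the other variables play no role.
\<close>

type_synonym mpoly = "(nat \<Rightarrow>\<^sub>0 nat) \<Rightarrow>\<^sub>0 complex"
type_synonym ratfun = "mpoly fract"

definition pvar :: "nat \<Rightarrow> mpoly" where
  "pvar i = Poly_Mapping.single (Poly_Mapping.single i 1) 1"

definition var :: "nat \<Rightarrow> ratfun" where
  "var i = Fract (pvar i) 1"

definition rconst :: "complex \<Rightarrow> ratfun" where
  "rconst c = Fract (Poly_Mapping.single 0 c) 1"

type_synonym seed = "(nat \<Rightarrow> nat \<Rightarrow> int) \<times> (nat \<Rightarrow> ratfun)"

definition mutate_matrix ::
    "nat \<Rightarrow> (nat \<Rightarrow> nat \<Rightarrow> int) \<Rightarrow> nat \<Rightarrow> nat \<Rightarrow> int" where
  "mutate_matrix k b i j =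
     (if i = k \<or> j = k then - b i j
      else b i j + max 0 (b i k) * max 0 (b k j) - max 0 (- b i k) * max 0 (- b k j))"

definition mutate :: "nat \<Rightarrow> nat \<Rightarrow> nat \<Rightarrow> seed \<Rightarrow> seed" where
  "mutate n m k S =
     (let b = fst S; x = snd S in
       (mutate_matrix k b,
        x(k := ((\<Prod>i\<in>{i\<in>{1..n + m}. b i k > 0}. x i ^ nat (b i k)) +
                (\<Prod>i\<in>{i\<in>{1..n + m}. b i k < 0}. x i ^ nat (- b i k))) / x k)))"

definition mutate_along :: "nat \<Rightarrow> nat \<Rightarrow> nat list \<Rightarrow> seed \<Rightarrow> seed" where
  "mutate_along n m ks S = fold (mutate n m) ks S"

definition cluster_variables :: "nat \<Rightarrow> nat \<Rightarrow> (nat \<Rightarrow> nat \<Rightarrow> int) \<Rightarrow> ratfun set" where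
  "cluster_variables n m Bt =
     {snd (mutate_along n m ks (Bt, var)) i | ks i. set ks \<subseteq> {1..n} \<and> i \<in> {1..n}}"

definition frozen_variables :: "nat \<Rightarrow> nat \<Rightarrow> ratfun set" where
  "frozen_variables n m = var ` {n + 1..n + m}"

inductive_set generated_calg :: "ratfun set \<Rightarrow> ratfun set" for G :: "ratfun set" where
  const: "rconst c \<in> generated_calg G"
| gen: "f \<in> G \<Longrightarrow> f \<in> generated_calg G"
| add: "f \<in> generated_calg G \<Longrightarrow> g \<in> generated_calg G \<Longrightarrow> f + g \<in> generated_calg G"
| mult: "f \<in> generated_calg G \<Longrightarrow> g \<in> generated_calg G \<Longrightarrow> f * g \<in> generated_calg G"

definition cluster_algebra :: "nat \<Rightarrow> nat \<Rightarrow> (nat \<Rightarrow> nat \<Rightarrow> int) \<Rightarrow> ratfun ring" where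
  "cluster_algebra n m Bt = ring_on (generated_calg
     (cluster_variables n m Bt \<union> frozen_variables n m \<union> inverse ` frozen_variables n m))"

text \<open>
  The coordinate ring of the open locus of \<open>X\<close> where no mutable cluster variable vanishes:
  the localization of the cluster algebra (a domain) at the mutable cluster variables, formed
  inside the ambient field.
\<close>

definition open_locus_ring :: "nat \<Rightarrow> nat \<Rightarrow> (nat \<Rightarrow> nat \<Rightarrow> int) \<Rightarrow> ratfun ring" where
  "open_locus_ring n m Bt = ring_on (generated_calg
     (carrier (cluster_algebra n m Bt) \<union> inverse ` cluster_variables n m Bt))"

text \<open>Elements of \<open>torus\<close> matter only through their values on the cluster algebra.\<close>

definition torus :: "nat \<Rightarrow> nat \<Rightarrow> (nat \<Rightarrow> nat \<Rightarrow> int) \<Rightarrow> (ratfun \<Rightarrow> ratfun) set" where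
  "torus n m Bt =
     {\<phi> \<in> calg_iso (cluster_algebra n m Bt) rconst (cluster_algebra n m Bt) rconst.
        \<forall>x \<in> cluster_variables n m Bt \<union> frozen_variables n m.
          \<exists>c. c \<noteq> 0 \<and> \<phi> x = rconst c * x}"

text \<open>
  The torus acts on the localization through the (unique) extension \<open>\<psi>\<close> of each \<open>\<phi>\<close>.
\<close>

definition invariant_ring :: "nat \<Rightarrow> nat \<Rightarrow> (nat \<Rightarrow> nat \<Rightarrow> int) \<Rightarrow> ratfun ring" where
  "invariant_ring n m Bt = ring_on
     {f \<in> carrier (open_locus_ring n m Bt).
        \<forall>\<phi> \<in> torus n m Bt.
        \<forall>\<psi> \<in> calg_iso (open_locus_ring n m Bt) rconst (open_locus_ring n m Bt) rconst.
          (\<forall>h \<in> carrier (cluster_algebra n m Bt). \<psi> h = \<phi> h) \<longrightarrow> \<psi> f = f}"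

text \<open>The ideal of the locus where all mutable cluster variables are set to \<open>1\<close>.\<close>

definition unit_locus_ideal :: "nat \<Rightarrow> nat \<Rightarrow> (nat \<Rightarrow> nat \<Rightarrow> int) \<Rightarrow> ratfun set" where
  "unit_locus_ideal n m Bt =
     genideal (cluster_algebra n m Bt) ((\<lambda>x. x - 1) ` cluster_variables n m Bt)"

definition unit_locus_ring :: "nat \<Rightarrow> nat \<Rightarrow> (nat \<Rightarrow> nat \<Rightarrow> int) \<Rightarrow> ratfun set ring" where
  "unit_locus_ring n m Bt = cluster_algebra n m Bt Quot unit_locus_ideal n m Bt"

definition unit_locus_class ::
    "nat \<Rightarrow> nat \<Rightarrow> (nat \<Rightarrow> nat \<Rightarrow> int) \<Rightarrow> ratfun \<Rightarrow> ratfun set" where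
  "unit_locus_class n m Bt f = unit_locus_ideal n m Bt +>\<^bsub>cluster_algebra n m Bt\<^esub> f"


section \<open>Indexing of cluster variables by sweeps of source mutations\<close>

text \<open>
  \<open>source_sequence n b ks\<close>: mutating along \<open>ks\<close> always mutates at a source of the current
  orientation. A sweep, i.e. such a list containing each vertex exactly once, reverses every
  arrow twice and so restores the orientation; hence the same list can be used in every sweep.
\<close>

fun source_sequence :: "nat \<Rightarrow> (nat \<Rightarrow> nat \<Rightarrow> int) \<Rightarrow> nat list \<Rightarrow> bool" where
  "source_sequence n b [] = True"
| "source_sequence n b (k # ks) =
     ((\<forall>j\<in>{1..n}. \<not> b j k > 0) \<and> source_sequence n (mutate_matrix k b) ks)"

definition source_sweep :: "nat \<Rightarrow> (nat \<Rightarrow> nat \<Rightarrow> int) \<Rightarrow> nat list \<Rightarrow> bool" where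
  "source_sweep n B vs \<longleftrightarrow> distinct vs \<and> set vs = {1..n} \<and> source_sequence n B vs"

text \<open>\<open>sweep_var n m Bt vs t i\<close> is the cluster variable with index \<open>(t, i)\<close>.\<close>

definition sweep_var ::
    "nat \<Rightarrow> nat \<Rightarrow> (nat \<Rightarrow> nat \<Rightarrow> int) \<Rightarrow> nat list \<Rightarrow> nat \<Rightarrow> nat \<Rightarrow> ratfun" where
  "sweep_var n m Bt vs t i = snd ((mutate_along n m vs ^^ t) (Bt, var)) i"

text \<open>
  The combinatorial data \<open>r\<close>, \<open>*\<close>, \<open>\<Pi>\<close> and the compatibility degree are those of the
  coefficient-free cluster algebra of \<open>B\<close>.
\<close>

definition sweep_len :: "nat \<Rightarrow> (nat \<Rightarrow> nat \<Rightarrow> int) \<Rightarrow> nat list \<Rightarrow> nat \<Rightarrow> nat" where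
  "sweep_len n B vs i =
     (LEAST t. t > 0 \<and> (\<exists>j\<in>{1..n}. sweep_var n 0 B vs t i = var j)) - 1"

definition star :: "nat \<Rightarrow> (nat \<Rightarrow> nat \<Rightarrow> int) \<Rightarrow> nat list \<Rightarrow> nat \<Rightarrow> nat" where
  "star n B vs i =
     (THE j. j \<in> {1..n} \<and> sweep_var n 0 B vs (sweep_len n B vs i + 1) i = var j)"

definition Pi_index :: "nat \<Rightarrow> (nat \<Rightarrow> nat \<Rightarrow> int) \<Rightarrow> nat list \<Rightarrow> (nat \<times> nat) set" where
  "Pi_index n B vs = {(s, i). i \<in> {1..n} \<and> s \<le> sweep_len n B vs i}"

definition tau :: "nat \<Rightarrow> (nat \<Rightarrow> nat \<Rightarrow> int) \<Rightarrow> nat list \<Rightarrow> nat \<times> nat \<Rightarrow> nat \<times> nat" where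
  "tau n B vs \<gamma> =
     (case \<gamma> of (t, j) \<Rightarrow>
        if t \<ge> 1 then (t - 1, j)
        else (sweep_len n B vs (star n B vs j), star n B vs j))"


section \<open>Compatibility degree\<close>

text \<open>
  \<open>d\<close> is the exponent vector of the denominator of \<open>f\<close>: the numerator is a polynomial
  divisible by none of the initial variables (so \<open>var i\<close> itself has exponent \<open>-1\<close> at \<open>i\<close>).
\<close>

definition has_denominator :: "nat \<Rightarrow> ratfun \<Rightarrow> (nat \<Rightarrow> int) \<Rightarrow> bool" where
  "has_denominator n f d \<longleftrightarrow>
     (\<exists>N. (\<forall>i\<in>{1..n}. \<not> pvar i dvd N) \<and> f = Fract N 1 / (\<Prod>i\<in>{1..n}. var i powi d i))"

definition denominator_exponent :: "nat \<Rightarrow> ratfun \<Rightarrow> nat \<Rightarrow> int" where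
  "denominator_exponent n f i = (THE k. \<exists>d. has_denominator n f d \<and> d i = k)"

definition compatibility_degree ::
    "nat \<Rightarrow> (nat \<Rightarrow> nat \<Rightarrow> int) \<Rightarrow> nat list \<Rightarrow> (nat \<times> nat \<Rightarrow> nat \<times> nat \<Rightarrow> nat) \<Rightarrow> bool" where
  "compatibility_degree n B vs c \<longleftrightarrow>
     (\<forall>\<omega> \<in> Pi_index n B vs. \<forall>\<gamma> \<in> Pi_index n B vs.
        c (tau n B vs \<omega>) (tau n B vs \<gamma>) = c \<omega> \<gamma>) \<and>
     (\<forall>i\<in>{1..n}. \<forall>(t, j) \<in> Pi_index n B vs.
        int (c (0, i) (t, j)) = max 0 (denominator_exponent n (sweep_var n 0 B vs t j) i))"


section \<open>The cluster configuration space\<close>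

text \<open>Laurent polynomials in variables \<open>u\<^sub>\<gamma>\<close>: finitely supported maps on integer exponent vectors.\<close>

type_synonym laurent = "((nat \<times> nat) \<Rightarrow>\<^sub>0 int) \<Rightarrow>\<^sub>0 complex"

definition lvar :: "nat \<times> nat \<Rightarrow> laurent" where
  "lvar \<gamma> = Poly_Mapping.single (Poly_Mapping.single \<gamma> 1) 1"

definition lconst :: "complex \<Rightarrow> laurent" where
  "lconst c = Poly_Mapping.single 0 c"

definition laurent_ring :: "(nat \<times> nat) set \<Rightarrow> laurent ring" where
  "laurent_ring P = ring_on {p. \<forall>e \<in> Poly_Mapping.keys p. Poly_Mapping.keys e \<subseteq> P}"

definition config_ideal ::
    "(nat \<times> nat) set \<Rightarrow> (nat \<times> nat \<Rightarrow> nat \<times> nat \<Rightarrow> nat) \<Rightarrow> laurent set" where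
  "config_ideal P c =
     genideal (laurent_ring P) ((\<lambda>\<gamma>. lvar \<gamma> + (\<Prod>\<omega>\<in>P. lvar \<omega> ^ c \<omega> \<gamma>) - 1) ` P)"

definition config_ring ::
    "(nat \<times> nat) set \<Rightarrow> (nat \<times> nat \<Rightarrow> nat \<times> nat \<Rightarrow> nat) \<Rightarrow> laurent set ring" where
  "config_ring P c = laurent_ring P Quot config_ideal P c"

definition config_class ::
    "(nat \<times> nat) set \<Rightarrow> (nat \<times> nat \<Rightarrow> nat \<times> nat \<Rightarrow> nat) \<Rightarrow> laurent \<Rightarrow> laurent set" where
  "config_class P c f = config_ideal P c +>\<^bsub>laurent_ring P\<^esub> f"


section \<open>g-vectors\<close>

definition principal_extension ::
    "nat \<Rightarrow> (nat \<Rightarrow> nat \<Rightarrow> int) \<Rightarrow> nat \<Rightarrow> nat \<Rightarrow> int" where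
  "principal_extension n C i j = (if i \<le> n then C i j else if i = n + j then 1 else 0)"

text \<open>
  Degree vectors are integer functions vanishing outside \<open>{1..n}\<close>. The initial variable
  \<open>var i\<close> has degree \<open>e\<^sub>i\<close> and the principal frozen variable \<open>var (n + i)\<close> has degree \<open>- C e\<^sub>i\<close>.
\<close>

definition var_degree :: "nat \<Rightarrow> (nat \<Rightarrow> nat \<Rightarrow> int) \<Rightarrow> nat \<Rightarrow> nat \<Rightarrow> int" where
  "var_degree n C v k =
     (if k \<in> {1..n} then (if v \<le> n then (if k = v then 1 else 0) else - C k (v - n)) else 0)"

definition homogeneous_poly ::
    "nat \<Rightarrow> (nat \<Rightarrow> nat \<Rightarrow> int) \<Rightarrow> mpoly \<Rightarrow> (nat \<Rightarrow> int) \<Rightarrow> bool" where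
  "homogeneous_poly n C p d \<longleftrightarrow>
     (\<forall>e \<in> Poly_Mapping.keys p. \<forall>k.
        (\<Sum>v \<in> Poly_Mapping.keys e. int (Poly_Mapping.lookup e v) * var_degree n C v k) = d k)"

definition has_degree :: "nat \<Rightarrow> (nat \<Rightarrow> nat \<Rightarrow> int) \<Rightarrow> ratfun \<Rightarrow> (nat \<Rightarrow> int) \<Rightarrow> bool" where
  "has_degree n C f d \<longleftrightarrow>
     (\<exists>p q dp dq. p \<noteq> 0 \<and> q \<noteq> 0 \<and> f = Fract p q \<and>
        homogeneous_poly n C p dp \<and> homogeneous_poly n C q dq \<and> d = (\<lambda>k. dp k - dq k))"

definition g_vectors :: "nat \<Rightarrow> (nat \<Rightarrow> nat \<Rightarrow> int) \<Rightarrow> (nat \<Rightarrow> int) set" where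
  "g_vectors n C =
     {g. \<exists>x \<in> cluster_variables n n (principal_extension n C). has_degree n C x g}"


section \<open>Universal coefficients\<close>

text \<open>
  The variable \<open>x\<close> with index \<open>(t - 1, i)\<close>, where \<open>(-1, i)\<close> stands for \<open>tau (0, i)\<close>.
\<close>

definition prev_var ::
    "nat \<Rightarrow> nat \<Rightarrow> (nat \<Rightarrow> nat \<Rightarrow> int) \<Rightarrow> (nat \<Rightarrow> nat \<Rightarrow> int) \<Rightarrow> nat list \<Rightarrow> nat \<Rightarrow> nat \<Rightarrow> ratfun" where
  "prev_var n m B Bt vs t i =
     (case tau n B vs (t, i) of (s, l) \<Rightarrow> sweep_var n m Bt vs s l)"

text \<open>
  \<open>Bt\<close> is the universal-coefficient extension of \<open>B\<close>, its coefficient rows being indexed by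
  \<open>\<Pi>\<close> through \<open>idx\<close>: row \<open>idx \<gamma>\<close> belongs to \<open>\<gamma>\<close>, and \<open>var (idx \<gamma>)\<close> is \<open>z\<^sub>\<gamma>\<close>. The last
  conjunct is the list of primitive exchange relations, which normalizes the indexing.
\<close>

definition universal_extension ::
    "nat \<Rightarrow> (nat \<Rightarrow> nat \<Rightarrow> int) \<Rightarrow> (nat \<Rightarrow> nat \<Rightarrow> bool) \<Rightarrow> nat list \<Rightarrow>
      (nat \<times> nat \<Rightarrow> nat \<times> nat \<Rightarrow> nat) \<Rightarrow> (nat \<Rightarrow> nat \<Rightarrow> int) \<Rightarrow> (nat \<times> nat \<Rightarrow> nat) \<Rightarrow> bool" where
  "universal_extension n a arr vs c Bt idx \<longleftrightarrow>
     (let B = exchange_matrix a arr; P = Pi_index n B vs; r = card P in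
       (\<forall>i\<in>{1..n}. \<forall>j\<in>{1..n}. Bt i j = B i j) \<and>
       bij_betw idx P {n + 1..n + r} \<and>
       bij_betw (\<lambda>\<gamma> k. if k \<in> {1..n} then Bt (idx \<gamma>) k else 0) P (g_vectors n (\<lambda>i j. B j i)) \<and>
       (\<forall>(t, j) \<in> P.
          prev_var n r B Bt vs t j * sweep_var n r Bt vs t j =
            var (idx (t, j)) *
              (\<Prod>i\<in>{i\<in>{1..n}. arr i j}. sweep_var n r Bt vs t i ^ nat (- a i j)) *
              (\<Prod>i\<in>{i\<in>{1..n}. arr j i}. prev_var n r B Bt vs t i ^ nat (- a i j)) +
            (\<Prod>\<omega>\<in>P. var (idx \<omega>) ^ c \<omega> (t, j))))"

end

theory Submission
  imports Defs "HOL-Library.Function_Algebras" "HOL-Library.FuncSet" "HOL-Computational_Algebra.Polynomial"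
begin

text \<open>The c-vectors of a seed are roots of the diagram, and the Euler form restricts which sets of roots
  occur. Mutation at a positive (green) c-vector shrinks the cone of positive roots, so mutations at
  negative (red) c-vectors terminate; by the polygon identities in rank two, tropical for c-vectors and
  logarithmic for the values of cluster variables, they are confluent. Hence a cluster variable depends
  only on the c-vectors of its seed, and the non-initial ones are indexed by the positive roots; these
  are exhausted by the mutations at sources, so that the \<open>x\<^sub>\<gamma>\<close> are all cluster variables.
  Evaluating the primitive exchange relations identifies the compatibility degrees with coordinates of
  roots. The additivity of the roots along the sweeps then gives the identity
  \<open>\<Prod>\<^sub>\<omega> (N\<^sub>\<omega> / (x\<^sub>\<tau>\<^sub>\<omega> x\<^sub>\<omega>))\<close> with exponents \<open>(\<omega>||\<gamma>)\<close> equal to \<open>1 / (x\<^sub>\<tau>\<^sub>\<gamma> x\<^sub>\<gamma>)\<close>, where \<open>N\<^sub>\<gamma>\<close> is the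
  product next to \<open>z\<^sub>\<gamma>\<close> in the exchange relation. Therefore \<open>u\<^sub>\<gamma> = z\<^sub>\<gamma> N\<^sub>\<gamma> / (x\<^sub>\<tau>\<^sub>\<gamma> x\<^sub>\<gamma>)\<close> satisfies the
  relations of the configuration space. Setting all \<open>x\<^sub>\<gamma>\<close> to \<open>1\<close> shows that there are no further relations,
  and torus elements acting with different characters eliminate the monomials in the \<open>x\<^sub>\<gamma>\<close> from an
  invariant function.\<close>

text \<open>Seeds are never compared symbolically. A fraction is known by its values at positive
  points, where no cluster variable has a pole, and the logarithms of the values of an extended
  cluster are packed into one vector. A mutation then moves vectors along one root, and equality of
  seeds becomes a question about a rewriting system; no Laurent phenomenon and no classification of
  diagrams enters. Signs of pairings alone are not stable under mutation. The missing information is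
  the time at which a root becomes simple, by which two positive roots with a negative pairing are
  ordered. Laurent denominators are computed only for the first sweep; later compatibility degrees
  are forced, since the primitive relation must agree with the one that mutation produces. The
  configuration ring is not known beforehand to be a domain, so fractions are specialised by a
  relation asking for an inverse modulo the ideal. The torus elements that matter act compatibly on
  both terms of an exchange relation, which rests on the fact that no \<open>uvar\<close> is
  constant.\<close>

abbreviation (input) iff (infixr "<->" 25) where "A <-> B \<equiv> (A :: bool) = B"
notation scaleR (infixr "*R" 75)

abbreviation "single \<equiv> Poly_Mapping.single"
abbreviation "lookup \<equiv> Poly_Mapping.lookup"
abbreviation "keys \<equiv> Poly_Mapping.keys"
abbreviation "cnt \<equiv> count_list"

section \<open>Sets of c-vectors\<close>

text \<open>In the application \<open>E\<close> is the Euler form of an orientation, \<open>om\<close> its antisymmetrization, extended to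
 the frozen directions, and \<open>ord\<close> the time at which a root becomes simple in the infinite periodic
 sequence of reflections at sources. The sets of c-vectors of seeds satisfy \<open>good\<close>, and mutation at a
 positive (green) or negative (red) c-vector changes the others by \<open>grn\<close> or \<open>red\<close>.\<close>

locale cluster_roots =
 fixes E om :: "'v::real_vector => 'v => real"
  and ht :: "'v => real" and \<Phi> :: "'v set" and ord :: "'v => int"
 assumes E_linear1: "linear (%x. E x y)" and E_linear2: "linear (E x)" and om_linear2: "linear (om x)"
  and om_antisym: "om x y = - om y x" and om_root: "v \<in> \<Phi> ==> w \<in> \<Phi> ==> om v w = E v w - E w v"
  and ht_linear: "linear ht" and E_nonneg: "E x x >= 0"
  and E_definite: "x \<in> span \<Phi> ==> E x x = 0 ==> x = 0" and ht_root: "v \<in> \<Phi> ==> ht v ~= 0"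
  and root_uminus: "v \<in> \<Phi> ==> - v \<in> \<Phi>"
  and root_reflect: "v \<in> \<Phi> ==> w \<in> \<Phi> ==> w - ((E v w + E w v) / E v v) *R v \<in> \<Phi>"
  and root_integral: "v \<in> \<Phi> ==> w \<in> \<Phi> ==> (E v w + E w v) / E v v \<in> \<int>"
  and root_reduced: "v \<in> \<Phi> ==> t *R v \<in> \<Phi> ==> t > 0 ==> t = 1" and finite_roots: "finite \<Phi>"
  and ord_pos: "v \<in> \<Phi> ==> w \<in> \<Phi> ==> ht v > 0 ==> ht w > 0 ==> E v w > 0 ==> ord w <= ord v"
  and ord_neg: "v \<in> \<Phi> ==> w \<in> \<Phi> ==> ht v > 0 ==> ht w > 0 ==> E v w < 0 ==> ord v < ord w"
begin

lemma E_add1 [simp]: "E (x + y) z = E x z + E y z" and E_scale1 [simp]: "E (r *R x) z = r * E x z"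
 and E_diff1 [simp]: "E (x - y) z = E x z - E y z" and E_minus1 [simp]: "E (- x) z = - E x z"
 and E_zero1 [simp]: "E 0 z = 0"
 using linear_add[OF E_linear1[of z]] linear_scale[OF E_linear1[of z]] linear_diff[OF E_linear1[of z]]
  linear_neg[OF E_linear1[of z]] linear_0[OF E_linear1[of z]] by simp_all

lemma E_add2 [simp]: "E z (x + y) = E z x + E z y" and E_scale2 [simp]: "E z (r *R x) = r * E z x"
 and E_diff2 [simp]: "E z (x - y) = E z x - E z y" and E_minus2 [simp]: "E z (- x) = - E z x"
 and E_zero2 [simp]: "E z 0 = 0"
 using E_linear2[of z] by (auto simp: linear_add linear_scale linear_diff linear_neg linear_0)

lemma E_sum1: "E (SUM i:A. f i) z = (SUM i:A. E (f i) z)"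
 and E_sum2: "E z (SUM i:A. f i) = (SUM i:A. E z (f i))"
 using linear_sum[OF E_linear1] linear_sum[OF E_linear2] by auto

lemma om_add2 [simp]: "om z (x + y) = om z x + om z y"
 and om_scale2 [simp]: "om z (r *R x) = r * om z x"
 and om_diff2 [simp]: "om z (x - y) = om z x - om z y" and om_minus2 [simp]: "om z (- x) = - om z x"
 using om_linear2[of z] by (auto simp: linear_add linear_scale linear_diff linear_neg)

lemma om_add1 [simp]: "om (x + y) z = om x z + om y z"
 using om_antisym[of "x + y" z] om_antisym[of x z] om_antisym[of y z] by simp

lemma om_scale1 [simp]: "om (r *R x) z = r * om x z"
 using om_antisym[of "r *R x" z] om_antisym[of x z] by simp

lemma om_minus1 [simp]: "om (- x) z = - om x z" using om_antisym[of "- x" z] om_antisym[of x z] by simp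

lemma om_self [simp]: "om x x = 0" using om_antisym[of x x] by simp

lemma ht_add [simp]: "ht (x + y) = ht x + ht y" and ht_scale [simp]: "ht (r *R x) = r * ht x"
 and ht_diff [simp]: "ht (x - y) = ht x - ht y" and ht_minus [simp]: "ht (- x) = - ht x"
 and ht_zero [simp]: "ht 0 = 0"
 using ht_linear by (auto simp: linear_add linear_scale linear_diff linear_neg linear_0)

lemma ht_sum: "ht (SUM i:A. f i) = (SUM i:A. ht (f i))" using linear_sum[OF ht_linear] by auto

lemma root_nonzero: "v \<in> \<Phi> ==> v ~= 0" using ht_root ht_zero by metis

lemma root_norm_pos: "v \<in> \<Phi> ==> E v v > 0"
 using E_nonneg[of v] E_definite[of v] root_nonzero[of v] span_base[of v \<Phi>] by fastforce

text \<open>Reversing \<open>E\<close> and negating heights interchanges green and red, so every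
  statement about green mutation has a red twin. A root that is positive for the new height is timed
  by its opposite, and the sign compensates for the exchanged arguments of \<open>E\<close>.\<close>

lemma dual: "cluster_roots (%x y. E y x) (%x y. - om x y) (%x. - ht x) \<Phi> (%v. - ord (- v))"
proof (rule cluster_roots.intro)
 show "linear (%x. E y x)" for y using E_linear2[of y] by simp
 show "linear (%y. E y x)" for x using E_linear1[of x] by simp
 show "linear (%y. - om x y)" for x by (rule linearI) auto
 show "- om x y = - (- om y x)" for x y using om_antisym[of x y] by simp
 show "- om v w = E w v - E v w" if "v \<in> \<Phi>" "w \<in> \<Phi>" for v w using om_root that by simp
 show "linear (%x. - ht x)" by (rule linearI) auto
 show "w - ((E w v + E v w) / E v v) *R v \<in> \<Phi>" if "v \<in> \<Phi>" "w \<in> \<Phi>" for v w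
  using root_reflect[OF that] by (simp add: add.commute)
 show "(E w v + E v w) / E v v \<in> \<int>" if "v \<in> \<Phi>" "w \<in> \<Phi>" for v w
  using root_integral[OF that] by (simp add: add.commute)
 show "- ord (- w) <= - ord (- v)" if "v \<in> \<Phi>" "w \<in> \<Phi>" "0 < - ht v" "0 < - ht w" "0 < E w v" for v w
  using ord_pos[of "- w" "- v"] that root_uminus by auto
 show "- ord (- v) < - ord (- w)" if "v \<in> \<Phi>" "w \<in> \<Phi>" "0 < - ht v" "0 < - ht w" "E w v < 0" for v w
  using ord_neg[of "- w" "- v"] that root_uminus by auto
qed (use E_nonneg E_definite ht_root root_uminus root_reduced finite_roots in auto)

section \<open>Sets of roots stable under green and red mutation\<close>

definition good :: "'v set => bool" where
 "good S <-> S \<subseteq> \<Phi> & (ALL v:S. ALL w:S. v ~= w -->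
    ((ht v > 0 <-> ht w > 0) --> E v w <= 0) & (ht v < 0 --> ht w > 0 --> E v w = 0))"

definition grn :: "'v => 'v => 'v" where
 "grn v x = x + (max 0 (- om v x) / E v v) *R v"

definition red :: "'v => 'v => 'v" where
 "red v x = x + (max 0 (om v x) / E v v) *R v"

lemma good_sub: "good S ==> v \<in> S ==> v \<in> \<Phi>" by (auto simp: good_def)

lemma good_finite: "good S ==> finite S" using finite_roots finite_subset by (auto simp: good_def)

lemma good_same: "good S ==> v \<in> S ==> w \<in> S ==> v ~= w ==> ht v > 0 <-> ht w > 0 ==> E v w <= 0"
 and good_neg_pos: "good S ==> v \<in> S ==> w \<in> S ==> ht v < 0 ==> ht w > 0 ==> E v w = 0"
 by (auto simp: good_def) (metis less_asym)

lemma good_pos1: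
 assumes "good S" "v \<in> S" "x \<in> S" "x ~= v" "ht v > 0"
 shows "E x v <= 0"
 using assms good_same[of S x v] good_neg_pos[of S x v] ht_root[OF good_sub[of S x]]
 by (cases "ht x > 0") auto

text \<open>For positive \<open>x\<close> two negative pairings would put each root strictly before
  the other in the order; for negative \<open>x\<close> the pairing vanishes by goodness.\<close>

lemma good_not_both_neg:
 assumes "good S" "v \<in> S" "x \<in> S" "x ~= v" "ht v > 0" "E v x < 0"
 shows "E x v = 0"
proof (cases "ht x > 0")
 case True
 have "E x v <= 0" using good_pos1 assms by blast
 moreover have "~ E x v < 0" using ord_neg[of x v] ord_neg[of v x] assms True good_sub by fastforce
 ultimately show ?thesis by simp
next
 case False
 thus ?thesis using good_neg_pos[of S x v] assms ht_root[OF good_sub[of S x]] by auto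
qed

text \<open>As \<open>E x v = 0\<close>, the form \<open>om v x\<close> equals \<open>E v x\<close>,
  and the mutation is the reflection in \<open>v\<close>.\<close>

lemma grn_J:
 assumes "good S" "v \<in> S" "x \<in> S" "x ~= v" "ht v > 0" "E v x < 0"
 shows "grn v x = x - (E v x / E v v) *R v"
 using good_not_both_neg[OF assms] om_root[of v x] good_sub[of S] assms by (auto simp: grn_def max_def)

lemma grn_nJ:
 assumes "good S" "v \<in> S" "x \<in> S" "x ~= v" "ht v > 0" "E v x >= 0"
 shows "grn v x = x"
 using good_pos1[of S v x] om_root[of v x] good_sub[of S] assms by (auto simp: grn_def max_def)

lemma grn_root:
 assumes "good S" "v \<in> S" "x \<in> S" "x ~= v" "ht v > 0"
 shows "grn v x \<in> \<Phi>"
proof (cases "E v x < 0")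
 case True
 thus ?thesis
  using grn_J[OF assms True] good_not_both_neg[OF assms True] root_reflect[of v x] good_sub[of S] assms
  by simp
next
 case False
 thus ?thesis using grn_nJ[OF assms] good_sub assms by simp
qed

lemma grn_ht:
 assumes "good S" "v \<in> S" "x \<in> S" "x ~= v" "ht v > 0" "ht x > 0"
 shows "ht (grn v x) > 0"
proof -
 have "ht (grn v x) = ht x + max 0 (- om v x) / E v v * ht v" by (simp add: grn_def)
 moreover have "max 0 (- om v x) / E v v * ht v >= 0" using assms E_nonneg[of v] by auto
 ultimately show ?thesis using assms by linarith
qed

text \<open>The members with \<open>E v x < 0\<close> are reflected and then satisfy
  \<open>E v x' = 0\<close> and \<open>E x' v = - E v x\<close>. Reflecting both members of a pair
  keeps their pairing, reflecting only the right one can only lower it; the remaining cases are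
  decided by the order of the roots.\<close>

lemma grn_pair:
 assumes S: "good S" "v \<in> S" "x \<in> S" "y \<in> S" "x ~= v" "y ~= v" "x ~= y" and v: "ht v > 0"
 shows "(ht (grn v x) > 0 <-> ht (grn v y) > 0) ==> E (grn v x) (grn v y) <= 0"
  and "ht (grn v x) < 0 ==> ht (grn v y) > 0 ==> E (grn v x) (grn v y) = 0"
proof -
 define d where "d = E v v"
 have d: "d > 0" using root_norm_pos S good_sub by (auto simp: d_def)
 define x' y' where "x' = grn v x" and "y' = grn v y"
 have R: "v \<in> \<Phi>" "x \<in> \<Phi>" "y \<in> \<Phi>" "x' \<in> \<Phi>" "y' \<in> \<Phi>" "- x \<in> \<Phi>" "- y \<in> \<Phi>" "- x' \<in> \<Phi>"
  using S v grn_root good_sub root_uminus by (auto simp: x'_def y'_def)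
 have hx: "ht x ~= 0" and hy: "ht y ~= 0" and hx': "ht x' ~= 0" and hy': "ht y' ~= 0"
  using R ht_root by auto
 have px: "ht x > 0 ==> ht x' > 0" and py: "ht y > 0 ==> ht y' > 0"
  using grn_ht S v by (auto simp: x'_def y'_def)
 have Exv: "E x v <= 0" "ht x < 0 ==> E x v = 0" using good_pos1 good_neg_pos S v by blast+
 have Exy: "(ht x > 0 <-> ht y > 0) ==> E x y <= 0" "ht x < 0 ==> ht y > 0 ==> E x y = 0"
  using good_same good_neg_pos S by blast+
 have Jx: "E x v = 0 & x' = x - (E v x / d) *R v & E v x' = 0 & E x' v = - E v x" if "E v x < 0"
  using good_not_both_neg[of S v x] grn_J[of S v x] S v that d by (auto simp: x'_def d_def)
 have Jy: "E y v = 0 & y' = y - (E v y / d) *R v & E v y' = 0 & E y' v = - E v y" if "E v y < 0"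
  using good_not_both_neg[of S v y] grn_J[of S v y] S v that d by (auto simp: y'_def d_def)
 have nJx: "x' = x & (ht x > 0 --> E v x = 0)" if "~ E v x < 0"
  using grn_nJ[of S v x] good_same[of S v x] S v that by (auto simp: x'_def)
 have nJy: "y' = y & (ht y > 0 --> E v y = 0)" if "~ E v y < 0"
  using grn_nJ[of S v y] good_same[of S v y] S v that by (auto simp: y'_def)
 have V1: "E x' y' = E x y & E x y' = E x y" if "E v x < 0" "E v y < 0" using Jx Jy that d by (simp add: d_def)
 have V2: "E x' y' = E x y' & E x y' <= E x y & (E x v = 0 --> E x y' = E x y)"
  if "~ E v x < 0" "E v y < 0"
  using nJx[OF that(1)] Jy[OF that(2)] d Exv(1) that(2) by (simp add: divide_nonpos_pos mult_nonpos_nonpos)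
 have V3: "E v y = 0 --> E x' y' = E x y" if "E v x < 0" "~ E v y < 0"
  using Jx[OF that(1)] nJy[OF that(2)] by simp
 have V4: "E x' y' = E x y" if "~ E v x < 0" "~ E v y < 0" using nJx nJy that by simp
 \<comment> \<open>The order facts for the sign patterns that occur. A negative root enters through
   its opposite: negating one argument flips the sign of \<open>E\<close>, negating both keeps
   it.\<close>
 have O: "ht x > 0 ==> ht y < 0 ==> E x y > 0 ==> ord x < ord (- y)"
  "ht x > 0 ==> ht y' > 0 ==> E x y' > 0 ==> ord y' <= ord x"
  "ht y < 0 ==> E v y > 0 ==> ord v < ord (- y)"
  "ht x' < 0 ==> ht y < 0 ==> E x' y > 0 ==> ord (- y) <= ord (- x')"
  "ht x' < 0 ==> E x' v > 0 ==> ord (- x') < ord v"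
  "ht x' < 0 ==> ht y' > 0 ==> E x' y' < 0 ==> ord y' <= ord (- x')"
  "ht x < 0 ==> ht y < 0 ==> E x y < 0 ==> ord (- x) < ord (- y)"
  "ht x < 0 ==> ht y' > 0 ==> E x y' < 0 ==> ord y' <= ord (- x)"
  "ht y < 0 ==> E v y < 0 ==> ord (- y) <= ord v" "ht y' > 0 ==> E y' v > 0 ==> ord v <= ord y'"
  using ord_neg[of x "- y"] ord_pos[of x y'] ord_neg[of v "- y"] ord_pos[of "- x'" "- y"] ord_neg[of "- x'" v]
   ord_pos[of "- x'" y'] ord_neg[of "- x" "- y"] ord_pos[of "- x" y'] ord_pos[of v "- y"] ord_pos[of y' v] R v by simp_all
 show "E (grn v x) (grn v y) <= 0" if "ht (grn v x) > 0 <-> ht (grn v y) > 0"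
  using that[folded x'_def y'_def] V1 V2 V3 V4 O Jx Jy nJx nJy Exv Exy hx hy hx' hy' px py
  unfolding x'_def[symmetric] y'_def[symmetric] by (smt (verit))
 show "E (grn v x) (grn v y) = 0" if "ht (grn v x) < 0" "ht (grn v y) > 0"
  using that[folded x'_def y'_def] V1 V2 V3 V4 O Jx Jy nJx nJy Exv Exy hx hy hx' hy' px py
  unfolding x'_def[symmetric] y'_def[symmetric] by (smt (verit))
qed

lemma good_green:
 assumes S: "good S" "v \<in> S" and v: "ht v > 0"
 shows "good (insert (- v) (grn v ` (S - {v})))"
proof -
 have vR: "v \<in> \<Phi>" "- v \<in> \<Phi>" using S good_sub root_uminus by auto
 have A: "E (- v) (grn v x) <= 0 & (ht (grn v x) > 0 --> E (- v) (grn v x) = 0)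
   & (ht (grn v x) < 0 --> E (grn v x) (- v) <= 0)" if x: "x \<in> S" "x ~= v" for x
 proof (cases "E v x < 0")
  case True
  thus ?thesis using good_not_both_neg[of S v x] grn_J[of S v x] S v x root_norm_pos[OF vR(1)] by simp
 next
  case False
  thus ?thesis using grn_nJ[of S v x] good_same[of S v x] good_neg_pos[of S x v] S v x by auto
 qed
 show ?thesis unfolding good_def
 proof (intro conjI ballI)
  show "insert (- v) (grn v ` (S - {v})) \<subseteq> \<Phi>" using grn_root S v vR by auto
 next
  fix p q assume p: "p \<in> insert (- v) (grn v ` (S - {v}))" and q: "q \<in> insert (- v) (grn v ` (S - {v}))"
  show "p ~= q --> ((0 < ht p) = (0 < ht q) --> E p q <= 0) & (ht p < 0 --> 0 < ht q --> E p q = 0)"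
  proof
   assume ne: "p ~= q"
   consider "p = - v" "q \<in> grn v ` (S - {v})" | "q = - v" "p \<in> grn v ` (S - {v})"
    | "p \<in> grn v ` (S - {v})" "q \<in> grn v ` (S - {v})" using p q ne by auto
   thus "((0 < ht p) = (0 < ht q) --> E p q <= 0) & (ht p < 0 --> 0 < ht q --> E p q = 0)"
   proof cases
    case 1 thus ?thesis using A v by auto
   next
    case 2
    then obtain x where x: "x \<in> S" "x ~= v" "p = grn v x" by auto
    have "ht p ~= 0" using grn_root S v x ht_root by auto
    thus ?thesis using 2 A[OF x(1,2)] v x by auto
   next
    case 3
    then obtain x y where "x \<in> S" "x ~= v" "p = grn v x" "y \<in> S" "y ~= v" "q = grn v y" by auto
    thus ?thesis using grn_pair[of S v x y] S v ne by blast
   qed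
  qed
 qed
qed

lemma good_dual: "cluster_roots.good (%x y. E y x) (%x. - ht x) \<Phi> S <-> good S"
proof -
 interpret d: cluster_roots "%x y. E y x" "%x y. - om x y" "%x. - ht x" \<Phi> "%v. - ord (- v)"
  by (rule dual)
 have *: "ht v < 0 <-> ~ ht v > 0" if "v \<in> S" "S \<subseteq> \<Phi>" for v using ht_root that by fastforce
 show ?thesis unfolding d.good_def good_def using * by (smt (verit))
qed

lemma good_red:
 assumes S: "good S" "v \<in> S" and v: "ht v < 0"
 shows "good (insert (- v) (red v ` (S - {v})))"
proof -
 interpret d: cluster_roots "%x y. E y x" "%x y. - om x y" "%x. - ht x" \<Phi> "%v. - ord (- v)"
  by (rule dual)
 have "d.grn v = red v" by (auto simp: d.grn_def red_def fun_eq_iff)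
 thus ?thesis using d.good_green[of S v] good_dual S v by simp
qed

text \<open>The parts of a relation with positive and with negative coefficients are equal vectors
  \<open>p = q\<close> with \<open>E p q <= 0\<close>, so both vanish; a vanishing sum of vectors of
  one sign with nonnegative coefficients has zero coefficients by its height. The factor
  \<open>s\<close> carries that sign, so that negative members are covered too.\<close>

lemma obtuse_combination_zero:
 assumes S: "good S" and T: "T \<subseteq> S" and s: "!!x. x \<in> T ==> s * ht x > 0"
  and z: "(SUM x:T. c x *R x) = 0" and x: "x \<in> T"
 shows "c x = 0"
proof -
 have fT: "finite T" using T S good_finite finite_subset by blast
 define p q where "p = (SUM x:T. max 0 (c x) *R x)" and "q = (SUM x:T. max 0 (- c x) *R x)"
 have "p - q = (SUM x:T. (max 0 (c x) - max 0 (- c x)) *R x)"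
  by (simp add: p_def q_def sum_subtractf scaleR_left_diff_distrib)
 also have "... = (SUM x:T. c x *R x)" by (intro sum.cong refl) (simp add: max_def)
 finally have pq: "p = q" using z by simp
 have sp: "p \<in> span \<Phi>" unfolding p_def
  by (intro span_sum span_scale span_base) (use good_sub[OF S] T in auto)
 have "E p q <= 0" unfolding p_def q_def E_sum1 E_sum2
 proof (intro sum_nonpos)
  fix y w assume yw: "y \<in> T" "w \<in> T"
  show "E (max 0 (c w) *R w) (max 0 (- c y) *R y) <= 0"
  proof (cases "w = y")
   case False
   have "ht w > 0 <-> ht y > 0" using s[OF yw(1)] s[OF yw(2)] by (auto simp: zero_less_mult_iff)
   hence "E w y <= 0" using good_same[OF S] False yw T by blast
   hence "max 0 (c w) * (max 0 (- c y) * E w y) <= 0" by (intro mult_nonneg_nonpos) auto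
   thus ?thesis by (simp add: mult.left_commute)
  qed (simp add: max_def)
 qed
 hence "E p p = 0" using pq E_nonneg[of p] by simp
 hence p0: "p = 0" "q = 0" using E_definite sp pq by auto
 have nn: "max 0 (b x) = 0" if "(SUM x:T. max 0 (b x) *R x) = 0" for b
 proof -
  have "(SUM y:T. max 0 (b y) * (s * ht y)) = s * ht (SUM x:T. max 0 (b x) *R x)"
   by (simp add: ht_sum sum_distrib_left mult_ac)
  hence "(SUM y:T. max 0 (b y) * (s * ht y)) = 0" using that by simp
  moreover have "ALL y:T. max 0 (b y) * (s * ht y) >= 0" using s by (simp add: less_imp_le)
  ultimately have "max 0 (b x) * (s * ht x) = 0" using fT x by (simp add: sum_nonneg_eq_0_iff)
  thus ?thesis using s[OF x] by auto
 qed
 show ?thesis using nn[of c] nn[of "%y. - c y"] p0 by (auto simp: p_def q_def max_def split: if_splits)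
qed

text \<open>The positive and the negative part of a relation are opposite vectors, and
  \<open>E\<close> of the negative with the positive part is zero by goodness. Definiteness kills
  both, and each sign is independent by itself.\<close>

lemma combination_zero:
 assumes S: "good S" and z: "(SUM x:S. c x *R x) = 0" and x: "x \<in> S"
 shows "c x = 0"
proof -
 have fS: "finite S" using S good_finite by auto
 define Pp Nn where "Pp = {x\<in>S. ht x > 0}" and "Nn = {x\<in>S. ht x < 0}"
 have S_eq: "S = Pp \<union> Nn" "Pp \<inter> Nn = {}" "finite Pp" "finite Nn"
  using ht_root good_sub[OF S] fS by (auto simp: Pp_def Nn_def not_less_iff_gr_or_eq)
 define p q where "p = (SUM x:Pp. c x *R x)" and "q = (SUM x:Nn. c x *R x)"
 have "p + q = 0" using z S_eq by (simp add: p_def q_def sum.union_disjoint)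
 hence pq: "p = - q" by (simp add: eq_neg_iff_add_eq_0)
 have sp: "q \<in> span \<Phi>" unfolding q_def
  by (intro span_sum span_scale span_base) (use good_sub[OF S] in "auto simp: Nn_def")
 have "E q p = 0" unfolding p_def q_def E_sum1 E_sum2
  by (intro sum.neutral ballI) (use good_neg_pos[OF S] in "auto simp: Pp_def Nn_def")
 hence "q = 0" "p = 0" using E_definite sp pq by auto
 hence "x \<in> Pp ==> c x = 0" "x \<in> Nn ==> c x = 0"
  using obtuse_combination_zero[OF S, of Pp 1 c x] obtuse_combination_zero[OF S, of Nn "- 1" c x]
  by (simp_all add: p_def q_def Pp_def Nn_def subset_iff)
 thus ?thesis using x S_eq(1) by blast
qed

lemma good_uminus_notin:
 assumes "good S" "v \<in> S"
 shows "- v \<notin> S"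
proof
 assume "- v \<in> S"
 moreover have "ht v ~= 0" "E v v > 0" using ht_root root_norm_pos good_sub assms by blast+
 ultimately show False
  using good_neg_pos[of S v "- v"] good_neg_pos[of S "- v" v] assms by (cases "ht v > 0") auto
qed

section \<open>Positive roots in the cone of a good set\<close>

definition pos_cone :: "'v set => 'v set" where
 "pos_cone S = {\<beta> \<in> \<Phi>. ht \<beta> > 0 & (EX c. (ALL x:S. c x >= 0) & \<beta> = (SUM x:S. c x *R x))}"

lemma grn_inj: "grn v x = grn v y ==> x = y"
proof -
 assume a: "grn v x = grn v y"
 have "om v (grn v z) = om v z" for z by (simp add: grn_def)
 hence "om v x = om v y" using a by metis
 thus ?thesis using a by (simp add: grn_def)
qed

lemma red_inj: "red v x = red v y ==> x = y"
proof -
 assume a: "red v x = red v y"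
 have "om v (red v z) = om v z" for z by (simp add: red_def)
 hence "om v x = om v y" using a by metis
 thus ?thesis using a by (simp add: red_def)
qed

lemma grn_neq_uminus:
 assumes "good S" "v \<in> S" "x \<in> S"
 shows "grn v x ~= - v"
proof
 assume "grn v x = - v"
 hence "grn v x = grn v (- v)" by (simp add: grn_def)
 thus False using grn_inj good_uminus_notin assms by metis
qed

text \<open>Written in \<open>S\<close>, a root \<beta> of the new cone has nonnegative coefficients
  except possibly at \<open>v\<close>. If that one were negative, \<open>E \<beta> v < 0\<close>
  would put \<beta> before \<open>v\<close> and force a negative member whose opposite comes later
  still. The part \<open>z\<close> of \<beta> carried by all negative members with opposites later
  than \<beta> satisfies \<open>E z z = E z \<beta> <= 0\<close>, so it vanishes, a
  contradiction.\<close>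

lemma pos_cone_green_subset:
 assumes S: "good S" "v \<in> S" and v: "ht v > 0"
 shows "pos_cone (insert (- v) (grn v ` (S - {v}))) \<subseteq> pos_cone S"
proof
 fix \<beta> assume "\<beta> \<in> pos_cone (insert (- v) (grn v ` (S - {v})))"
 then obtain c where \<beta>: "\<beta> \<in> \<Phi>" "ht \<beta> > 0" and c: "ALL x:insert (- v) (grn v ` (S - {v})). c x >= 0"
  and eq: "\<beta> = (SUM x:insert (- v) (grn v ` (S - {v})). c x *R x)"
  unfolding pos_cone_def by blast
 have fS: "finite S" using S good_finite by auto
 define S1 where "S1 = S - {v}"
 define a where "a x = c (grn v x)" for x
 define c0 where "c0 = c (- v)"
 have a0: "a x >= 0" if "x \<in> S1" for x using c that by (auto simp: a_def S1_def)
 define d where "d = E v v"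
 have d: "d > 0" using root_norm_pos S good_sub by (auto simp: d_def)
 define m where "m x = max 0 (- om v x) / d" for x
 have m0: "m x >= 0" for x using d by (simp add: m_def)
 have "- v \<notin> grn v ` S1" using grn_neq_uminus[OF S] by (auto simp: S1_def) (metis)
 hence "\<beta> = c0 *R (- v) + (SUM x:grn v ` S1. c x *R x)" using eq fS by (simp add: c0_def S1_def)
 also have "(SUM x:grn v ` S1. c x *R x) = (SUM x:S1. a x *R grn v x)"
  by (subst sum.reindex) (auto simp: inj_on_def a_def dest: grn_inj)
 also have "... = (SUM x:S1. a x *R x) + (SUM x:S1. a x * m x) *R v"
  by (simp add: grn_def m_def d_def scaleR_add_right sum.distrib scaleR_left.sum)
 finally have eq2: "\<beta> = (SUM x:S1. a x *R x) + ((SUM x:S1. a x * m x) - c0) *R v"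
  by (simp add: algebra_simps)
 define k where "k = (SUM x:S1. a x * m x) - c0"
 have eq3: "\<beta> = (SUM x:S1. a x *R x) + k *R v" using eq2 by (simp add: k_def)
 have S1: "x \<in> S" "x ~= v" if "x \<in> S1" for x using that by (auto simp: S1_def)
 have "k >= 0"
 proof (rule ccontr)
  assume "~ k >= 0"
  hence k: "k < 0" by simp
  have vR: "v \<in> \<Phi>" using S good_sub by auto
  have "E \<beta> v = (SUM x:S1. a x * E x v) + k * d" by (simp add: eq3 E_sum1 d_def)
  moreover have "(SUM x:S1. a x * E x v) <= 0"
   by (intro sum_nonpos mult_nonneg_nonpos a0) (use good_pos1 S S1 v in auto)
  moreover have "k * d < 0" using k d by (simp add: mult_neg_pos)
  ultimately have "E \<beta> v < 0" by linarith
  hence ov: "ord \<beta> < ord v" using ord_neg \<beta> vR v by blast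
  hence "~ E v \<beta> < 0" using ord_neg[of v \<beta>] \<beta> vR v by fastforce
  moreover have "E v \<beta> = (SUM x:S1. a x * (E v x + m x * d)) - c0 * d"
   by (simp add: eq2 E_sum2 d_def algebra_simps sum.distrib sum_distrib_left)
  moreover have "c0 * d > 0"
  proof -
   have "(SUM x:S1. a x * m x) >= 0" using a0 m0 by (intro sum_nonneg) auto
   thus ?thesis using k d by (auto simp: k_def)
  qed
  ultimately have "(SUM x:S1. a x * (E v x + m x * d)) > 0" by linarith
  then obtain y where y: "y \<in> S1" "a y * (E v y + m y * d) > 0" by (meson not_le sum_nonpos)
  have ay: "a y > 0" using y a0[of y] by (auto simp: zero_less_mult_iff)
  have my: "m y * d = max 0 (- om v y)" using d by (simp add: m_def)
  have Evy: "E v y > 0"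
  proof (rule ccontr)
   assume "~ ?thesis"
   moreover have "E v y < 0 ==> max 0 (- om v y) = - E v y"
    using good_not_both_neg[of S v y] S S1 y v om_root[of v y] vR good_sub[of S y] by auto
   moreover have "E v y = 0 ==> max 0 (- om v y) = 0"
    using good_pos1[of S v y] S S1 y v om_root[of v y] vR good_sub[of S y] by auto
   ultimately show False using y ay my by (cases "E v y = 0") auto
  qed
  have yneg: "ht y < 0"
   using good_same[of S v y] S S1 y v Evy ht_root[OF good_sub[of S y]] by (cases "ht y > 0") auto
  have yR: "- y \<in> \<Phi>" using S S1 y good_sub root_uminus by auto
  have "ord v < ord (- y)" using ord_neg[of v "- y"] vR yR v yneg Evy by simp
  hence oy: "ord \<beta> < ord (- y)" using ov by simp
  define Z where "Z = {x\<in>S1. ht x < 0 & ord \<beta> < ord (- x)}"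
  define N where "N = {x\<in>S1. ht x < 0 & ~ ord \<beta> < ord (- x)}"
  define Q where "Q = {x\<in>S1. ht x > 0}"
  have fin: "finite Z" "finite N" "finite Q" using fS by (auto simp: Z_def N_def Q_def S1_def)
  have S1eq: "S1 = Z \<union> (N \<union> Q)" "Z \<inter> (N \<union> Q) = {}" "N \<inter> Q = {}"
   using ht_root good_sub[OF S(1)] by (auto simp: Z_def N_def Q_def S1_def not_less_iff_gr_or_eq)
  define z where "z = (SUM x:Z. a x *R x)"
  have bz: "\<beta> = z + ((SUM x:N. a x *R x) + (SUM x:Q. a x *R x)) + k *R v"
   unfolding eq3 z_def using S1eq fin by (simp add: sum.union_disjoint)
  have "E z (SUM x:N. a x *R x) = 0" unfolding z_def E_sum1 E_sum2
  proof (intro sum.neutral ballI)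
   fix p q assume pq: "p \<in> N" "q \<in> Z"
   hence "p ~= q" by (auto simp: N_def Z_def)
   hence "E q p <= 0" using good_same[OF S(1), of q p] S1 pq by (auto simp: N_def Z_def)
   moreover have "~ E q p < 0"
    using ord_neg[of "- q" "- p"] pq S1 S good_sub root_uminus by (force simp: N_def Z_def)
   ultimately have "E q p = 0" by simp
   thus "E (a q *R q) (a p *R p) = 0" by simp
  qed
  moreover have "E z (SUM x:Q. a x *R x) = 0" unfolding z_def E_sum1 E_sum2
   by (intro sum.neutral ballI) (use good_neg_pos[OF S(1)] S1 in "auto simp: Q_def Z_def")
  moreover have "E z v = 0" unfolding z_def E_sum1
   by (intro sum.neutral ballI) (use good_neg_pos[OF S(1)] S v S1 in "auto simp: Q_def Z_def")
  ultimately have "E z \<beta> = E z z" by (subst bz) simp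
  moreover have "E z \<beta> <= 0" unfolding z_def E_sum1
  proof (intro sum_nonpos)
   fix q assume q: "q \<in> Z"
   have "~ E (- q) \<beta> < 0" using ord_neg[of "- q" \<beta>] q S1 S good_sub root_uminus \<beta> by (force simp: Z_def)
   thus "E (a q *R q) \<beta> <= 0" using a0 q by (simp add: Z_def mult_nonneg_nonpos)
  qed
  ultimately have "E z z = 0" using E_nonneg[of z] by simp
  moreover have "z \<in> span \<Phi>" unfolding z_def
   by (intro span_sum span_scale span_base) (use good_sub[OF S(1)] S1 in "auto simp: Z_def")
  ultimately have "z = 0" using E_definite by simp
  hence "ht z = 0" by simp
  hence "(SUM x:Z. a x * (- ht x)) = 0" by (simp add: z_def ht_sum sum_negf)
  moreover have "ALL x:Z. a x * (- ht x) >= 0" using a0 by (auto simp: Z_def mult_nonneg_nonpos)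
  ultimately have "ALL x:Z. a x * (- ht x) = 0" using fin by (simp add: sum_nonneg_eq_0_iff)
  moreover have "y \<in> Z" using y yneg oy by (simp add: Z_def)
  ultimately show False using ay yneg by force
 qed
 define b where "b x = (if x = v then k else a x)" for x
 have "S = insert v S1" "v \<notin> S1" using S by (auto simp: S1_def)
 have "(SUM x:S. b x *R x) = k *R v + (SUM x:S1. b x *R x)"
  unfolding S1_def by (subst sum.remove[OF fS S(2)]) (simp add: b_def)
 also have "(SUM x:S1. b x *R x) = (SUM x:S1. a x *R x)"
  by (intro sum.cong) (auto simp: b_def S1_def)
 finally have "\<beta> = (SUM x:S. b x *R x)" using eq3 by simp
 moreover have "ALL x:S. b x >= 0" using `k >= 0` a0 `S = insert v S1` by (auto simp: b_def)
 ultimately show "\<beta> \<in> pos_cone S" using \<beta> by (auto simp: pos_cone_def)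
qed

lemma pos_cone_finite: "finite (pos_cone S)"
 using finite_roots by (rule finite_subset[rotated]) (auto simp: pos_cone_def)

text \<open>The inclusion is strict because \<open>v\<close> drops out: as a nonnegative combination
  of the new set it would give a relation in which \<open>- v\<close> has coefficient at least
  \<open>1\<close>.\<close>

lemma pos_cone_green:
 assumes S: "good S" "v \<in> S" and v: "ht v > 0"
 shows "pos_cone (insert (- v) (grn v ` (S - {v}))) \<subset> pos_cone S"
proof -
 let ?S = "insert (- v) (grn v ` (S - {v}))"
 have fS: "finite S" using S good_finite by auto
 have vR: "v \<in> \<Phi>" using S good_sub by auto
 have "v = (SUM x:S. (if x = v then 1 else 0) *R x)"
  using S fS by (simp add: if_distrib[of "%c. c *R _"] cong: if_cong)
 hence "v \<in> pos_cone S" using vR v unfolding pos_cone_def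
  by (intro CollectI conjI exI[of _ "%x. if x = v then 1 else 0"]) auto
 moreover have "v \<notin> pos_cone ?S"
 proof
  assume "v \<in> pos_cone ?S"
  then obtain c where c: "ALL x:?S. c x >= 0" and eq: "v = (SUM x:?S. c x *R x)"
   unfolding pos_cone_def by blast
  define b where "b x = (if x = - v then c x + 1 else c x)" for x
  have f: "finite ?S" using fS by simp
  have "(SUM x:?S. b x *R x) = (SUM x:?S. c x *R x) + (SUM x:?S. (if x = - v then 1 else 0) *R x)"
   unfolding sum.distrib[symmetric] by (intro sum.cong) (auto simp: b_def scaleR_left_distrib)
  also have "(SUM x:?S. (if x = - v then 1 else 0) *R x) = - v"
   using f by (simp add: if_distrib[of "%c. c *R _"] cong: if_cong)
  finally have "(SUM x:?S. b x *R x) = 0" using eq by simp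
  from combination_zero[OF good_green[OF S v] this] have "b (- v) = 0" by simp
  thus False using c by (auto simp: b_def)
 qed
 ultimately show ?thesis using pos_cone_green_subset[OF S v] by blast
qed

text \<open>Members with negative coefficients are separated into those later than \<open>w\<close>
  and the others. One group is paired with \<open>w\<close> from the left and the other from the
  right, so that in both cases the order shows that the group sums to a vector of nonpositive
  norm.\<close>

lemma obtuse_cone:
 assumes S: "good S" and T: "T \<subseteq> S" and pos: "!!x. x \<in> T ==> ht x > 0"
  and w: "w \<in> \<Phi>" "ht w > 0" and eq: "w = (SUM x:T. c x *R x)" and y: "y \<in> T"
 shows "c y >= 0"
proof (cases "w \<in> T")
 case True
 have fT: "finite T" using T S good_finite finite_subset by blast
 have "(SUM x:T. (if x = w then 1 else 0) *R x) = w"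
  using fT True by (simp add: if_distrib[of "%c. c *R _"] cong: if_cong)
 hence "(SUM x:T. (c x - (if x = w then 1 else 0)) *R x) = 0"
  using eq by (simp add: scaleR_left_diff_distrib sum_subtractf)
 from obtuse_combination_zero[OF S T, of 1, OF _ this y] have "c y - (if y = w then 1 else 0) = 0"
  using pos by auto
 thus ?thesis by (auto split: if_splits)
next
 case wT: False
 have fT: "finite T" using T S good_finite finite_subset by blast
 define A where "A = {x\<in>T. c x < 0 & ord x <= ord w}"
 define C where "C = {x\<in>T. c x < 0 & ~ ord x <= ord w}"
 define D where "D = {x\<in>T. ~ c x < 0}"
 have fin: "finite A" "finite C" "finite D" using fT by (auto simp: A_def C_def D_def)
 have Teq: "T = A \<union> (C \<union> D)" "A \<inter> (C \<union> D) = {}" "C \<inter> D = {}" by (auto simp: A_def C_def D_def)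
 define p q r where "p = (SUM x:A. c x *R x)" and "q = (SUM x:C. c x *R x)" and "r = (SUM x:D. c x *R x)"
 have w_eq: "w = p + (q + r)"
  unfolding eq p_def q_def r_def using Teq fin by (simp add: sum.union_disjoint)
 have TR: "x \<in> \<Phi>" if "x \<in> T" for x using that T S good_sub by auto
 have TT: "E x x' <= 0" if "x \<in> T" "x' \<in> T" "x ~= x'" for x x' using good_same[OF S] that T pos by blast
 have AC: "E x x' = 0" if "x \<in> C" "x' \<in> A" for x x'
 proof -
  have "E x x' <= 0" using TT that by (auto simp: A_def C_def)
  moreover have "~ E x x' < 0" using ord_neg[of x x'] that TR pos by (force simp: A_def C_def)
  ultimately show ?thesis by simp
 qed
 \<comment> \<open>\<open>E q w <= 0\<close> by the order, while \<open>E q w >= E q q\<close> as the sums are obtuse.\<close>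
 have spq: "p \<in> span \<Phi>" "q \<in> span \<Phi>" unfolding p_def q_def
  by (intro span_sum span_scale span_base; use TR in "auto simp: A_def C_def")+
 have "E q r >= 0" "E r p >= 0" "E q p = 0" unfolding p_def q_def r_def E_sum1 E_sum2
  by (intro sum_nonneg sum.neutral ballI; use TT AC in "auto simp: A_def C_def D_def mult_nonpos_nonneg mult_nonneg_nonpos zero_le_mult_iff mult_le_0_iff")+
 hence "E q w >= E q q" "E w p >= E p p" by (simp_all add: w_eq)
 moreover have "E q w <= 0" unfolding q_def E_sum1
 proof (intro sum_nonpos)
  fix x assume x: "x \<in> C"
  hence "~ E x w < 0" using ord_neg[of x w] TR pos w by (force simp: C_def)
  thus "E (c x *R x) w <= 0" using x by (simp add: C_def mult_nonpos_nonneg)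
 qed
 moreover have "E w p <= 0" unfolding p_def E_sum2
 proof (intro sum_nonpos)
  fix x assume x: "x \<in> A"
  hence "~ E w x < 0" using ord_neg[of w x] TR pos w by (force simp: A_def)
  thus "E w (c x *R x) <= 0" using x by (simp add: A_def mult_nonpos_nonneg)
 qed
 ultimately have "p = 0" "q = 0" using E_nonneg[of p] E_nonneg[of q] E_definite spq by auto
 show ?thesis
 proof (rule ccontr)
  assume n: "~ ?thesis"
  have "c x * ht x = 0" if "x \<in> A \<union> C" for x
  proof -
   have "(SUM x:A. - (c x * ht x)) = 0" "(SUM x:C. - (c x * ht x)) = 0"
    using arg_cong[OF `p = 0`, of ht] arg_cong[OF `q = 0`, of ht]
    by (simp_all add: p_def q_def ht_sum sum_negf)
   moreover have "ALL x:A. - (c x * ht x) >= 0" "ALL x:C. - (c x * ht x) >= 0"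
    using pos by (auto simp: A_def C_def mult_le_0_iff less_imp_le)
   ultimately have "ALL x:A. - (c x * ht x) = 0" "ALL x:C. - (c x * ht x) = 0"
    using fin by (simp_all add: sum_nonneg_eq_0_iff)
   thus ?thesis using that by auto
  qed
  moreover have "y \<in> A \<union> C" using y n by (auto simp: A_def C_def)
  ultimately show False using pos[OF y] n by fastforce
 qed
qed

text \<open>As \<open>E v\<close> vanishes on the other members, these are combinations of the other
  members of the second set alone, with nonnegative coefficients by \<open>obtuse_cone\<close>. Two
  independent systems spanning the same simplicial cone have the same extremal rays, and a ray
  contains only one root.\<close>

lemma only_red_subset:
 assumes S: "good S" and S': "good S'" and v: "v \<in> S" "v \<in> S'" and red: "ht v < 0"
  and only: "!!x. x \<in> S - {v} ==> ht x > 0" and only': "!!x. x \<in> S' - {v} ==> ht x > 0"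
  and sp: "S \<subseteq> span S'" "S' \<subseteq> span S"
 shows "S \<subseteq> S'"
proof -
 have cone: "EX c. (ALL x:A - {v}. c x >= 0) & w = (SUM x:A - {v}. c x *R x)"
  if A: "good A" "v \<in> A" "!!x. x \<in> A - {v} ==> ht x > 0" and B: "good B" "v \<in> B"
   and sp: "B \<subseteq> span A" and w: "w \<in> B - {v}" "ht w > 0" for A B w
 proof -
  have fA: "finite A" using A good_finite by auto
  have "w \<in> span A" using sp w by auto
  then obtain c where c: "w = (SUM x:A. c x *R x)" unfolding span_finite[OF fA] by blast
  have eq: "w = c v *R v + (SUM x:A - {v}. c x *R x)" using c A fA by (simp add: sum.remove[of A v])
  have "E v (SUM x:A - {v}. c x *R x) = 0"
   unfolding E_sum2 using good_neg_pos[OF A(1)] A red by (intro sum.neutral) auto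
  hence "E v w = c v * E v v" by (subst eq) simp
  moreover have "E v w = 0" using good_neg_pos[OF B(1)] B w red by auto
  ultimately have "c v = 0" using root_norm_pos[of v] A good_sub by fastforce
  hence "w = (SUM x:A - {v}. c x *R x)" using eq by simp
  thus ?thesis using obtuse_cone[OF A(1), of "A - {v}" w c] A w good_sub[OF B(1)] by blast
 qed
 show "S \<subseteq> S'"
 proof
  fix w assume w: "w \<in> S"
  show "w \<in> S'"
  proof (cases "w = v")
   case True thus ?thesis using v by simp
  next
   case False
   have f: "finite S" "finite S'" using S S' good_finite by auto
   have hw: "ht w > 0" using only w False by auto
   obtain c where c: "ALL x:S' - {v}. c x >= 0" "w = (SUM x:S' - {v}. c x *R x)"
    using cone[OF S' v(2) only' S v(1) sp(1)] w False hw by blast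
   have "ALL u:S' - {v}. EX e. (ALL x:S - {v}. e x >= 0) & u = (SUM x:S - {v}. e x *R x)"
    using cone[OF S v(1) only S' v(2) sp(2)] only' by blast
   then obtain e where e: "!!u x. u \<in> S' - {v} ==> x \<in> S - {v} ==> e u x >= 0"
     "!!u. u \<in> S' - {v} ==> u = (SUM x:S - {v}. e u x *R x)" by metis
   have "w = (SUM u:S' - {v}. c u *R (SUM x:S - {v}. e u x *R x))"
    using c e(2) by (smt (verit, best) sum.cong)
   also have "... = (SUM u:S' - {v}. SUM x:S - {v}. (c u * e u x) *R x)"
    by (simp add: scaleR_sum_right)
   also have "... = (SUM x:S - {v}. (SUM u:S' - {v}. c u * e u x) *R x)"
    by (subst sum.swap) (simp add: scaleR_left.sum)
   finally have w_eq: "w = (SUM x:S - {v}. (SUM u:S' - {v}. c u * e u x) *R x)" .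
   \<comment> \<open>Substituting the two kinds of combinations into each other expresses
     \<open>w\<close> by itself. No coefficient away from \<open>w\<close> survives, and since all
     products are nonnegative each single one vanishes.\<close>
   have zero: "c u * e u x = 0" if u: "u \<in> S' - {v}" and x: "x \<in> S - {v}" "x ~= w" for u x
   proof -
    have "(SUM x:S - {v}. (if x = w then 1 else 0) *R x) = w"
     using f w False by (simp add: if_distrib[of "%c. c *R _"] cong: if_cong)
    hence "(SUM x:S - {v}. ((SUM u:S' - {v}. c u * e u x) - (if x = w then 1 else 0)) *R x) = 0"
     using w_eq by (simp add: scaleR_left_diff_distrib sum_subtractf)
    hence "(SUM u:S' - {v}. c u * e u x) - (if x = w then 1 else 0) = 0"
     by (rule obtuse_combination_zero[OF S, of _ 1, rotated 2]) (use only x in auto)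
    hence "(SUM u:S' - {v}. c u * e u x) = 0" using x by simp
    thus ?thesis using c e(1) u x f by (subst (asm) sum_nonneg_eq_0_iff) auto
   qed
   have "EX u:S' - {v}. c u ~= 0"
   proof (rule ccontr)
    assume "~ ?thesis"
    hence "w = 0" using c(2) by (simp add: sum.neutral)
    thus False using hw by simp
   qed
   then obtain u where u: "u \<in> S' - {v}" "c u ~= 0" by blast
   have "u = (SUM x:S - {v}. e u x *R x)" using e(2) u by blast
   also have "... = e u w *R w"
    using zero[OF u(1)] u(2) f w False by (subst sum.remove[of _ w]) (auto intro!: sum.neutral)
   finally have uw: "u = e u w *R w" .
   have "ht u = e u w * ht w" using arg_cong[OF uw, of ht] by simp
   hence "e u w > 0" using only' u hw by (metis zero_less_mult_pos2)
   hence "e u w = 1" using root_reduced[of w "e u w"] uw good_sub[OF S w] good_sub[OF S'] u by auto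
   thus ?thesis using uw u by simp
  qed
 qed
qed

lemma only_red_unique:
 assumes "good S" "good S'" "v \<in> S" "v \<in> S'" "ht v < 0"
  and "!!x. x \<in> S - {v} ==> ht x > 0" "!!x. x \<in> S' - {v} ==> ht x > 0" and "S \<subseteq> span S'" "S' \<subseteq> span S"
 shows "S = S'"
 using only_red_subset[of S S' v] only_red_subset[of S' S v] assms by blast

end

section \<open>Rank two polygons and confluence\<close>

text \<open>The softplus function: it treats logarithms of the two sides of an exchange relation as
  \<open>max 0\<close> treats their exponents.\<close>

definition soft :: "real => real" where
 "soft a = ln (1 + exp a)"

lemma soft_ln:
 assumes "s > 0" "t > 0" "a = ln s - ln t"
 shows "soft a = ln (s + t) - ln t"
proof -
 have "exp a = s / t" unfolding assms(3) exp_diff using assms(1,2) by simp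
 hence "1 + exp a = (s + t) / t" using assms(1,2) by (simp add: field_simps)
 thus ?thesis using assms by (simp add: soft_def ln_div)
qed

text \<open>In the plane of two roots \<open>P\<close>, \<open>Q\<close> with \<open>om Q P = g E P P = c E Q Q\<close>, the pair \<open>(A, C)\<close> stands for the
 point \<open>x + A P / E P P + C Q / E Q Q\<close> and \<open>(i, j)\<close> for the root \<open>i P + j Q\<close>.\<close>

definition pair_step_at ::
 "(real => real) => real => real => real => real => real * real => real * real => real * real" where
 "pair_step_at f g c a b = (%(i, j) (A, C).
   let y = f (i * a + j * b + j * g * A - i * c * C); m = i * i + j * j * g / c - i * j * g
   in (A + i / m * y, C + j * g / (c * m) * y))"

definition polygon :: "(real => real) => real => real => (real * real) list => bool" where
 "polygon f g c ws <->
   (ALL a b. fold (pair_step_at f g c a b) ws (0, 0) = fold (pair_step_at f g c a b) [(1, 0), (0, 1)] (0, 0))"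

text \<open>The types \<open>A\<^sub>2\<close>, \<open>B\<^sub>2\<close> and \<open>G\<^sub>2\<close>, with the positive roots in the order of the longer chain.\<close>

inductive rank_two :: "real => real => (real * real) list => bool" where
 "rank_two 1 1 [(0, 1), (1, 1), (1, 0)]"
| "rank_two 2 1 [(0, 1), (1, 1), (2, 1), (1, 0)]"
| "rank_two 1 2 [(0, 1), (1, 2), (1, 1), (1, 0)]"
| "rank_two 3 1 [(0, 1), (1, 1), (3, 2), (2, 1), (3, 1), (1, 0)]"
| "rank_two 1 3 [(0, 1), (1, 3), (1, 2), (2, 3), (1, 1), (1, 0)]"

text \<open>The premise names the value of \<open>f\<close> before it is used, so that a long chain
  is evaluated step by step without nesting.\<close>

lemma fold_pair_step_atI: "(!!y. y = f (i * a + j * b + j * g * A - i * c * C) ==>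
   fold (pair_step_at f g c a b) ws (A + i / (i * i + j * j * g / c - i * j * g) * y,
    C + j * g / (c * (i * i + j * j * g / c - i * j * g)) * y) = s) ==>
  fold (pair_step_at f g c a b) ((i, j) # ws) (A, C) = s" by (simp add: pair_step_at_def Let_def)

text \<open>Both sides are piecewise linear in the two parameters, so splitting the maxima leaves
  linear arithmetic.\<close>

lemma relu_polygon: "rank_two g c ws ==> polygon (max 0) g c ws" unfolding polygon_def
 by (cases rule: rank_two.cases, assumption; hypsubst; intro allI fold_pair_step_atI; 
  simp add: pair_step_at_def max_def split: if_splits; auto)

text \<open>A step whose argument is the logarithm of \<open>s / t\<close> is an exchange relation
  with sum \<open>p = s + t\<close>; the sum has its own name so that a factorised form can be
  supplied.\<close>

lemma soft_step:
 assumes "s > 0" "t > 0" "p = s + t" "i * a + j * b + j * g * A - i * c * C = ln s - ln t"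
  and "A' = A + i / (i * i + j * j * g / c - i * j * g) * (ln p - ln t)"
  and "C' = C + j * g / (c * (i * i + j * j * g / c - i * j * g)) * (ln p - ln t)"
 shows "pair_step_at soft g c a b (i, j) (A, C) = (A', C')"
 using soft_ln[OF assms(1,2,4)] assms(3,5,6) by (simp add: pair_step_at_def Let_def)

text \<open>The auxiliary \<open>p1\<close>, \<open>p2\<close>, ... are the F-polynomials of the
  rank two cluster algebra in \<open>U\<close> and \<open>W\<close>. The top monomial of each has
  the coordinates of the corresponding root as exponents, and every step is an exchange relation
  between consecutive ones.\<close>

lemma soft_polygon: "rank_two g c ws ==> polygon soft g c ws" unfolding polygon_def
proof (intro allI)
 fix a b :: real assume r: "rank_two g c ws"
 let ?S = "%g c. pair_step_at soft g c a b"
 define U W where "U = exp a" and "W = exp b"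
 have UW: "U > 0" "W > 0" "1 + U > 0" "1 + W > 0" "a = ln U" "b = ln W" by (simp_all add: U_def W_def add_pos_pos)
 define l where "l = ln (1 + U)"
 note logs = UW(5,6) l_def ln_mult ln_realpow and powers = power2_eq_square power3_eq_cube algebra_simps
 have P: "?S g c (1, 0) (0, 0) = (l, 0)" for g c
  unfolding l_def by (rule soft_step[of U 1 "1 + U"]) (use UW in "simp_all add: logs")
 have Q: "?S g c (0, 1) (0, 0) = (0, ln (1 + W))" if "g ~= 0" "c ~= 0" for g c
  by (rule soft_step[of W 1 "1 + W"]) (use UW that in "simp_all add: logs")
 have PQ: "?S g c (0, 1) (l, 0) = (l, ln (1 + W * (1 + U) ^ m))" if "g = real m" "m > 0" "c ~= 0" for g m c
  unfolding l_def by (rule soft_step[of "W * (1 + U) ^ m" 1 "1 + W * (1 + U) ^ m"])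
   (use UW that in "simp_all add: logs")
 show "fold (?S g c) ws (0, 0) = fold (?S g c) [(1, 0), (0, 1)] (0, 0)" using r
 proof cases
  case 1
  define p1 p2 where "p1 = 1 + W" and "p2 = 1 + W * (1 + U)"
  note d = p1_def p2_def
  have p: "p1 > 0" "p2 > 0" using UW by (simp_all add: d add_pos_pos)
  have "?S 1 1 (1, 1) (0, ln p1) = (ln p2 - ln p1, ln p2)"
   by (rule soft_step[of "U * W" p1 p2]) (use UW p in "simp_all add: logs", simp_all add: d powers)
  moreover have "?S 1 1 (1, 0) (ln p2 - ln p1, ln p2) = (l, ln p2)"
   by (rule soft_step[of U p2 "(1 + U) * p1"]) (use UW p in "simp_all add: logs", simp_all add: d powers)
  ultimately show ?thesis using 1 P Q[of 1 1] PQ[of 1 1 1] by (simp add: d)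
 next
  case 2
  define p1 p2 p3 where "p1 = 1 + W" and "p2 = 1 + W + U * W" and "p3 = 1 + W * (1 + U) ^ 2"
  note d = p1_def p2_def p3_def
  have p: "p1 > 0" "p2 > 0" "p3 > 0" using UW by (simp_all add: d add_pos_pos)
  have "?S 2 1 (1, 1) (0, ln p1) = (ln p2 - ln p1, 2 * ln p2 - ln p1)"
   by (rule soft_step[of "U * W" p1 p2]) (use UW p in "simp_all add: logs", simp_all add: d powers)
  moreover have "?S 2 1 (2, 1) (ln p2 - ln p1, 2 * ln p2 - ln p1) = (ln p3 - ln p2, ln p3)"
   by (rule soft_step[of "U ^ 2 * W" "p2 ^ 2" "p1 * p3"]) (use UW p in "simp_all add: logs", simp_all add: d powers)
  moreover have "?S 2 1 (1, 0) (ln p3 - ln p2, ln p3) = (l, ln p3)"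
   by (rule soft_step[of U p3 "(1 + U) * p2"]) (use UW p in "simp_all add: logs", simp_all add: d powers)
  ultimately show ?thesis using 2 P Q[of 2 1] PQ[of 2 2 1] by (simp add: d)
 next
  case 3
  define p1 p2 p3 where "p1 = 1 + W" and "p2 = (1 + W) ^ 2 + U * W ^ 2" and "p3 = 1 + W * (1 + U)"
  note d = p1_def p2_def p3_def
  have p: "p1 > 0" "p2 > 0" "p3 > 0" using UW by (simp_all add: d add_pos_pos)
  have "?S 1 2 (1, 2) (0, ln p1) = (ln p2 - 2 * ln p1, ln p2 - ln p1)"
   by (rule soft_step[of "U * W ^ 2" "p1 ^ 2" p2]) (use UW p in "simp_all add: logs", simp_all add: d powers)
  moreover have "?S 1 2 (1, 1) (ln p2 - 2 * ln p1, ln p2 - ln p1) = (2 * ln p3 - ln p2, ln p3)"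
   by (rule soft_step[of "U * W" p2 "p1 * p3"]) (use UW p in "simp_all add: logs", simp_all add: d powers)
  moreover have "?S 1 2 (1, 0) (2 * ln p3 - ln p2, ln p3) = (l, ln p3)"
   by (rule soft_step[of U "p3 ^ 2" "(1 + U) * p2"]) (use UW p in "simp_all add: logs", simp_all add: d powers)
  ultimately show ?thesis using 3 P Q[of 1 2] PQ[of 1 1 2] by (simp add: d)
 next
  case 4
  define p1 p2 p3 p4 p5 where "p1 = 1 + W" and "p2 = 1 + W + U * W" and "p3 = (1 + W) ^ 2 + 3 * (1 + W) * U * W + 3 * U ^ 2 * W ^ 2 + U ^ 3 * W ^ 2" and "p4 = 1 + W * (1 + U) ^ 2" and "p5 = 1 + W * (1 + U) ^ 3"
  note d = p1_def p2_def p3_def p4_def p5_def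
  have p: "p1 > 0" "p2 > 0" "p3 > 0" "p4 > 0" "p5 > 0" using UW by (simp_all add: d add_pos_pos)
  have "?S 3 1 (1, 1) (0, ln p1) = (ln p2 - ln p1, 3 * ln p2 - 2 * ln p1)"
   by (rule soft_step[of "U * W" p1 p2]) (use UW p in "simp_all add: logs", simp_all add: d powers)
  moreover have "?S 3 1 (3, 2) (ln p2 - ln p1, 3 * ln p2 - 2 * ln p1) = (ln p3 - 2 * ln p2, 2 * ln p3 - 3 * ln p2)"
   by (rule soft_step[of "U ^ 3 * W ^ 2" "p2 ^ 3" "p1 * p3"]) (use UW p in "simp_all add: logs", simp_all add: d powers)
  moreover have "?S 3 1 (2, 1) (ln p3 - 2 * ln p2, 2 * ln p3 - 3 * ln p2) = (2 * ln p4 - ln p3, 3 * ln p4 - ln p3)"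
   by (rule soft_step[of "U ^ 2 * W" p3 "p2 * p4"]) (use UW p in "simp_all add: logs", simp_all add: d powers)
  moreover have "?S 3 1 (3, 1) (2 * ln p4 - ln p3, 3 * ln p4 - ln p3) = (ln p5 - ln p4, ln p5)"
   by (rule soft_step[of "U ^ 3 * W" "p4 ^ 3" "p3 * p5"]) (use UW p in "simp_all add: logs", simp_all add: d powers)
  moreover have "?S 3 1 (1, 0) (ln p5 - ln p4, ln p5) = (l, ln p5)"
   by (rule soft_step[of U p5 "(1 + U) * p4"]) (use UW p in "simp_all add: logs", simp_all add: d powers)
  ultimately show ?thesis using 4 P Q[of 3 1] PQ[of 3 3 1] by (simp add: d)
 next
  case 5
  define p1 p2 p3 p4 p5 where "p1 = 1 + W" and "p2 = (1 + W) ^ 3 + U * W ^ 3" and "p3 = (1 + W) ^ 2 + U * W ^ 2" and "p4 = (1 + W) ^ 3 + (3 * W ^ 2 + 2 * W ^ 3) * U + W ^ 3 * U ^ 2" and "p5 = 1 + W * (1 + U)"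
  note d = p1_def p2_def p3_def p4_def p5_def
  have p: "p1 > 0" "p2 > 0" "p3 > 0" "p4 > 0" "p5 > 0" using UW by (simp_all add: d add_pos_pos)
  have "?S 1 3 (1, 3) (0, ln p1) = (ln p2 - 3 * ln p1, ln p2 - 2 * ln p1)"
   by (rule soft_step[of "U * W ^ 3" "p1 ^ 3" p2]) (use UW p in "simp_all add: logs", simp_all add: d powers)
  moreover have "?S 1 3 (1, 2) (ln p2 - 3 * ln p1, ln p2 - 2 * ln p1) = (3 * ln p3 - 2 * ln p2, 2 * ln p3 - ln p2)"
   by (rule soft_step[of "U * W ^ 2" p2 "p1 * p3"]) (use UW p in "simp_all add: logs", simp_all add: d powers)
  moreover have "?S 1 3 (2, 3) (3 * ln p3 - 2 * ln p2, 2 * ln p3 - ln p2) = (2 * ln p4 - 3 * ln p3, ln p4 - ln p3)"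
   by (rule soft_step[of "U ^ 2 * W ^ 3" "p3 ^ 3" "p2 * p4"]) (use UW p in "simp_all add: logs", simp_all add: d powers)
  moreover have "?S 1 3 (1, 1) (2 * ln p4 - 3 * ln p3, ln p4 - ln p3) = (3 * ln p5 - ln p4, ln p5)"
   by (rule soft_step[of "U * W" p4 "p3 * p5"]) (use UW p in "simp_all add: logs", simp_all add: d powers)
  moreover have "?S 1 3 (1, 0) (3 * ln p5 - ln p4, ln p5) = (l, ln p5)"
   by (rule soft_step[of U "p5 ^ 3" "(1 + U) * p4"]) (use UW p in "simp_all add: logs", simp_all add: d powers)
  ultimately show ?thesis using 5 P Q[of 1 3] PQ[of 1 1 3] by (simp add: d)
 qed
qed

section \<open>Red mutations as a rewriting system\<close>

context cluster_roots
begin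

definition shift :: "(real => real) => 'v => 'v => 'v" where
 "shift f v x = x + (f (om v x) / E v v) *R v"

lemma red_shift: "red = shift (max 0)" by (auto simp: fun_eq_iff red_def shift_def)

definition red_step :: "'v set \<times> (nat => 'v) \<times> 'v => 'v set \<times> (nat => 'v) \<times> 'v => bool" where
 "red_step s s' <-> (case s of (S, U, X) =>
   EX v:S. good S & ht v < 0 & s' = (insert (- v) (red v ` (S - {v})), red v o U, shift soft v X))"

lemma red_stepI: "good S ==> v \<in> S ==> ht v < 0 ==>
  red_step (S, U, X) (insert (- v) (red v ` (S - {v})), red v o U, shift soft v X)"
 by (auto simp: red_step_def)

definition pair_state :: "'v => 'v => 'v set => bool" where
 "pair_state e f R <-> good (insert e (insert f R)) & e ~= f & e \<notin> R & f \<notin> R"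

lemma pair_state_commute: "pair_state e f R <-> pair_state f e R"
 by (auto simp: pair_state_def insert_commute)

text \<open>The pair is returned with \<open>- e\<close> in second place, so that the next mutation
  of a chain again happens at the first entry.\<close>

lemma pair_step:
 assumes e: "pair_state e f R" "ht e < 0"
 shows "red_step (insert e (insert f R), U, X)
   (insert (red e f) (insert (- e) (red e ` R)), red e o U, shift soft e X)"
  and "pair_state (red e f) (- e) (red e ` R)"
proof -
 let ?S = "insert e (insert f R)"
 have eq: "insert (- e) (red e ` (?S - {e})) = insert (red e f) (insert (- e) (red e ` R))"
  using e by (auto simp: pair_state_def)
 show "red_step (?S, U, X) (insert (red e f) (insert (- e) (red e ` R)), red e o U, shift soft e X)"
  using red_stepI[of ?S e U X] e unfolding eq by (auto simp: pair_state_def)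
 have n: "red e x ~= - e" if "x \<in> ?S" for x
 proof
  assume "red e x = - e"
  hence "red e x = red e (- e)" by (simp add: red_def)
  hence "x = - e" by (rule red_inj)
  thus False using good_uminus_notin[of ?S e] e that by (simp add: pair_state_def)
 qed
 have "good (insert (red e f) (insert (- e) (red e ` R)))"
  using good_red[of ?S e] e unfolding eq by (auto simp: pair_state_def)
 moreover have "red e f \<notin> red e ` R" using e red_inj by (auto simp: pair_state_def)
 moreover have "- e \<notin> red e ` R" using n by (metis imageE insertI2)
 ultimately show "pair_state (red e f) (- e) (red e ` R)" using n[of f] by (auto simp: pair_state_def)
qed

primrec red_walk :: "'v list => 'v => 'v => 'v \<times> 'v => bool" where
 "red_walk [] e f s <-> s = (e, f)"
| "red_walk (w # ws) e f s <-> w = e & ht e < 0 & red_walk ws (red e f) (- e) s"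

lemma red_walk_steps: "red_walk ws e f (e', f') ==> pair_state e f R ==>
  red_step\<^sup>*\<^sup>* (insert e (insert f R), U, X)
   (insert e' (insert f' (fold red ws ` R)), fold red ws o U, fold (shift soft) ws X)"
proof (induction ws arbitrary: e f R U X)
 case (Cons w ws)
 hence w: "w = e" "ht e < 0" "red_walk ws (red e f) (- e) (e', f')" by simp_all
 show ?case using converse_rtranclp_into_rtranclp[OF pair_step(1)[OF Cons.prems(2) w(2)]
    Cons.IH[OF w(3) pair_step(2)[OF Cons.prems(2) w(2)]]] by (simp add: w(1) image_image comp_def)
qed simp

section \<open>The plane of two roots\<close>

context
 fixes P Q :: 'v and dP dQ g c k :: real
 assumes PQ: "P \<in> \<Phi>" "Q \<in> \<Phi>" "E Q P = 0" "E P Q = - k"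
  and dP: "E P P = dP" and dQ: "E Q Q = dQ" and kg: "k = g * dP" and kc: "k = c * dQ"
begin

lemma d_pos: "dP > 0" "dQ > 0" using root_norm_pos PQ dP dQ by auto

lemma om_PQ: "om P Q = - k" "om Q P = k" using om_root[of P Q] om_root[of Q P] PQ by auto

definition comb :: "real * real => 'v" where
 "comb w = fst w *R P + snd w *R Q"

definition offset :: "'v => real * real => 'v" where
 "offset x s = x + (fst s / dP) *R P + (snd s / dQ) *R Q"

lemma E_comb: "c ~= 0 ==> E (comb (i, j)) (comb (i, j)) = (i * i + j * j * g / c - i * j * g) * dP"
proof -
 assume "c ~= 0"
 hence "dQ = g / c * dP" using kg kc by (simp add: field_simps)
 thus ?thesis using PQ dP dQ kg by (simp add: comb_def algebra_simps)
qed

lemma comb_simps: "comb (1, 0) = P" "comb (0, 1) = Q" "- comb (i, j) = comb (- i, - j)"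
 by (simp_all add: comb_def)

text \<open>Inside the plane a shift sees only the two coordinates of the offset and the pairings of
  \<open>x\<close> with \<open>P\<close> and \<open>Q\<close>; this turns a polygon of mutations
  into an identity of real functions.\<close>

lemma shift_comb:
 assumes "g ~= 0" "c ~= 0"
 shows "shift f (comb w) (offset x s) = offset x (pair_step_at f g c (om P x) (om Q x) w s)"
proof -
 obtain i j A C where w: "w = (i, j)" "s = (A, C)" by (metis surj_pair)
 define y m where "y = f (i * om P x + j * om Q x + j * g * A - i * c * C)" and "m = i * i + j * j * g / c - i * j * g"
 have "om (comb w) (offset x s) = i * om P x + j * om Q x + j * (A / dP) * k - i * (C / dQ) * k"
  using om_PQ by (simp add: comb_def offset_def w algebra_simps)
 also have "j * (A / dP) * k = j * g * A" using d_pos kg by simp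
 also have "i * (C / dQ) * k = i * c * C" using d_pos kc by simp
 finally have y: "f (om (comb w) (offset x s)) = y" by (simp add: y_def)
 have "g / (c * m) * y / dQ = g * y / (m * (c * dQ))" by (simp add: mult_ac)
 hence e: "y / (m * dP) = g / (c * m) * y / dQ" using kg[unfolded kc] assms by simp
 have "y / (m * dP) * i = i / m * y / dP" by simp
 moreover have "y / (m * dP) * j = j * g / (c * m) * y / dQ" unfolding e by simp
 ultimately have "(y / (m * dP)) *R comb w = (i / m * y / dP) *R P + (j * g / (c * m) * y / dQ) *R Q"
  unfolding comb_def scaleR_add_right scaleR_scaleR w fst_conv snd_conv by (simp only:)
 hence "shift f (comb w) (offset x s) = offset x (A + i / m * y, C + j * g / (c * m) * y)"
  unfolding shift_def y unfolding w E_comb[OF assms(2)] m_def[symmetric]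
  by (simp add: offset_def add_divide_distrib scaleR_left_distrib)
 thus ?thesis by (simp add: pair_step_at_def w Let_def y_def m_def)
qed

lemma shift_polygon:
 assumes "polygon f g c ws" "g ~= 0" "c ~= 0"
 shows "fold (shift f) (map comb ws) x = shift f Q (shift f P x)"
proof -
 have "fold (shift f) (map comb ws) (offset x s) = offset x (fold (pair_step_at f g c (om P x) (om Q x)) ws s)" for ws s
  by (induction ws arbitrary: s) (simp_all add: shift_comb[OF assms(2,3)])
 from this[of ws "(0, 0)"] this[of "[(1, 0), (0, 1)]" "(0, 0)"] show ?thesis
  using assms(1) by (simp add: polygon_def offset_def comb_simps)
qed

lemma commuting_shift:
 assumes "k = 0"
 shows "shift f Q (shift f P x) = shift f P (shift f Q x)"
 using om_PQ assms by (simp add: shift_def)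

lemma red_comb:
 assumes "g >= 0" "c ~= 0"
 shows "red (comb (i, j)) (comb (i', j')) =
  comb (i' + max 0 (i' * j - i * j') * g / (i * i + j * j * g / c - i * j * g) * i,
   j' + max 0 (i' * j - i * j') * g / (i * i + j * j * g / c - i * j * g) * j)"
proof -
 have "om (comb (i, j)) (comb (i', j')) = (i' * j - i * j') * g * dP"
  using om_PQ kg by (simp add: comb_def algebra_simps)
 hence "max 0 (om (comb (i, j)) (comb (i', j'))) = max 0 (i' * j - i * j') * g * dP"
  using assms(1) d_pos by (simp add: max_def zero_le_mult_iff mult_le_0_iff)
 hence "max 0 (om (comb (i, j)) (comb (i', j'))) / E (comb (i, j)) (comb (i, j))
   = max 0 (i' * j - i * j') * g / (i * i + j * j * g / c - i * j * g)"
  unfolding E_comb[OF assms(2)] using d_pos by simp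
 thus ?thesis unfolding red_def by (simp add: comb_def algebra_simps)
qed

lemma rank_two_walk:
 assumes "rank_two g c ws" "ht P < 0" "ht Q < 0"
 shows "red_walk (map comb ws) Q P (- Q, - P)"
proof -
 have n: "ht (comb (i, j)) = i * ht P + j * ht Q" for i j by (simp add: comb_def)
 have "red_walk (map comb ws) (comb (0, 1)) (comb (1, 0)) (- comb (0, 1), - comb (1, 0))" using assms(1)
 proof cases
 qed (use assms(2,3) in "simp_all add: red_comb comb_simps(3) n")
 thus ?thesis by (simp add: comb_simps)
qed

text \<open>On the short side of the polygon the two mutations do not disturb each other, since
  \<open>om P Q\<close> and \<open>om Q (- P)\<close> are both \<open>- k <= 0\<close>.\<close>

lemma red_chain_second:
 assumes p: "pair_state P Q R" and neg: "ht P < 0" "ht Q < 0" and k: "k >= 0"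
 shows "red_step (insert (red P Q) (insert (- P) (red P ` R)), red P o U, shift soft P X)
   (insert (- Q) (insert (- P) ((%x. red Q (red P x)) ` R)), (%x. red Q (red P x)) o U,
   shift soft Q (shift soft P X))"
proof -
 have e: "red P Q = Q" "red Q (- P) = - P" using om_PQ k by (simp_all add: red_def)
 from pair_step(1)[of Q "- P" "red P ` R" "red P o U" "shift soft P X"] pair_step(2)[OF p neg(1)] neg
 show ?thesis unfolding e by (simp add: insert_commute image_image comp_def)
qed

text \<open>The numbers \<open>g\<close> and \<open>c\<close> are the negatives of the two Cartan
  integers. Definiteness leaves the types A1 x A1, A2, B2 and G2, and in each of them the two sides
  of the polygon meet in \<open>?s\<close>.\<close>

lemma pair_confluent:
 assumes p: "pair_state P Q R" and neg: "ht P < 0" "ht Q < 0" and k: "k >= 0"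
  and g: "g \<in> \<int>" and c: "c \<in> \<int>"
 shows "EX s. red_step\<^sup>*\<^sup>* (insert (red P Q) (insert (- P) (red P ` R)), red P o U, shift soft P X) s
   & red_step\<^sup>*\<^sup>* (insert (red Q P) (insert (- Q) (red Q ` R)), red Q o U, shift soft Q X) s"
proof -
 let ?s = "(insert (- Q) (insert (- P) ((%x. red Q (red P x)) ` R)), (%x. red Q (red P x)) o U,
   shift soft Q (shift soft P X))"
 have 1: "red_step\<^sup>*\<^sup>* (insert (red P Q) (insert (- P) (red P ` R)), red P o U, shift soft P X) ?s"
  using red_chain_second[OF p neg k] by (rule r_into_rtranclp)
 have p': "pair_state Q P R" using p pair_state_commute by blast
 have "g = k / dP" unfolding kg using d_pos by simp
 moreover have "c = k / dQ" unfolding kc using d_pos by simp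
 ultimately have gc0: "g >= 0" "c >= 0" using k d_pos by simp_all
 obtain g' c' :: int where gi: "g = of_int g'" "c = of_int c'" using g c by (auto elim!: Ints_cases)
 have "red_step\<^sup>*\<^sup>* (insert (red Q P) (insert (- Q) (red Q ` R)), red Q o U, shift soft Q X) ?s"
 proof (cases "k = 0")
  case True
  have e: "red Q P = P" "red P (- Q) = - Q" using om_PQ True by (simp_all add: red_def)
  have c: "red P (red Q x) = red Q (red P x)" "shift soft P (shift soft Q x) = shift soft Q (shift soft P x)" for x
   using commuting_shift[OF True] by (auto simp: red_shift)
  from pair_step(1)[of P "- Q" "red Q ` R" "red Q o U" "shift soft Q X"] pair_step(2)[OF p' neg(2)] neg
  show ?thesis unfolding e by (simp add: insert_commute image_image comp_def c r_into_rtranclp)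
 next
  case False
  hence "g' >= 1" "c' >= 1" using gc0 kg kc gi by (auto simp: order_le_less)
  \<comment> \<open>The vector of least norm among \<open>t *R P + Q\<close>; its norm is
    \<open>dQ * (1 - g * c / 4)\<close>, and positivity yields \<open>g * c < 4\<close>.\<close>
  define y where "y = (g / 2) *R P + Q"
  have "E y y = g * g / 4 * dP - g / 2 * k + dQ" using PQ dP dQ by (simp add: y_def algebra_simps)
  also have "g * g / 4 * dP = g / 4 * k" using kg by simp
  finally have Ey: "E y y = dQ * (1 - g * c / 4)" using kc by (simp add: algebra_simps)
  have "E y y ~= 0"
  proof
   assume "E y y = 0"
   moreover have "y \<in> span \<Phi>" unfolding y_def by (intro span_add span_scale span_base PQ)
   ultimately have "y = 0" using E_definite by blast
   hence "ht y = 0" by simp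
   thus False using neg mult_nonneg_nonpos[of "g / 2" "ht P"] gc0 by (simp add: y_def)
  qed
  hence "dQ * (1 - g * c / 4) > 0" using E_nonneg[of y] unfolding Ey by linarith
  hence "g * c < 4" using d_pos by (simp add: zero_less_mult_iff)
  hence "g' * c' < 4" unfolding gi by (metis of_int_less_iff of_int_mult of_int_numeral)
  moreover have "g' * 1 <= g' * c'" "1 * c' <= g' * c'"
   using `g' >= 1` `c' >= 1` by (intro mult_mono; simp)+
  ultimately have "g' <= 3" "c' <= 3" by linarith+
  then consider "g' = 1" "c' = 1" | "g' = 2" "c' = 1" | "g' = 1" "c' = 2" | "g' = 3" "c' = 1" | "g' = 1" "c' = 3"
   using `g' >= 1` `c' >= 1` `g' * c' < 4`
   by (cases "g' = 1"; cases "g' = 2"; cases "g' = 3"; cases "c' = 1"; cases "c' = 2"; cases "c' = 3"; auto)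
  then obtain ws where r: "rank_two g c ws" unfolding gi by cases (auto intro: rank_two.intros)
  obtain vs where vs: "map comb ws = Q # vs" using rank_two_walk[OF r neg] r by (auto elim: rank_two.cases)
  have gc: "g ~= 0" "c ~= 0" using False kg kc by auto
  have "fold red (Q # vs) x = red Q (red P x)" "fold (shift soft) (Q # vs) x = shift soft Q (shift soft P x)" for x
   using shift_polygon[OF relu_polygon[OF r] gc] shift_polygon[OF soft_polygon[OF r] gc] by (simp_all add: vs red_shift)
  moreover have "red_walk vs (red Q P) (- Q) (- Q, - P)" using rank_two_walk[OF r neg] by (simp add: vs)
  from red_walk_steps[OF this pair_step(2)[OF p' neg(2)], of "red Q o U" "shift soft Q X"]
  have "red_step\<^sup>*\<^sup>* (insert (red Q P) (insert (- Q) (red Q ` R)), red Q o U, shift soft Q X)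
   (insert (- Q) (insert (- P) ((%x. fold red (Q # vs) x) ` R)), (%x. fold red (Q # vs) x) o U, fold (shift soft) (Q # vs) X)"
   by (simp add: image_image comp_def)
  ultimately show ?thesis by simp
 qed
 thus ?thesis using 1 by blast
qed

end

lemma span_red:
 assumes S: "v \<in> S"
 shows "span (insert (- v) (red v ` (S - {v}))) = span S"
proof -
 let ?S = "insert (- v) (red v ` (S - {v}))"
 have "v \<in> span S" using S by (rule span_base)
 hence "?S \<subseteq> span S" by (auto simp: red_def intro: span_add span_scale span_neg span_base)
 moreover have "S \<subseteq> span ?S"
 proof
  fix x assume x: "x \<in> S"
  have "- v \<in> span ?S" by (rule span_base) simp
  hence v: "v \<in> span ?S" using span_neg by fastforce
  show "x \<in> span ?S"
  proof (cases "x = v")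
   case True thus ?thesis using v by simp
  next
   case False
   hence "red v x \<in> span ?S" using x by (intro span_base) auto
   hence "red v x - (max 0 (om v x) / E v v) *R v \<in> span ?S" using v by (intro span_diff span_scale)
   thus ?thesis by (simp add: red_def)
  qed
 qed
 ultimately show ?thesis by (metis span_minimal subspace_span subset_antisym)
qed

lemma grn__red: "grn (- v) (red v x) = x" by (simp add: grn_def red_def)

lemma green_of_red:
 assumes "good S" "v \<in> S"
 shows "insert v (grn (- v) ` (insert (- v) (red v ` (S - {v})) - {- v})) = S"
proof -
 have "- v \<notin> red v ` (S - {v})"
 proof
  assume "- v \<in> red v ` (S - {v})"
  then obtain x where x: "x \<in> S" "- v = red v x" by blast
  have "red v (- v) = - v" by (simp add: red_def)
  hence "red v x = red v (- v)" using x by simp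
  thus False using red_inj good_uminus_notin[OF assms] x by metis
 qed
 hence "insert (- v) (red v ` (S - {v})) - {- v} = red v ` (S - {v})" by auto
 thus ?thesis using assms by (auto simp: image_image grn__red)
qed

lemma pos_cone_red:
 assumes S: "good S" "v \<in> S" and v: "ht v < 0"
 shows "pos_cone S \<subset> pos_cone (insert (- v) (red v ` (S - {v})))"
 using pos_cone_green[of "insert (- v) (red v ` (S - {v}))" "- v"] good_red[OF S v] v
  green_of_red[OF S] by simp

text \<open>A natural number that falls under red mutation, because the cone of positive roots grows
  inside the finite set of all roots.\<close>

definition height :: "'v set => nat" where
 "height S = card \<Phi> - card (pos_cone S)"

lemma height_red:
 assumes S: "good S" "v \<in> S" and v: "ht v < 0"
 shows "height (insert (- v) (red v ` (S - {v}))) < height S"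
proof -
 let ?S = "insert (- v) (red v ` (S - {v}))"
 have "card (pos_cone S) < card (pos_cone ?S)"
  using pos_cone_red[OF assms] pos_cone_finite by (rule psubset_card_mono[rotated])
 moreover have "card (pos_cone ?S) <= card \<Phi>"
  using finite_roots by (rule card_mono) (auto simp: pos_cone_def)
 ultimately show ?thesis by (simp add: height_def)
qed

lemma red_step_height: "red_step s s' ==> height (fst s') < height (fst s)"
 using height_red by (auto simp: red_step_def)

text \<open>Two negative members cannot pair negatively in both directions, by the order of their
  opposites. So one of \<open>E P Q\<close> and \<open>E Q P\<close> vanishes and the analysis of
  the plane applies.\<close>

lemma red_step_confluent:
 assumes "red_step s s1" "red_step s s2"
 shows "EX s'. red_step\<^sup>*\<^sup>* s1 s' & red_step\<^sup>*\<^sup>* s2 s'"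
proof -
 obtain S U X where s: "s = (S, U, X)" by (cases s)
 obtain P Q where P: "good S" "P \<in> S" "ht P < 0" "s1 = (insert (- P) (red P ` (S - {P})), red P o U, shift soft P X)"
  and Q: "Q \<in> S" "ht Q < 0" "s2 = (insert (- Q) (red Q ` (S - {Q})), red Q o U, shift soft Q X)"
  using assms by (auto simp: s red_step_def)
 have main: "EX s'. red_step\<^sup>*\<^sup>* (insert (- P) (red P ` (S - {P})), red P o U, shift soft P X) s'
   & red_step\<^sup>*\<^sup>* (insert (- Q) (red Q ` (S - {Q})), red Q o U, shift soft Q X) s'"
  if P: "P \<in> S" "ht P < 0" and Q: "Q \<in> S" "ht Q < 0" and ne: "P ~= Q" and z: "E Q P = 0" for P Q
 proof -
  define R where "R = S - {P, Q}"
  have S: "S = insert P (insert Q R)" "P \<notin> R" "Q \<notin> R" using P Q by (auto simp: R_def)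
  have p: "pair_state P Q R" using `good S` S ne by (auto simp: pair_state_def)
  have R: "P \<in> \<Phi>" "Q \<in> \<Phi>" using P Q `good S` good_sub by auto
  have d: "E P P > 0" "E Q Q > 0" using R root_norm_pos by auto
  define k where "k = - E P Q"
  have "k >= 0" using good_same[OF `good S`, of P Q] P Q ne by (simp add: k_def)
  moreover have "k / E P P \<in> \<int>" "k / E Q Q \<in> \<int>"
   using root_integral[of P Q] root_integral[of Q P] R z by (simp_all add: k_def)
  ultimately have c: "EX s. red_step\<^sup>*\<^sup>* (insert (red P Q) (insert (- P) (red P ` R)), red P o U, shift soft P X) s
    & red_step\<^sup>*\<^sup>* (insert (red Q P) (insert (- Q) (red Q ` R)), red Q o U, shift soft Q X) s"
   using pair_confluent[OF R z _ refl refl, of k "k / E P P" "k / E Q Q" R U X] p P Q d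
   by (simp add: k_def)
  have "insert (- P) (red P ` (S - {P})) = insert (red P Q) (insert (- P) (red P ` R))"
   "insert (- Q) (red Q ` (S - {Q})) = insert (red Q P) (insert (- Q) (red Q ` R))" using S ne by auto
  thus ?thesis using c by simp
 qed
 show ?thesis
 proof (cases "P = Q")
  case True thus ?thesis using P Q by auto
 next
  case False
  have "E P Q = 0 | E Q P = 0"
  proof (rule ccontr)
   assume "~ ?thesis"
   moreover have "E P Q <= 0" "E Q P <= 0" using good_same[OF `good S`] P Q False by auto
   ultimately have "E P Q < 0" "E Q P < 0" by auto
   thus False
    using ord_neg[of "- P" "- Q"] ord_neg[of "- Q" "- P"] P Q good_sub root_uminus by fastforce
  qed
  thus ?thesis using main[of P Q] main[of Q P] P Q False by blast
 qed
qed

definition normal :: "'v set \<times> (nat => 'v) \<times> 'v => bool" where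
 "normal s <-> (ALL s'. ~ red_step s s')"

lemma exists_normal: "EX s'. red_step\<^sup>*\<^sup>* s s' & normal s'"
proof (induction "height (fst s)" arbitrary: s rule: less_induct)
 case less
 show ?case
 proof (cases "normal s")
  case True thus ?thesis by blast
 next
  case False
  then obtain s1 where "red_step s s1" by (auto simp: normal_def)
  thus ?thesis using less[OF red_step_height] by (meson converse_rtranclp_into_rtranclp)
 qed
qed

text \<open>Newman's lemma, with \<open>height\<close> as the measure of the induction.\<close>

lemma unique_normal: "red_step\<^sup>*\<^sup>* s s1 ==> red_step\<^sup>*\<^sup>* s s2 ==> normal s1 ==> normal s2 ==> s1 = s2"
proof (induction "height (fst s)" arbitrary: s s1 s2 rule: less_induct)
 case less
 show ?case
 proof (cases "normal s")
  case True
  hence "s1 = s" "s2 = s" using less.prems by (auto simp: normal_def elim: converse_rtranclpE)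
  thus ?thesis by simp
 next
  case False
  have "s ~= s1" "s ~= s2" using less.prems False by auto
  then obtain a b where a: "red_step s a" "red_step\<^sup>*\<^sup>* a s1" and b: "red_step s b" "red_step\<^sup>*\<^sup>* b s2"
   using less.prems by (metis converse_rtranclpE)
  obtain c where c: "red_step\<^sup>*\<^sup>* a c" "red_step\<^sup>*\<^sup>* b c" using red_step_confluent a b by blast
  obtain d where d: "red_step\<^sup>*\<^sup>* c d" "normal d" using exists_normal by blast
  have "s1 = d" using less.hyps[OF red_step_height[OF a(1)] a(2), of d] c d less.prems by (meson rtranclp_trans)
  moreover have "s2 = d" using less.hyps[OF red_step_height[OF b(1)] b(2), of d] c d less.prems by (meson rtranclp_trans)
  ultimately show ?thesis by simp
 qed
qed

abbreviation linked :: "'v set \<times> (nat => 'v) \<times> 'v => 'v set \<times> (nat => 'v) \<times> 'v => bool" where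
 "linked \<equiv> (%s s'. red_step s s' | red_step s' s)\<^sup>*\<^sup>*"

text \<open>A forward step cannot change the normal form by \<open>unique_normal\<close>, and a
  backward step only prolongs the reduction.\<close>

lemma linked_normal:
 assumes "linked s0 s" "normal s0"
 shows "red_step\<^sup>*\<^sup>* s s0"
 using assms(1)
proof (induction rule: rtranclp_induct)
 case base show ?case by simp
next
 case (step s t)
 thus ?case
 proof (elim disjE)
  assume st: "red_step s t"
  obtain u where u: "red_step\<^sup>*\<^sup>* t u" "normal u" using exists_normal by blast
  hence "red_step\<^sup>*\<^sup>* s u" using st by (meson converse_rtranclp_into_rtranclp)
  hence "u = s0" using unique_normal[of s u s0] step.IH u assms(2) by blast
  thus ?thesis using u by simp
 next
  assume "red_step t s"
  thus ?thesis using step.IH by (meson converse_rtranclp_into_rtranclp)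
 qed
qed

lemma shift_inj: "shift f v x = shift f v y ==> x = y"
proof -
 assume a: "shift f v x = shift f v y"
 have "om v (shift f v z) = om v z" for z by (simp add: shift_def)
 hence "om v x = om v y" using a by metis
 thus ?thesis using a by (simp add: shift_def)
qed

text \<open>Both states are reduced along the same members of \<open>S\<close> until they reach
  \<open>s0\<close>. As \<open>red v\<close> and \<open>shift soft v\<close> are injective, equality
  propagates back.\<close>

theorem linked_state_unique:
 assumes "linked s0 (S, U, X)" "linked s0 (S, U', X')" "normal s0" "good (fst s0)"
 shows "U = U' & X = X'"
 using assms(1,2)
proof (induction "height S" arbitrary: S U X U' X' rule: less_induct)
 case less
 have r: "red_step\<^sup>*\<^sup>* (S, U, X) s0" "red_step\<^sup>*\<^sup>* (S, U', X') s0"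
  using linked_normal less.prems assms(3) by auto
 show ?case
 proof (cases "good S & (EX v:S. ht v < 0)")
  case True
  then obtain v where v: "good S" "v \<in> S" "ht v < 0" by blast
  let ?S = "insert (- v) (red v ` (S - {v}))"
  have s: "red_step (S, U, X) (?S, red v o U, shift soft v X)"
   "red_step (S, U', X') (?S, red v o U', shift soft v X')" using red_stepI v by auto
  hence "linked s0 (?S, red v o U, shift soft v X)" "linked s0 (?S, red v o U', shift soft v X')"
   using less.prems by (auto intro: rtranclp.rtrancl_into_rtrancl)
  hence "red v o U = red v o U' & shift soft v X = shift soft v X'"
   using less.hyps height_red[OF v] by blast
  thus ?thesis using red_inj shift_inj by (metis comp_apply ext)
 next
  case False
  hence "normal (S, W, Y)" for W Y by (auto simp: normal_def red_step_def)
  hence "(S, U, X) = s0" "(S, U', X') = s0" using r by (auto simp: normal_def elim: converse_rtranclpE)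
  thus ?thesis by auto
 qed
qed

end

section \<open>Roots and orientations\<close>

instantiation "fun" :: (type, scaleR) scaleR
begin
definition "r *R f = (%x. r *R f x)"
instance ..
end

lemma scaleR_fun_apply [simp]: "(r *R f) x = r *R f x" by (simp add: scaleR_fun_def)

instance "fun" :: (type, real_vector) real_vector
 by standard (simp_all add: fun_eq_iff scaleR_add_right scaleR_add_left)

type_synonym rvec = "nat => real"

definition simple :: "nat => rvec" where
 "simple i = (%j. if j = i then 1 else 0)"

lemma simple_apply: "simple i j = (if j = i then 1 else 0)" by (simp add: simple_def)

lemma sum_fun_apply: "(SUM i:A. f i) x = (SUM i:A. f i x)" for f :: "'a => 'b => 'c::comm_monoid_add"
 by (induction A rule: infinite_finite_induct) simp_all

locale cartan_datum =
 fixes n :: nat and a :: "nat => nat => int" and d :: "nat => real"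
 assumes a_diag: "i \<in> {1..n} ==> a i i = 2"
  and a_nonpos: "i \<in> {1..n} ==> j \<in> {1..n} ==> i ~= j ==> a i j <= 0"
  and a_zero: "i \<in> {1..n} ==> j \<in> {1..n} ==> a i j = 0 <-> a j i = 0"
  and d_pos: "i \<in> {1..n} ==> d i > 0"
  and d_sym: "i \<in> {1..n} ==> j \<in> {1..n} ==> d i * of_int (a i j) = d j * of_int (a j i)"
  and form_definite: "EX i:{1..n}. v i ~= 0 ==>
    (SUM i:{1..n}. SUM j:{1..n}. d i * of_int (a i j) * v i * v j) > 0"
begin

abbreviation "I \<equiv> {1..n}"

definition form :: "rvec => rvec => real" where
 "form x y = (SUM i:I. SUM j:I. d i * of_int (a i j) * x i * y j)"

text \<open>Half of the symmetrised Cartan form: symmetrising it gives \<open>form\<close>, and the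
  diagonal carries \<open>d i\<close> instead of \<open>2 * d i\<close>, which makes half norms
  visible.\<close>

definition euler :: "(nat => nat => bool) => rvec => rvec => real" where
 "euler arr x y = (SUM i:I. SUM j:I.
   (if i = j then d i else if arr i j then d i * of_int (a i j) else 0) * x i * y j)"

definition hgt :: "rvec => real" where
 "hgt x = (SUM i:I. x i)"

text \<open>In spite of the name a real subspace, the span of the simple roots; integrality is
  imposed in \<open>roots\<close>.\<close>

definition lattice :: "rvec set" where
 "lattice = {x. ALL i. i \<notin> I --> x i = 0}"

text \<open>An intrinsic description without the Weyl group:
  \<open>x i * d i / (form x x / 2)\<close> are the coordinates of the coroot in the simple coroots,
  so a root is a nonzero integral vector with integral coroot.\<close>

definition roots :: "rvec set" where
 "roots = {x \<in> lattice. x ~= 0 & (ALL i:I. x i \<in> \<int> & x i * d i / (form x x / 2) \<in> \<int>)}"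

lemma form_sym: "form x y = form y x"
 unfolding form_def by (subst sum.swap) (intro sum.cong refl, simp add: d_sym mult_ac)

lemma linear_form: "linear (form x)" "linear (%x. form x y)"
 by (rule linearI; simp add: form_def algebra_simps sum.distrib sum_distrib_left)+

lemma linear_euler: "linear (euler arr x)" "linear (%x. euler arr x y)"
 by (rule linearI; simp add: euler_def algebra_simps sum.distrib sum_distrib_left)+

lemma linear_height: "linear hgt" by (rule linearI) (simp_all add: hgt_def sum.distrib sum_distrib_left)

lemma form_add: "form (x + y) z = form x z + form y z" "form z (x + y) = form z x + form z y"
 and form_scale: "form (r *R x) z = r * form x z" "form z (r *R x) = r * form z x"
 and form_diff: "form (x - y) z = form x z - form y z" "form z (x - y) = form z x - form z y"
 and form_minus: "form (- x) z = - form x z" "form z (- x) = - form z x"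
 using linear_add[OF linear_form(2)[of z]] linear_scale[OF linear_form(2)[of z]]
  linear_diff[OF linear_form(2)[of z]] linear_neg[OF linear_form(2)[of z]]
  linear_add[OF linear_form(1)[of z]] linear_scale[OF linear_form(1)[of z]]
  linear_diff[OF linear_form(1)[of z]] linear_neg[OF linear_form(1)[of z]] by simp_all

lemma euler_add: "euler r (x + y) z = euler r x z + euler r y z" "euler r z (x + y) = euler r z x + euler r z y"
 and euler_scale: "euler r (t *R x) z = t * euler r x z" "euler r z (t *R x) = t * euler r z x"
 and euler_minus: "euler r (- x) z = - euler r x z" "euler r z (- x) = - euler r z x"
 using linear_add[OF linear_euler(2)[of r z]] linear_scale[OF linear_euler(2)[of r z]]
  linear_neg[OF linear_euler(2)[of r z]]
  linear_add[OF linear_euler(1)[of r z]] linear_scale[OF linear_euler(1)[of r z]]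
  linear_neg[OF linear_euler(1)[of r z]] by simp_all

lemma height_scale: "hgt (r *R x) = r * hgt x" and height_minus: "hgt (- x) = - hgt x"
 using linear_scale[OF linear_height] linear_neg[OF linear_height] by simp_all

lemma euler_form:
 assumes "orientation n a arr"
 shows "euler arr x y + euler arr y x = form x y"
proof -
 have "euler arr y x = (SUM i:I. SUM j:I.
   (if j = i then d j else if arr j i then d j * of_int (a j i) else 0) * y j * x i)"
  unfolding euler_def by (rule sum.swap)
 hence "euler arr x y + euler arr y x = (SUM i:I. SUM j:I.
   ((if i = j then d i else if arr i j then d i * of_int (a i j) else 0) +
   (if j = i then d j else if arr j i then d j * of_int (a j i) else 0)) * x i * y j)"
  by (simp add: euler_def sum.distrib[symmetric] algebra_simps)
 also have "... = form x y"
  unfolding form_def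
 proof (intro sum.cong refl)
  fix i j assume ij: "i \<in> I" "j \<in> I"
  have o: "(arr i j | arr j i) <-> (i ~= j & a i j ~= 0)" "~ (arr i j & arr j i)"
   using assms ij by (auto simp: orientation_def)
  show "((if i = j then d i else if arr i j then d i * of_int (a i j) else 0) +
   (if j = i then d j else if arr j i then d j * of_int (a j i) else 0)) * x i * y j =
   d i * of_int (a i j) * x i * y j" using o a_diag[OF ij(1)] d_sym[OF ij] by auto
 qed
 finally show ?thesis .
qed

lemma euler_diag: "orientation n a arr ==> euler arr x x = form x x / 2"
 using euler_form[of arr x x] by simp

lemma form_pos:
 assumes "x \<in> lattice" "x ~= 0"
 shows "form x x > 0"
proof -
 have "EX i:I. x i ~= 0" using assms unfolding lattice_def fun_eq_iff zero_fun_apply by blast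
 thus ?thesis using form_definite[of x] by (simp add: form_def)
qed

lemma form_nonneg: "form x x >= 0"
proof (cases "EX i:I. x i ~= 0")
 case True thus ?thesis using form_definite[of x] by (simp add: form_def)
next
 case False thus ?thesis by (simp add: form_def)
qed

lemma subspace_lattice: "subspace lattice" by (auto simp: subspace_def lattice_def)

lemma roots_lattice: "v \<in> roots ==> v \<in> lattice" by (simp add: roots_def)

lemma span_roots: "span roots \<subseteq> lattice"
 using subspace_lattice roots_lattice by (intro span_minimal) auto

lemma root_form_pos: "v \<in> roots ==> form v v > 0" using form_pos by (auto simp: roots_def)

lemma form_integral:
 assumes v: "!!i. i \<in> I ==> v i * d i / D \<in> \<int>" and w: "!!i. i \<in> I ==> w i \<in> \<int>"
 shows "form v w / D \<in> \<int>"
proof -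
 have "form v w / D = (SUM i:I. SUM j:I. (v i * d i / D) * (of_int (a i j) * w j))"
  by (simp add: form_def sum_divide_distrib mult_ac)
 also have "... \<in> \<int>" by (intro Ints_sum Ints_mult v w Ints_of_int)
 finally show ?thesis .
qed

lemma root_form_integral: "v \<in> roots ==> w \<in> roots ==> form v w / (form v v / 2) \<in> \<int>"
 by (rule form_integral) (auto simp: roots_def)

text \<open>Half the norm is \<open>euler arr v v\<close>, whose matrix is the diagonal of the
  \<open>d i\<close> times an integral one; hence the factor two is not lost.\<close>

lemma half_norm_integral:
 assumes o: "orientation n a arr" and v: "!!i. i \<in> I ==> v i * d i / D \<in> \<int>" "!!i. i \<in> I ==> v i \<in> \<int>"
 shows "form v v / 2 / D \<in> \<int>"
proof -
 have "euler arr v v / D = (SUM i:I. SUM j:I.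
   (v i * d i / D) * ((if i = j then 1 else if arr i j then of_int (a i j) else 0) * v j))"
  unfolding euler_def sum_divide_distrib by (intro sum.cong refl) auto
 also have "... \<in> \<int>" by (intro Ints_sum Ints_mult v) auto
 finally show ?thesis using euler_diag[OF o] by simp
qed

definition srefl :: "nat => rvec => rvec" where
 "srefl k x = x - (form (simple k) x / d k) *R simple k"

lemma form_simple:
 assumes "k \<in> I"
 shows "form (simple k) x = d k * (SUM j:I. of_int (a k j) * x j)"
proof -
 have "form (simple k) x = (SUM i:I. if i = k then SUM j:I. d i * of_int (a i j) * x j else 0)"
  unfolding form_def by (intro sum.cong refl) (simp add: simple_apply)
 also have "... = (SUM j:I. d k * of_int (a k j) * x j)" using assms by simp
 finally show ?thesis by (simp add: sum_distrib_left mult_ac)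
qed

lemma form_simple_simple: "i \<in> I ==> j \<in> I ==> form (simple i) (simple j) = d i * of_int (a i j)"
 by (simp add: form_simple simple_apply if_distrib cong: if_cong)

lemma form_simple_zero:
 assumes x: "x \<in> lattice" and zero: "!!i. i \<in> I ==> form (simple i) x = 0"
 shows "x = 0"
proof -
 have "(SUM j:I. of_int (a i j) * x j) = 0" if i: "i \<in> I" for i
  using zero[OF i] d_pos[OF i] form_simple[OF i, of x] by simp
 hence "(SUM i:I. (d i * x i) * (SUM j:I. of_int (a i j) * x j)) = 0" by (intro sum.neutral) simp
 moreover have "form x x = (SUM i:I. (d i * x i) * (SUM j:I. of_int (a i j) * x j))"
  by (simp add: form_def sum_distrib_left mult_ac)
 ultimately show "x = 0" using form_pos[OF x] by fastforce
qed

lemma simple_lattice: "i \<in> I ==> simple i \<in> lattice" by (auto simp: lattice_def simple_apply)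

lemma simple_nonzero: "simple i ~= 0" by (simp add: simple_def fun_eq_iff)

lemma simple_root:
 assumes "i \<in> I"
 shows "simple i \<in> roots"
 using assms form_simple_simple[OF assms assms] a_diag[OF assms] d_pos[OF assms] simple_lattice simple_nonzero
 by (auto simp: roots_def simple_apply)

lemma root_uminus: "v \<in> roots ==> - v \<in> roots"
 by (auto simp: roots_def lattice_def form_minus fun_eq_iff)

lemma root_reflect:
 assumes v: "v \<in> roots" and w: "w \<in> roots"
 shows "w - (form v w / (form v v / 2)) *R v \<in> roots"
proof -
 define N where "N = form v w / (form v v / 2)"
 define u where "u = w - N *R v"
 have N: "N \<in> \<int>" using root_form_integral v w by (simp add: N_def)
 have fv: "form v v > 0" and fw: "form w w > 0" using root_form_pos v w by auto
 have "form u u = form w w - 2 * N * form v w + N * N * form v v"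
  by (simp add: u_def form_diff form_scale form_sym[of w v] algebra_simps)
 also have "N * N * form v v = 2 * N * form v w" using fv by (simp add: N_def)
 finally have fu: "form u u = form w w" by simp
 have "u \<in> lattice" unfolding u_def
  by (intro subspace_diff subspace_scale subspace_lattice roots_lattice v w)
 moreover have "u ~= 0" using fu fw by (auto simp: form_def)
 moreover have "u i \<in> \<int>" if "i \<in> I" for i
  using N v w that by (auto simp: u_def roots_def intro!: Ints_diff Ints_mult)
 moreover have "u i * d i / (form u u / 2) \<in> \<int>" if i: "i \<in> I" for i
 proof -
  have "u i * d i / (form u u / 2) = w i * d i / (form w w / 2)
    - (form w v / (form w w / 2)) * (v i * d i / (form v v / 2))"
   unfolding fu using fv fw by (simp add: u_def N_def form_sym[of w v] field_simps)
  moreover have "form w v / (form w w / 2) \<in> \<int>" using root_form_integral v w by blast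
  moreover have "w i * d i / (form w w / 2) \<in> \<int>" "v i * d i / (form v v / 2) \<in> \<int>"
   using v w i unfolding roots_def by blast+
  ultimately show ?thesis by (metis Ints_diff Ints_mult)
 qed
 ultimately have "u \<in> roots" by (simp add: roots_def)
 thus ?thesis by (simp only: u_def N_def)
qed

lemma srefl_root: "k \<in> I ==> x \<in> roots ==> srefl k x \<in> roots"
 using root_reflect[OF simple_root, of k x] form_simple_simple[of k k] a_diag[of k]
 by (simp add: srefl_def)

lemma exists_orientation: "orientation n a (%i j. i < j & a i j ~= 0)"
 using a_zero by (auto simp: orientation_def)

text \<open>If both signs occurred, the positive part \<open>x\<close> and the negative part
  \<open>y\<close> would each have half norm at least \<open>D\<close> by integrality, where
  \<open>D\<close> is the half norm of \<open>v\<close>. As \<open>form x y <= 0\<close>, the half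
  norm of \<open>v\<close> would be at least \<open>2 * D\<close>.\<close>

lemma root_sign:
 assumes v: "v \<in> roots"
 shows "(ALL i. v i >= 0) | (ALL i. v i <= 0)"
proof (rule ccontr)
 assume n: "~ ?thesis"
 define D where "D = form v v / 2"
 have D: "D > 0" using root_form_pos v by (simp add: D_def)
 define x y where "x = (%i. max 0 (v i))" and "y = (%i. max 0 (- v i))"
 have vxy: "v = x - y" by (auto simp: x_def y_def fun_eq_iff)
 have lat: "x \<in> lattice" "y \<in> lattice" using roots_lattice[OF v] by (auto simp: lattice_def x_def y_def)
 obtain p q where pq: "v p < 0" "v q > 0" using n by (auto simp: not_le)
 have "x q ~= 0" "y p ~= 0" using pq by (auto simp: x_def y_def)
 hence "x ~= 0" "y ~= 0" by (metis zero_fun_apply)+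
 hence pos: "form x x > 0" "form y y > 0" using form_pos lat by auto
 have vi: "v i \<in> \<int>" "v i * d i / D \<in> \<int>" if "i \<in> I" for i using v that by (auto simp: roots_def D_def)
 have xi: "x i \<in> \<int>" "x i * d i / D \<in> \<int>" "y i \<in> \<int>" "y i * d i / D \<in> \<int>" if "i \<in> I" for i
  using vi[OF that] by (auto simp: x_def y_def max_def)
 have "form x x / 2 / D \<in> \<int>" "form y y / 2 / D \<in> \<int>"
  using half_norm_integral[OF exists_orientation] xi by blast+
 moreover have "form x x / 2 / D > 0" "form y y / 2 / D > 0" using pos D by auto
 ultimately have "form x x / 2 / D >= 1" "form y y / 2 / D >= 1"
  by (metis Ints_cases int_one_le_iff_zero_less of_int_0_less_iff of_int_1_le_iff)+
 hence "form x x >= 2 * D" "form y y >= 2 * D" using D by (simp_all add: pos_le_divide_eq)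
 moreover have "form x y <= 0" unfolding form_def
 proof (intro sum_nonpos)
  fix i j assume ij: "i \<in> I" "j \<in> I"
  show "d i * of_int (a i j) * x i * y j <= 0"
  proof (cases "i = j")
   case True thus ?thesis by (simp add: x_def y_def max_def)
  next
   case False
   have "d i * of_int (a i j) <= 0" using a_nonpos[OF ij False] d_pos[OF ij(1)] by (simp add: mult_nonneg_nonpos)
   hence "d i * of_int (a i j) * (x i * y j) <= 0" by (rule mult_nonpos_nonneg) (simp add: x_def y_def)
   thus ?thesis by (simp add: mult.assoc)
  qed
 qed
 moreover have "form v v = form x x + form y y - 2 * form x y"
  by (simp add: vxy form_diff form_sym[of y x])
 ultimately show False using D unfolding D_def by linarith
qed

lemma root_height:
 assumes v: "v \<in> roots"
 shows "hgt v ~= 0" "hgt v > 0 <-> (ALL i. v i >= 0)" "hgt v < 0 <-> (ALL i. v i <= 0)"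
proof -
 obtain k where k: "k \<in> I" "v k ~= 0" using v by (auto simp: roots_def lattice_def fun_eq_iff)
 have pos: "hgt w > 0" if "ALL i. w i >= 0" "w k ~= 0" for w
  unfolding hgt_def using that k by (intro sum_pos2[of _ k]) (auto simp: order_less_le)
 have "(ALL i. v i >= 0) ==> hgt v > 0" using pos k by blast
 moreover have "(ALL i. v i <= 0) ==> hgt v < 0" using pos[of "- v"] k by (simp add: height_minus)
 ultimately show "hgt v ~= 0" "hgt v > 0 <-> (ALL i. v i >= 0)" "hgt v < 0 <-> (ALL i. v i <= 0)"
  using root_sign[OF v] by auto
qed

text \<open>Integrality of the coroot of \<open>2 *R v\<close> would make half the norm of
  \<open>v\<close> an integral multiple of the norm.\<close>

lemma twice_root:
 assumes "v \<in> roots"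
 shows "2 *R v \<notin> roots"
proof
 assume w: "2 *R v \<in> roots"
 have D: "form v v > 0" using root_form_pos assms by simp
 have "v i * d i / form v v \<in> \<int>" if "i \<in> I" for i
 proof -
  have "(2 *R v) i * d i / (form (2 *R v) (2 *R v) / 2) \<in> \<int>" using w that unfolding roots_def by blast
  moreover have "(2 *R v) i * d i / (form (2 *R v) (2 *R v) / 2) = v i * d i / form v v"
   using D by (simp add: form_scale)
  ultimately show ?thesis by simp
 qed
 hence "form v v / 2 / form v v \<in> \<int>"
  by (rule half_norm_integral[OF exists_orientation]) (use assms in "auto simp: roots_def")
 hence "(1 / 2 :: real) \<in> \<int>" using D by simp
 then obtain k :: int where "(1 / 2 :: real) = of_int k" by (auto elim: Ints_cases)
 hence "(1 :: real) = of_int (2 * k)" by simp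
 hence "2 * k = 1" by linarith
 thus False by presburger
qed

text \<open>Both \<open>2 * t\<close> and \<open>2 / t\<close> are integers with product
  \<open>4\<close>, which leaves \<open>t = 1\<close> or a doubled root.\<close>

lemma root_reduced:
 assumes v: "v \<in> roots" and w: "t *R v \<in> roots" and t: "t > 0"
 shows "t = 1"
proof -
 have D: "form v v > 0" using root_form_pos v by simp
 have "form v (t *R v) / (form v v / 2) = 2 * t" using D by (simp add: form_scale)
 hence i1: "2 * t \<in> \<int>" using root_form_integral[OF v w] by simp
 have "form (t *R v) v / (form (t *R v) (t *R v) / 2) = 2 / t" using D t by (simp add: form_scale)
 hence i2: "2 / t \<in> \<int>" using root_form_integral[OF w v] by simp
 obtain p q :: int where p: "2 * t = of_int p" and q: "2 / t = of_int q" using i1 i2 by (auto elim!: Ints_cases)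
 have "of_int p * of_int q = (4 :: real)" using t unfolding p[symmetric] q[symmetric] by simp
 hence pq: "p * q = 4" by (metis of_int_eq_iff of_int_mult of_int_numeral)
 have "p > 0" using p t by (metis mult_pos_pos of_int_0_less_iff zero_less_numeral)
 moreover have "p dvd 4" using pq by (metis dvd_triv_left)
 ultimately have "p <= 4" using zdvd_imp_le by fastforce
 then consider "p = 1" | "p = 2" | "p = 3" | "p = 4" using `p > 0` by linarith
 thus ?thesis
 proof cases
  case 1
  hence "2 *R (t *R v) = v" using p by simp
  thus ?thesis using twice_root[OF w] v by simp
 next
  case 4
  hence "t = 2" using p by simp
  thus ?thesis using twice_root[OF v] w by simp
 next
  case 3
  thus ?thesis using pq by presburger
 qed (use p in auto)
qed

lemma cauchy_schwarz:
 assumes v: "form v v > 0"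
 shows "form v w * form v w <= form v v * form w w"
proof -
 define u where "u = w - (form v w / form v v) *R v"
 have "form u u = form w w - form v w * form v w / form v v"
  using v by (simp add: u_def form_diff form_scale form_sym[of w v] field_simps)
 hence "form v w * form v w / form v v <= form w w" using form_nonneg[of u] by simp
 thus ?thesis using v by (simp add: pos_divide_le_eq mult.commute)
qed

text \<open>The pairings with the simple coroots determine a root, and they are integers bounded by
  \<open>4\<close> through the Cauchy-Schwarz inequality.\<close>

lemma finite_roots: "finite roots"
proof -
 define g where "g x = restrict (%i. form (simple i) x / d i) I" for x
 have "g x \<in> I \<rightarrow>\<^sub>E of_int ` {-4..4}" if x: "x \<in> roots" for x
 proof -
  have "g x i \<in> of_int ` {-4..4}" if i: "i \<in> I" for i
  proof -
   have s: "form (simple i) (simple i) = 2 * d i" using form_simple_simple[OF i i] a_diag[OF i] by simp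
   obtain p :: int where p: "form (simple i) x / d i = of_int p"
    using root_form_integral[OF simple_root[OF i] x] s by (auto elim!: Ints_cases)
   obtain q :: int where q: "form x (simple i) / (form x x / 2) = of_int q"
    using root_form_integral[OF x simple_root[OF i]] by (auto elim!: Ints_cases)
   have pos: "form x x > 0" "d i > 0" using root_form_pos x d_pos i by auto
   have "of_int (p * q) = form (simple i) x * form (simple i) x * 2 / (d i * form x x)"
    using pos unfolding of_int_mult p[symmetric] q[symmetric] form_sym[of x "simple i"] by simp
   also have "... <= 4"
    using cauchy_schwarz[of "simple i" x] pos by (simp add: s pos_divide_le_eq)
   finally have pq: "p * q <= 4" by linarith
   have qp: "q = 0 <-> p = 0" "q > 0 <-> p > 0"
   proof -
    have "real_of_int p * d i = real_of_int q * (form x x / 2)"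
     using pos unfolding p[symmetric] q[symmetric] form_sym[of x "simple i"] by simp
    hence "real_of_int p * d i / d i = real_of_int q * (form x x / 2) / d i" by (rule arg_cong)
    moreover define c where "c = form x x / 2 / d i"
    ultimately have "real_of_int p = real_of_int q * c" using pos by simp
    moreover have "c > 0" using pos by (simp add: c_def)
    ultimately have "real_of_int q = 0 <-> real_of_int p = 0" "real_of_int q > 0 <-> real_of_int p > 0"
     by (auto simp: zero_less_mult_iff)
    thus "q = 0 <-> p = 0" "q > 0 <-> p > 0" by auto
   qed
   have "p \<in> {-4..4}"
   proof (cases "p = 0")
    case False
    then consider "p > 0" "q > 0" | "p < 0" "q < 0" using qp by linarith
    thus ?thesis
    proof cases
     case 1
     hence "p * 1 <= p * q" by (intro mult_left_mono) auto
     hence "p <= 4" using pq by linarith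
     thus ?thesis using 1 by simp
    next
     case 2
     hence "(- p) * 1 <= (- p) * (- q)" by (intro mult_left_mono) auto
     hence "- p <= 4" using pq by simp
     thus ?thesis using 2 by simp
    qed
   qed auto
   thus ?thesis using i p by (auto simp: g_def)
  qed
  thus ?thesis by (auto simp: g_def PiE_iff)
 qed
 hence "g ` roots \<subseteq> I \<rightarrow>\<^sub>E of_int ` {-4..4}" by blast
 moreover have "finite (I \<rightarrow>\<^sub>E of_int ` {-4..4::int} :: (nat => real) set)" by (rule finite_PiE) simp_all
 ultimately have "finite (g ` roots)" by (rule finite_subset)
 moreover have "inj_on g roots"
 proof (rule inj_onI)
  fix x y assume xy: "x \<in> roots" "y \<in> roots" "g x = g y"
  have u: "x - y \<in> lattice" by (intro subspace_diff subspace_lattice roots_lattice xy)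
  have "form (simple i) (x - y) = 0" if i: "i \<in> I" for i
   using fun_cong[OF xy(3), of i] i d_pos[OF i] by (simp add: g_def form_diff)
  hence "x - y = 0" by (rule form_simple_zero[OF u])
  thus "x = y" by simp
 qed
 ultimately show ?thesis using finite_imageD by blast
qed

lemma srefl_form:
 assumes k: "k \<in> I"
 shows "form (srefl k x) (srefl k y) = form x y"
proof -
 have "form (simple k) (simple k) = 2 * d k" "d k > 0"
  using form_simple_simple[OF k k] a_diag[OF k] d_pos[OF k] by simp_all
 moreover have "form x (simple k) = form (simple k) x" by (rule form_sym)
 ultimately show ?thesis by (simp add: srefl_def form_diff form_scale field_simps)
qed

lemma linear_srefl: "linear (srefl k)"
 by (rule linearI) (simp_all add: srefl_def form_add form_scale add_divide_distrib algebra_simps)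

lemma srefl_srefl: "k \<in> I ==> srefl k (srefl k x) = x"
 using form_simple_simple[of k k] a_diag[of k] d_pos[of k] by (simp add: srefl_def form_diff form_scale)

lemma srefl_simple: "k \<in> I ==> srefl k (simple k) = - simple k"
 using form_simple_simple[of k k] a_diag[of k] d_pos[of k] by (simp add: srefl_def scaleR_2)

lemma srefl_apply_other: "j ~= k ==> srefl k x j = x j" by (simp add: srefl_def simple_apply)

lemma srefl_apply_self: "srefl k x k = x k - form (simple k) x / d k"
 by (simp add: srefl_def simple_apply)

text \<open>A positive root other than \<open>simple k\<close> has another positive coordinate,
  which the reflection leaves alone; a single coordinate decides the sign of a root.\<close>

lemma srefl_positive:
 assumes k: "k \<in> I" and x: "x \<in> roots" "!!i. x i >= 0" and ne: "x ~= simple k"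
 shows "srefl k x i >= 0"
proof -
 have r: "srefl k x \<in> roots" using srefl_root k x by blast
 have "EX j. j ~= k & x j ~= 0"
 proof (rule ccontr)
  assume "~ ?thesis"
  hence e: "x = x k *R simple k" by (auto simp: fun_eq_iff simple_apply)
  hence "x k ~= 0" using x(1) by (auto simp: roots_def)
  hence "x k > 0" using x(2)[of k] by simp
  hence "x k = 1" using root_reduced[OF simple_root[OF k], of "x k"] x(1) e by simp
  thus False using e ne by simp
 qed
 then obtain j where "j ~= k" "x j > 0" using x(2) by (metis order_less_le)
 hence "srefl k x j > 0" by (simp add: srefl_apply_other)
 thus ?thesis using root_sign[OF r] by (meson not_le)
qed

section \<open>Reflection at a source and the Euler form\<close>

definition flip :: "nat => (nat => nat => bool) => nat => nat => bool" where
 "flip k arr i j = (if i = k | j = k then arr j i else arr i j)"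

lemma flip_orientation: "orientation n a arr ==> orientation n a (flip k arr)"
 using a_zero by (auto simp: orientation_def flip_def)

lemma euler_simple1:
 assumes k: "k \<in> I"
 shows "euler arr (simple k) y = d k * y k + (SUM j:I. (if j ~= k & arr k j then d k * of_int (a k j) else 0) * y j)"
proof -
 have "euler arr (simple k) y = (SUM i:I. if i = k then SUM j:I.
   (if k = j then d k else if arr k j then d k * of_int (a k j) else 0) * y j else 0)"
  unfolding euler_def by (intro sum.cong refl) (auto simp: simple_apply intro!: sum.cong)
 also have "... = (SUM j:I. (if j = k then d k * y k else 0) + (if j ~= k & arr k j then d k * of_int (a k j) else 0) * y j)"
  using k by (simp, intro sum.cong refl) auto
 also have "... = d k * y k + (SUM j:I. (if j ~= k & arr k j then d k * of_int (a k j) else 0) * y j)"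
  using k by (simp add: sum.distrib)
 finally show ?thesis .
qed

lemma euler_simple2:
 assumes k: "k \<in> I"
 shows "euler arr x (simple k) = d k * x k + (SUM i:I. (if i ~= k & arr i k then d i * of_int (a i k) else 0) * x i)"
proof -
 have "euler arr x (simple k) = (SUM i:I. (if i = k then d k * x k else 0) + (if i ~= k & arr i k then d i * of_int (a i k) else 0) * x i)"
  unfolding euler_def
 proof (intro sum.cong refl)
  fix i assume "i \<in> I"
  have "(SUM j:I. (if i = j then d i else if arr i j then d i * of_int (a i j) else 0) * x i * simple k j)
   = (SUM j:I. if j = k then (if i = k then d i else if arr i k then d i * of_int (a i k) else 0) * x i else 0)"
   by (intro sum.cong refl) (simp add: simple_apply)
  also have "... = (if i = k then d i else if arr i k then d i * of_int (a i k) else 0) * x i"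
   using k by simp
  finally show "(SUM j:I. (if i = j then d i else if arr i j then d i * of_int (a i j) else 0) * x i * simple k j)
   = (if i = k then d k * x k else 0) + (if i ~= k & arr i k then d i * of_int (a i k) else 0) * x i" by auto
 qed
 thus ?thesis using k by (simp add: sum.distrib)
qed

lemma euler_source:
 assumes "k \<in> I" "!!i. i \<in> I ==> ~ arr i k"
 shows "euler arr x (simple k) = d k * x k"
 using assms by (simp add: euler_simple2)

lemma euler_sink:
 assumes "k \<in> I" "!!i. i \<in> I ==> ~ arr k i"
 shows "euler arr (simple k) y = d k * y k"
 using assms by (simp add: euler_simple1)

lemma euler_cong_off:
 assumes "x k = 0" "y k = 0"
 shows "euler (flip k arr) x y = euler arr x y"
 unfolding euler_def by (intro sum.cong refl) (use assms in "auto simp: flip_def")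

text \<open>Away from \<open>k\<close> the two Euler forms agree. At the source \<open>k\<close>
  pairing with \<open>simple k\<close> from the right reads the \<open>k\<close>-th coordinate, and
  after the flip \<open>k\<close> is a sink and the same holds from the left.\<close>

lemma euler_flip:
 assumes o: "orientation n a arr" and k: "k \<in> I" and src: "!!i. i \<in> I ==> ~ arr i k"
 shows "euler (flip k arr) (srefl k x) (srefl k y) = euler arr x y"
proof -
 define x' y' where "x' = x - x k *R simple k" and "y' = y - y k *R simple k"
 have x: "x = x' + x k *R simple k" and y: "y = y' + y k *R simple k" by (simp_all add: x'_def y'_def)
 have z: "x' k = 0" "y' k = 0" by (simp_all add: x'_def y'_def simple_apply)
 define p q where "p = form (simple k) x' / d k" and "q = form (simple k) y' / d k"
 have dk: "d k > 0" using d_pos k by blast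
 have skk: "form (simple k) (simple k) = 2 * d k" using form_simple_simple[OF k k] a_diag[OF k] by simp
 have rx: "srefl k x = x' + (- x k - p) *R simple k" and ry: "srefl k y = y' + (- y k - q) *R simple k"
  using dk skk
  by (simp_all add: srefl_def x'_def y'_def p_def q_def form_diff form_scale field_simps fun_eq_iff)
 have o': "orientation n a (flip k arr)" using flip_orientation o by blast
 have snk: "euler (flip k arr) (simple k) w = d k * w k" for w
  by (rule euler_sink[OF k]) (use src in "auto simp: flip_def")
 have src': "euler arr w (simple k) = d k * w k" for w using euler_source[OF k] src by blast
 have 1: "euler arr (simple k) y' = q * d k"
  using euler_form[OF o, of "simple k" y'] src'[of y'] z dk by (simp add: q_def)
 have 2: "euler (flip k arr) x' (simple k) = p * d k"
  using euler_form[OF o', of "simple k" x'] snk[of x'] z dk by (simp add: p_def)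
 have 3: "euler (flip k arr) x' y' = euler arr x' y'" using euler_cong_off z by blast
 have "euler (flip k arr) (srefl k x) (srefl k y) = euler arr x' y' + x k * (y k + q) * d k"
  unfolding rx ry by (simp add: euler_add euler_scale snk z 2 3 simple_apply) (simp add: algebra_simps)
 also have "... = euler arr x y"
  by (subst (2) x, subst (2) y) (simp add: euler_add euler_scale src' z 1 simple_apply algebra_simps)
 finally show ?thesis .
qed

end

section \<open>The periodic sequence of reflections at sources\<close>

locale sweep_datum = cartan_datum n a d for n a d +
 fixes arr :: "nat => nat => bool" and vs :: "nat list"
 assumes orient: "orientation n a arr" and vs: "distinct vs" "set vs = {1..n}" and n_pos: "n >= 1"
  and arr_vs: "p < n ==> q < n ==> arr (vs ! p) (vs ! q) ==> p < q"
begin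

lemma length_vs: "length vs = n" using distinct_card[OF vs(1)] vs(2) by simp

lemma vs_nth: "p < n ==> vs ! p \<in> I" using vs length_vs nth_mem by metis

lemma vs_nth_eq: "p < n ==> q < n ==> vs ! p = vs ! q <-> p = q"
 using nth_eq_iff_index_eq[OF vs(1)] length_vs by simp

definition vseq :: "nat => nat" where "vseq T = vs ! (T mod n)"

lemma vseq_in: "vseq T \<in> I" using vs_nth[of "T mod n"] n_pos by (simp add: vseq_def)

fun arrow_at :: "nat => nat => nat => bool" where
 "arrow_at 0 = arr"
| "arrow_at (Suc T) = flip (vseq T) (arrow_at T)"

lemma arrow_at_orientation: "orientation n a (arrow_at T)"
 by (induction T) (use orient flip_orientation in auto)

text \<open>A full sweep flips every edge twice, so only the \<open>p\<close> vertices already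
  treated in the current sweep matter.\<close>

lemma arrow_at_nth: "p <= n ==> i < n ==> j < n ==>
   arrow_at (t * n + p) (vs ! i) (vs ! j) <->
    (if i < p <-> j < p then arr (vs ! i) (vs ! j) else arr (vs ! j) (vs ! i))"
proof (induction t arbitrary: p i j)
 case 0
 thus ?case
 proof (induction p arbitrary: i j)
  case 0
  thus ?case by simp
 next
  case (Suc p)
  have "vseq p = vs ! p" using Suc.prems by (simp add: vseq_def)
  thus ?case using Suc by (auto simp: flip_def vs_nth_eq less_Suc_eq)
 qed
next
 case (Suc t)
 note outer = Suc.IH
 from Suc.prems show ?case
 proof (induction p arbitrary: i j)
  case 0
  have "Suc t * n + 0 = t * n + n" by simp
  thus ?case using outer[of n i j] 0 by (simp add: add.commute)
 next
  case (Suc p)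
  have "(Suc t * n + p) mod n = p" using Suc.prems by (metis Suc_le_lessD mod_less mod_mult_self3)
  hence "vseq (Suc t * n + p) = vs ! p" by (simp add: vseq_def)
  moreover have "arrow_at (Suc t * n + Suc p) = flip (vseq (Suc t * n + p)) (arrow_at (Suc t * n + p))" by simp
  ultimately show ?case using Suc by (auto simp: flip_def vs_nth_eq less_Suc_eq simp del: mult_Suc)
 qed
qed

lemma vseq_source:
 assumes "j \<in> I"
 shows "~ arrow_at T j (vseq T)"
proof -
 obtain q where q: "q < n" "j = vs ! q" using assms vs length_vs by (metis in_set_conv_nth)
 define p where "p = T mod n"
 have p: "p < n" using n_pos by (simp add: p_def)
 have "T = T div n * n + p" by (simp add: p_def)
 hence "arrow_at T j (vseq T) <->
   (if q < p <-> p < p then arr (vs ! q) (vs ! p) else arr (vs ! p) (vs ! q))"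
  using arrow_at_nth[of p q p "T div n"] p q by (simp add: vseq_def p_def)
 thus ?thesis using arr_vs[OF p q(1)] arr_vs[OF q(1) p] by auto
qed

fun refl_upto :: "nat => rvec => rvec" where
 "refl_upto 0 x = x"
| "refl_upto (Suc T) x = srefl (vseq T) (refl_upto T x)"

lemma refl_upto_root: "x \<in> roots ==> refl_upto T x \<in> roots"
 by (induction T) (use srefl_root vseq_in in auto)

lemma linear_refl_upto: "linear (refl_upto T)"
proof (induction T)
 case 0
 show ?case by (rule linearI) auto
next
 case (Suc T)
 have "refl_upto (Suc T) = srefl (vseq T) o refl_upto T" by (simp add: fun_eq_iff)
 thus ?case using linear_compose[OF Suc linear_srefl, of "vseq T"] by (simp only:)
qed

lemma refl_upto_inj: "refl_upto T x = refl_upto T y ==> x = y"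
 by (induction T) (use srefl_srefl[OF vseq_in] in "auto, metis")

lemma refl_upto_euler: "euler (arrow_at T) (refl_upto T x) (refl_upto T y) = euler arr x y"
proof (induction T)
 case (Suc T)
 thus ?case
  using euler_flip[OF arrow_at_orientation vseq_in, of T T "refl_upto T x" "refl_upto T y"] vseq_source by simp
qed simp

lemma refl_upto_period: "refl_upto (t * n + p) x = refl_upto p ((refl_upto n ^^ t) x)" if "p <= n" for t p x
proof -
 have add: "refl_upto (n + T) x = refl_upto T (refl_upto n x)" for T x
  by (induction T) (simp_all add: vseq_def)
 show ?thesis
 proof (induction t arbitrary: x)
  case (Suc t)
  have "refl_upto (Suc t * n + p) x = refl_upto (t * n + p) (refl_upto n x)"
   using add[of "t * n + p" x] by (simp add: add.assoc)
  thus ?case using Suc by (simp add: funpow_swap1)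
 qed simp
qed

text \<open>During one sweep each coordinate is changed only by its own reflection. So a vector
  fixed by the product is fixed by every factor, hence orthogonal to all simple roots.\<close>

lemma coxeter_no_fixpoint:
 assumes x: "x \<in> lattice" and fp: "refl_upto n x = x"
 shows "x = 0"
proof -
 have later: "refl_upto T x (vs ! p) = refl_upto q x (vs ! p)" if "p < q" "q <= T" "T <= n" for p q T
  using that
 proof (induction T)
  case (Suc T)
  thus ?case
  proof (cases "q = Suc T")
   case False
   hence "refl_upto T x (vs ! p) = refl_upto q x (vs ! p)" using Suc by simp
   moreover have "vs ! p ~= vseq T" using Suc.prems False vs_nth_eq by (simp add: vseq_def)
   ultimately show ?thesis by (simp add: srefl_apply_other)
  qed simp
 qed simp
 have fixed: "refl_upto p x = x" if "p <= n" for p using that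
 proof (induction p)
  case (Suc p)
  have v: "vseq p = vs ! p" using Suc.prems by (simp add: vseq_def)
  have "refl_upto (Suc p) x (vs ! p) = x (vs ! p)" using later[of p "Suc p" n] Suc.prems fp by simp
  moreover have "refl_upto (Suc p) x = srefl (vs ! p) x" using Suc v by simp
  ultimately show ?case by (auto simp: fun_eq_iff) (metis srefl_apply_other)
 qed simp
 have "form (simple k) x = 0" if k: "k \<in> I" for k
 proof -
  obtain p where p: "p < n" "k = vs ! p" using k vs length_vs by (metis in_set_conv_nth)
  have "srefl k x = x" using fixed[of p] fixed[of "Suc p"] p by (simp add: vseq_def)
  hence "srefl k x k = x k" by simp
  thus ?thesis using d_pos[OF k] by (simp add: srefl_apply_self)
 qed
 thus ?thesis by (rule form_simple_zero[OF x])
qed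

text \<open>A root that stayed positive would run into a cycle of the Coxeter element, as there are
  finitely many roots. The sum over the cycle is a fixed vector, hence zero, although its height is
  positive.\<close>

lemma eventually_negative:
 assumes v: "v \<in> roots"
 shows "EX T. EX i. refl_upto T v i < 0"
proof (rule ccontr)
 assume "~ ?thesis"
 hence pos: "refl_upto T v i >= 0" for T i by (meson not_le)
 define f where "f t = (refl_upto n ^^ t) v" for t
 have f_eq: "f t = refl_upto (t * n) v" for t using refl_upto_period[of 0 t v] by (simp add: f_def)
 have fr: "f t \<in> roots" for t using refl_upto_root v by (simp add: f_eq)
 have "~ inj f"
 proof
  assume "inj f"
  hence "infinite (range f)" using finite_imageD by blast
  thus False using finite_subset[of "range f" roots] fr finite_roots by blast
 qed
 then obtain s t where st: "s < t" "f s = f t" by (metis injI linorder_neqE_nat)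
 define K where "K = t - s"
 have shift: "f (Suc t) = refl_upto n (f t)" for t by (simp add: f_def)
 define Z where "Z = (SUM r:{s..<t}. f r)"
 have "refl_upto n Z = (SUM r:{s..<t}. f (Suc r))"
  unfolding Z_def shift using linear_sum[OF linear_refl_upto] by blast
 also have "... = (SUM r:{Suc s..<Suc t}. f r)" by (rule sum.shift_bounds_Suc_ivl[symmetric])
 also have "... = Z"
  unfolding Z_def using st by (simp add: sum.atLeast_Suc_lessThan[of s t] sum.atLeastLessThan_Suc add.commute)
 finally have "refl_upto n Z = Z" .
 moreover have "Z \<in> lattice" unfolding Z_def by (intro subspace_sum subspace_lattice roots_lattice fr)
 ultimately have "Z = 0" using coxeter_no_fixpoint by blast
 moreover have "hgt Z = (SUM r:{s..<t}. hgt (f r))"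
  unfolding Z_def using linear_sum[OF linear_height] by blast
 moreover have "hgt (f r) > 0" for r using root_height(2)[OF fr] pos by (simp add: f_eq)
 ultimately show False using st sum_pos[of "{s..<t}" "%r. hgt (f r)"] by (simp add: hgt_def)
qed

text \<open>\<open>Suc T\<close> is the first time at which the root has turned negative; just
  before, it is the simple root of the vertex about to be reflected.\<close>

definition root_time :: "rvec => nat" where
 "root_time v = (LEAST T. EX i. refl_upto (Suc T) v i < 0)"

lemma root_time_props:
 assumes v: "v \<in> roots" "!!i. v i >= 0"
 shows "t <= root_time v ==> refl_upto t v i >= 0"
  and "refl_upto (root_time v) v = simple (vseq (root_time v))"
proof -
 obtain T where "EX i. refl_upto T v i < 0" using eventually_negative v by blast
 then obtain T' where "EX i. refl_upto (Suc T') v i < 0" using v(2) by (cases T) (auto simp: not_less[symmetric])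
 hence neg: "EX i. refl_upto (Suc (root_time v)) v i < 0" unfolding root_time_def by (rule LeastI)
 have pos: "refl_upto t v i >= 0" if "t <= root_time v" for t i
 proof (cases t)
  case 0 thus ?thesis using v by simp
 next
  case (Suc t')
  hence "t' < root_time v" using that by simp
  thus ?thesis using not_less_Least[of t' "%T. EX i. refl_upto (Suc T) v i < 0"] Suc
   by (auto simp: root_time_def not_less simp del: refl_upto.simps)
 qed
 thus "t <= root_time v ==> refl_upto t v i >= 0" by blast
 show "refl_upto (root_time v) v = simple (vseq (root_time v))"
 proof (rule ccontr)
  assume "~ ?thesis"
  hence "srefl (vseq (root_time v)) (refl_upto (root_time v) v) i >= 0" for i
   using srefl_positive[OF vseq_in refl_upto_root[OF v(1)]] pos by blast
  thus False using neg by (auto simp: not_less[symmetric])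
 qed
qed

text \<open>Transported to time \<open>root_time v\<close>, the root \<open>v\<close> is simple at a
  source \<open>k\<close>. The two pairings with \<open>w\<close> become \<open>d k\<close> times
  the \<open>k\<close>-th coordinate of \<open>w\<close> before, and \<open>- d k\<close> times that
  after reflecting at \<open>k\<close>; both coordinates are still nonnegative.\<close>

lemma root_time_less:
 assumes v: "v \<in> roots" "!!i. v i >= 0" and w: "w \<in> roots" "!!i. w i >= 0" and less: "root_time v < root_time w"
 shows "euler arr v w <= 0" "euler arr w v >= 0"
proof -
 define T k where "T = root_time v" and "k = vseq T"
 define u where "u = refl_upto T w"
 have k: "k \<in> I" using vseq_in by (simp add: k_def)
 have vk: "refl_upto T v = simple k" using root_time_props(2)[OF v] by (simp add: T_def k_def)
 have u: "u k >= 0" using root_time_props(1)[OF w, of T] less by (simp add: u_def T_def)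
 have "refl_upto (Suc T) w k >= 0" using root_time_props(1)[OF w, of "Suc T"] less by (simp add: T_def)
 hence su: "u k - form (simple k) u / d k >= 0" by (simp add: u_def k_def[symmetric] srefl_apply_self)
 have dk: "d k > 0" using d_pos k by blast
 have 1: "euler (arrow_at T) u (simple k) = d k * u k"
  by (rule euler_source[OF k]) (use vseq_source in "simp add: k_def")
 have 2: "euler (arrow_at T) (simple k) u = form (simple k) u - d k * u k"
  using euler_form[OF arrow_at_orientation, of T "simple k" u] 1 by simp
 have "euler arr w v = d k * u k" "euler arr v w = form (simple k) u - d k * u k"
  using refl_upto_euler[of T w v] refl_upto_euler[of T v w] 1 2 by (simp_all add: vk u_def)
 thus "euler arr v w <= 0" "euler arr w v >= 0" using u su dk by (simp_all add: field_simps)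
qed

lemma root_order:
 assumes v: "v \<in> roots" "!!i. v i >= 0" and w: "w \<in> roots" "!!i. w i >= 0"
 shows "euler arr v w > 0 ==> root_time w <= root_time v"
  and "euler arr v w < 0 ==> root_time v < root_time w"
proof -
 show "euler arr v w > 0 ==> root_time w <= root_time v" using root_time_less(1)[OF v w] by fastforce
 show "euler arr v w < 0 ==> root_time v < root_time w"
 proof (rule ccontr)
  assume neg: "euler arr v w < 0" and "~ root_time v < root_time w"
  then consider "root_time w < root_time v" | "root_time w = root_time v" by linarith
  thus False
  proof cases
   case 1 thus ?thesis using root_time_less(2)[OF w v] neg by simp
  next
   case 2
   hence "refl_upto (root_time v) v = refl_upto (root_time v) w"
    using root_time_props(2)[OF v] root_time_props(2)[OF w] by simp
   hence "v = w" by (rule refl_upto_inj)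
   thus ?thesis using neg euler_diag[OF orient, of v] form_nonneg[of v] by simp
  qed
 qed
qed

end

section \<open>Evaluation of rational functions\<close>

text \<open>One notion for polynomials and Laurent polynomials: \<open>\<phi>\<close> gives the
  values of monomials, \<open>\<iota>\<close> those of coefficients.\<close>

definition pm_eval :: "('k => 'r) => ('c => 'r) => ('k \<Rightarrow>\<^sub>0 'c::zero) => 'r::comm_ring_1" where
 "pm_eval \<phi> \<iota> p = (SUM e:keys p. \<iota> (lookup p e) * \<phi> e)"

lemma pm_eval_superset:
 assumes "finite A" "keys p \<subseteq> A" "\<iota> 0 = 0"
 shows "pm_eval \<phi> \<iota> p = (SUM e:A. \<iota> (lookup p e) * \<phi> e)"
 unfolding pm_eval_def using assms by (intro sum.mono_neutral_left) (auto simp: in_keys_iff)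

lemma poly_mapping_sum_single: "p = (SUM e:keys p. single e (lookup p e))"
 for p :: "'k \<Rightarrow>\<^sub>0 'c::comm_monoid_add"
proof (rule poly_mapping_eqI)
 fix k
 have "lookup (SUM e:keys p. single e (lookup p e)) k = (SUM e:keys p. if e = k then lookup p e else 0)"
  by (simp add: lookup_sum lookup_single when_def)
 also have "... = lookup p k" by (simp add: in_keys_iff)
 finally show "lookup p k =
   lookup (SUM e:keys p. single e (lookup p e)) k" by simp
qed

locale evaluation =
 fixes \<phi> :: "'k::comm_monoid_add => 'r::comm_ring_1" and \<iota> :: "'c::comm_ring_1 => 'r"
 assumes \<phi>_zero: "\<phi> 0 = 1" and \<phi>_add: "\<phi> (e + f) = \<phi> e * \<phi> f"
  and \<iota>_zero: "\<iota> 0 = 0" and \<iota>_one: "\<iota> 1 = 1" and \<iota>_add: "\<iota> (c + c') = \<iota> c + \<iota> c'"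
  and \<iota>_mult: "\<iota> (c * c') = \<iota> c * \<iota> c'"
begin

abbreviation ev :: "('k \<Rightarrow>\<^sub>0 'c) => 'r" where "ev \<equiv> pm_eval \<phi> \<iota>"

lemma ev_zero [simp]: "ev 0 = 0" by (simp add: pm_eval_def)

lemma ev_single [simp]: "ev (single e c) = \<iota> c * \<phi> e"
 by (cases "c = 0") (simp_all add: pm_eval_def \<iota>_zero)

lemma ev_one [simp]: "ev 1 = 1" using ev_single[of 0 1] by (simp add: \<iota>_one \<phi>_zero del: ev_single)

lemma ev_add [simp]: "ev (p + q) = ev p + ev q"
proof -
 let ?A = "keys p \<union> keys q"
 have f: "finite ?A" by simp
 have "ev (p + q) = (SUM e:?A. \<iota> (lookup (p + q) e) * \<phi> e)"
  by (rule pm_eval_superset) (use keys_add[of p q] \<iota>_zero in auto)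
 also have "... = (SUM e:?A. \<iota> (lookup p e) * \<phi> e) + (SUM e:?A. \<iota> (lookup q e) * \<phi> e)"
  by (simp add: lookup_add \<iota>_add distrib_right sum.distrib)
 also have "... = ev p + ev q"
  using pm_eval_superset[of ?A p \<iota> \<phi>] pm_eval_superset[of ?A q \<iota> \<phi>] \<iota>_zero by simp
 finally show ?thesis .
qed

lemma ev_sum: "ev (SUM i:A. f i) = (SUM i:A. ev (f i))"
 by (induction A rule: infinite_finite_induct) simp_all

lemma ev_mult [simp]: "ev (p * q) = ev p * ev q"
proof -
 have "ev (p * q) = ev ((SUM e:keys p. single e (lookup p e)) * (SUM e:keys q. single e (lookup q e)))"
  using poly_mapping_sum_single[of p] poly_mapping_sum_single[of q] by simp
 also have "... = (SUM e:keys p. SUM f:keys q.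
   \<iota> (lookup p e) * \<phi> e * (\<iota> (lookup q f) * \<phi> f))"
  by (simp add: sum_product ev_sum mult_single \<iota>_mult \<phi>_add mult_ac)
 also have "... = ev p * ev q" by (simp add: pm_eval_def sum_product)
 finally show ?thesis .
qed

lemma ev_uminus [simp]: "ev (- p) = - ev p"
 using ev_add[of p "- p"] by (simp add: eq_neg_iff_add_eq_0 add.commute)

lemma ev_diff [simp]: "ev (p - q) = ev p - ev q" using ev_add[of p "- q"] by simp

lemma ev_power [simp]: "ev (p ^ k) = ev p ^ k" by (induction k) simp_all

lemma ev_prod: "ev (PROD i:A. f i) = (PROD i:A. ev (f i))"
 by (induction A rule: infinite_finite_induct) simp_all

end

definition mvalue :: "(nat => 'r) => (nat \<Rightarrow>\<^sub>0 nat) => 'r::comm_ring_1" where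
 "mvalue x e = (PROD i:keys e. x i ^ lookup e i)"

lemma mvalue_superset: "finite A ==> keys e \<subseteq> A ==> mvalue x e = (PROD i:A. x i ^ lookup e i)"
 unfolding mvalue_def by (intro prod.mono_neutral_left) (auto simp: in_keys_iff)

lemma mvalue_add: "mvalue x (e + f) = mvalue x e * mvalue x f"
proof -
 let ?A = "keys e \<union> keys f"
 show ?thesis using mvalue_superset[of ?A "e + f" x] keys_add[of e f]
   mvalue_superset[of ?A e x] mvalue_superset[of ?A f x]
  by (simp add: lookup_add power_add prod.distrib)
qed

lemma evaluation_monomial:
 fixes \<iota> :: "'c::comm_ring_1 => 'r::comm_ring_1"
 assumes "\<iota> 0 = 0" "\<iota> 1 = 1" "!!c c'. \<iota> (c + c') = \<iota> c + \<iota> c'" "!!c c'. \<iota> (c * c') = \<iota> c * \<iota> c'"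
 shows "evaluation (mvalue x) \<iota>"
 using assms by unfold_locales (simp_all add: mvalue_add, simp add: mvalue_def)

definition poly_at :: "(nat => complex) => mpoly => complex" where
 "poly_at z = pm_eval (mvalue z) (%c. c)"

interpretation poly_at: evaluation "mvalue z" "%c::complex. c"
 rewrites "pm_eval (mvalue z) (%c. c) = poly_at z"
 by (rule evaluation_monomial) (simp_all add: poly_at_def)

lemma poly_at_pvar [simp]: "poly_at z (pvar i) = z i" by (simp add: pvar_def mvalue_def)

lemma poly_at_const [simp]: "poly_at z (single 0 c) = c" by (simp add: mvalue_def)

text \<open>Substituting \<open>t ^ (M ^ i)\<close> for the \<open>i\<close>-th variable separates the monomials whose exponents
 are below \<open>M\<close>.\<close>

lemma digits_unique:
 fixes e f :: "nat => nat"
 assumes "!!i. e i < M" "!!i. f i < M" "(\<Sum>i<k. e i * M ^ i) = (\<Sum>i<k. f i * M ^ i)" "i < k"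
 shows "e i = f i"
 using assms(1,2,3,4)
proof (induction k arbitrary: e f i)
 case (Suc k)
 have M: "M > 0" using Suc.prems(1)[of 0] by simp
 have s: "(\<Sum>i<Suc k. g i * M ^ i) = g 0 + M * (\<Sum>i<k. g (Suc i) * M ^ i)" for g :: "nat => nat"
  by (subst sum.lessThan_Suc_shift) (simp add: sum_distrib_left mult_ac)
 have eq: "e 0 + M * (\<Sum>i<k. e (Suc i) * M ^ i) = f 0 + M * (\<Sum>i<k. f (Suc i) * M ^ i)"
  using Suc.prems(3) unfolding s .
 have "(e 0 + M * (\<Sum>i<k. e (Suc i) * M ^ i)) mod M = e 0" "(f 0 + M * (\<Sum>i<k. f (Suc i) * M ^ i)) mod M = f 0"
  using Suc.prems(1)[of 0] Suc.prems(2)[of 0] by simp_all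
 hence e0: "e 0 = f 0" using eq by simp
 hence "(\<Sum>i<k. e (Suc i) * M ^ i) = (\<Sum>i<k. f (Suc i) * M ^ i)" using eq M by simp
 hence "e (Suc j) = f (Suc j)" if "j < k" for j by (rule Suc.IH[OF Suc.prems(1,2) _ that])
 thus ?case using e0 Suc.prems(4) by (cases i) auto
qed simp

lemma poly_at_zero:
 assumes "!!z :: nat => real. (!!i. z i > 0) ==> poly_at (%i. of_real (z i)) p = 0"
 shows "p = 0"
proof (rule ccontr)
 assume "p ~= 0"
 define K where "K = keys p"
 have K: "finite K" "K ~= {}" using `p ~= 0` by (auto simp: K_def)
 define V where "V = (\<Union>e\<in>K. keys e)"
 have V: "finite V" using K by (simp add: V_def)
 define k where "k = Suc (Max (insert 0 V))"
 have Vk: "V \<subseteq> {..<k}" using V by (auto simp: k_def less_Suc_eq_le)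
 define M where "M = Suc (Max (insert 0 (\<Union>e\<in>K. lookup e ` V)))"
 have M: "lookup e i < M" if "e \<in> K" for e i
 proof (cases "i \<in> V")
  case True
  have "finite (\<Union>e\<in>K. lookup e ` V)" using K V by simp
  thus ?thesis using that True by (auto simp: M_def less_Suc_eq_le intro!: Max_ge)
 next
  case False
  hence "lookup e i = 0" using that by (auto simp: V_def in_keys_iff)
  thus ?thesis by (simp add: M_def)
 qed
 define w where "w e = (\<Sum>i<k. lookup e i * M ^ i)" for e :: "nat \<Rightarrow>\<^sub>0 nat"
 have inj: "inj_on w K"
 proof (rule inj_onI)
  fix e f assume ef: "e \<in> K" "f \<in> K" "w e = w f"
  show "e = f"
  proof (rule poly_mapping_eqI)
   fix i
   show "lookup e i = lookup f i"
   proof (cases "i < k")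
    case True
    thus ?thesis using digits_unique[of "lookup e" M "lookup f" k i] M ef by (simp add: w_def)
   next
    case False
    hence "i \<notin> keys e" "i \<notin> keys f" using Vk ef by (auto simp: V_def)
    thus ?thesis by (simp add: in_keys_iff)
   qed
  qed
 qed
 define q where "q = (SUM e:K. monom (lookup p e) (w e))"
 have "poly q (of_real t) = 0" if t: "t > 0" for t :: real
 proof -
  have "poly_at (%i. of_real (t ^ (M ^ i))) p = (SUM e:K. lookup p e * of_real t ^ w e)"
   unfolding poly_at_def pm_eval_def K_def[symmetric]
  proof (intro sum.cong refl arg_cong2[of _ _ _ _ "(*)"])
   fix e assume e: "e \<in> K"
   have "mvalue (%i. complex_of_real (t ^ (M ^ i))) e = (\<Prod>i<k. of_real (t ^ (M ^ i)) ^ lookup e i)"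
    by (rule mvalue_superset) (use e Vk in "auto simp: V_def")
   also have "... = (\<Prod>i<k. of_real t ^ (lookup e i * M ^ i))"
    by (simp add: power_mult[symmetric] mult.commute)
   also have "... = of_real t ^ w e" by (simp add: w_def power_sum)
   finally show "mvalue (%i. complex_of_real (t ^ (M ^ i))) e = of_real t ^ w e" .
  qed
  moreover have "poly_at (%i. of_real (t ^ (M ^ i))) p = 0" using assms[of "%i. t ^ (M ^ i)"] t by simp
  ultimately show ?thesis by (simp add: q_def poly_sum poly_monom)
 qed
 hence "complex_of_real ` {0<..} \<subseteq> {y0. poly q y0 = 0}" by auto
 moreover have "infinite (complex_of_real ` {0<..})"
  using infinite_Ioi[of "0::real"] by (subst finite_image_iff) (auto simp: inj_on_def)
 ultimately have "q = 0" using poly_roots_finite finite_subset by blast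
 obtain e where e: "e \<in> K" using K by blast
 have "coeff q (w e) = (SUM f:K. if f = e then lookup p e else 0)"
  unfolding q_def coeff_sum by (intro sum.cong refl) (use inj e in "auto simp: inj_on_def")
 hence "lookup p e = 0" using `q = 0` K e by simp
 thus False using e by (simp add: K_def in_keys_iff)
qed

text \<open>A relation, because a value exists only if some representation of the fraction has a
  denominator that does not vanish at \<open>z\<close>.\<close>

definition value_at :: "(nat => complex) => ratfun => complex => bool" where
 "value_at z f v <-> (EX p q. q ~= 0 & f = Fract p q & poly_at z q ~= 0 & v = poly_at z p / poly_at z q)"

lemma value_at_unique:
 assumes "value_at z f v" "value_at z f w"
 shows "v = w"
proof -
 obtain p q where p: "q ~= 0" "f = Fract p q" "poly_at z q ~= 0" "v = poly_at z p / poly_at z q"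
  using assms by (auto simp: value_at_def)
 obtain p' q' where p': "q' ~= 0" "f = Fract p' q'" "poly_at z q' ~= 0" "w = poly_at z p' / poly_at z q'"
  using assms by (auto simp: value_at_def)
 have "p * q' = p' * q" using p p' by (simp add: eq_fract)
 hence "poly_at z p * poly_at z q' = poly_at z p' * poly_at z q" by (simp flip: poly_at.ev_mult)
 thus ?thesis using p p' by (simp add: frac_eq_eq)
qed

lemma value_at_const: "value_at z (rconst c) c" unfolding value_at_def rconst_def
 by (rule exI[of _ "single 0 c"], rule exI[of _ 1]) (simp del: poly_at.ev_single)

lemma value_at_one: "value_at z 1 1" unfolding value_at_def One_fract_def by (intro exI[of _ 1]) simp

lemma value_at_var: "value_at z (var i) (z i)"
 unfolding value_at_def var_def by (intro exI[of _ "pvar i"] exI[of _ 1]) simp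

lemma value_at_add: "value_at z f v ==> value_at z g w ==> value_at z (f + g) (v + w)"
proof -
 assume "value_at z f v" "value_at z g w"
 then obtain p q p' q' where "q ~= 0" "f = Fract p q" "poly_at z q ~= 0" "v = poly_at z p / poly_at z q"
   "q' ~= 0" "g = Fract p' q'" "poly_at z q' ~= 0" "w = poly_at z p' / poly_at z q'"
  by (auto simp: value_at_def)
 thus ?thesis unfolding value_at_def
  by (intro exI[of _ "p * q' + p' * q"] exI[of _ "q * q'"]) (simp add: add_frac_eq)
qed

lemma value_at_mult: "value_at z f v ==> value_at z g w ==> value_at z (f * g) (v * w)"
proof -
 assume "value_at z f v" "value_at z g w"
 then obtain p q p' q' where "q ~= 0" "f = Fract p q" "poly_at z q ~= 0" "v = poly_at z p / poly_at z q"
   "q' ~= 0" "g = Fract p' q'" "poly_at z q' ~= 0" "w = poly_at z p' / poly_at z q'"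
  by (auto simp: value_at_def)
 thus ?thesis unfolding value_at_def by (intro exI[of _ "p * p'"] exI[of _ "q * q'"]) simp
qed

lemma value_at_inverse: "value_at z f v ==> v ~= 0 ==> value_at z (inverse f) (inverse v)"
proof -
 assume "value_at z f v" "v ~= 0"
 then obtain p q where "q ~= 0" "f = Fract p q" "poly_at z q ~= 0" "v = poly_at z p / poly_at z q" "poly_at z p ~= 0"
  by (auto simp: value_at_def)
 thus ?thesis unfolding value_at_def by (intro exI[of _ q] exI[of _ p]) auto
qed

lemma value_at_divide: "value_at z f v ==> value_at z g w ==> w ~= 0 ==> value_at z (f / g) (v / w)"
 using value_at_mult[OF _ value_at_inverse, of z f v g w] by (simp add: divide_inverse)

lemma value_at_power: "value_at z f v ==> value_at z (f ^ k) (v ^ k)"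
 by (induction k) (simp_all add: value_at_one value_at_mult)

lemma value_at_prod:
 "(!!i. i \<in> A ==> value_at z (f i) (v i)) ==> value_at z (PROD i:A. f i) (PROD i:A. v i)"
 by (induction A rule: infinite_finite_induct) (simp_all add: value_at_one value_at_mult)

text \<open>After cross-multiplication the difference is a polynomial that vanishes at all positive
  points. Cluster variables always have values there, so no poles need to be discussed.\<close>

lemma ratfun_eqI:
 assumes "!!z :: nat => real. (!!i. z i > 0) ==>
   EX v. value_at (%i. of_real (z i)) f v & value_at (%i. of_real (z i)) g v" shows "f = g"
proof -
 obtain p q where f: "f = Fract p q" "q ~= 0" by (cases f) auto
 obtain p' q' where g: "g = Fract p' q'" "q' ~= 0" by (cases g) auto
 have num: "poly_at \<zeta> r = v * poly_at \<zeta> s" if hv: "h = Fract r s" "s ~= 0" "value_at \<zeta> h v" for h r s \<zeta> v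
 proof -
  obtain r' s' where h: "s' ~= 0" "h = Fract r' s'" "poly_at \<zeta> s' ~= 0" "v = poly_at \<zeta> r' / poly_at \<zeta> s'"
   using hv(3) unfolding value_at_def by blast
  hence "r * s' = r' * s" using hv by (simp add: eq_fract)
  hence "poly_at \<zeta> r * poly_at \<zeta> s' = poly_at \<zeta> r' * poly_at \<zeta> s" by (simp flip: poly_at.ev_mult)
  thus ?thesis unfolding h(4) using h(3) by (simp add: nonzero_eq_divide_eq)
 qed
 have "p * q' - p' * q = 0"
 proof (rule poly_at_zero)
  fix z :: "nat => real" assume "!!i. z i > 0"
  then obtain v where "value_at (%i. of_real (z i)) f v" "value_at (%i. of_real (z i)) g v" using assms by blast
  thus "poly_at (%i. of_real (z i)) (p * q' - p' * q) = 0" using num[OF f] num[OF g] by simp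
 qed
 thus ?thesis using f g by (simp add: eq_fract)
qed

section \<open>Seeds and their potentials\<close>

locale seed_datum = sweep_datum n a d arr vs for n a d arr vs +
 fixes m :: nat and Bt :: "nat => nat => int"
 assumes top_block: "i \<in> {1..n} ==> j \<in> {1..n} ==> Bt i j = exchange_matrix a arr i j"
begin

definition om :: "rvec => rvec => real" where
 "om x y = euler arr x y - euler arr y x
   + (SUM r:{n+1..n+m}. SUM j:I. of_int (Bt r j) * (x j * y r - x r * y j))"

lemma linear__om: "linear (om x)"
proof (rule linearI)
 show "om x (y + z) = om x y + om x z" for y z
  by (simp add: om_def euler_add algebra_simps sum.distrib sum_subtractf)
 show "om x (r *R y) = r *R om x y" for r y
  by (simp add: om_def euler_scale algebra_simps sum_distrib_left)
qed

lemma om_antisym: "om x y = - om y x"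
 by (simp add: om_def sum_negf[symmetric] algebra_simps sum_subtractf)

lemma frozen_zero: "x \<in> lattice ==> r \<in> {n+1..n+m} ==> x r = 0" by (auto simp: lattice_def)

lemma om_lattice: "x \<in> lattice ==> y \<in> lattice ==> om x y = euler arr x y - euler arr y x"
proof -
 assume xy: "x \<in> lattice" "y \<in> lattice"
 have "(SUM r:{n+1..n+m}. SUM j:I. of_int (Bt r j) * (x j * y r - x r * y j)) = 0"
  by (intro sum.neutral ballI) (simp add: frozen_zero[OF xy(1)] frozen_zero[OF xy(2)])
 thus ?thesis by (simp add: om_def)
qed

sublocale cr: cluster_roots "euler arr" om hgt roots "%v. int (root_time v)"
proof (rule cluster_roots.intro)
 show "euler arr x x >= 0" for x unfolding euler_diag[OF orient, of x] using form_nonneg[of x] by simp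
 show "x = 0" if "x \<in> span roots" "euler arr x x = 0" for x
 proof (rule ccontr)
  assume "x ~= 0"
  hence "form x x > 0" using form_pos span_roots that by blast
  thus False using that euler_diag[OF orient, of x] by simp
 qed
 show "om v w = euler arr v w - euler arr w v" if "v \<in> roots" "w \<in> roots" for v w
  using that roots_lattice om_lattice by blast
 show "w - ((euler arr v w + euler arr w v) / euler arr v v) *R v \<in> roots" if "v \<in> roots" "w \<in> roots" for v w
  unfolding euler_form[OF orient] euler_diag[OF orient] by (rule root_reflect[OF that])
 show "(euler arr v w + euler arr w v) / euler arr v v \<in> \<int>" if "v \<in> roots" "w \<in> roots" for v w
  unfolding euler_form[OF orient] euler_diag[OF orient] by (rule root_form_integral[OF that])
 show "int (root_time w) <= int (root_time v)"
  if "v \<in> roots" "w \<in> roots" "hgt v > 0" "hgt w > 0" "euler arr v w > 0" for v w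
  using root_order(1)[of v w] that root_height(2) by simp
 show "int (root_time v) < int (root_time w)"
  if "v \<in> roots" "w \<in> roots" "hgt v > 0" "hgt w > 0" "euler arr v w < 0" for v w
  using root_order(2)[of v w] that root_height(2) by simp
 show "om x y = - om y x" for x y by (rule om_antisym)
 show "v = 1" if "w \<in> roots" "v *R w \<in> roots" "v > 0" for v w using root_reduced[OF that] .
qed (fact linear_euler linear__om linear_height root_height(1) root_uminus finite_roots)+

definition dd :: "nat => real" where
 "dd i = (if i <= n then d i else 1)"

lemma dd_pos: "i \<in> {1..n+m} ==> dd i > 0" using d_pos by (auto simp: dd_def)

lemma arr_asym: "i \<in> I ==> j \<in> I ==> arr i j ==> ~ arr j i"
 using orient unfolding orientation_def by blast+

lemma sum_simple:
 assumes l: "l \<in> I"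
 shows "(SUM j:I. g j * simple l j) = g l"
proof -
 have "(SUM j:I. g j * simple l j) = (SUM j:I. if j = l then g j else 0)"
  by (intro sum.cong refl) (simp add: simple_apply)
 thus ?thesis using l by simp
qed

lemma euler_simple_simple:
 assumes k: "k \<in> I" and l: "l \<in> I"
 shows "euler arr (simple k) (simple l) = (if k = l then d k else if arr k l then d k * of_int (a k l) else 0)"
 unfolding euler_simple1[OF k] sum_simple[OF l] by (simp add: simple_apply)

lemma om_simple:
 assumes i: "i \<in> {1..n+m}" and j: "j \<in> I"
 shows "of_int (Bt i j) = - om (simple i) (simple j) / dd i"
proof (cases "i <= n")
 case True
 hence i': "i \<in> I" using i by simp
 have o: "arr i j ==> ~ arr j i" "i = j ==> ~ arr i j" using arr_asym[OF i' j] by auto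
 have "om (simple i) (simple j) = (if i = j then 0 else if arr i j then d i * of_int (a i j)
   else if arr j i then - (d j * of_int (a j i)) else 0)"
  using o(1) unfolding om_lattice[OF simple_lattice[OF i'] simple_lattice[OF j]]
   euler_simple_simple[OF i' j] euler_simple_simple[OF j i'] by simp
 moreover have "dd i = d i" using True by (simp add: dd_def)
 moreover have "Bt i j = (if arr i j then - a i j else if arr j i then a i j else 0)"
  using top_block[OF i' j] by (simp add: exchange_matrix_def)
 moreover have "arr j j ==> i ~= j" using o by blast
 ultimately show ?thesis
  using o d_pos[OF i'] d_sym[OF i' j] by (cases "i = j"; cases "arr i j"; cases "arr j i") (simp_all add: field_simps)
next
 case False
 hence fi: "i \<in> {n+1..n+m}" using i by auto
 have z: "simple i l = 0" if "l \<in> I" for l using False that by (simp add: simple_apply)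
 have e: "euler arr (simple i) y = 0" "euler arr y (simple i) = 0" for y
  unfolding euler_def using z by (simp_all add: sum.neutral)
 have "(SUM l:I. of_int (Bt r l) * (simple i l * simple j r - simple i r * simple j l))
   = (if r = i then - of_int (Bt i j) else 0)" if "r \<in> {n+1..n+m}" for r
 proof -
  have "(SUM l:I. of_int (Bt r l) * (simple i l * simple j r - simple i r * simple j l))
    = (SUM l:I. (- of_int (Bt r l) * simple i r) * simple j l)" by (intro sum.cong refl) (simp add: z)
  thus ?thesis unfolding sum_simple[OF j] by (simp add: simple_apply)
 qed
 hence "(SUM r:{n+1..n+m}. SUM l:I. of_int (Bt r l) * (simple i l * simple j r - simple i r * simple j l))
   = (SUM r:{n+1..n+m}. if r = i then - of_int (Bt i j) else 0)" by (intro sum.cong refl) blast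
 also have "... = - of_int (Bt i j)" using fi by simp
 finally show ?thesis using False by (simp add: om_def e dd_def)
qed

section \<open>The c-vectors of seeds\<close>

definition gmut :: "nat => (nat => rvec) => nat => rvec" where
 "gmut k V i = (if i = k then - V k else if hgt (V k) > 0 then cr.grn (V k) (V i) else cr.red (V k) (V i))"

definition ghost :: "nat list => nat => rvec" where
 "ghost ks = fold gmut ks simple"

definition seedB :: "nat list => nat => nat => int" where
 "seedB ks = fst (mutate_along n m ks (Bt, var))"

definition seedX :: "nat list => nat => ratfun" where
 "seedX ks = snd (mutate_along n m ks (Bt, var))"

lemma ghost_Nil [simp]: "ghost [] = simple" and seedB_Nil [simp]: "seedB [] = Bt"
 and seedX_Nil [simp]: "seedX [] = var"
 by (simp_all add: ghost_def seedB_def seedX_def mutate_along_def)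

lemma ghost_snoc: "ghost (ks @ [k]) = gmut k (ghost ks)"
 and seedB_snoc: "seedB (ks @ [k]) = mutate_matrix k (seedB ks)"
 and seedX_snoc: "seedX (ks @ [k]) = (seedX ks)(k :=
    ((PROD i:{i\<in>{1..n+m}. seedB ks i k > 0}. seedX ks i ^ nat (seedB ks i k)) +
     (PROD i:{i\<in>{1..n+m}. seedB ks i k < 0}. seedX ks i ^ nat (- seedB ks i k))) / seedX ks k)"
 by (simp_all add: ghost_def seedB_def seedX_def mutate_along_def mutate_def Let_def)

definition ghost_ok :: "(nat => rvec) => bool" where
 "ghost_ok V <-> cr.good (V ` I) & inj_on V I & span (V ` I) = span roots
   & (ALL i:I. euler arr (V i) (V i) = d i)"

lemma ghost_ok_root: "ghost_ok V ==> i \<in> I ==> V i \<in> roots" by (auto simp: ghost_ok_def cr.good_def)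

lemma lattice_combination:
 assumes "x \<in> lattice"
 shows "x = (SUM i:I. x i *R simple i)"
proof
 fix j
 show "x j = (SUM i:I. x i *R simple i) j"
  using assms by (auto simp: sum_fun_apply simple_apply lattice_def if_distrib cong: if_cong)
qed

lemma span_simple: "span (simple ` I) = span roots"
proof -
 have "simple ` I \<subseteq> span roots" using simple_root by (auto intro: span_base)
 moreover have "roots \<subseteq> span (simple ` I)"
 proof
  fix x assume "x \<in> roots"
  hence "x = (SUM i:I. x i *R simple i)" by (intro lattice_combination roots_lattice)
  moreover have "(SUM i:I. x i *R simple i) \<in> span (simple ` I)"
   by (intro span_sum span_scale, rule span_base) simp
  ultimately show "x \<in> span (simple ` I)" by simp
 qed
 ultimately show ?thesis by (metis span_minimal subspace_span subset_antisym)
qed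

lemma euler_simple_nonpos:
 assumes "i \<in> I" "j \<in> I" "i ~= j"
 shows "euler arr (simple i) (simple j) <= 0"
 using d_pos[OF assms(1)] a_nonpos[OF assms] assms(3)
 by (simp add: euler_simple_simple[OF assms(1,2)] mult_nonneg_nonpos)

lemma height_simple: "i \<in> I ==> hgt (simple i) = 1" by (simp add: hgt_def simple_apply)

lemma ghost_ok_simple: "ghost_ok simple"
proof -
 have "inj simple" by (auto simp: inj_def simple_def fun_eq_iff)
 hence inj: "inj_on simple I" by (rule inj_on_subset) simp
 moreover have "euler arr (simple i) (simple i) = d i" if "i \<in> I" for i
  unfolding euler_diag[OF orient] form_simple_simple[OF that that] using a_diag[OF that] by simp
 moreover have gd: "cr.good (simple ` I)"
  unfolding cr.good_def by (auto simp: height_simple intro!: simple_root euler_simple_nonpos)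
 ultimately show ?thesis unfolding ghost_ok_def using span_simple inj gd by blast
qed

lemma gmut_image:
 assumes V: "inj_on V I" and k: "k \<in> I"
 shows "gmut k V ` I = insert (- V k)
   ((if hgt (V k) > 0 then cr.grn (V k) else cr.red (V k)) ` (V ` I - {V k}))"
proof -
 have e: "V ` I - {V k} = V ` (I - {k})" using inj_on_image_set_diff[OF V, of "I" "{k}"] k by simp
 have "gmut k V ` I = insert (gmut k V k) (gmut k V ` (I - {k}))" using k by blast
 also have "gmut k V ` (I - {k})
   = (%i. (if hgt (V k) > 0 then cr.grn (V k) else cr.red (V k)) (V i)) ` (I - {k})"
  by (intro image_cong refl) (simp add: gmut_def)
 finally show ?thesis unfolding e image_image by (simp only: gmut_def[of k V k] refl if_True)
qed

lemma span_green:
 assumes S: "v \<in> S" "cr.good S"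
 shows "span (insert (- v) (cr.grn v ` (S - {v}))) = span S"
proof -
 have n: "- v \<notin> cr.grn v ` (S - {v})" using cr.grn_neq_uminus[OF S(2,1)] by (metis DiffD1 imageE)
 have e: "cr.red (- v) (cr.grn v x) = x" for x by (simp add: cr.grn_def cr.red_def)
 have "insert (- (- v)) (cr.red (- v) ` (insert (- v) (cr.grn v ` (S - {v})) - {- v})) = S"
  using n S(1) by (auto simp: image_image e)
 thus ?thesis using cr.span_red[of "- v" "insert (- v) (cr.grn v ` (S - {v}))"] by simp
qed

lemma norm_reflect:
 assumes vw: "v \<in> roots" "w \<in> roots"
 shows "euler arr (w - ((euler arr v w + euler arr w v) / euler arr v v) *R v)
    (w - ((euler arr v w + euler arr w v) / euler arr v v) *R v) = euler arr w w"
 using cr.root_norm_pos[OF vw(1)] by (simp add: field_simps)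

text \<open>A member either stays or is reflected in the mutated root, so its norm is kept; the red
  case is read off in the dual system.\<close>

lemma gmut_ok:
 assumes V: "ghost_ok V" and k: "k \<in> I"
 shows "ghost_ok (gmut k V)"
proof -
 let ?S = "V ` I" and ?v = "V k"
 have S: "cr.good ?S" "?v \<in> ?S" "inj_on V I" using V k by (auto simp: ghost_ok_def)
 have R: "?v \<in> roots" "- ?v \<in> roots" using ghost_ok_root[OF V k] root_uminus by auto
 have inj: "inj_on (gmut k V) I"
 proof (rule inj_onI)
  fix i j assume ij: "i \<in> I" "j \<in> I" "gmut k V i = gmut k V j"
  have n: "cr.grn ?v (V i) ~= - ?v" "cr.red ?v (V i) ~= - ?v" if "i \<in> I" for i
  proof -
   show "cr.grn ?v (V i) ~= - ?v" using cr.grn_neq_uminus[OF S(1,2)] that by blast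
   show "cr.red ?v (V i) ~= - ?v"
   proof
    assume "cr.red ?v (V i) = - ?v"
    moreover have "cr.red ?v (- ?v) = - ?v" by (simp add: cr.red_def)
    ultimately have "V i = - ?v" using cr.red_inj by metis
    thus False using cr.good_uminus_notin[OF S(1,2)] that by (metis imageI)
   qed
  qed
  have "V i = V j" if "i ~= k" "j ~= k"
   using ij(3) that cr.grn_inj[of ?v "V i" "V j"] cr.red_inj[of ?v "V i" "V j"] by (simp add: gmut_def split: if_splits)
  hence "i ~= k ==> j ~= k ==> i = j" using inj_onD[OF S(3)] ij(1,2) by blast
  moreover have "i = k <-> j = k"
   using ij(3) n[OF ij(1)] n[OF ij(2)] unfolding gmut_def by (simp split: if_splits)
  ultimately show "i = j" by blast
 qed
 have norm: "euler arr (gmut k V i) (gmut k V i) = d i" if i: "i \<in> I" for i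
 proof (cases "i = k")
  case True
  thus ?thesis using V i by (simp add: gmut_def ghost_ok_def)
 next
  case False
  have Vi: "V i \<in> ?S" "V i ~= ?v" "euler arr (V i) (V i) = d i" "V i \<in> roots"
   using V i k False ghost_ok_root[OF V i] inj_onD[OF S(3)] unfolding ghost_ok_def by blast+
  note nr = norm_reflect[OF R(1) Vi(4)]
  show ?thesis
  proof (cases "hgt ?v > 0")
   case True
   show ?thesis
   proof (cases "euler arr ?v (V i) < 0")
    case neg: True
    show ?thesis
     using nr cr.grn_J[OF S(1,2) Vi(1,2) True neg] cr.good_not_both_neg[OF S(1,2) Vi(1,2) True neg] True False Vi(3)
     by (simp add: gmut_def)
   next
    case nneg: False
    show ?thesis using cr.grn_nJ[OF S(1,2) Vi(1,2) True] nneg True False Vi(3) by (simp add: gmut_def)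
   qed
  next
   case nh: False
   hence neg: "hgt ?v < 0" using root_height(1)[OF R(1)] by simp
   interpret du: cluster_roots "%x y. euler arr y x" "%x y. - om x y" "%x. - hgt x" roots
     "%v. - int (root_time (- v))" by (rule cr.dual)
   have gd: "du.good ?S" using cr.good_dual S(1) by blast
   have th: "du.grn ?v (V i) = cr.red ?v (V i)" by (simp add: du.grn_def cr.red_def)
   have h: "0 < - hgt ?v" using neg by simp
   show ?thesis
   proof (cases "euler arr (V i) ?v < 0")
    case ng: True
    show ?thesis
     using nr du.grn_J[OF gd S(2) Vi(1,2) h ng] du.good_not_both_neg[OF gd S(2) Vi(1,2) h ng] nh False Vi(3) th
     by (simp add: gmut_def)
   next
    case nneg: False
    show ?thesis using du.grn_nJ[OF gd S(2) Vi(1,2) h] nneg nh False Vi(3) th by (simp add: gmut_def)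
   qed
  qed
 qed
 have "cr.good (gmut k V ` I) & span (gmut k V ` I) = span roots"
 proof (cases "hgt ?v > 0")
  case True
  thus ?thesis using cr.good_green[OF S(1,2) True] span_green[OF S(2,1)] gmut_image[OF S(3) k] V
   by (simp add: ghost_ok_def)
 next
  case False
  hence "hgt ?v < 0" using root_height(1)[OF R(1)] by simp
  thus ?thesis using cr.good_red[OF S(1,2)] cr.span_red[OF S(2)] gmut_image[OF S(3) k] V False
   by (simp add: ghost_ok_def)
 qed
 thus ?thesis using inj norm by (auto simp: ghost_ok_def)
qed

lemma ghost_ok_ghost: "set ks \<subseteq> I ==> ghost_ok (ghost ks)"
 by (induction ks rule: rev_induct) (auto simp: ghost_ok_simple ghost_snoc gmut_ok)

text \<open>Green and red mutation change \<open>om\<close> by the same amount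
  \<open>(max 0 A * max 0 C - max 0 (- A) * max 0 (- C)) / d k\<close>, which is matrix mutation.
  This independence of the sign lets the vectors compute the whole matrix.\<close>

lemma seedB_ghost: "set ks \<subseteq> I ==> i \<in> {1..n+m} ==> j \<in> I ==>
   real_of_int (seedB ks i j) = - om (ghost ks i) (ghost ks j) / dd i"
proof (induction ks arbitrary: i j rule: rev_induct)
 case Nil
 thus ?case using om_simple by simp
next
 case (snoc k ks)
 hence ks: "set ks \<subseteq> I" and k: "k \<in> I" "k \<in> {1..n+m}" by auto
 define V where "V = ghost ks"
 have IH: "real_of_int (seedB ks p q) = - om (V p) (V q) / dd p" if "p \<in> {1..n+m}" "q \<in> I" for p q
  using snoc.IH ks that by (simp add: V_def)
 have dk: "euler arr (V k) (V k) = d k" "d k > 0" "dd k = d k"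
  using ghost_ok_ghost[OF ks] k d_pos by (auto simp: ghost_ok_def V_def dd_def)
 have di: "dd i > 0" using dd_pos snoc.prems by auto
 show ?case
 proof (cases "i = k | j = k")
  case True
  have om_V: "om (V k) (gmut k V p) = om (V k) (V p)" "om (gmut k V p) (V k) = om (V p) (V k)" if "p ~= k" for p
   using that by (simp_all add: gmut_def cr.grn_def cr.red_def)
  have "gmut k V k = - V k" by (simp add: gmut_def)
  hence "om (gmut k V i) (gmut k V j) = - om (V i) (V j)"
   using True om_V[of i] om_V[of j] by (cases "i = k"; cases "j = k") simp_all
  thus ?thesis
   using True IH[OF snoc.prems(2,3)] by (auto simp: seedB_snoc mutate_matrix_def ghost_snoc V_def[symmetric])
 next
  case False
  define A C where "A = om (V i) (V k)" and "C = om (V k) (V j)"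
  have bik: "real_of_int (seedB ks i k) = - A / dd i" and bkj: "real_of_int (seedB ks k j) = - C / d k"
   using IH[of i k] IH[of k j] snoc.prems k dk by (simp_all add: A_def C_def)
  have "om (gmut k V i) (gmut k V j) = om (V i) (V j) + (max 0 A * max 0 C - max 0 (- A) * max 0 (- C)) / d k"
  proof (cases "hgt (V k) > 0")
   case True
   have "om (gmut k V i) (gmut k V j) = om (V i) (V j) + (max 0 (- C) / d k * A + max 0 A / d k * C)"
    using True False dk(1) cr.om_antisym[of "V k" "V i"]
    by (simp add: gmut_def cr.grn_def A_def[symmetric] C_def[symmetric])
   also have "max 0 (- C) / d k * A + max 0 A / d k * C = (max 0 A * max 0 C - max 0 (- A) * max 0 (- C)) / d k"
    by (simp add: max_def add_divide_distrib[symmetric])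
   finally show ?thesis .
  next
   case nh: False
   have "om (gmut k V i) (gmut k V j) = om (V i) (V j) + (max 0 C / d k * A + max 0 (- A) / d k * C)"
    using nh False dk(1) cr.om_antisym[of "V k" "V i"]
    by (simp add: gmut_def cr.red_def A_def[symmetric] C_def[symmetric])
   also have "max 0 C / d k * A + max 0 (- A) / d k * C = (max 0 A * max 0 C - max 0 (- A) * max 0 (- C)) / d k"
    by (simp add: max_def add_divide_distrib[symmetric])
   finally show ?thesis .
  qed
  moreover have "real_of_int (seedB (ks @ [k]) i j) = - om (V i) (V j) / dd i
    + (max 0 (- A / dd i) * max 0 (- C / d k) - max 0 (A / dd i) * max 0 (C / d k))"
   using False IH[OF snoc.prems(2,3)] bik bkj by (simp add: seedB_snoc mutate_matrix_def of_int_max)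
  moreover have "max 0 (- A / dd i) * max 0 (- C / d k) - max 0 (A / dd i) * max 0 (C / d k)
    = - ((max 0 A * max 0 C - max 0 (- A) * max 0 (- C)) / d k) / dd i"
   using di dk by (simp add: max_def zero_le_divide_iff divide_le_0_iff field_simps)
  ultimately show ?thesis by (simp add: ghost_snoc V_def[symmetric] diff_divide_distrib add_divide_distrib)
 qed
qed

end

section \<open>Values at positive points and the potential\<close>

abbreviation rvalue :: "(nat => real) => ratfun => real => bool" where
 "rvalue z f v \<equiv> value_at (%i. complex_of_real (z i)) f (complex_of_real v)"

lemma rvalue_unique: "rvalue z f v ==> rvalue z f w ==> v = w" using value_at_unique by fastforce

lemma rvalue_var: "rvalue z (var i) (z i)"
 and rvalue_add: "rvalue z f v ==> rvalue z g w ==> rvalue z (f + g) (v + w)"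
 and rvalue_mult: "rvalue z f v ==> rvalue z g w ==> rvalue z (f * g) (v * w)"
 and rvalue_divide: "rvalue z f v ==> rvalue z g w ==> w ~= 0 ==> rvalue z (f / g) (v / w)"
 and rvalue_power: "rvalue z f v ==> rvalue z (f ^ k) (v ^ k)"
 using value_at_var value_at_add[of "%i. complex_of_real (z i)" f "of_real v" g "of_real w"]
  value_at_mult[of "%i. complex_of_real (z i)" f "of_real v" g "of_real w"]
  value_at_divide[of "%i. complex_of_real (z i)" f "of_real v" g "of_real w"]
  value_at_power[of "%i. complex_of_real (z i)" f "of_real v" k] by simp_all

lemma rvalue_prod: "(!!i. i \<in> A ==> rvalue z (f i) (v i)) ==> rvalue z (PROD i:A. f i) (PROD i:A. v i)"
 using value_at_prod[of A "%i. complex_of_real (z i)" f "%i. complex_of_real (v i)"] by simp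

lemma ln_prod_powers:
 fixes x :: "'a => real" and b :: "'a => int"
 assumes "finite A" "!!i. i \<in> A ==> x i > 0"
 shows "ln (PROD i:{i\<in>A. b i > 0}. x i ^ nat (b i)) = (SUM i:A. max 0 (of_int (b i)) * ln (x i))"
proof -
 have "ln (PROD i:{i\<in>A. b i > 0}. x i ^ nat (b i)) = (SUM i:{i\<in>A. b i > 0}. ln (x i ^ nat (b i)))"
  using assms(1) by (intro ln_prod) (auto simp: less_imp_neq[OF assms(2), symmetric] assms(2))
 also have "... = (SUM i:{i\<in>A. b i > 0}. max 0 (of_int (b i)) * ln (x i))"
  using assms by (intro sum.cong) (auto simp: ln_realpow)
 also have "... = (SUM i:A. max 0 (of_int (b i)) * ln (x i))"
  using assms by (intro sum.mono_neutral_left) auto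
 finally show ?thesis .
qed

context seed_datum begin

text \<open>One of the two monomials of an exchange relation; the other one belongs to
  \<open>- b\<close>.\<close>

definition bside :: "(nat => int) => (nat => 'f) => 'f::comm_monoid_mult" where
 "bside b x = (PROD i:{i\<in>{1..n+m}. b i > 0}. x i ^ nat (b i))"

lemma bside_cong: "(!!i. i \<in> {1..n+m} ==> b i > 0 ==> x i = y i) ==> bside b x = bside b y"
 by (auto simp: bside_def intro!: prod.cong)

lemma bside_pos: "(!!i. x i > 0) ==> bside b x > (0::real)" by (auto simp: bside_def intro!: prod_pos)

lemma seedX_step: "seedX (ks @ [k]) = (seedX ks)(k :=
  (bside (%i. seedB ks i k) (seedX ks) + bside (%i. - seedB ks i k) (seedX ks)) / seedX ks k)"
 by (simp add: seedX_snoc bside_def)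

lemma seedB_diag: "set ks \<subseteq> I ==> k \<in> I ==> seedB ks k k = 0" using seedB_ghost[of ks k k] by simp

definition real_mutate :: "nat list => nat => (nat => real) => nat => real" where
 "real_mutate ks k y = y(k := (bside (%i. seedB ks i k) y + bside (%i. - seedB ks i k) y) / y k)"

lemma real_mutate_pos: "(!!i. y i > 0) ==> real_mutate ks k y i > 0"
 using bside_pos[of y] by (auto simp: real_mutate_def intro!: divide_pos_pos add_pos_pos)

lemma real_mutate_twice:
 assumes "set ks \<subseteq> I" "k \<in> I" "!!i. y i > 0"
 shows "real_mutate ks k (real_mutate ks k y) = y"
proof -
 have s: "bside b (y(k := t)) = bside b y" if "b k = 0" for b and t :: real
  using that by (intro bside_cong) auto
 define s where "s = bside (%i. seedB ks i k) y + bside (%i. - seedB ks i k) y"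
 have "s > 0" unfolding s_def using bside_pos[of y] assms(3) by (simp add: add_pos_pos)
 thus ?thesis using assms(3)[of k] seedB_diag[OF assms(1,2)] unfolding real_mutate_def
  by (simp add: s s_def[symmetric] fun_eq_iff)
qed

definition cvalue :: "(nat => real) => nat list => nat => real" where
 "cvalue z ks i = (THE v. rvalue z (seedX ks i) v)"

lemma cvalue_eqI: "rvalue z (seedX ks i) v ==> cvalue z ks i = v"
 unfolding cvalue_def using rvalue_unique by blast

lemma seedX_values:
 assumes "!!i. z i > 0"
 shows "EX y. (ALL i. y i > 0 & rvalue z (seedX ks i) (y i))"
proof (induction ks rule: rev_induct)
 case Nil
 thus ?case using assms rvalue_var by (intro exI[of _ z]) simp
next
 case (snoc k ks)
 then obtain y where y: "!!i. y i > 0" "!!i. rvalue z (seedX ks i) (y i)" by blast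
 have "rvalue z (bside b (seedX ks)) (bside b y)" for b
  unfolding bside_def by (intro rvalue_prod rvalue_power y)
 hence "rvalue z (seedX (ks @ [k]) i) (real_mutate ks k y i)" for i
  unfolding seedX_step real_mutate_def using y(1)[of k] y(2)
  by (auto intro!: rvalue_divide rvalue_add simp del: of_real_divide of_real_add)
 thus ?case using real_mutate_pos[of y ks k] y(1) by (intro exI[of _ "real_mutate ks k y"]) blast
qed

lemma cvalue:
 assumes "!!i. z i > 0"
 shows "rvalue z (seedX ks i) (cvalue z ks i)" "cvalue z ks i > 0"
 using seedX_values[of z ks, OF assms] cvalue_eqI by metis+

lemma cvalue_step:
 assumes "!!i. z i > 0"
 shows "cvalue z (ks @ [k]) = real_mutate ks k (cvalue z ks)"
proof
 fix i
 note y = cvalue[of z ks, OF assms]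
 have "rvalue z (bside b (seedX ks)) (bside b (cvalue z ks))" for b
  unfolding bside_def by (intro rvalue_prod rvalue_power y)
 hence "rvalue z (seedX (ks @ [k]) i) (real_mutate ks k (cvalue z ks) i)" for i
  unfolding seedX_step real_mutate_def using y(2)[of k] y(1)
  by (auto intro!: rvalue_divide rvalue_add simp del: of_real_divide of_real_add)
 thus "cvalue z (ks @ [k]) i = real_mutate ks k (cvalue z ks) i" by (rule cvalue_eqI)
qed

lemma cvalue_Nil: "cvalue z [] = z" using cvalue_eqI[of z "[]"] rvalue_var by auto

text \<open>Mutation of positive values is an involution, so values prescribed at any seed can be
  mutated back to the initial one. This allows identities to be tested at convenient points of
  arbitrary seeds.\<close>

lemma cvalue_surj:
 assumes "set ks \<subseteq> I" "!!i. y i > 0"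
 shows "EX z. (ALL i. z i > 0) & cvalue z ks = y"
 using assms
proof (induction ks arbitrary: y rule: rev_induct)
 case Nil
 thus ?case using cvalue_Nil by auto
next
 case (snoc k ks)
 hence ks: "set ks \<subseteq> I" "k \<in> I" by auto
 have "real_mutate ks k y i > 0" for i using real_mutate_pos snoc.prems(2) by blast
 then obtain z where z: "!!i. z i > 0" "cvalue z ks = real_mutate ks k y" using snoc.IH[OF ks(1)] by blast
 hence "cvalue z (ks @ [k]) = y"
  using cvalue_step[OF z(1)] real_mutate_twice[OF ks snoc.prems(2)] by simp
 thus ?case using z(1) by blast
qed

text \<open>The logarithms of the values of the extended cluster enter the potential with the weights that
 make an exchange relation into a softplus shift along the mutated root.\<close>

definition potential :: "(nat => real) => nat list => rvec" where
 "potential z ks = - (SUM i:{1..n+m}. (ln (cvalue z ks i) / dd i) *R ghost ks i)"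

definition state :: "(nat => real) => nat list => rvec set \<times> (nat => rvec) \<times> rvec" where
 "state z ks = (ghost ks ` I, %r. ghost ks (n + 1 + r), potential z ks)"

lemma ln_bside:
 assumes "!!i. z i > 0" "set ks \<subseteq> I" "k \<in> I"
 shows "ln (bside (%i. seedB ks i k) (cvalue z ks))
   = (SUM i:{1..n+m}. max 0 (om (ghost ks k) (ghost ks i)) * (ln (cvalue z ks i) / dd i))"
  and "ln (bside (%i. - seedB ks i k) (cvalue z ks))
   = (SUM i:{1..n+m}. max 0 (- om (ghost ks k) (ghost ks i)) * (ln (cvalue z ks i) / dd i))"
proof -
 have e: "real_of_int (seedB ks i k) = om (ghost ks k) (ghost ks i) / dd i" if "i \<in> {1..n+m}" for i
  using seedB_ghost[OF assms(2) that assms(3)] om_antisym[of "ghost ks i" "ghost ks k"] by simp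
 have m: "max 0 (x / dd i) = max 0 x / dd i" if "i \<in> {1..n+m}" for x i
  using dd_pos[OF that] by (simp add: max_def zero_le_divide_iff)
 have fin: "finite {1..n+m}" by simp
 have pos: "cvalue z ks i > 0" for i using cvalue(2) assms(1) by blast
 show "ln (bside (%i. seedB ks i k) (cvalue z ks))
   = (SUM i:{1..n+m}. max 0 (om (ghost ks k) (ghost ks i)) * (ln (cvalue z ks i) / dd i))"
  unfolding bside_def ln_prod_powers[OF fin pos]
  by (intro sum.cong refl) (simp only: e m times_divide_eq_left times_divide_eq_right)
 have e': "real_of_int (- seedB ks i k) = (- om (ghost ks k) (ghost ks i)) / dd i" if "i \<in> {1..n+m}" for i
  using e[OF that] by simp
 show "ln (bside (%i. - seedB ks i k) (cvalue z ks))
   = (SUM i:{1..n+m}. max 0 (- om (ghost ks k) (ghost ks i)) * (ln (cvalue z ks i) / dd i))"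
  unfolding bside_def ln_prod_powers[OF fin pos]
  by (intro sum.cong refl) (simp only: e' m times_divide_eq_left times_divide_eq_right)
qed

text \<open>With \<open>P\<close> and \<open>Q\<close> the two monomials of the exchange relation,
  \<open>om (ghost ks k)\<close> of the potential is \<open>ln Q - ln P\<close>. The change of the
  other vectors contributes \<open>ln P\<close> or \<open>ln Q\<close> according to the colour, the
  new variable contributes \<open>ln (P + Q)\<close>, and the difference is a softplus.\<close>

lemma potential_step:
 assumes z: "!!i. z i > 0" and ks: "set ks \<subseteq> I" and k: "k \<in> I"
 shows "potential z (ks @ [k]) = potential z ks
   + (soft (if hgt (ghost ks k) < 0 then om (ghost ks k) (potential z ks) else - om (ghost ks k) (potential z ks))
    / euler arr (ghost ks k) (ghost ks k)) *R ghost ks k"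
proof -
 define V y where "V = ghost ks" and "y = cvalue z ks"
 define L where "L = (%i. ln (y i) / dd i)"
 define W where "W = (%i. ghost (ks @ [k]) i)"
 define L' where "L' = (%i. ln (cvalue z (ks @ [k]) i) / dd i)"
 define P where "P = bside (%i. seedB ks i k) y"
 define Q where "Q = bside (%i. - seedB ks i k) y"
 define g where "g = (%i. if hgt (V k) < 0 then max 0 (om (V k) (V i)) else max 0 (- om (V k) (V i)))"
 have ypos: "y i > 0" for i using cvalue(2)[OF z] by (simp add: y_def)
 have PQ: "P > 0" "Q > 0" using bside_pos[OF ypos] by (auto simp: P_def Q_def)
 have lnP: "ln P = (SUM i:{1..n+m}. max 0 (om (V k) (V i)) * L i)"
  and lnQ: "ln Q = (SUM i:{1..n+m}. max 0 (- om (V k) (V i)) * L i)"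
  using ln_bside[OF z ks k] by (simp_all add: P_def Q_def V_def L_def y_def)
 have dk: "euler arr (V k) (V k) = d k" "dd k = d k" "d k > 0"
  using ghost_ok_ghost[OF ks] k d_pos by (auto simp: ghost_ok_def V_def dd_def)
 have ht: "hgt (V k) > 0 <-> ~ hgt (V k) < 0"
  using root_height(1)[OF ghost_ok_root[OF ghost_ok_ghost[OF ks] k]] by (auto simp: V_def)
 have W: "W i = V i + (g i / d k) *R V k" if "i ~= k" for i
  using that ht dk by (simp add: W_def ghost_snoc gmut_def V_def[symmetric] cr.grn_def cr.red_def g_def)
 have Wk: "W k = - V k" by (simp add: W_def ghost_snoc gmut_def V_def)
 have L': "L' i = L i" if "i ~= k" for i
  using that by (simp add: L'_def cvalue_step[OF z] real_mutate_def L_def y_def)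
 have "cvalue z (ks @ [k]) k = (P + Q) / y k"
  by (simp add: cvalue_step[OF z] real_mutate_def P_def Q_def y_def)
 hence L'k: "L' k = ln (P + Q) / d k - L k"
  using ypos[of k] PQ by (simp add: L'_def ln_div L_def dk diff_divide_distrib)
 have gk: "g k = 0" by (simp add: g_def)
 have kin: "k \<in> {1..n+m}" using k by auto
 have X: "potential z ks = - (SUM i:{1..n+m}. L i *R V i)"
  by (simp add: potential_def L_def V_def y_def)
 have X': "potential z (ks @ [k]) = - (SUM i:{1..n+m}. L' i *R W i)"
  by (simp add: potential_def L'_def W_def)
 have "L' i *R W i = L i *R V i + (g i * L i / d k) *R V k - (if i = k then (ln (P + Q) / d k) *R V k else 0)" for i
 proof (cases "i = k")
  case True
  thus ?thesis by (simp add: Wk L'k gk scaleR_left_diff_distrib)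
 next
  case False
  thus ?thesis by (simp add: W L' scaleR_right_distrib mult.commute)
 qed
 hence "(SUM i:{1..n+m}. L' i *R W i) = (SUM i:{1..n+m}. L i *R V i)
   + ((SUM i:{1..n+m}. g i * L i / d k) *R V k) - (ln (P + Q) / d k) *R V k"
  using kin by (simp add: sum.distrib sum_subtractf scaleR_sum_left)
 hence "potential z (ks @ [k]) = potential z ks + ((ln (P + Q) - (SUM i:{1..n+m}. g i * L i)) / d k) *R V k"
  by (simp add: X X' sum_divide_distrib[symmetric] diff_divide_distrib scaleR_left_diff_distrib)
 also have "ln (P + Q) - (SUM i:{1..n+m}. g i * L i)
   = soft (if hgt (V k) < 0 then om (V k) (potential z ks) else - om (V k) (potential z ks))"
 proof -
  have "om (V k) (potential z ks) = - om (V k) (SUM i:{1..n+m}. L i *R V i)"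
   unfolding X by (rule linear_neg[OF linear__om])
  also have "... = - (SUM i:{1..n+m}. L i * om (V k) (V i))"
   unfolding linear_sum[OF linear__om] by (simp add: linear_scale[OF linear__om])
  also have "... = (SUM i:{1..n+m}. max 0 (- om (V k) (V i)) * L i - max 0 (om (V k) (V i)) * L i)"
   unfolding sum_negf[symmetric] by (intro sum.cong refl) (simp add: max_def)
  finally have w: "om (V k) (potential z ks) = ln Q - ln P" by (simp add: lnP lnQ sum_subtractf)
  show ?thesis
  proof (cases "hgt (V k) < 0")
   case True
   hence "(SUM i:{1..n+m}. g i * L i) = ln P" by (simp add: g_def lnP)
   thus ?thesis using True soft_ln[OF PQ(2,1) refl] w by (simp add: add.commute)
  next
   case False
   hence "(SUM i:{1..n+m}. g i * L i) = ln Q" by (simp add: g_def lnQ)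
   thus ?thesis using False soft_ln[OF PQ refl] w by (simp add: add.commute)
  qed
 qed
 finally show ?thesis unfolding V_def[symmetric] dk(1) .
qed

lemma red_mutation:
 assumes z: "!!i. z i > 0" and ks: "set ks \<subseteq> I" and k: "k \<in> I" and red: "hgt (ghost ks k) < 0"
 shows "cr.red_step (state z ks) (state z (ks @ [k]))"
proof -
 let ?v = "ghost ks k" and ?S = "ghost ks ` I"
 have ok: "ghost_ok (ghost ks)" by (rule ghost_ok_ghost[OF ks])
 have g: "cr.good ?S" "inj_on (ghost ks) I" using ok by (auto simp: ghost_ok_def)
 have v: "?v \<in> ?S" using k by blast
 have S: "ghost (ks @ [k]) ` I = insert (- ?v) (cr.red ?v ` (?S - {?v}))"
  unfolding ghost_snoc gmut_image[OF g(2) k] using red by simp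
 have U: "(%r. ghost (ks @ [k]) (n + 1 + r)) = cr.red ?v o (%r. ghost ks (n + 1 + r))"
  using red k by (simp add: fun_eq_iff ghost_snoc gmut_def)
 have X: "potential z (ks @ [k]) = cr.shift soft ?v (potential z ks)"
  unfolding potential_step[OF z ks k] cr.shift_def using red by simp
 show ?thesis unfolding state_def S U X by (rule cr.red_stepI[OF g(1) v red])
qed

text \<open>A green mutation is a red step read backwards: the new vector \<open>- v\<close> is
  negative, and \<open>red (- v)\<close> undoes \<open>grn v\<close>.\<close>

lemma green_mutation:
 assumes z: "!!i. z i > 0" and ks: "set ks \<subseteq> I" and k: "k \<in> I" and green: "hgt (ghost ks k) > 0"
 shows "cr.red_step (state z (ks @ [k])) (state z ks)"
proof -
 let ?v = "ghost ks k" and ?S = "ghost ks ` I"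
 let ?S' = "ghost (ks @ [k]) ` I"
 have ok: "ghost_ok (ghost ks)" by (rule ghost_ok_ghost[OF ks])
 have g: "cr.good ?S" "inj_on (ghost ks) I" using ok by (auto simp: ghost_ok_def)
 have g': "cr.good ?S'" using ghost_ok_ghost[of "ks @ [k]"] ks k by (simp add: ghost_ok_def)
 have v: "?v \<in> ?S" using k by blast
 have S': "?S' = insert (- ?v) (cr.grn ?v ` (?S - {?v}))"
  unfolding ghost_snoc gmut_image[OF g(2) k] using green by simp
 have e: "cr.red (- ?v) (cr.grn ?v x) = x" for x by (simp add: cr.grn_def cr.red_def)
 have "- ?v \<notin> cr.grn ?v ` (?S - {?v})"
 proof
  assume "- ?v \<in> cr.grn ?v ` (?S - {?v})"
  then obtain x where "x \<in> ?S" "- ?v = cr.grn ?v x" by blast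
  thus False using cr.grn_neq_uminus[OF g(1) v, of x] by argo
 qed
 hence "?S' - {- ?v} = cr.grn ?v ` (?S - {?v})" unfolding S' by blast
 hence S: "?S = insert (- (- ?v)) (cr.red (- ?v) ` (?S' - {- ?v}))"
  using v by (simp add: image_image e insert_absorb)
 have U: "(%r. ghost ks (n + 1 + r)) = cr.red (- ?v) o (%r. ghost (ks @ [k]) (n + 1 + r))"
  using green k by (simp add: fun_eq_iff ghost_snoc gmut_def e)
 have X: "potential z ks = cr.shift soft (- ?v) (potential z (ks @ [k]))"
  unfolding potential_step[OF z ks k] cr.shift_def using green by simp
 have r: "hgt (- ?v) < 0" "- ?v \<in> ?S'" using green S' by simp_all
 have "cr.red_step (state z (ks @ [k])) (insert (- (- ?v)) (cr.red (- ?v) ` (?S' - {- ?v})),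
   cr.red (- ?v) o (%r. ghost (ks @ [k]) (n + 1 + r)), cr.shift soft (- ?v) (potential z (ks @ [k])))"
  unfolding state_def by (rule cr.red_stepI[OF g' r(2,1)])
 thus ?thesis unfolding S[symmetric] U[symmetric] X[symmetric] by (simp only: state_def)
qed

lemma state_linked:
 assumes z: "!!i. z i > 0"
 shows "set ks \<subseteq> I ==> cr.linked (state z []) (state z ks)"
proof (induction ks rule: rev_induct)
 case Nil
 show ?case by simp
next
 case (snoc k ks)
 hence ks: "set ks \<subseteq> I" "k \<in> I" by auto
 have "hgt (ghost ks k) ~= 0" using root_height(1) ghost_ok_root ghost_ok_ghost ks by blast
 hence "cr.red_step (state z ks) (state z (ks @ [k])) | cr.red_step (state z (ks @ [k])) (state z ks)"
  using red_mutation[of z, OF z ks] green_mutation[of z, OF z ks] by linarith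
 with snoc.IH[OF ks(1)] show ?case by (rule rtranclp.rtrancl_into_rtrancl)
qed

theorem same_state:
 assumes ks: "set ks \<subseteq> I" and ks': "set ks' \<subseteq> I" and S: "ghost ks ` I = ghost ks' ` I"
  and k: "k \<in> I" "k' \<in> I" "ghost ks k = ghost ks' k'"
 shows "seedX ks k = seedX ks' k'"
proof (rule ratfun_eqI)
 fix z :: "nat => real" assume z: "!!i. z i > 0"
 let ?S = "ghost ks ` I"
 have ok: "ghost_ok (ghost ks)" "ghost_ok (ghost ks')" using ghost_ok_ghost ks ks' by blast+
 have g: "cr.good ?S" "inj_on (ghost ks) I" "inj_on (ghost ks') I" using ok by (auto simp: ghost_ok_def)
 have "~ cr.red_step (state z []) s'" for s' by (auto simp: cr.red_step_def state_def height_simple)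
 hence nrm: "cr.normal (state z [])" by (simp add: cr.normal_def)
 have g0: "cr.good (fst (state z []))" using ghost_ok_simple by (simp add: state_def ghost_ok_def)
 have "cr.linked (state z []) (?S, %r. ghost ks (n + 1 + r), potential z ks)"
  "cr.linked (state z []) (?S, %r. ghost ks' (n + 1 + r), potential z ks')"
  using state_linked[OF z ks] state_linked[OF z ks'] by (simp_all only: state_def S)
 from cr.linked_state_unique[OF this nrm g0]
 have UX: "(%r. ghost ks (n + 1 + r)) = (%r. ghost ks' (n + 1 + r))" "potential z ks = potential z ks'" by auto
 have frozen: "ghost ks i = ghost ks' i" "cvalue z ks i = cvalue z ks' i" if i: "i \<in> {n+1..n+m}" for i
 proof -
  obtain r where r: "i = n + 1 + r" using i by (metis atLeastAtMost_iff le_Suc_ex)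
  thus "ghost ks i = ghost ks' i" using fun_cong[OF UX(1), of r] by simp
  have "seedX qs i = var i" if "set qs \<subseteq> I" for qs
   using that i by (induction qs rule: rev_induct) (auto simp: seedX_step)
  thus "cvalue z ks i = cvalue z ks' i" using ks ks' by (simp add: cvalue_def)
 qed
 \<comment> \<open>The coefficients are indexed by the c-vectors themselves, since the two seeds may
   number the same set differently.\<close>
 define lv lv' where "lv = (%v. ln (cvalue z ks (the_inv_into I (ghost ks) v)) / euler arr v v)"
  and "lv' = (%v. ln (cvalue z ks' (the_inv_into I (ghost ks') v)) / euler arr v v)"
 have mut: "(SUM i:I. (ln (cvalue z qs i) / dd i) *R ghost qs i)
   = (SUM v:ghost qs ` I. (ln (cvalue z qs (the_inv_into I (ghost qs) v)) / euler arr v v) *R v)"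
  if "ghost_ok (ghost qs)" for qs
 proof -
  have i: "inj_on (ghost qs) I" using that by (simp add: ghost_ok_def)
  have e: "euler arr (ghost qs j) (ghost qs j) = dd j" if "j \<in> I" for j
   using `ghost_ok (ghost qs)` that by (auto simp: ghost_ok_def dd_def)
  thus ?thesis
   unfolding sum.reindex[OF i] by (intro sum.cong refl) (simp only: o_apply e the_inv_into_f_f[OF i])
 qed
 have split: "(SUM i:{1..n+m}. f i) = (SUM i:I. f i) + (SUM i:{n+1..n+m}. f i)" for f :: "nat => rvec"
  using sum.ub_add_nat[of 1 n f m] by simp
 have "(SUM i:{n+1..n+m}. (ln (cvalue z ks i) / dd i) *R ghost ks i)
   = (SUM i:{n+1..n+m}. (ln (cvalue z ks' i) / dd i) *R ghost ks' i)"
  by (intro sum.cong refl) (simp only: frozen)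
 hence "(SUM i:I. (ln (cvalue z ks i) / dd i) *R ghost ks i)
   = (SUM i:I. (ln (cvalue z ks' i) / dd i) *R ghost ks' i)"
  using UX(2) unfolding potential_def split by simp
 hence "(SUM v:?S. lv v *R v) = (SUM v:?S. lv' v *R v)"
  unfolding mut[OF ok(1)] mut[OF ok(2)] S[symmetric] lv_def lv'_def .
 hence "(SUM v:?S. (lv v - lv' v) *R v) = 0" by (simp add: scaleR_left_diff_distrib sum_subtractf)
 hence "lv (ghost ks k) = lv' (ghost ks k)"
  using cr.combination_zero[OF g(1), of "%v. lv v - lv' v" "ghost ks k"] k(1) by simp
 moreover have "euler arr (ghost ks k) (ghost ks k) > 0"
  using ok(1) k(1) d_pos by (simp add: ghost_ok_def)
 ultimately have "ln (cvalue z ks k) = ln (cvalue z ks' k')"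
  unfolding lv_def lv'_def the_inv_into_f_f[OF g(2) k(1)] unfolding k(3) the_inv_into_f_f[OF g(3) k(2)] by simp
 hence "cvalue z ks k = cvalue z ks' k'" using cvalue(2)[OF z] by simp
 thus "EX v. value_at (%i. complex_of_real (z i)) (seedX ks k) v & value_at (%i. complex_of_real (z i)) (seedX ks' k') v"
  using cvalue(1)[of z ks k, OF z] cvalue(1)[of z ks' k', OF z] by auto
qed

end

section \<open>Source paths and sweeps\<close>

context sweep_datum begin

lemma ori_adj:
 assumes "orientation n a r" "i \<in> I" "j \<in> I"
 shows "r i j | r j i <-> i ~= j & a i j ~= 0" "~ (r i j & r j i)"
 using assms unfolding orientation_def by blast+

lemma arr_irrefl: "i \<in> I ==> ~ arr i i" using ori_adj[OF orient] by blast

definition is_source :: "(nat => nat => bool) => nat => bool" where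
 "is_source r k <-> k \<in> I & (ALL j:I. ~ r j k)"

definition arrows :: "nat list => nat => nat => bool" where
 "arrows ks = fold flip ks arr"

lemma arrows_simps [simp]: "arrows [] = arr" "arrows (ks @ [k]) = flip k (arrows ks)"
 by (simp_all add: arrows_def)

lemma arrows_orientation: "orientation n a (arrows ks)"
 by (induction ks rule: rev_induct) (use orient flip_orientation in auto)

lemmas arr_adj = ori_adj[OF orient] and arrows_adj = ori_adj[OF arrows_orientation]

inductive src_path :: "nat list => bool" where
 Nil: "src_path []"
| snoc: "src_path ks ==> is_source (arrows ks) k ==> src_path (ks @ [k])"

lemma src_path_snoc: "src_path (ks @ [k]) <-> src_path ks & is_source (arrows ks) k"
 by (subst src_path.simps) auto

lemma src_path_set: "src_path ks ==> set ks \<subseteq> I"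
 by (induction rule: src_path.induct) (auto simp: is_source_def)

lemma src_path_append: "src_path (ks @ ls) ==> src_path ks"
 by (induction ls rule: rev_induct) (auto simp: src_path_snoc simp flip: append_assoc)

text \<open>The two ends of an arrow have to be mutated alternately, beginning with its tail, so the
  counts differ by at most one and tell the current direction.\<close>

lemma arrows_count:
 assumes "src_path ks" "i \<in> I" "j \<in> I" "arr i j"
 shows "(cnt ks i = cnt ks j & arrows ks i j & ~ arrows ks j i) |
     (cnt ks i = Suc (cnt ks j) & arrows ks j i & ~ arrows ks i j)" using assms
proof (induction rule: src_path.induct)
 case Nil
 thus ?case using orient by (simp add: orientation_def)
next
 case (snoc ks k)
 have ij: "i ~= j" using arr_irrefl snoc.prems by auto
 have "~ arrows ks i k" "~ arrows ks j k" using snoc.hyps snoc.prems by (auto simp: is_source_def)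
 thus ?case using snoc.IH[OF snoc.prems] ij by (auto simp: flip_def)
qed

lemma arrows_eq_count:
 assumes "src_path ks" "src_path ls" "!!i. i \<in> I ==> cnt ks i = cnt ls i + c" and ij: "i \<in> I" "j \<in> I"
 shows "arrows ks i j <-> arrows ls i j"
proof -
 consider "arr i j" | "arr j i" | "~ (i ~= j & a i j ~= 0)" using arr_adj(1)[OF ij] by blast
 thus ?thesis
 proof cases
  case 1
  thus ?thesis
   using arrows_count[OF assms(1) ij 1] arrows_count[OF assms(2) ij 1] assms(3)[OF ij(1)] assms(3)[OF ij(2)] by force
 next
  case 2
  thus ?thesis
   using arrows_count[OF assms(1) ij(2,1) 2] arrows_count[OF assms(2) ij(2,1) 2] assms(3)[OF ij(1)] assms(3)[OF ij(2)] by force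
 next
  case 3
  thus ?thesis using arrows_adj(1)[OF ij] by blast
 qed
qed

lemma src_path_vseq: "src_path (map vseq [0..<T])" and arrows_vseq: "arrows (map vseq [0..<T]) = arrow_at T"
proof (induction T)
 case 0
 { case 1 show ?case by (simp add: src_path.Nil) }
 { case 2 show ?case by simp }
next
 case (Suc T)
 { case 1 show ?case using Suc vseq_source vseq_in by (simp add: src_path_snoc is_source_def) }
 { case 2 show ?case using Suc by simp }
qed

lemma map_vseq_sweep: "map vseq [t * n..<t * n + n] = vs"
proof (rule nth_equalityI)
 show "length (map vseq [t * n..<t * n + n]) = length vs" by (simp add: length_vs)
 show "map vseq [t * n..<t * n + n] ! i = vs ! i" if "i < length (map vseq [t * n..<t * n + n])" for i
  using that by (simp add: vseq_def)
qed

abbreviation sweeps :: "nat => nat list" where "sweeps t \<equiv> map vseq [0..<t * n]"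

lemma sweeps_Suc: "sweeps (Suc t) = sweeps t @ vs"
proof -
 have "[0..<Suc t * n] = [0..<t * n] @ [t * n..<t * n + n]"
  using upt_add_eq_append[of 0 "t * n" n] by (simp add: add.commute)
 thus ?thesis using map_vseq_sweep by simp
qed

lemma count_vs: "j \<in> I ==> cnt vs j = 1"
proof -
 have "distinct xs ==> cnt xs j = (if j \<in> set xs then 1 else 0)" for xs by (induction xs) auto
 thus "j \<in> I ==> cnt vs j = 1" using vs by simp
qed

lemma count_sweeps: "j \<in> I ==> cnt (sweeps t) j = t"
proof (induction t)
 case (Suc t)
 thus ?case using count_vs unfolding sweeps_Suc by simp
qed simp

lemma src_path_cong:
 assumes ks: "src_path ks" "src_path ls" "!!i j. i \<in> I ==> j \<in> I ==> arrows ks i j <-> arrows ls i j"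
 shows "src_path (ks @ us) ==> src_path (ls @ us) &
   (ALL i:I. ALL j:I. arrows (ks @ us) i j <-> arrows (ls @ us) i j)"
proof (induction us rule: rev_induct)
 case Nil
 thus ?case using ks by simp
next
 case (snoc u us)
 hence "src_path (ks @ us)" "is_source (arrows (ks @ us)) u" using src_path_snoc[of "ks @ us" u] by auto
 thus ?case
  using snoc.IH src_path_snoc[of "ls @ us" u] arrows_simps(2)[of "ls @ us" u] arrows_simps(2)[of "ks @ us" u]
  by (auto simp: is_source_def flip_def)
qed

lemma src_path_sweeps: "src_path (sweeps t)" by (rule src_path_vseq)

lemma src_path_vs_append: "src_path ks ==> src_path (vs @ ks)"
proof -
 assume ks: "src_path ks"
 have vs: "src_path vs" using src_path_sweeps[of 1] sweeps_Suc[of 0] by simp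
 have "arrows vs i j <-> arrows [] i j" if "i \<in> I" "j \<in> I" for i j
  by (rule arrows_eq_count[OF vs src_path.Nil _ that, of 1]) (simp only: count_vs count_list.simps add_0)
 thus ?thesis using src_path_cong[of "[]" vs ks] ks vs src_path.Nil by simp
qed

text \<open>A vertex of \<open>ls\<close> still missing from the extended path is a source there, by
  comparing counts along its edges.\<close>

lemma src_path_join:
 assumes "src_path ks" "src_path ls"
 shows "EX us. src_path (ks @ us) & (ALL j:I. cnt (ks @ us) j = max (cnt ks j) (cnt ls j))"
 using assms(2)
proof (induction rule: src_path.induct)
 case Nil
 show ?case using assms(1) by (intro exI[of _ "[]"]) simp
next
 case (snoc ls k)
 then obtain us where us: "src_path (ks @ us)"
  "!!j. j \<in> I ==> cnt (ks @ us) j = max (cnt ks j) (cnt ls j)" by auto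
 have k: "k \<in> I" using snoc.hyps by (simp add: is_source_def)
 show ?case
 proof (cases "cnt ks k >= Suc (cnt ls k)")
  case True
  hence "cnt (ks @ us) j = max (cnt ks j) (cnt (ls @ [k]) j)" if "j \<in> I" for j
   using us(2)[OF that] by auto
  thus ?thesis using us(1) by blast
 next
  case False
  have "~ arrows (ks @ us) i k" if i: "i \<in> I" for i
  proof
   assume A: "arrows (ks @ us) i k"
   hence "arr i k | arr k i" using arrows_adj(1)[OF i k, of "ks @ us"] arr_adj(1)[OF i k] by blast
   have ls: "~ arrows ls i k" using snoc.hyps i by (simp add: is_source_def)
   have le: "cnt ls i <= cnt (ks @ us) i" "cnt (ks @ us) k = cnt ls k"
    using us(2)[OF i] us(2)[OF k] False by simp_all
   from `arr i k | arr k i` show False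
   proof
    assume "arr i k"
    thus False using A ls le arrows_count[OF us(1) i k] arrows_count[OF snoc.hyps(1) i k] by linarith
   next
    assume "arr k i"
    thus False using A ls le arrows_count[OF us(1) k i] arrows_count[OF snoc.hyps(1) k i] by linarith
   qed
  qed
  hence "src_path (ks @ us @ [k])" using us(1) k by (simp add: src_path_snoc is_source_def flip: append_assoc)
  moreover have "cnt (ks @ us @ [k]) j = max (cnt ks j) (cnt (ls @ [k]) j)" if "j \<in> I" for j
   using us(2)[OF that] False by auto
  ultimately show ?thesis by blast
 qed
qed

lemma mutate_matrix_commute:
 assumes "k ~= l" "b k l = 0" "b l k = 0"
 shows "mutate_matrix k (mutate_matrix l b) = mutate_matrix l (mutate_matrix k b)"
proof (intro ext)
 fix i j
 show "mutate_matrix k (mutate_matrix l b) i j = mutate_matrix l (mutate_matrix k b) i j"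
  using assms by (cases "i = k"; cases "i = l"; cases "j = k"; cases "j = l") (simp_all add: mutate_matrix_def)
qed

lemma mutate_commute:
 assumes kl: "k ~= l" "b k l = 0" "b l k = 0"
 shows "mutate n m k (mutate n m l (b, x)) = mutate n m l (mutate n m k (b, x))"
proof -
 have col: "mutate_matrix q b i p = b i p" if "{p, q} = {k, l}" "i ~= q" for p q i
  using that kl by (auto simp: mutate_matrix_def doubleton_eq_iff)
 have zero: "mutate_matrix q b q p = 0" if "{p, q} = {k, l}" for p q
  using that kl by (auto simp: mutate_matrix_def doubleton_eq_iff)
 have set: "{i \<in> {1..n + m}. mutate_matrix q b i p > 0} = {i \<in> {1..n + m}. b i p > 0}"
  "{i \<in> {1..n + m}. mutate_matrix q b i p < 0} = {i \<in> {1..n + m}. b i p < 0}"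
  "b q p = 0" if "{p, q} = {k, l}" for p q
 proof -
  show z: "b q p = 0" using that kl by (auto simp: doubleton_eq_iff)
  have "mutate_matrix q b i p = b i p" for i using col[OF that] zero[OF that] z by (cases "i = q") auto
  thus "{i \<in> {1..n + m}. mutate_matrix q b i p > 0} = {i \<in> {1..n + m}. b i p > 0}"
   "{i \<in> {1..n + m}. mutate_matrix q b i p < 0} = {i \<in> {1..n + m}. b i p < 0}" by auto
 qed
 have prod: "(PROD i:{i \<in> {1..n + m}. mutate_matrix q b i p > 0}. (x(q := t)) i ^ nat (mutate_matrix q b i p))
   = (PROD i:{i \<in> {1..n + m}. b i p > 0}. x i ^ nat (b i p))"
  "(PROD i:{i \<in> {1..n + m}. mutate_matrix q b i p < 0}. (x(q := t)) i ^ nat (- mutate_matrix q b i p))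
   = (PROD i:{i \<in> {1..n + m}. b i p < 0}. x i ^ nat (- b i p))" if pq: "{p, q} = {k, l}" for p q t
  unfolding set[OF pq] by (intro prod.cong refl; use set(3)[OF pq] col[OF pq] in force)+
 have "{k, l} = {k, l}" "{l, k} = {k, l}" by auto
 note p = prod[OF this(1)] prod[OF this(2)]
 show ?thesis unfolding mutate_def Let_def fst_conv snd_conv p mutate_matrix_commute[of k l b, OF kl]
  using kl(1) by (simp add: fun_upd_twist p)
qed

end

context seed_datum begin

lemma seedB_arrows:
 "src_path ks ==> i \<in> I ==> j \<in> I ==> seedB ks i j = exchange_matrix a (arrows ks) i j"
proof (induction arbitrary: i j rule: src_path.induct)
 case Nil
 thus ?case by (simp add: top_block)
next
 case (snoc ks k)
 have k: "k \<in> I" "!!j. j \<in> I ==> ~ arrows ks j k" using snoc.hyps by (auto simp: is_source_def)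
 have s: "seedB ks i k <= 0" "seedB ks k j >= 0"
  using snoc.IH[OF snoc.prems(1) k(1)] snoc.IH[OF k(1) snoc.prems(2)] k(2)[OF snoc.prems(1)] k(2)[OF snoc.prems(2)]
   arrows_adj(1)[OF k(1) snoc.prems(1), of ks]
   arrows_adj(1)[OF k(1) snoc.prems(2), of ks]
   a_nonpos[OF snoc.prems(1) k(1)] a_nonpos[OF k(1) snoc.prems(2)] by (auto simp: exchange_matrix_def)
 have anti: "~ (arrows ks i j & arrows ks j i)" using arrows_adj(2)[OF snoc.prems] .
 show ?case
  using s anti snoc.IH[OF snoc.prems] by (auto simp: seedB_snoc mutate_matrix_def exchange_matrix_def flip_def)
qed

lemma swap_nonadjacent:
 assumes p: "src_path (as @ [k, l] @ us)" and kl: "k ~= l" "a k l = 0"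
 shows "src_path (as @ [l, k] @ us)"
  "mutate_along n m (as @ [k, l] @ us) (Bt, var) = mutate_along n m (as @ [l, k] @ us) (Bt, var)"
proof -
 have p1: "src_path (as @ [k, l])" using p src_path_append[of "as @ [k, l]" us] by simp
 hence p0: "src_path as" "is_source (arrows as) k" "is_source (flip k (arrows as)) l"
  using src_path_snoc[of "as @ [k]" l] src_path_snoc[of as k] by auto
 have in_n: "k \<in> I" "l \<in> I" using p0 by (auto simp: is_source_def)
 have no: "~ arrows as k l" "~ arrows as l k" using arrows_adj(1)[OF in_n, of as] kl(2) by auto
 have l: "~ arrows as j l" if "j \<in> I" for j
  using p0(3) that no kl(1) unfolding is_source_def flip_def by (cases "j = k") (blast, metis)
 have k: "~ flip l (arrows as) j k" if "j \<in> I" for j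
  using p0(2) that no kl(1) by (simp add: is_source_def flip_def)
 have "is_source (arrows as) l" "is_source (flip l (arrows as)) k"
  using l k in_n by (auto simp: is_source_def)
 hence p2: "src_path (as @ [l, k])"
  using src_path_snoc[of "as @ [l]" k] src_path_snoc[of as l] p0(1) by simp
 have "arrows (as @ [k, l]) i j <-> arrows (as @ [l, k]) i j" if "i \<in> I" "j \<in> I" for i j
  by (rule arrows_eq_count[OF p1 p2 _ that, of 0]) simp
 thus "src_path (as @ [l, k] @ us)" using src_path_cong[OF p1 p2, of us] p by simp
 have "seedB as k l = 0" "seedB as l k = 0"
  using seedB_arrows[OF p0(1) in_n] seedB_arrows[OF p0(1) in_n(2,1)] no by (auto simp: exchange_matrix_def)
 hence "mutate n m l (mutate n m k (mutate_along n m as (Bt, var)))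
   = mutate n m k (mutate n m l (mutate_along n m as (Bt, var)))"
  using mutate_commute[of l k "seedB as" m "seedX as"] kl(1) by (simp add: seedB_def seedX_def)
 thus "mutate_along n m (as @ [k, l] @ us) (Bt, var) = mutate_along n m (as @ [l, k] @ us) (Bt, var)"
  by (simp add: mutate_along_def)
qed

lemma move_to_end:
 assumes "src_path (as @ [k] @ us)" "k \<notin> set us" "!!l. l \<in> set us ==> a k l = 0"
 shows "src_path (as @ us @ [k])"
  "mutate_along n m (as @ [k] @ us) (Bt, var) = mutate_along n m (as @ us @ [k]) (Bt, var)"
proof -
 have "src_path (as @ us @ [k]) &
   mutate_along n m (as @ [k] @ us) (Bt, var) = mutate_along n m (as @ us @ [k]) (Bt, var)" using assms
 proof (induction us arbitrary: as)
  case Nil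
  thus ?case by simp
 next
  case (Cons l us)
  have kl: "k ~= l" "a k l = 0" using Cons.prems by auto
  have p: "src_path (as @ [k, l] @ us)" using Cons.prems(1) by simp
  note s = swap_nonadjacent[OF p kl]
  have "src_path ((as @ [l]) @ [k] @ us)" using s(1) by simp
  hence "src_path ((as @ [l]) @ us @ [k]) &
   mutate_along n m ((as @ [l]) @ [k] @ us) (Bt, var) = mutate_along n m ((as @ [l]) @ us @ [k]) (Bt, var)"
   by (rule Cons.IH) (use Cons.prems in auto)
  thus ?case using s(2) by simp
 qed
 thus "src_path (as @ us @ [k])"
  "mutate_along n m (as @ [k] @ us) (Bt, var) = mutate_along n m (as @ us @ [k]) (Bt, var)" by auto
qed

text \<open>The last \<open>k\<close> in \<open>ls\<close> can be moved to the end because no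
  neighbour follows it: just after that occurrence, and at the end of \<open>ks @ [k]\<close>, the
  vertex \<open>k\<close> is a sink, which fixes the counts of its neighbours relative to its own,
  and a later mutation of a neighbour would change them.\<close>

theorem same_count_same_seed: "src_path ks ==> src_path ls ==> (!!i. i \<in> I ==> cnt ks i = cnt ls i) ==>
   mutate_along n m ks (Bt, var) = mutate_along n m ls (Bt, var)"
proof (induction arbitrary: ls rule: src_path.induct)
 case Nil
 have "ls = []"
 proof (rule ccontr)
  assume "ls ~= []"
  then obtain x where x: "x \<in> set ls" by (cases ls) auto
  hence "cnt ls x = 0" using Nil.prems src_path_set by fastforce
  thus False using x by (simp add: count_list_0_iff)
 qed
 thus ?case by simp
next
 case (snoc ks k)
 have k: "k \<in> I" "!!j. j \<in> I ==> ~ arrows ks j k" using snoc.hyps by (auto simp: is_source_def)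
 have pk: "src_path (ks @ [k])" using snoc.hyps src_path_snoc by simp
 have "cnt ls k ~= 0" using snoc.prems(2)[OF k(1)] by simp
 hence "k \<in> set ls" by (meson count_notin)
 then obtain as bs where ls: "ls = as @ k # bs" "k \<notin> set bs" by (meson split_list_last)
 have pa: "src_path (as @ [k])" using snoc.prems(1) src_path_append[of "as @ [k]" bs] ls by simp
 have nadj: "a k l = 0" if l: "l \<in> set bs" for l
 proof (rule ccontr)
  assume A: "a k l ~= 0"
  have ln: "l \<in> I" using src_path_set[OF snoc.prems(1)] ls l by auto
  have kl: "k ~= l" using ls(2) l by auto
  have "~ arrows (ks @ [k]) k l" using k(2)[OF ln] kl by (simp add: flip_def)
  moreover have "~ arrows (as @ [k]) k l"
   using pa ln kl src_path_snoc[of as k] by (auto simp: flip_def is_source_def)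
  moreover have "cnt bs l ~= 0" using l by (simp add: count_list_0_iff)
  hence "cnt ls l > cnt (as @ [k]) l" "cnt ls k = cnt (as @ [k]) k"
   using ls kl count_notin[OF ls(2)] by simp_all
  moreover have "arr k l | arr l k" using arr_adj(1)[OF k(1) ln] kl A by blast
  ultimately show False
   using arrows_count[OF pk k(1) ln] arrows_count[OF pk ln k(1)] arrows_count[OF pa k(1) ln] arrows_count[OF pa ln k(1)]
    snoc.prems(2)[OF k(1)] snoc.prems(2)[OF ln] by linarith
 qed
 note mv = move_to_end[of as k bs, OF _ ls(2) nadj]
 have p: "src_path (as @ [k] @ bs)" using snoc.prems(1) ls by simp
 have "src_path (as @ bs)" using mv(1)[OF p] src_path_append[of "as @ bs" "[k]"] by simp
 moreover have "cnt ks i = cnt (as @ bs) i" if "i \<in> I" for i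
  using snoc.prems(2)[OF that] ls by (simp split: if_splits)
 ultimately have "mutate_along n m ks (Bt, var) = mutate_along n m (as @ bs) (Bt, var)" using snoc.IH by blast
 thus ?case using mv(2)[OF p] ls by (simp add: mutate_along_def)
qed

lemma seedX_append_other: "j \<notin> set us ==> seedX (ks @ us) j = seedX ks j"
 by (induction us rule: rev_induct) (auto simp: seedX_step simp flip: append_assoc)

text \<open>Both paths are prolonged to the same counts without mutating at \<open>j\<close>
  again.\<close>

theorem seedX_count:
 assumes "src_path ks" "src_path ls" "j \<in> I" "cnt ks j = cnt ls j"
 shows "seedX ks j = seedX ls j"
proof -
 obtain us where us: "src_path (ks @ us)" "!!i. i \<in> I ==> cnt (ks @ us) i = max (cnt ks i) (cnt ls i)"
  using src_path_join[OF assms(1,2)] by blast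
 obtain ws where ws: "src_path (ls @ ws)" "!!i. i \<in> I ==> cnt (ls @ ws) i = max (cnt ls i) (cnt ks i)"
  using src_path_join[OF assms(2,1)] by blast
 have "mutate_along n m (ks @ us) (Bt, var) = mutate_along n m (ls @ ws) (Bt, var)"
  by (rule same_count_same_seed[OF us(1) ws(1)]) (simp only: us(2) ws(2) max.commute)
 hence "seedX (ks @ us) j = seedX (ls @ ws) j" by (simp add: seedX_def)
 moreover have "cnt us j = 0" "cnt ws j = 0" using us(2)[OF assms(3)] ws(2)[OF assms(3)] assms(4) by auto
 hence "j \<notin> set us" "j \<notin> set ws" by (simp_all add: count_list_0_iff)
 ultimately show ?thesis by (simp add: seedX_append_other)
qed

lemma sweep_var_seedX: "sweep_var n m Bt vs t j = seedX (sweeps t) j"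
proof -
 have "(mutate_along n m vs ^^ t) (Bt, var) = mutate_along n m (sweeps t) (Bt, var)"
 proof (induction t)
  case (Suc t)
  thus ?case unfolding sweeps_Suc by (simp add: mutate_along_def)
 qed (simp add: mutate_along_def)
 thus ?thesis by (simp add: sweep_var_def seedX_def)
qed

lemma seedX_sweep_var: "src_path ks ==> j \<in> I ==> seedX ks j = sweep_var n m Bt vs (cnt ks j) j"
 unfolding sweep_var_seedX using seedX_count[OF _ src_path_sweeps] count_sweeps by metis

end

section \<open>Words in simple reflections\<close>

context cartan_datum begin

lemma srefl_simple_simple:
 "k \<in> I ==> j \<in> I ==> srefl k (simple j) = simple j - of_int (a k j) *R simple k"
 using d_pos[of k] by (simp only: srefl_def form_simple_simple) simp

definition word :: "nat list => rvec => rvec" where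
 "word ks = foldr srefl ks"

lemma word_simps [simp]: "word [] x = x" "word (k # ks) x = srefl k (word ks x)" "word (ks @ ls) x = word ks (word ls x)"
 by (simp_all add: word_def)

lemma linear_word: "linear (word ks)"
proof (induction ks)
 case Nil
 show ?case by (rule linearI) auto
next
 case (Cons k ks)
 have "word (k # ks) = srefl k o word ks" by (simp add: fun_eq_iff)
 thus ?case using linear_compose[OF Cons linear_srefl, of k] by (simp only:)
qed

lemma word_source: "k \<in> I ==> word (ks @ [k]) (simple k) = - word ks (simple k)"
 using srefl_simple[of k] linear_neg[OF linear_word, of ks "simple k"] by simp

lemma word_other: "k \<in> I ==> j \<in> I ==>
  word (ks @ [k]) (simple j) = word ks (simple j) - of_int (a k j) *R word ks (simple k)"
 using linear_diff[OF linear_word, of ks "simple j" "of_int (a k j) *R simple k"]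
  linear_scale[OF linear_word, of ks "of_int (a k j)" "simple k"] by (simp add: srefl_simple_simple)

lemma word_root: "set ks \<subseteq> I ==> x \<in> roots ==> word ks x \<in> roots"
 by (induction ks) (auto intro: srefl_root simp del: atLeastAtMost_iff)

lemma word_form: "set ks \<subseteq> I ==> form (word ks x) (word ks y) = form x y"
 by (induction ks) (auto simp: srefl_form simp del: atLeastAtMost_iff)

lemma word_rev: "set ks \<subseteq> I ==> word ks (word (rev ks) x) = x"
 by (induction ks arbitrary: x) (auto simp: srefl_srefl simp del: atLeastAtMost_iff)

lemma word_rev': "set ks \<subseteq> I ==> word (rev ks) (word ks x) = x" using word_rev[of "rev ks" x] by simp

lemma word_srefl:
 assumes ks: "set ks \<subseteq> I" and kp: "k \<in> I" "p \<in> I" "word ks (simple k) = simple p"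
 shows "word ks (srefl k x) = srefl p (word ks x)"
proof -
 have "form (simple k) (simple k) = form (simple p) (simple p)"
  using word_form[OF ks, of "simple k" "simple k"] kp(3) by simp
 hence d: "d k = d p"
  unfolding form_simple_simple[OF kp(1,1)] form_simple_simple[OF kp(2,2)] a_diag[OF kp(1)] a_diag[OF kp(2)] by simp
 have "form (simple k) x = form (simple p) (word ks x)" using word_form[OF ks, of "simple k" x] kp(3) by simp
 thus ?thesis using linear_word[of ks] by (simp add: srefl_def linear_diff linear_scale kp(3) d)
qed

text \<open>The deletion argument: a word keeping the simple roots positive can be shortened.\<close>

lemma positive_word_identity:
 assumes "set ks \<subseteq> I" "!!j i. j \<in> I ==> word ks (simple j) i >= 0"
 shows "word ks x = x"
 using assms
proof (induction "length ks" arbitrary: ks rule: less_induct)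
 case less
 show ?case
 proof (cases ks rule: rev_cases)
  case Nil
  thus ?thesis by simp
 next
  case (snoc us k)
  have us: "set us \<subseteq> I" and k: "k \<in> I" using less.prems(1) snoc by auto
  have neg: "word us (simple k) i <= 0" for i
   using less.prems(2)[OF k, of i] word_source[OF k, of us] snoc by simp
  have "EX vs p ws. us = vs @ p # ws & word ws (simple k) = simple p"
   if "set us \<subseteq> I" "!!i. word us (simple k) i <= 0" for us using that
  proof (induction us)
   case Nil
   thus ?case using Nil(2)[of k] by (simp add: simple_apply)
  next
   case (Cons q us)
   have q: "q \<in> I" and us: "set us \<subseteq> I" using Cons.prems by auto
   have r: "word us (simple k) \<in> roots" using word_root[OF us simple_root[OF k]] .
   show ?case
   proof (cases "ALL i. word us (simple k) i <= 0")
    case True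
    thus ?thesis using Cons.IH[OF us] by (metis append_Cons)
   next
    case False
    hence pos: "word us (simple k) i >= 0" for i using root_sign[OF r] by auto
    have "word us (simple k) = simple q"
    proof (rule ccontr)
     assume ne: "word us (simple k) ~= simple q"
     have "srefl q (word us (simple k)) i = 0" for i
      using srefl_positive[OF q r pos ne] Cons.prems(2)[of i] by (simp add: order_antisym)
     hence "srefl q (word us (simple k)) = 0" by (simp add: fun_eq_iff)
     thus False using srefl_root[OF q r] by (simp add: roots_def)
    qed
    thus ?thesis by blast
   qed
  qed
  from this[OF us neg] obtain vs p ws where vw: "us = vs @ p # ws" "word ws (simple k) = simple p" by blast
  have ws: "set ws \<subseteq> I" and p: "p \<in> I" and vs: "set vs \<subseteq> I" using us vw by auto
  have e: "word ks y = word (vs @ ws) y" for y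
   using word_srefl[OF ws k p vw(2), of "srefl k y"] srefl_srefl[OF k] srefl_srefl[OF p] vw snoc by (metis word_simps(2,3) word_simps(1))
  have "length (vs @ ws) < length ks" using vw snoc by simp
  moreover have "set (vs @ ws) \<subseteq> I" using vs ws by simp
  ultimately have "word (vs @ ws) x = x" using less.hyps[of "vs @ ws"] less.prems(2) e by simp
  thus ?thesis using e by simp
 qed
qed

lemma euler_simple_pair:
 assumes k: "k \<in> I" and l: "l \<in> I"
 shows "euler r (simple k) (simple l) = (if k = l then d k else if r k l then d k * of_int (a k l) else 0)"
proof -
 have "(SUM j:I. (if j ~= k & r k j then d k * of_int (a k j) else 0) * simple l j)
   = (SUM j:I. if j = l then (if l ~= k & r k l then d k * of_int (a k l) else 0) else 0)"
  by (intro sum.cong refl) (simp add: simple_apply)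
 thus ?thesis unfolding euler_simple1[OF k] using l by (simp add: simple_apply)
qed

lemma simple_inject: "simple i = simple j <-> i = j" by (metis simple_apply zero_neq_one)

lemma root_height_ge:
 assumes "v \<in> roots" "hgt v < 0"
 shows "hgt v <= - 1"
proof -
 have "hgt v \<in> \<int>" using assms(1) unfolding roots_def hgt_def by (auto intro!: Ints_sum)
 thus ?thesis using assms(2) by (auto elim!: Ints_cases)
qed

lemma lattice_sum_simple:
 assumes "x \<in> lattice"
 shows "x = (SUM i:I. x i *R simple i)"
proof
 fix j
 have "(SUM i:I. x i *R simple i) j = (SUM i:I. if i = j then x i else 0)"
  unfolding sum_fun_apply by (intro sum.cong refl) (simp add: simple_apply)
 thus "x j = (SUM i:I. x i *R simple i) j" using assms by (auto simp: lattice_def)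
qed

lemma word_sum_simple: "x \<in> lattice ==> word ks x = (SUM i:I. x i *R word ks (simple i))"
 using linear_sum[OF linear_word[of ks], of "%i. x i *R simple i" "I"] lattice_sum_simple[of x]
  linear_scale[OF linear_word[of ks]] by simp

text \<open>The preimage of \<open>- simple i\<close> is a positive root; applying the word adds up
  heights that are each at most \<open>- 1\<close> to a total of \<open>- 1\<close>, so this root is
  simple. Injectivity turns the assignment into a permutation of the vertices.\<close>

lemma negative_word_simple:
 assumes ks: "set ks \<subseteq> I" and neg: "!!j. j \<in> I ==> hgt (word ks (simple j)) < 0" and j: "j \<in> I"
 shows "EX i:I. word ks (simple j) = - simple i"
proof -
 have ex: "EX j:I. word ks (simple j) = - simple i" if i: "i \<in> I" for i
 proof -
  define x where "x = - word (rev ks) (simple i)"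
  have xr: "x \<in> roots" unfolding x_def using word_root[of "rev ks"] ks simple_root[OF i] root_uminus by simp
  have wx: "word ks x = - simple i"
   unfolding x_def linear_neg[OF linear_word] using word_rev[OF ks] by simp
  have int: "x j \<in> \<int>" if "j \<in> I" for j using xr that by (simp add: roots_def)
  have hs: "hgt (simple i) = 1" using i by (simp add: hgt_def simple_apply)
  have h: "(SUM j:I. x j * hgt (word ks (simple j))) = - 1"
  proof -
   have "hgt (word ks x) = (SUM j:I. x j * hgt (word ks (simple j)))"
    unfolding word_sum_simple[OF roots_lattice[OF xr]] linear_sum[OF linear_height] by (simp add: height_scale)
   thus ?thesis using wx hs by (simp add: height_minus)
  qed
  have le: "hgt (word ks (simple j)) <= - 1" if "j \<in> I" for j
   using root_height_ge[OF word_root[OF ks simple_root[OF that]] neg[OF that]] .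
  have pos: "x j >= 0" for j
  proof (rule ccontr)
   assume "~ x j >= 0"
   hence "x j <= 0" for j using root_sign[OF xr] by (metis order.trans linear)
   hence "(SUM j:I. x j * hgt (word ks (simple j))) >= 0"
    by (intro sum_nonneg mult_nonpos_nonpos) (use le in force)+
   thus False using h by simp
  qed
  have "x ~= 0" using xr by (simp add: roots_def)
  then obtain l where l: "x l ~= 0" by (auto simp: fun_eq_iff)
  have ln: "l \<in> I" using l roots_lattice[OF xr] by (auto simp: lattice_def)
  have xl: "x l >= 1" using l pos[of l] int[OF ln] by (auto elim!: Ints_cases)
  have t: "- (x j * hgt (word ks (simple j))) >= x j" if "j \<in> I" for j
   using mult_left_mono[OF le[OF that] pos[of j]] by simp
  have "(SUM j:I. x j) <= (SUM j:I. - (x j * hgt (word ks (simple j))))" by (intro sum_mono t)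
  hence "(SUM j:I. x j) <= 1" using h by (simp add: sum_negf)
  moreover have "(SUM j:I. x j) = x l + (SUM j:I - {l}. x j)" using ln by (simp add: sum.remove)
  moreover have "(SUM j:I - {l}. x j) >= 0" using pos by (intro sum_nonneg)
  ultimately have "x l = 1" "(SUM j:I - {l}. x j) = 0" using xl by linarith+
  hence "x l = 1" "ALL j:I - {l}. x j = 0" using pos sum_nonneg_eq_0_iff[of "I - {l}" x] by auto
  hence "x i = simple l i" for i
   using roots_lattice[OF xr] by (cases "i = l"; cases "i \<in> I") (simp_all add: simple_apply lattice_def)
  hence "x = simple l" by (simp add: fun_eq_iff)
  thus ?thesis using wx ln by blast
 qed
 then obtain g where g: "!!i. i \<in> I ==> g i \<in> I & word ks (simple (g i)) = - simple i" by metis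
 have "inj_on g I"
 proof (rule inj_onI)
  fix i i' assume "i \<in> I" "i' \<in> I" "g i = g i'"
  hence "- simple i = - simple i'" using g by metis
  thus "i = i'" using simple_inject by simp
 qed
 hence "g ` I = I" using g by (intro endo_inj_surj) auto
 thus ?thesis using g j by (metis imageE)
qed

end

section \<open>Green source paths and the longest word\<close>

context sweep_datum begin

text \<open>Greenness is expressed by \<open>word\<close> and not by c-vectors, so that it does not
  depend on the coefficients.\<close>

inductive grn_path :: "nat list => bool" where
 Nil: "grn_path []"
| snoc: "grn_path ks ==> is_source (arrows ks) k ==> hgt (word ks (simple k)) > 0 ==> grn_path (ks @ [k])"

lemma grn_path_snoc:
 "grn_path (ks @ [k]) <-> grn_path ks & is_source (arrows ks) k & hgt (word ks (simple k)) > 0"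
 by (subst grn_path.simps) auto

lemma grn_path_append: "grn_path (ks @ ls) ==> grn_path ks"
 by (induction ls rule: rev_induct) (auto simp: grn_path_snoc simp flip: append_assoc)

lemma green_src_path: "grn_path ks ==> src_path ks"
 by (induction rule: grn_path.induct) (auto intro: src_path.intros)

lemma grn_path_set: "grn_path ks ==> set ks \<subseteq> I" using green_src_path src_path_set by blast

lemma word_euler: "src_path ks ==> euler arr (word ks x) (word ks y) = euler (arrows ks) x y"
proof (induction arbitrary: x y rule: src_path.induct)
 case (snoc ks k)
 have k: "k \<in> I" "!!i. i \<in> I ==> ~ arrows ks i k" using snoc.hyps by (auto simp: is_source_def)
 show ?case
  using snoc.IH euler_flip[OF arrows_orientation k, of "srefl k x" "srefl k y"] srefl_srefl[OF k(1)] by simp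
qed simp

definition inversions :: "nat list => rvec set" where
 "inversions ks = {v \<in> roots. hgt v > 0 & hgt (word (rev ks) v) < 0}"

text \<open>A green mutation adds \<open>word ks (simple k)\<close> to the positive roots turned
  negative and loses none of them, since the reflection keeps every other positive root positive.
  This bounds the length of green paths.\<close>

lemma grn_path_inversions: "grn_path ks ==> length ks <= card (inversions ks)"
proof (induction rule: grn_path.induct)
 case (snoc ks k)
 have ks: "set ks \<subseteq> I" and k: "k \<in> I" using grn_path_set snoc.hyps by (auto simp: is_source_def)
 let ?b = "word ks (simple k)"
 have b: "?b \<in> roots" using word_root[OF ks simple_root[OF k]] .
 have h1: "hgt (simple k) = 1" using k by (simp add: hgt_def simple_apply)
 have "?b \<notin> inversions ks" by (simp add: inversions_def word_rev'[OF ks] h1)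
 moreover have "insert ?b (inversions ks) \<subseteq> inversions (ks @ [k])"
 proof
  fix v assume v: "v \<in> insert ?b (inversions ks)"
  show "v \<in> inversions (ks @ [k])"
  proof (cases "v = ?b")
   case True
   thus ?thesis
    using b snoc.hyps(3) by (simp add: inversions_def word_rev'[OF ks] srefl_simple[OF k] height_minus h1)
  next
   case False
   hence v: "v \<in> roots" "hgt v > 0" "hgt (word (rev ks) v) < 0" using v by (auto simp: inversions_def)
   let ?y = "- word (rev ks) v"
   have y: "?y \<in> roots" using v(1) word_root[of "rev ks"] ks root_uminus by simp
   hence yp: "?y i >= 0" for i using root_height(2)[OF y] v(3) by (simp add: height_minus)
   have "?y ~= simple k"
   proof
    assume "?y = simple k"
    hence "word ks ?y = ?b" by simp
    hence "- v = ?b" unfolding linear_neg[OF linear_word] word_rev[OF ks] .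
    thus False using v(2) snoc.hyps(3) by (metis height_minus neg_less_0_iff_less less_asym)
   qed
   hence "srefl k ?y i >= 0" for i using srefl_positive[OF k y yp] by blast
   hence "hgt (srefl k ?y) > 0" using root_height(2)[OF srefl_root[OF k y]] by blast
   hence "hgt (srefl k (word (rev ks) v)) < 0"
    unfolding linear_neg[OF linear_srefl] height_minus by simp
   thus ?thesis using v by (simp add: inversions_def)
  qed
 qed
 moreover have "finite (inversions (ks @ [k]))" "finite (inversions ks)" using finite_roots by (auto simp: inversions_def)
 ultimately show ?case using snoc.IH card_mono[of "inversions (ks @ [k])" "insert ?b (inversions ks)"] by simp
qed simp

lemma exists_maximal_green:
 "EX gs. grn_path gs & (ALL k. is_source (arrows gs) k --> ~ hgt (word gs (simple k)) > 0)"
proof -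
 have "EX gs. grn_path gs & (ALL ks. grn_path ks --> length ks <= length gs)"
 proof (rule ex_has_greatest_nat[of _ "[]" _ "Suc (card roots)"])
  show "grn_path []" by (rule grn_path.Nil)
  show "ALL ks. grn_path ks --> length ks < Suc (card roots)"
  proof (intro allI impI)
   fix ks assume "grn_path ks"
   hence "length ks <= card (inversions ks)" by (rule grn_path_inversions)
   also have "... <= card roots" using finite_roots by (intro card_mono) (auto simp: inversions_def)
   finally show "length ks < Suc (card roots)" by simp
  qed
 qed
 then obtain gs where gs: "grn_path gs" "!!ks. grn_path ks ==> length ks <= length gs" by blast
 have "~ hgt (word gs (simple k)) > 0" if "is_source (arrows gs) k" for k
  using gs(2)[of "gs @ [k]"] gs(1) that by (auto simp: grn_path_snoc)
 thus ?thesis using gs(1) by blast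
qed

definition greens :: "nat list" where
 "greens = (SOME gs. grn_path gs & (ALL k. is_source (arrows gs) k --> ~ hgt (word gs (simple k)) > 0))"

lemma greens: "grn_path greens" "is_source (arrows greens) k ==> ~ hgt (word greens (simple k)) > 0"
 using someI_ex[OF exists_maximal_green] unfolding greens_def by blast+

text \<open>The rank \<open>cnt * n + position\<close> increases along the arrows of every
  intermediate orientation, which allows a minimal vertex to be chosen at any stage.\<close>

lemma arrows_rank:
 assumes ks: "src_path ks" and pq: "p < n" "q < n" and r: "arrows ks (vs ! p) (vs ! q)"
 shows "cnt ks (vs ! p) * n + p < cnt ks (vs ! q) * n + q"
proof -
 note v = vs_nth[OF pq(1)] vs_nth[OF pq(2)]
 have "arr (vs ! p) (vs ! q) | arr (vs ! q) (vs ! p)"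
  using arrows_adj(1)[OF v] arr_adj(1)[OF v] r by blast
 thus ?thesis
 proof
  assume A: "arr (vs ! p) (vs ! q)"
  thus ?thesis using arrows_count[OF ks v A] r arr_vs[OF pq A] by auto
 next
  assume A: "arr (vs ! q) (vs ! p)"
  thus ?thesis using arrows_count[OF ks v(2,1) A] r pq by auto
 qed
qed

end

context seed_datum begin

lemma source_omega:
 assumes "src_path ks" "is_source (arrows ks) k" "j \<in> I" "j ~= k"
 shows "om (ghost ks k) (ghost ks j) = d k * of_int (a k j)"
proof -
 have k: "k \<in> I" "k \<in> {1..n+m}" "~ arrows ks j k" using assms by (auto simp: is_source_def)
 have "real_of_int (exchange_matrix a (arrows ks) k j) = - om (ghost ks k) (ghost ks j) / d k"
  using seedB_ghost[OF src_path_set[OF assms(1)] k(2) assms(3)] seedB_arrows[OF assms(1) k(1) assms(3)] k(1)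
  by (simp add: dd_def)
 moreover have "exchange_matrix a (arrows ks) k j = - a k j"
  using arrows_adj(1)[OF k(1) assms(3), of ks] k(3) assms(4) by (auto simp: exchange_matrix_def)
 ultimately show ?thesis using d_pos[OF k(1)] by (simp add: field_simps)
qed

text \<open>At a source \<open>om\<close> is nonpositive on all other c-vectors, so a red mutation
  only negates, whereas a green one acts as a simple reflection.\<close>

lemma ghost_red_source:
 assumes "src_path ks" "is_source (arrows ks) k" "hgt (ghost ks k) < 0" "j \<in> I"
 shows "ghost (ks @ [k]) j = (if j = k then - ghost ks k else ghost ks j)"
proof (cases "j = k")
 case False
 have k: "k \<in> I" using assms(2) by (simp add: is_source_def)
 have "d k * of_int (a k j) <= 0"
  using d_pos[OF k] a_nonpos[OF k assms(4)] False by (simp add: mult_nonneg_nonpos)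
 hence "cr.red (ghost ks k) (ghost ks j) = ghost ks j"
  unfolding cr.red_def source_omega[OF assms(1,2,4) False] by simp
 thus ?thesis using False assms(3) by (simp add: ghost_snoc gmut_def)
qed (simp add: ghost_snoc gmut_def)

lemma ghost_green_source:
 assumes "src_path ks" "is_source (arrows ks) k" "hgt (ghost ks k) > 0" "j \<in> I"
 shows "ghost (ks @ [k]) j = (if j = k then - ghost ks k else ghost ks j - of_int (a k j) *R ghost ks k)"
proof (cases "j = k")
 case False
 have k: "k \<in> I" using assms(2) by (simp add: is_source_def)
 have "d k * of_int (a k j) <= 0"
  using d_pos[OF k] a_nonpos[OF k assms(4)] False by (simp add: mult_nonneg_nonpos)
 moreover have "euler arr (ghost ks k) (ghost ks k) = d k"
  using ghost_ok_ghost[OF src_path_set[OF assms(1)]] k by (simp add: ghost_ok_def)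
 ultimately have "cr.grn (ghost ks k) (ghost ks j) = ghost ks j - of_int (a k j) *R ghost ks k"
  unfolding cr.grn_def source_omega[OF assms(1,2,4) False] using d_pos[OF k] by simp
 thus ?thesis using False assms(3) by (simp add: ghost_snoc gmut_def)
qed (simp add: ghost_snoc gmut_def)

lemma ghost_word: "grn_path ks ==> j \<in> I ==> ghost ks j = word ks (simple j)"
proof (induction arbitrary: j rule: grn_path.induct)
 case (snoc ks k)
 have k: "k \<in> I" using snoc.hyps by (simp add: is_source_def)
 have "ghost (ks @ [k]) j = (if j = k then - word ks (simple k) else word ks (simple j) - of_int (a k j) *R word ks (simple k))"
  using ghost_green_source[OF green_src_path[OF snoc.hyps(1)] snoc.hyps(2) _ snoc.prems] snoc.hyps(3)
   snoc.IH[OF k] snoc.IH[OF snoc.prems] by simp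
 thus ?case using word_source[OF k, of ks] word_other[OF k snoc.prems, of ks]
  by (cases "j = k") (simp_all del: word_simps)
qed simp

lemma ghost_height_nonzero: "set ks \<subseteq> I ==> j \<in> I ==> hgt (ghost ks j) ~= 0"
 using root_height(1) ghost_ok_root ghost_ok_ghost by blast

text \<open>Otherwise choose a positive c-vector whose vertex has least rank. By maximality this
  vertex is not a source; an arrow arrives from a vertex with negative c-vector, and goodness makes
  their Euler pairing zero, although it is a nonzero multiple of a Cartan entry.\<close>

lemma ghost_greens_negative:
 assumes j: "j \<in> I"
 shows "hgt (ghost greens j) < 0"
proof (rule ccontr)
 assume neg: "~ hgt (ghost greens j) < 0"
 let ?V = "ghost greens"
 note sp = green_src_path[OF greens(1)]
 have h: "hgt (?V i) ~= 0" if "i \<in> I" for i using ghost_height_nonzero[OF src_path_set[OF sp] that] .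
 define Q where "Q = (%p. p < n & hgt (?V (vs ! p)) > 0)"
 obtain p0 where "p0 < n" "j = vs ! p0" using j vs length_vs by (metis in_set_conv_nth)
 hence "Q p0" using neg h[OF j] by (simp add: Q_def)
 then obtain p where p: "Q p" "!!q. Q q ==> cnt greens (vs ! p) * n + p <= cnt greens (vs ! q) * n + q"
  using exists_least_iff[of "%N. EX q. Q q & N = cnt greens (vs ! q) * n + q"] by (metis linorder_not_le)
 have pn: "p < n" "hgt (?V (vs ! p)) > 0" using p(1) by (auto simp: Q_def)
 note vp = vs_nth[OF pn(1)]
 have "~ is_source (arrows greens) (vs ! p)" using greens(2)[of "vs ! p"] pn(2) ghost_word[OF greens(1) vp] by auto
 then obtain i where i: "i \<in> I" "arrows greens i (vs ! p)" using vp by (auto simp: is_source_def)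
 obtain q where q: "q < n" "i = vs ! q" using i(1) vs length_vs by (metis in_set_conv_nth)
 have "cnt greens (vs ! q) * n + q < cnt greens (vs ! p) * n + p"
  using arrows_rank[OF sp q(1) pn(1)] i(2) q(2) by simp
 hence "~ Q q" using p(2) by (meson linorder_not_le)
 hence vi: "hgt (?V i) < 0" using h[OF i(1)] q by (auto simp: Q_def)
 have ad: "i ~= vs ! p" "a i (vs ! p) ~= 0" using arrows_adj(1)[OF i(1) vp, of greens] i(2) by auto
 have gd: "cr.good (?V ` I)" using ghost_ok_ghost[OF src_path_set[OF sp]] by (simp add: ghost_ok_def)
 have "euler arr (?V i) (?V (vs ! p)) = 0"
  by (rule cr.good_neg_pos[OF gd imageI[OF i(1)] imageI[OF vp] vi pn(2)])
 moreover have "euler arr (?V i) (?V (vs ! p)) = d i * of_int (a i (vs ! p))"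
  using ghost_word[OF greens(1) i(1)] ghost_word[OF greens(1) vp] word_euler[OF sp] euler_simple_pair[OF i(1) vp] i(2) ad(1)
  by simp
 ultimately show False using ad(2) d_pos[OF i(1)] by simp
qed

end

context sweep_datum begin

lemma greens_negative:
 assumes "j \<in> I"
 shows "hgt (word greens (simple j)) < 0"
proof -
 \<comment> \<open>A seed without frozen variables suffices, as the words do not involve
   coefficients.\<close>
 interpret z: seed_datum n a d arr vs 0 "exchange_matrix a arr" by unfold_locales simp
 show ?thesis using z.ghost_greens_negative[OF assms] z.ghost_word[OF greens(1) assms] by simp
qed

text \<open>The list \<open>greens\<close> spells the longest element, which sends every simple root
  to the negative of a simple root; the resulting diagram involution is identified with
  \<open>star\<close> in \<open>star_eq\<close>.\<close>

definition opp :: "nat => nat" where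
 "opp j = (SOME i. i \<in> I & word greens (simple j) = - simple i)"

abbreviation "free_var \<equiv> sweep_var n 0 (exchange_matrix a arr) vs"

definition len :: "nat => nat" where
 "len j = cnt greens j"

lemma opp: "j \<in> I ==> opp j \<in> I" "j \<in> I ==> word greens (simple j) = - simple (opp j)"
proof -
 assume j: "j \<in> I"
 have "EX i. i \<in> I & word greens (simple j) = - simple i"
  using negative_word_simple[OF grn_path_set[OF greens(1)] greens_negative j] by blast
 from someI_ex[OF this] show "opp j \<in> I" "word greens (simple j) = - simple (opp j)"
  unfolding opp_def by auto
qed

text \<open>The square of the longest word permutes the simple roots, so it keeps them positive and
  is the identity.\<close>

lemma opp_opp:
 assumes j: "j \<in> I"
 shows "opp (opp j) = j"
proof -
 have w: "word (greens @ greens) (simple i) = simple (opp (opp i))" if "i \<in> I" for i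
  using opp(2)[OF that] opp(2)[OF opp(1)[OF that]] linear_neg[OF linear_word, of greens] by simp
 have "word (greens @ greens) (simple j) = simple j"
  by (rule positive_word_identity) (use grn_path_set[OF greens(1)] w in "auto simp: simple_apply simp del: word_simps")
 thus ?thesis using w[OF j] simple_inject by simp
qed

lemma opp_image: "opp ` I = I"
 using opp(1) opp_opp by (metis (no_types, lifting) image_iff subsetI subset_antisym image_subsetI)

lemma opp_euler:
 assumes "i \<in> I" "j \<in> I"
 shows "euler arr (simple (opp i)) (simple (opp j)) = euler (arrows greens) (simple i) (simple j)"
 using word_euler[OF green_src_path[OF greens(1)], of "simple i" "simple j"] opp(2)[OF assms(1)] opp(2)[OF assms(2)]
 by (simp add: euler_minus)

lemma opp_d: "i \<in> I ==> d (opp i) = d i"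
 using opp_euler[of i i] euler_simple_pair[OF opp(1) opp(1)] euler_simple_pair by simp

lemma opp_a:
 assumes "i \<in> I" "j \<in> I"
 shows "a (opp i) (opp j) = a i j"
proof -
 have "form (simple (opp i)) (simple (opp j)) = form (simple i) (simple j)"
  using word_form[OF grn_path_set[OF greens(1)], of "simple i" "simple j"] opp(2)[OF assms(1)] opp(2)[OF assms(2)]
  by (simp add: form_minus)
 thus ?thesis
  using form_simple_simple[OF opp(1)[OF assms(1)] opp(1)[OF assms(2)]] form_simple_simple[OF assms] opp_d[OF assms(1)]
   d_pos[OF assms(1)] by simp
qed

text \<open>The longest word carries the orientation reached at its end to the initial one, with
  vertices renamed by \<open>opp\<close>; the counts tell which edges are reversed at its
  end.\<close>

lemma opp_arr:
 assumes ij: "i \<in> I" "j \<in> I" and r: "arr i j"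
 shows "(len i = len j & arr (opp i) (opp j)) | (len i = Suc (len j) & arr (opp j) (opp i))"
proof -
 have ne: "i ~= j" "a i j ~= 0" "a j i ~= 0" using arr_adj(1)[OF ij] arr_adj(1)[OF ij(2,1)] r by auto
 have one: "opp i ~= opp j" using opp_opp[OF ij(1)] opp_opp[OF ij(2)] ne(1) by metis
 have e: "arr (opp k) (opp l)" if kl: "k \<in> I" "l \<in> I" "opp k ~= opp l" "k ~= l" "a k l ~= 0" "arrows greens k l" for k l
 proof (rule ccontr)
  assume "~ arr (opp k) (opp l)"
  hence "euler arr (simple (opp k)) (simple (opp l)) = 0"
   using euler_simple_pair[OF opp(1)[OF kl(1)] opp(1)[OF kl(2)]] kl(3) by simp
  moreover have "euler (arrows greens) (simple k) (simple l) = d k * of_int (a k l)"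
   using euler_simple_pair[OF kl(1,2)] kl by simp
  ultimately show False using opp_euler[OF kl(1,2)] d_pos[OF kl(1)] kl(5) by simp
 qed
 from arrows_count[OF green_src_path[OF greens(1)] ij r] show ?thesis
  using e[OF ij one ne(1,2)] e[OF ij(2,1) one[symmetric] ne(1)[symmetric] ne(3)] by (auto simp: len_def)
qed

text \<open>The whole word turns every positive root negative, so there is a letter at which this
  happens, and there the root has become the simple root of that letter.\<close>

lemma root_in_greens:
 assumes g: "g \<in> roots" "hgt g > 0"
 shows "EX ks k. grn_path (ks @ [k]) & (EX ls. greens = ks @ k # ls) & word ks (simple k) = g"
proof -
 have neg: "hgt (word (rev greens) g) < 0"
 proof (rule ccontr)
  let ?y = "word (rev greens) g"
  have s: "set greens \<subseteq> I" using grn_path_set[OF greens(1)] .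
  have y: "?y \<in> roots" using word_root[of "rev greens" g] g(1) s by simp
  assume "~ hgt ?y < 0"
  hence pos: "?y i >= 0" for i using root_height[OF y] by (metis linorder_neqE_linordered_idom)
  have "word greens ?y = (SUM i:I. ?y i *R word greens (simple i))"
   by (rule word_sum_simple[OF roots_lattice[OF y]])
  hence "g = (SUM i:I. ?y i *R word greens (simple i))" using word_rev[OF s, of g] by simp
  hence "hgt g = hgt (SUM i:I. ?y i *R word greens (simple i))" by (rule arg_cong)
  also have "... = (SUM i:I. ?y i * hgt (word greens (simple i)))"
   unfolding linear_sum[OF linear_height] by (simp add: height_scale)
  also have "... <= 0" using pos greens_negative by (intro sum_nonpos mult_nonneg_nonpos) (auto intro: less_imp_le)
  finally show False using g(2) by simp
 qed
 have "EX ls us k. ks = ls @ k # us & word ls (simple k) = g"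
  if "grn_path ks" "hgt (word (rev ks) g) < 0" for ks using that
 proof (induction rule: grn_path.induct)
  case Nil
  thus ?case using g(2) by simp
 next
  case (snoc ks k)
  have ks: "set ks \<subseteq> I" and k: "k \<in> I" using grn_path_set snoc.hyps by (auto simp: is_source_def)
  show ?case
  proof (cases "hgt (word (rev ks) g) < 0")
   case True
   thus ?thesis using snoc.IH by (metis append_Cons append_assoc)
  next
   case False
   let ?y = "word (rev ks) g"
   have y: "?y \<in> roots" using word_root[of "rev ks" g] g(1) ks by simp
   have pos: "?y i >= 0" for i using root_height[OF y] False by (metis linorder_neqE_linordered_idom)
   have "?y = simple k"
   proof (rule ccontr)
    assume "?y ~= simple k"
    hence "hgt (srefl k ?y) > 0"
     using srefl_positive[OF k y pos] root_height(2)[OF srefl_root[OF k y]] by blast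
    thus False using snoc.prems by simp
   qed
   hence "word ks (simple k) = g" using word_rev[OF ks, of g] by simp
   thus ?thesis by blast
  qed
 qed
 from this[OF greens(1) neg] obtain ls us k where "greens = ls @ k # us" "word ls (simple k) = g" by blast
 moreover from this have "grn_path (ls @ [k])" using greens(1) grn_path_append[of "ls @ [k]" us] by simp
 ultimately show ?thesis by blast
qed

text \<open>This plays the role of the denominator vector of the current variable at
  \<open>j\<close>: the root of its last mutation, or \<open>- simple j\<close> as long as the
  variable is initial.\<close>

fun last_root_rev :: "nat list => nat => rvec" where
 "last_root_rev [] j = - simple j"
| "last_root_rev (k # ks) j = (if j = k then word (rev ks) (simple k) else last_root_rev ks j)"

definition last_root :: "nat list => nat => rvec" where
 "last_root ks = last_root_rev (rev ks)"

lemma last_root_simps [simp]: "last_root [] j = - simple j"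
 "last_root (ks @ [k]) j = (if j = k then word ks (simple k) else last_root ks j)"
 by (simp_all add: last_root_def)

lemma last_root_unmutated: "i \<notin> set ks ==> last_root ks i = - simple i"
 by (induction ks rule: rev_induct) auto

lemma green_roots:
 assumes "grn_path ks" "j \<in> set ks"
 shows "last_root ks j \<in> roots" "hgt (last_root ks j) > 0"
proof -
 have "last_root ks j \<in> roots & hgt (last_root ks j) > 0" using assms
 proof (induction rule: grn_path.induct)
  case (snoc ks k)
  thus ?case using word_root[OF grn_path_set[OF snoc.hyps(1)] simple_root] by (auto simp: is_source_def)
 qed simp
 thus "last_root ks j \<in> roots" "hgt (last_root ks j) > 0" by auto
qed

text \<open>The additive shadow of the exchange relation. The restriction to
  \<open>i \<in> set ks\<close> leaves out initial variables, whose vectors are negative and do not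
  take part in the maximum.\<close>

lemma last_root_recurrence:
 assumes "grn_path ks" "j \<in> I"
 shows "word ks (simple j) + last_root ks j
   = (SUM i:I. (if arrows ks j i & i \<in> set ks then - of_int (a i j) else 0) *R last_root ks i)"
 using assms
proof (induction rule: grn_path.induct)
 case Nil
 show ?case by simp
next
 case (snoc ks k)
 have k: "k \<in> I" "!!i. i \<in> I ==> ~ arrows ks i k" using snoc.hyps by (auto simp: is_source_def)
 show ?case
 proof (cases "j = k")
  case True
  have z: "(SUM i:I. (if arrows (ks @ [k]) j i & i \<in> set (ks @ [k]) then - of_int (a i j) else 0) *R last_root (ks @ [k]) i) = 0"
   using k(2) True by (intro sum.neutral ballI) (simp add: flip_def)
  show ?thesis unfolding z using True word_source[OF k(1), of ks] by simp
 next
  case False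
  let ?w = "word ks (simple k)"
  have "a k j ~= 0 <-> arrows ks k j"
   using arrows_adj(1)[OF k(1) snoc.prems, of ks] k(2)[OF snoc.prems] False by auto
  hence c: "(if arrows ks k j then - of_int (a k j) else 0) = (- of_int (a k j) :: real)" by auto
  have "(SUM i:I. (if arrows (ks @ [k]) j i & i \<in> set (ks @ [k]) then - of_int (a i j) else 0) *R last_root (ks @ [k]) i)
    = (SUM i:I. (if arrows ks j i & i \<in> set ks then - of_int (a i j) else 0) *R last_root ks i
      + (if i = k then (if arrows ks k j then - of_int (a k j) else 0) *R ?w else 0))"
   using k(2)[OF snoc.prems] False by (intro sum.cong refl) (simp add: flip_def)
  also have "... = word ks (simple j) + last_root ks j + (if arrows ks k j then - of_int (a k j) else 0) *R ?w"
   unfolding sum.distrib snoc.IH[OF snoc.prems] using k(1) by simp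
  also have "... = word (ks @ [k]) (simple j) + last_root (ks @ [k]) j"
   unfolding c using False word_other[OF k(1) snoc.prems, of ks] by simp
  finally show ?thesis by (rule sym)
 qed
qed

lemma unmutated_coordinate:
 assumes "grn_path ks" "l \<notin> set ks" "j \<in> I" "j ~= l"
 shows "word ks (simple j) l = 0 & last_root ks j l = 0"
 using assms
proof (induction arbitrary: j rule: grn_path.induct)
 case Nil
 thus ?case by (simp add: simple_apply)
next
 case (snoc ks k)
 have k: "k \<in> I" "k ~= l" "l \<notin> set ks" using snoc by (auto simp: is_source_def)
 show ?case using word_other[OF k(1) snoc.prems(2), of ks] snoc.IH[OF k(3) snoc.prems(2,3)] snoc.IH[OF k(3,1,2)] by simp
qed

lemma split_at_count: "1 <= t ==> t <= cnt xs j ==> EX ks us. xs = ks @ j # us & Suc (cnt ks j) = t"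
proof (induction xs arbitrary: t)
 case Nil
 thus ?case by simp
next
 case (Cons x xs)
 show ?case
 proof (cases "x = j & t = 1")
  case True
  thus ?thesis by (intro exI[of _ "[]"] exI[of _ xs]) auto
 next
  case False
  hence "EX ks us. xs = ks @ j # us & Suc (cnt ks j) = (if x = j then t - 1 else t)"
   using Cons.prems by (intro Cons.IH) auto
  then obtain ks us where "xs = ks @ j # us" "Suc (cnt ks j) = (if x = j then t - 1 else t)" by blast
  hence "x # xs = (x # ks) @ j # us" "Suc (cnt (x # ks) j) = t" by (auto split: if_splits)
  thus ?thesis by blast
 qed
qed

lemma greens_split:
 assumes "1 <= t" "t <= len j"
 obtains ks where "grn_path (ks @ [j])" "cnt ks j = t - 1" "cnt (ks @ [j]) j = t" "EX us. greens = ks @ j # us"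
proof -
 obtain ks us where ks: "greens = ks @ j # us" "Suc (cnt ks j) = t"
  using split_at_count[OF assms[unfolded len_def]] by blast
 have "grn_path (ks @ [j])" using greens(1) grn_path_append[of "ks @ [j]" us] ks(1) by simp
 moreover have "cnt ks j = t - 1" "cnt (ks @ [j]) j = t" using ks(2) by auto
 ultimately show ?thesis using that ks(1) by blast
qed

lemma len_pos:
 assumes j: "j \<in> I"
 shows "len j >= 1"
proof (rule ccontr)
 assume "~ len j >= 1"
 hence "cnt greens j = 0" by (simp add: len_def)
 hence jn: "j \<notin> set greens" by (simp add: count_list_0_iff)
 have "word greens (simple j) j >= 1"
 proof -
  have "grn_path ks ==> j \<notin> set ks ==> word ks (simple j) j = 1" for ks
  proof (induction rule: grn_path.induct)
   case (snoc ks k)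
   hence k: "k \<in> I" "j \<notin> set ks" "k ~= j" by (auto simp: is_source_def)
   show ?case using word_other[OF k(1) j, of ks] snoc.IH[OF k(2)] unmutated_coordinate[OF snoc.hyps(1) k(2,1,3)] by simp
  qed (simp add: simple_apply)
  thus ?thesis using greens(1) jn by simp
 qed
 thus False using opp(2)[OF j] by (simp add: simple_apply split: if_splits)
qed

lemma greens_first:
 assumes "j \<in> I"
 obtains ks us where "greens = ks @ j # us" "cnt ks j = 0"
 using split_at_count[of 1 greens j] len_pos[OF assms] unfolding len_def by auto

end

section \<open>Growth of cluster variables near a coordinate hyperplane\<close>

lemma soft_bounds: "max 0 y <= soft y" "soft y <= max 0 y + ln 2"
proof -
 have "exp (max 0 y) <= 1 + exp y" by (simp add: max_def)
 hence "ln (exp (max 0 y)) <= soft y" unfolding soft_def by (intro ln_mono) auto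
 thus "max 0 y <= soft y" by simp
 have "1 + exp y <= exp (max 0 y) * 2" by (simp add: max_def)
 hence "soft y <= ln (exp (max 0 y) * 2)" unfolding soft_def by (intro ln_mono) (auto simp: add_pos_pos)
 thus "soft y <= max 0 y + ln 2" by (simp add: ln_mult)
qed

text \<open>Softplus differs from \<open>max 0\<close> by at most \<open>ln 2\<close>, which
  disappears after division by \<open>s\<close>.\<close>

lemma soft_growth:
 assumes y: "((%s. y s / s) \<longlongrightarrow> c) at_top"
 shows "((%s. soft (y s) / s) \<longlongrightarrow> max 0 c) (at_top :: real filter)"
proof (rule tendsto_sandwich)
 have m: "((%s. max 0 (y s / s)) \<longlongrightarrow> max 0 c) at_top" by (intro tendsto_max tendsto_const y)
 have l: "((%s. ln 2 / s) \<longlongrightarrow> 0) (at_top :: real filter)"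
  by (rule tendsto_divide_0[OF tendsto_const filterlim_at_top_imp_at_infinity[OF filterlim_ident]])
 show "((%s. max 0 (y s / s)) \<longlongrightarrow> max 0 c) at_top" by (rule m)
 show "((%s. max 0 (y s / s) + ln 2 / s) \<longlongrightarrow> max 0 c) at_top" using tendsto_add[OF m l] by simp
 have e: "max 0 (y s / s) = max 0 (y s) / s" if "s > 0" for s using that by (simp add: max_def divide_le_0_iff zero_le_divide_iff)
 show "\<forall>\<^sub>F s in at_top. max 0 (y s / s) <= soft (y s) / s"
  using eventually_gt_at_top[of 0] by eventually_elim (simp only: e, intro divide_right_mono soft_bounds less_imp_le)
 show "\<forall>\<^sub>F s in at_top. soft (y s) / s <= max 0 (y s / s) + ln 2 / s" using eventually_gt_at_top[of 0]
  by eventually_elim (simp only: e add_divide_distrib[symmetric], intro divide_right_mono soft_bounds less_imp_le)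
qed

context seed_datum begin

text \<open>For growing \<open>s\<close> the point approaches the hyperplane \<open>x_l = 0\<close>,
  so the growth rate of the logarithm of a variable measures its pole along it.\<close>

definition spike :: "nat => real => nat => real" where
 "spike l s i = (if i = l then exp (- s) else 1)"

lemma spike_pos: "spike l s i > 0" by (simp add: spike_def)

lemma seedX_frozen: "set ks \<subseteq> I ==> i \<notin> I ==> seedX ks i = var i"
 by (induction ks rule: rev_induct) (auto simp: seedX_step)

text \<open>The exchange relation at a green source tropicalises to
  \<open>last_root_recurrence\<close>. If \<open>l\<close> has been mutated, or is mutated now, the
  sum is nonnegative and equals the maximum; otherwise only the initial variable at \<open>l\<close>
  contributes, with negative sign, and the maximum is zero.\<close>

lemma growth:
 assumes "grn_path ks" "j \<in> I" and l: "l \<in> I"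
 shows "((%s. ln (cvalue (spike l s) ks j) / s) \<longlongrightarrow> last_root ks j l) at_top"
 using assms(1,2)
proof (induction arbitrary: j rule: grn_path.induct)
 case Nil
 have "\<forall>\<^sub>F s in at_top. ln (cvalue (spike l s) [] j) / s = (- simple j) l"
  using eventually_gt_at_top[of 0] by eventually_elim (simp add: cvalue_Nil spike_def simple_apply)
 thus ?case by (simp add: tendsto_eventually)
next
 case (snoc ks k)
 show ?case
 proof (cases "j = k")
  case False
  thus ?thesis using snoc.IH[OF snoc.prems] cvalue_step[of "spike l _" ks k, OF spike_pos]
   by (simp add: real_mutate_def)
 next
  case True
  have k: "k \<in> I" "!!i. i \<in> I ==> ~ arrows ks i k" using snoc.hyps by (auto simp: is_source_def)
  have sp: "src_path ks" using green_src_path[OF snoc.hyps(1)] .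
  have ks: "set ks \<subseteq> I" using src_path_set[OF sp] .
  define c where "c i = (if i = k then 0 else - real_of_int (a i k))" for i
  have b: "real_of_int (seedB ks i k) = - c i" and c: "c i >= 0" and carr: "c i = (if arrows ks k i then - real_of_int (a i k) else 0)"
   if i: "i \<in> I" for i
  proof -
   note ad = arrows_adj(1)[OF i k(1), of ks]
   have az: "a i k = 0" if "i ~= k" "~ arrows ks k i" using ad k(2)[OF i] that by blast
   have ir: "~ arrows ks k k" using k by blast
   show "real_of_int (seedB ks i k) = - c i"
    using seedB_arrows[OF sp i k(1)] k(2)[OF i] az ir by (auto simp: exchange_matrix_def c_def)
   show "c i >= 0" using a_nonpos[OF i k(1)] by (simp add: c_def)
   show "c i = (if arrows ks k i then - real_of_int (a i k) else 0)" using az ir by (auto simp: c_def)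
  qed
  define y where "y s = cvalue (spike l s) ks" for s
  have ypos: "y s i > 0" for s i unfolding y_def by (rule cvalue(2)[OF spike_pos])
  have yfrozen: "y s i = 1" if "i \<in> {n+1..n+m}" for s i
   using that seedX_frozen[OF ks, of i] l rvalue_var[of "spike l s" i]
   by (auto simp: y_def spike_def intro!: cvalue_eqI)
  have split: "(SUM i:{1..n+m}. f i) = (SUM i:I. f i) + (SUM i:{n+1..n+m}. f i)" for f :: "nat => real"
   using sum.ub_add_nat[of 1 n f m] by simp
  have lnb: "ln (bside g (y s)) = (SUM i:I. max 0 (of_int (g i)) * ln (y s i))" for g s
   unfolding bside_def ln_prod_powers[OF finite_atLeastAtMost ypos] split
   by (simp add: yfrozen sum.neutral)
  have P: "ln (bside (%i. seedB ks i k) (y s)) = 0" for s unfolding lnb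
  proof (intro sum.neutral ballI)
   fix i assume i: "i \<in> I"
   show "max 0 (real_of_int (seedB ks i k)) * ln (y s i) = 0" unfolding b[OF i] using c[OF i] by simp
  qed
  have Q: "ln (bside (%i. - seedB ks i k) (y s)) = (SUM i:I. c i * ln (y s i))" for s
   unfolding lnb by (intro sum.cong refl) (simp only: of_int_minus b minus_minus max_absorb2[OF c])
  have bpos: "bside g (y s) > 0" for g s using bside_pos ypos by blast
  have step: "ln (cvalue (spike l s) (ks @ [k]) k) = soft (SUM i:I. c i * ln (y s i)) - ln (y s k)" for s
  proof -
   have "cvalue (spike l s) (ks @ [k]) k
     = (bside (%i. - seedB ks i k) (y s) + bside (%i. seedB ks i k) (y s)) / y s k"
    by (simp add: cvalue_step[OF spike_pos] real_mutate_def y_def add.commute)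
   hence "ln (cvalue (spike l s) (ks @ [k]) k)
     = ln (bside (%i. - seedB ks i k) (y s) + bside (%i. seedB ks i k) (y s)) - ln (y s k)"
    using ypos[of s k] bpos[of "%i. - seedB ks i k" s] bpos[of "%i. seedB ks i k" s] by (simp add: ln_div add_pos_pos)
   also have "ln (bside (%i. - seedB ks i k) (y s) + bside (%i. seedB ks i k) (y s))
     = soft (SUM i:I. c i * ln (y s i))"
    using soft_ln[OF bpos bpos refl, of "%i. - seedB ks i k" s "%i. seedB ks i k" s] P[of s] Q[of s] by simp
   finally show ?thesis .
  qed
  define sg where "sg = (SUM i:I. c i * last_root ks i l)"
  have "((%s. SUM i:I. c i * (ln (y s i) / s)) \<longlongrightarrow> sg) at_top"
   unfolding sg_def y_def by (intro tendsto_sum tendsto_mult tendsto_const snoc.IH)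
  hence "((%s. (SUM i:I. c i * ln (y s i)) / s) \<longlongrightarrow> sg) at_top" by (simp add: sum_divide_distrib)
  hence lim: "((%s. soft (SUM i:I. c i * ln (y s i)) / s - ln (y s k) / s) \<longlongrightarrow> max 0 sg - last_root ks k l) at_top"
   unfolding y_def by (intro tendsto_diff soft_growth snoc.IH k)
  have rec: "word ks (simple k) l + last_root ks k l = (SUM i:I. (if i \<in> set ks then c i else 0) * last_root ks i l)"
  proof -
   have "(word ks (simple k) + last_root ks k) l
     = (SUM i:I. (if arrows ks k i & i \<in> set ks then - of_int (a i k) else 0) *R last_root ks i) l"
    by (simp only: last_root_recurrence[OF snoc.hyps(1) k(1)])
   also have "... = (SUM i:I. (if i \<in> set ks then c i else 0) * last_root ks i l)"
    unfolding sum_fun_apply by (intro sum.cong refl) (simp add: carr)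
   finally show ?thesis by (simp only: plus_fun_apply)
  qed
  have "max 0 sg - last_root ks k l = word ks (simple k) l"
  proof (cases "l \<in> set ks | l = k")
   case True
   have "c i * last_root ks i l = (if i \<in> set ks then c i else 0) * last_root ks i l" if "i \<in> I" for i
    using True last_root_unmutated[of i ks] by (cases "i \<in> set ks") (auto simp: simple_apply c_def)
   hence sg: "sg = word ks (simple k) l + last_root ks k l"
    unfolding rec sg_def by (intro sum.cong refl)
   have "(if i \<in> set ks then c i else 0) * last_root ks i l >= 0" if i: "i \<in> I" for i
    using c[OF i] green_roots[OF snoc.hyps(1), of i] root_height(2)[of "last_root ks i"] by simp
   hence "sg >= 0" unfolding sg rec by (rule sum_nonneg)
   thus ?thesis using sg by simp
  next
   case False
   hence z: "word ks (simple i) l = 0" "last_root ks i l = 0" if "i \<in> I" "i ~= l" for i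
    using unmutated_coordinate[OF snoc.hyps(1) _ that] by auto
   have "last_root ks l l = - 1" using last_root_unmutated[of l ks] False by (simp add: simple_apply)
   hence "c i * last_root ks i l <= 0" if "i \<in> I" for i
    using z(2)[OF that] c[OF that] by (cases "i = l") (simp_all add: mult_nonneg_nonpos)
   hence "sg <= 0" unfolding sg_def by (rule sum_nonpos)
   thus ?thesis using z[OF k(1)] False by auto
  qed
  thus ?thesis using lim True step by (simp add: diff_divide_distrib)
 qed
qed

text \<open>An initial variable has growth rates \<open>- 1\<close> and \<open>0\<close> only,
  whereas a positive root has a positive coordinate.\<close>

lemma sweep_var_not_initial:
 assumes t: "1 <= t" "t <= len j" and j: "j \<in> I"
 shows "sweep_var n m Bt vs t j ~= var i"
proof
 assume eq: "sweep_var n m Bt vs t j = var i"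
 obtain ks where ks: "grn_path (ks @ [j])" "cnt (ks @ [j]) j = t" using greens_split[OF t] by metis
 have x: "seedX (ks @ [j]) j = var i" using seedX_sweep_var[OF green_src_path[OF ks(1)] j] eq ks(2) by simp
 let ?b = "last_root (ks @ [j]) j"
 have b: "?b \<in> roots" "hgt ?b > 0" using green_roots[OF ks(1), of j] by auto
 hence bp: "?b l >= 0" for l using root_height(2)[OF b(1)] by blast
 obtain l where l: "?b l ~= 0" using b(1) by (auto simp: roots_def fun_eq_iff)
 have ln: "l \<in> I" using l roots_lattice[OF b(1)] by (auto simp: lattice_def)
 have cv: "cvalue (spike l s) (ks @ [j]) j = spike l s i" for s
  using x rvalue_var[of "spike l s" i] by (intro cvalue_eqI) simp
 have "\<forall>\<^sub>F s in at_top. ln (cvalue (spike l s) (ks @ [j]) j) / s = (if i = l then - 1 else 0)"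
  using eventually_gt_at_top[of 0] by eventually_elim (simp add: cv spike_def)
 hence "((%s. ln (cvalue (spike l s) (ks @ [j]) j) / s) \<longlongrightarrow> (if i = l then - 1 else 0)) at_top"
  by (rule tendsto_eventually)
 hence "?b l = (if i = l then - 1 else 0)"
  using growth[OF ks(1) j ln] tendsto_unique[of "at_top :: real filter"] by force
 thus False using l bp[of l] by (simp split: if_splits)
qed

text \<open>After \<open>greens\<close> the c-vectors are the negatives of the simple roots. One
  further mutation at every vertex, always at sources, only negates them, so the seed is the initial
  one with vertices renamed by \<open>opp\<close>.\<close>

lemma sweep_var_after:
 assumes j: "j \<in> I"
 shows "sweep_var n m Bt vs (Suc (len j)) j = var (opp j)"
proof -
 note sp = green_src_path[OF greens(1)]
 \<comment> \<open>The counts of \<open>vs @ greens\<close> exceed those of \<open>greens\<close> by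
   one everywhere, so the join supplies exactly one more mutation at each vertex.\<close>
 obtain us where us: "src_path (greens @ us)"
  "!!i. i \<in> I ==> cnt (greens @ us) i = max (cnt greens i) (cnt (vs @ greens) i)"
  using src_path_join[OF sp src_path_vs_append[OF sp]] by blast
 have cnt: "cnt us i = 1" if "i \<in> I" for i using us(2)[OF that] count_vs[OF that] by simp
 have "src_path (greens @ ws) ==> (!!i. i \<in> I ==> cnt ws i <= 1) ==> i \<in> I ==>
   ghost (greens @ ws) i = (if i \<in> set ws then simple (opp i) else - simple (opp i))" for ws i
 proof (induction ws arbitrary: i rule: rev_induct)
  case Nil
  thus ?case using ghost_word[OF greens(1) Nil(3)] opp(2)[OF Nil(3)] by simp
 next
  case (snoc k ws)
  have p: "src_path (greens @ ws)" "is_source (arrows (greens @ ws)) k"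
   using snoc.prems(1) src_path_snoc[of "greens @ ws" k] by auto
  have k: "k \<in> I" using p(2) by (simp add: is_source_def)
  have c: "cnt ws i <= 1" if "i \<in> I" for i using snoc.prems(2)[OF that] by (simp split: if_splits)
  have "cnt ws k = 0" using snoc.prems(2)[OF k] by simp
  hence kw: "k \<notin> set ws" by (simp add: count_list_0_iff)
  have IH: "ghost (greens @ ws) i = (if i \<in> set ws then simple (opp i) else - simple (opp i))" if "i \<in> I" for i
   by (rule snoc.IH[OF p(1) _ that]) (rule c)
  have gk: "ghost (greens @ ws) k = - simple (opp k)" unfolding IH[OF k] using kw by (simp only: if_False)
  have hs: "hgt (- simple (opp k)) < 0" using height_simple[OF opp(1)[OF k]] by (simp add: height_minus)
  have "hgt (ghost (greens @ ws) k) < 0" unfolding gk by (rule hs)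
  from ghost_red_source[OF p this snoc.prems(3)] show ?case
   using kw by (cases "i = k") (simp_all add: IH[OF snoc.prems(3)] gk)
 qed
 from this[of us] have gh: "ghost (greens @ us) i = simple (opp i)" if "i \<in> I" for i
  using us(1) cnt that by (metis count_notin le_refl zero_neq_one)
 have "ghost (greens @ us) ` I = simple ` opp ` I" using gh by (simp add: image_image)
 hence "ghost (greens @ us) ` I = ghost [] ` I" unfolding opp_image ghost_Nil .
 hence "seedX (greens @ us) j = seedX [] (opp j)"
  using gh[OF j] by (intro same_state[OF src_path_set[OF us(1)] _ _ j opp(1)[OF j]]) auto
 thus ?thesis using seedX_sweep_var[OF us(1) j] us(2)[OF j] count_vs[OF j] by (simp add: len_def)
qed

text \<open>The states of both seeds are normal, and normal forms are unique.\<close>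

lemma positive_seed:
 assumes ks: "set ks \<subseteq> I" and pos: "!!i. i \<in> I ==> hgt (ghost ks i) > 0"
 shows "ghost ks ` I = simple ` I"
proof -
 define z :: "nat => real" where "z = (%_. 1)"
 have z: "z i > 0" for i by (simp add: z_def)
 have nrm: "cr.normal (state z qs)" if "!!i. i \<in> I ==> hgt (ghost qs i) > 0" for qs
  using that unfolding cr.normal_def cr.red_step_def state_def by fastforce
 have n0: "cr.normal (state z [])" by (rule nrm) (simp add: height_simple)
 have "cr.red_step\<^sup>*\<^sup>* (state z ks) (state z [])" using cr.linked_normal[OF state_linked[OF z ks] n0] .
 hence "state z ks = state z []"
  using nrm[OF pos] by (auto simp: cr.normal_def elim: converse_rtranclpE)
 thus ?thesis by (simp add: state_def)
qed

lemma reduce_except: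
 assumes "set ks \<subseteq> I" "P ks"
  and step: "!!qs q. set qs \<subseteq> I ==> P qs ==> q \<in> I ==> q ~= p ==> hgt (ghost qs q) < 0 ==> P (qs @ [q])"
 shows "EX us. set us \<subseteq> I - {p} & P (ks @ us) & (ALL i:I - {p}. hgt (ghost (ks @ us) i) > 0)"
 using assms(1,2)
proof (induction "cr.height (ghost ks ` I)" arbitrary: ks rule: less_induct)
 case less
 show ?case
 proof (cases "ALL i:I - {p}. hgt (ghost ks i) > 0")
  case True
  thus ?thesis using less.prems by (intro exI[of _ "[]"]) simp
 next
  case False
  then obtain q where q: "q \<in> I" "q ~= p" "hgt (ghost ks q) < 0"
   using ghost_height_nonzero[OF less.prems(1)] by (metis DiffE linorder_neqE_linordered_idom singletonI)
  define z :: "nat => real" where "z = (%_. 1)"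
  have "z i > 0" for i by (simp add: z_def)
  hence "cr.red_step (state z ks) (state z (ks @ [q]))" using red_mutation[OF _ less.prems(1) q(1,3)] by blast
  from cr.red_step_height[OF this] have "cr.height (ghost (ks @ [q]) ` I) < cr.height (ghost ks ` I)"
   by (simp add: state_def)
  then obtain us where "set us \<subseteq> I - {p}" "P ((ks @ [q]) @ us)" "ALL i:I - {p}. hgt (ghost ((ks @ [q]) @ us) i) > 0"
   using less.hyps[of "ks @ [q]"] less.prems q step[OF less.prems q] by auto
  thus ?thesis using q by (intro exI[of _ "q # us"]) auto
 qed
qed

text \<open>Red mutations at the other vertices keep the given variable and end with at most its own
  c-vector negative. If that one is positive, the seed is initial up to numbering. Otherwise its
  opposite occurs as a root along \<open>greens\<close>, and reducing from there ends in a seed with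
  the same single negative vector, hence with the same c-vectors.\<close>

theorem cluster_variables_sweep:
 "cluster_variables n m Bt = {sweep_var n m Bt vs t j | t j. j \<in> I & t <= len j}"
proof (intro equalityI subsetI)
 fix x assume "x \<in> {sweep_var n m Bt vs t j | t j. j \<in> I & t <= len j}"
 then obtain t j where "x = seedX (sweeps t) j" "j \<in> I" by (auto simp: sweep_var_seedX)
 thus "x \<in> cluster_variables n m Bt"
  unfolding cluster_variables_def seedX_def using src_path_set[OF src_path_sweeps] by blast
next
 fix x assume "x \<in> cluster_variables n m Bt"
 then obtain ks p where x: "x = seedX ks p" "set ks \<subseteq> I" "p \<in> I"
  by (auto simp: cluster_variables_def seedX_def)
 obtain us where us: "set us \<subseteq> I - {p}" "!!i. i \<in> I ==> i ~= p ==> hgt (ghost (ks @ us) i) > 0"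
  using reduce_except[OF x(2), of "%_. True" p] by blast
 let ?k1 = "ks @ us"
 have k1: "set ?k1 \<subseteq> I" using x(2) us(1) by auto
 have "p \<notin> set us" using us(1) by blast
 hence x1: "x = seedX ?k1 p" using x(1) seedX_append_other[of p us ks] by simp
 show "x \<in> {sweep_var n m Bt vs t j | t j. j \<in> I & t <= len j}"
 proof (cases "hgt (ghost ?k1 p) > 0")
  case True
  have pos: "hgt (ghost ?k1 i) > 0" if "i \<in> I" for i using us(2)[OF that] True by (cases "i = p") simp_all
  hence img: "ghost ?k1 ` I = ghost [] ` I" using positive_seed[OF k1] by simp
  hence "ghost ?k1 p \<in> ghost [] ` I" using x(3) by blast
  then obtain i where i: "i \<in> I" "ghost ?k1 p = ghost [] i" by blast
  have "x = seedX [] i" unfolding x1 by (rule same_state[OF k1 _ img x(3) i]) simp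
  hence "x = sweep_var n m Bt vs 0 i" by (simp add: sweep_var_seedX)
  thus ?thesis using i(1) by blast
 next
  case False
  let ?b = "- ghost ?k1 p"
  have neg: "hgt (ghost ?k1 p) < 0" using ghost_height_nonzero[OF k1 x(3)] False by simp
  have ok1: "ghost_ok (ghost ?k1)" using ghost_ok_ghost[OF k1] .
  have b: "?b \<in> roots" "hgt ?b > 0"
   using ghost_ok_root[OF ok1 x(3)] root_uminus neg by (auto simp: height_minus)
  obtain ls k where lk: "grn_path (ls @ [k])" "EX ws. greens = ls @ k # ws" "word ls (simple k) = ?b"
   using root_in_greens[OF b] by blast
  have kn: "k \<in> I" and src: "is_source (arrows ls) k" using lk(1) by (auto simp: grn_path_snoc is_source_def)
  \<comment> \<open>Left orthogonality to the other c-vectors is what lets the vector at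
    \<open>k\<close> survive their red mutations; it holds at the start because \<open>k\<close> has
    just become a sink.\<close>
  define P where "P qs <-> ghost qs k = - ?b & (ALL j:I - {k}. euler arr (ghost qs k) (ghost qs j) = 0)" for qs
  have vk: "word (ls @ [k]) (simple k) = - ?b" using word_source[OF kn, of ls] lk(3) by simp
  have P0: "P (ls @ [k])" unfolding P_def
  proof (intro conjI ballI)
   show "ghost (ls @ [k]) k = - ?b" using ghost_word[OF lk(1) kn] vk by simp
   fix j assume j: "j \<in> I - {k}"
   hence jn: "j \<in> I" by blast
   have "~ arrows (ls @ [k]) k j" using src jn j by (simp add: is_source_def flip_def)
   thus "euler arr (ghost (ls @ [k]) k) (ghost (ls @ [k]) j) = 0"
    using ghost_word[OF lk(1) kn] ghost_word[OF lk(1) jn] word_euler[OF green_src_path[OF lk(1)]]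
     euler_simple_pair[OF kn jn] j by auto
  qed
  have Pstep: "P (qs @ [q])" if qs: "set qs \<subseteq> I" "P qs" "q \<in> I" "q ~= k" "hgt (ghost qs q) < 0" for qs q
  proof -
   let ?V = "ghost qs"
   have ok: "ghost_ok ?V" using ghost_ok_ghost[OF qs(1)] .
   have gd: "cr.good (?V ` I)" "inj_on ?V I" using ok by (auto simp: ghost_ok_def)
   have vq: "euler arr (?V k) (?V q) = 0" and vkn: "hgt (?V k) < 0" using qs(2-4) b(2) by (auto simp: P_def)
   have ne: "?V q ~= ?V k" using inj_onD[OF gd(2) _ qs(3) kn] qs(4) by blast
   have "euler arr (?V q) (?V k) <= 0"
    by (rule cr.good_same[OF gd(1) imageI[OF qs(3)] imageI[OF kn] ne]) (use qs(5) vkn in auto)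
   moreover have "om (?V q) (?V k) = euler arr (?V q) (?V k) - euler arr (?V k) (?V q)"
    by (intro cr.om_root ghost_ok_root[OF ok] qs kn)
   ultimately have "max 0 (om (?V q) (?V k)) = 0" using vq by simp
   hence Vk: "ghost (qs @ [q]) k = ?V k" using qs(4,5) by (simp add: ghost_snoc gmut_def cr.red_def)
   have "euler arr (?V k) (ghost (qs @ [q]) j) = 0" if j: "j \<in> I - {k}" for j
   proof -
    have "euler arr (?V k) (?V j) = 0" using qs(2) j unfolding P_def by blast
    thus ?thesis using qs(5) vq by (simp add: ghost_snoc gmut_def cr.red_def)
   qed
   thus ?thesis using Vk qs(2) by (simp add: P_def)
  qed
  have lset: "set (ls @ [k]) \<subseteq> I" using grn_path_set[OF lk(1)] .
  obtain ws where ws: "set ws \<subseteq> I - {k}" "P ((ls @ [k]) @ ws)"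
   "!!i. i \<in> I ==> i ~= k ==> hgt (ghost ((ls @ [k]) @ ws) i) > 0"
   using reduce_except[OF lset, of P k, OF P0 Pstep] by blast
  let ?k2 = "(ls @ [k]) @ ws"
  have k2: "set ?k2 \<subseteq> I" using lset ws(1) by auto
  have ok2: "ghost_ok (ghost ?k2)" using ghost_ok_ghost[OF k2] .
  have vk2: "ghost ?k2 k = ghost ?k1 p" using ws(2) by (simp add: P_def)
  have img: "ghost ?k1 ` I = ghost ?k2 ` I"
  proof (rule cr.only_red_unique[of _ _ "ghost ?k1 p"])
   show "cr.good (ghost ?k1 ` I)" "cr.good (ghost ?k2 ` I)" using ok1 ok2 by (auto simp: ghost_ok_def)
   show "ghost ?k1 p \<in> ghost ?k1 ` I" using x(3) by blast
   show "ghost ?k1 p \<in> ghost ?k2 ` I" using vk2 kn by (metis imageI)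
   show "hgt (ghost ?k1 p) < 0" by (rule neg)
   show "hgt v > 0" if "v \<in> ghost ?k1 ` I - {ghost ?k1 p}" for v using that us(2) by blast
   show "hgt v > 0" if "v \<in> ghost ?k2 ` I - {ghost ?k1 p}" for v
   proof -
    obtain i where i: "i \<in> I" "v = ghost ?k2 i" using \<open>v \<in> ghost ?k2 ` I - {ghost ?k1 p}\<close> by blast
    hence "i ~= k" using that vk2 by blast
    thus ?thesis unfolding i(2) by (rule ws(3)[OF i(1)])
   qed
   have "span (ghost ?k1 ` I) = span (ghost ?k2 ` I)" using ok1 ok2 by (simp add: ghost_ok_def)
   thus "ghost ?k1 ` I \<subseteq> span (ghost ?k2 ` I)" "ghost ?k2 ` I \<subseteq> span (ghost ?k1 ` I)"
    using span_superset by blast+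
  qed
  have "x = seedX ?k2 k" unfolding x1 by (rule same_state[OF k1 k2 img x(3) kn vk2[symmetric]])
  also have "... = seedX (ls @ [k]) k" using ws(1) by (intro seedX_append_other) blast
  also have "... = sweep_var n m Bt vs (cnt (ls @ [k]) k) k"
   by (rule seedX_sweep_var[OF green_src_path[OF lk(1)] kn])
  finally have "x = sweep_var n m Bt vs (cnt (ls @ [k]) k) k" .
  moreover have "cnt (ls @ [k]) k <= len k" using lk(2) by (auto simp: len_def)
  ultimately show ?thesis using kn by blast
 qed
qed

end

lemma var_inject: "var i = var j <-> i = j"
proof
 assume e: "var i = var j"
 show "i = j"
 proof (rule ccontr)
  assume "i ~= j"
  hence "rvalue (%k. if k = i then 1 else 2) (var i) 1" "rvalue (%k. if k = i then 1 else 2) (var j) 2"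
   using rvalue_var[of "%k. if k = i then 1 else 2" i] rvalue_var[of "%k. if k = i then 1 else 2" j] by auto
  hence "(1::real) = 2" using rvalue_unique e by metis
  thus False by simp
 qed
qed simp

lemma split_unique:
 assumes "xs = ks @ j # us" "xs = ks' @ j # us'" "cnt ks j = cnt ks' j"
 shows "ks = ks'"
proof -
 have nil: "zs = []" if "j # us = zs @ ws" "cnt zs j = 0" for zs ws us :: "'a list"
  using that by (cases zs) auto
 have "ks @ j # us = ks' @ j # us'" using assms by simp
 then obtain zs where "(ks = ks' @ zs & zs @ j # us = j # us') | (ks @ zs = ks' & j # us = zs @ j # us')"
  unfolding append_eq_append_conv2 by blast
 thus ?thesis
 proof
  assume z: "ks = ks' @ zs & zs @ j # us = j # us'"
  hence "zs = []" using assms(3) by (intro nil[of us' zs "j # us"]) auto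
  thus ?thesis using z by simp
 next
  assume z: "ks @ zs = ks' & j # us = zs @ j # us'"
  hence "zs = []" using assms(3) by (intro nil[of us zs "j # us'"]) auto
  thus ?thesis using z by simp
 qed
qed

section \<open>The index set and the roots along the longest word\<close>

context sweep_datum begin

definition indices :: "(nat * nat) set" where
 "indices = {(s, i). i \<in> I & s <= len i}"

lemma indices_iff [simp]: "(s, i) \<in> indices <-> i \<in> I & s <= len i" by (simp add: indices_def)

lemma finite_indices: "finite indices"
proof -
 have "indices \<subseteq> (\<Union>i\<in>I. (%s. (s, i)) ` {..len i})" by (auto simp: indices_def)
 thus ?thesis by (rule finite_subset) simp
qed

lemma coefficient_free: "seed_datum n a d arr vs (exchange_matrix a arr)" by unfold_locales simp

lemma sweep_len_eq:
 assumes j: "j \<in> I"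
 shows "sweep_len n (exchange_matrix a arr) vs j = len j"
proof -
 interpret z: seed_datum n a d arr vs 0 "exchange_matrix a arr" by (rule coefficient_free)
 have "(LEAST t. t > 0 & (EX i:I. free_var t j = var i)) = Suc (len j)"
 proof (rule Least_equality)
  show "Suc (len j) > 0 & (EX i:I. free_var (Suc (len j)) j = var i)"
   using z.sweep_var_after[OF j] opp(1)[OF j] by blast
  show "Suc (len j) <= t" if "t > 0 & (EX i:I. free_var t j = var i)" for t
  proof (rule ccontr)
   assume "~ Suc (len j) <= t"
   hence "1 <= t" "t <= len j" using that by auto
   thus False using z.sweep_var_not_initial[OF _ _ j] that by blast
  qed
 qed
 thus ?thesis by (simp add: sweep_len_def)
qed

lemma star_eq:
 assumes j: "j \<in> I"
 shows "star n (exchange_matrix a arr) vs j = opp j"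
proof -
 interpret z: seed_datum n a d arr vs 0 "exchange_matrix a arr" by (rule coefficient_free)
 show ?thesis
  unfolding star_def sweep_len_eq[OF j] add_Suc_right add_0_right One_nat_def z.sweep_var_after[OF j] var_inject
  using opp(1)[OF j] by (intro the_equality) auto
qed

lemma Pi_index_eq: "Pi_index n (exchange_matrix a arr) vs = indices"
 by (auto simp: Pi_index_def indices_def sweep_len_eq)

definition prev :: "nat * nat => nat * nat" where
 "prev \<gamma> = (case \<gamma> of (t, j) => if t >= 1 then (t - 1, j) else (len (opp j), opp j))"

lemma prev_simps: "prev (Suc t, j) = (t, j)" "prev (0, j) = (len (opp j), opp j)"
 by (simp_all add: prev_def)

lemma tau_eq: "j \<in> I ==> tau n (exchange_matrix a arr) vs (t, j) = prev (t, j)"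
 unfolding tau_def prev_def using star_eq[of j] sweep_len_eq[OF opp(1), of j] by simp

lemma prev_in: "\<gamma> \<in> indices ==> prev \<gamma> \<in> indices"
 using opp(1) by (cases \<gamma>) (auto simp: prev_def simp del: atLeastAtMost_iff)

lemma prev_inj: "inj_on prev indices"
proof (rule inj_onI)
 fix \<gamma> \<delta> assume g: "\<gamma> \<in> indices" "\<delta> \<in> indices" and e: "prev \<gamma> = prev \<delta>"
 obtain t j s i where gd: "\<gamma> = (t, j)" "\<delta> = (s, i)" by (meson surj_pair)
 have m: "i \<in> I" "j \<in> I" "t <= len j" "s <= len i" using g gd by auto
 show "\<gamma> = \<delta>"
 proof (cases t)
  case 0
  show ?thesis
  proof (cases s)
   case 0
   hence "opp j = opp i" using e `t = 0` gd by (simp add: prev_simps)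
   hence "j = i" using opp_opp[OF m(1)] opp_opp[OF m(2)] by simp
   thus ?thesis using gd 0 `t = 0` by simp
  next
   case (Suc s')
   thus ?thesis using e gd 0 m(4) by (auto simp: prev_simps)
  qed
 next
  case (Suc t')
  thus ?thesis using e gd m(3) by (cases s) (simp_all add: prev_simps)
 qed
qed

lemma prev_bij: "bij_betw prev indices indices"
 using prev_inj prev_in finite_indices by (simp add: bij_betw_def endo_inj_surj image_subsetI)

lemma prev_eq_iff: "\<gamma> \<in> indices ==> \<delta> \<in> indices ==> prev \<gamma> = prev \<delta> <-> \<gamma> = \<delta>"
 using prev_inj by (meson inj_on_eq_iff)

text \<open>Counting starts at \<open>1\<close>: the \<open>t\<close>-th mutation at
  \<open>j\<close> produces the variable with index \<open>(t, j)\<close>.\<close>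

definition root_at :: "nat => nat => rvec" where
 "root_at t j = word (SOME ks. (EX us. greens = ks @ j # us) & cnt ks j = t - 1) (simple j)"

lemma root_at_eq:
 assumes "greens = ks @ j # us"
 shows "root_at (Suc (cnt ks j)) j = word ks (simple j)"
proof -
 have "(SOME ks'. (EX us. greens = ks' @ j # us) & cnt ks' j = Suc (cnt ks j) - 1) = ks"
 proof (rule some_equality)
  show "(EX us. greens = ks @ j # us) & cnt ks j = Suc (cnt ks j) - 1" using assms by auto
  show "ks' = ks" if "(EX us. greens = ks' @ j # us) & cnt ks' j = Suc (cnt ks j) - 1" for ks'
   using that split_unique[of greens ks' j _ ks us] assms by auto
 qed
 thus ?thesis by (simp add: root_at_def)
qed

lemma word_rev_other: "j \<notin> set ws ==> word (rev ws) x j = x j"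
 by (induction ws arbitrary: x) (auto simp: srefl_apply_other)

lemma greens_prefix:
 assumes "greens = ks @ j # us"
 shows "grn_path ks" "is_source (arrows ks) j" "j \<in> I" "set ks \<subseteq> I" "grn_path (ks @ [j])"
proof -
 show g: "grn_path (ks @ [j])" using greens(1) grn_path_append[of "ks @ [j]" us] assms by simp
 thus "grn_path ks" "is_source (arrows ks) j" by (auto simp: grn_path_snoc)
 thus "j \<in> I" "set ks \<subseteq> I" using grn_path_set by (auto simp: is_source_def)
qed

text \<open>Just before its mutation \<open>j\<close> is a source and just after it a sink; so
  pairing from the right reads a coordinate before the mutation, and pairing from the left, in
  \<open>euler_after\<close>, one after it.\<close>

lemma euler_before:
 assumes g: "greens = ks @ j # us"
 shows "euler arr x (word ks (simple j)) = d j * word (rev ks) x j"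
proof -
 note p = greens_prefix[OF g]
 have "euler arr (word ks (word (rev ks) x)) (word ks (simple j)) = euler (arrows ks) (word (rev ks) x) (simple j)"
  by (rule word_euler[OF green_src_path[OF p(1)]])
 also have "... = d j * word (rev ks) x j"
  using p(2) by (intro euler_source) (auto simp: is_source_def)
 finally show ?thesis by (simp only: word_rev[OF p(4)])
qed

lemma euler_after:
 assumes g: "greens = ks @ j # us"
 shows "euler arr (word ks (simple j)) x = - (d j * word (rev (ks @ [j])) x j)"
proof -
 note p = greens_prefix[OF g]
 have s: "set (ks @ [j]) \<subseteq> I" using p by simp
 have "euler arr (word (ks @ [j]) (simple j)) (word (ks @ [j]) (word (rev (ks @ [j])) x))
   = euler (arrows (ks @ [j])) (simple j) (word (rev (ks @ [j])) x)"
  by (rule word_euler[OF green_src_path[OF p(5)]])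
 also have "... = d j * word (rev (ks @ [j])) x j"
  using p(2) by (intro euler_sink) (auto simp: is_source_def flip_def)
 finally have e: "euler arr (word (ks @ [j]) (simple j)) x = d j * word (rev (ks @ [j])) x j"
  by (simp only: word_rev[OF s])
 have "word (ks @ [j]) (simple j) = - word ks (simple j)" by (rule word_source[OF p(3)])
 thus ?thesis using e by (simp add: euler_minus)
qed

text \<open>Between two mutations at \<open>j\<close> the \<open>j\<close>-th coordinate of a vector in the current basis is
 unchanged, and pairing with the root mutated at \<open>j\<close> reads off this coordinate.\<close>

lemma root_at_pairing:
 assumes t: "1 <= t" "Suc t <= len j"
 shows "euler arr x (root_at (Suc t) j) + euler arr (root_at t j) x = 0"
proof -
 obtain ks us where ks: "greens = ks @ j # us" "cnt ks j = t"
  using split_at_count[of "Suc t" greens j] t unfolding len_def by auto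
 obtain ls ws where ls: "ks = ls @ j # ws" "Suc (cnt ls j) = t"
  using split_at_count[of t ks j] t ks(2) by auto
 have g: "greens = ls @ j # (ws @ j # us)" using ks(1) ls(1) by simp
 have "cnt ws j = 0" using ks(2) ls by auto
 hence jw: "j \<notin> set ws" by (simp add: count_list_0_iff)
 have "word (rev ks) x j = word (rev ws) (word (rev (ls @ [j])) x) j" using ls(1) by simp
 hence "word (rev ks) x j = word (rev (ls @ [j])) x j" using word_rev_other[OF jw] by simp
 thus ?thesis
  using euler_before[OF ks(1), of x] euler_after[OF g, of x] root_at_eq[OF ks(1)] root_at_eq[OF g] ks(2) ls(2) by simp
qed

text \<open>Until the first mutation at \<open>j\<close> the \<open>j\<close>-th coordinate is the
  initial one.\<close>

lemma root_at_first:
 assumes j: "j \<in> I"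
 shows "euler arr (simple i) (root_at 1 j) = (if j = i then d j else 0)"
proof -
 obtain ks us where ks: "greens = ks @ j # us" "cnt ks j = 0" using greens_first[OF j] .
 hence "j \<notin> set ks" by (simp add: count_list_0_iff)
 hence "word (rev ks) (simple i) j = simple i j" by (rule word_rev_other)
 thus ?thesis using euler_before[OF ks(1), of "simple i"] root_at_eq[OF ks(1)] ks(2) by (simp add: simple_apply)
qed

lemma root_at_last:
 assumes j: "j \<in> I" and i: "i \<in> I"
 shows "euler arr (root_at (len j) j) (simple i) = (if j = opp i then d j else 0)"
proof -
 obtain ks us where ks: "greens = ks @ j # us" "Suc (cnt ks j) = len j"
  using split_at_count[of "len j" greens j] len_pos[OF j] unfolding len_def by auto
 have "len j = cnt ks j + Suc (cnt us j)" using ks(1) by (simp add: len_def)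
 hence "j \<notin> set us" using ks(2) by (simp add: count_list_0_iff)
 hence "word (rev (ks @ [j])) (simple i) j = word (rev us) (word (rev (ks @ [j])) (simple i)) j"
  using word_rev_other by simp
 also have "... = word (rev greens) (simple i) j" using ks(1) by simp
 also have "word (rev greens) (simple i) = - simple (opp i)"
 proof -
  have "word greens (- simple (opp i)) = simple i"
   using opp(2)[OF opp(1)[OF i]] opp_opp[OF i] linear_neg[OF linear_word, of greens "simple (opp i)"] by simp
  thus ?thesis using word_rev'[OF grn_path_set[OF greens(1)], of "- simple (opp i)"] by simp
 qed
 finally have e: "word (rev (ks @ [j])) (simple i) j = - (if j = opp i then 1 else 0)"
  unfolding uminus_apply simple_apply .
 have "root_at (len j) j = word ks (simple j)" using root_at_eq[OF ks(1)] ks(2) by simp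
 thus ?thesis using euler_after[OF ks(1), of "simple i"] unfolding e by simp
qed

text \<open>Zero at \<open>t = 0\<close>, because compatibility degrees are cut off at zero, where
  the denominator vector of an initial variable would have an entry \<open>- 1\<close>.\<close>

definition root_vec :: "nat * nat => rvec" where
 "root_vec \<gamma> = (case \<gamma> of (t, j) => if t = 0 then 0 else root_at t j)"

text \<open>Going round the cycle of \<open>prev\<close>, the pairings cancel except where the index
  passes \<open>t = 0\<close>; the two deltas are these boundary terms.\<close>

lemma root_vec_euler:
 assumes g: "\<gamma> \<in> indices" and i: "i \<in> I"
 shows "euler arr (simple i) (root_vec \<gamma>) + euler arr (root_vec (prev \<gamma>)) (simple i)
   = d i * (of_bool (\<gamma> = (0, i)) + of_bool (prev \<gamma> = (0, i)))"
proof -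
 obtain t j where tj: "\<gamma> = (t, j)" "j \<in> I" "t <= len j" using g by (cases \<gamma>) auto
 have z: "euler arr x 0 = 0" "euler arr 0 x = 0" for x by (simp_all add: euler_def)
 consider "t = 0" | "t = 1" | s where "t = Suc (Suc s)" by (cases t rule: nat.exhaust; metis not0_implies_Suc One_nat_def)
 thus ?thesis
 proof cases
  case 1
  have l: "len (opp j) >= 1" using len_pos opp(1) tj(2) by blast
  have "opp j = opp i <-> i = j" using opp_opp i tj(2) by metis
  thus ?thesis
   using root_at_last[OF opp(1)[OF tj(2)] i] l 1 tj opp_d[OF tj(2)] by (auto simp: root_vec_def prev_simps z)
 next
  case 2
  thus ?thesis using root_at_first[OF tj(2), of i] tj(1) by (auto simp: root_vec_def prev_def z)
 next
  case 3
  thus ?thesis using root_at_pairing[of "Suc s" j "simple i"] tj by (simp add: root_vec_def prev_simps)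
 qed
qed

lemma root_vec_recurrence:
 assumes g: "\<gamma> \<in> indices" and i: "i \<in> I"
 shows "root_vec \<gamma> i + root_vec (prev \<gamma>) i
   + (SUM j:I. of_int (a i j) * (if arr i j then root_vec \<gamma> j else if arr j i then root_vec (prev \<gamma>) j else 0))
   = of_bool (\<gamma> = (0, i)) + of_bool (prev \<gamma> = (0, i))"
proof -
 let ?x = "root_vec \<gamma>" and ?y = "root_vec (prev \<gamma>)"
 let ?S = "SUM j:I. of_int (a i j) * (if arr i j then ?x j else if arr j i then ?y j else 0)"
 have "(SUM j:I. (if j ~= i & arr i j then d i * of_int (a i j) else 0) * ?x j)
   + (SUM j:I. (if j ~= i & arr j i then d j * of_int (a j i) else 0) * ?y j) = d i * ?S"
  unfolding sum_distrib_left sum.distrib[symmetric]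
 proof (intro sum.cong refl)
  fix j assume j: "j \<in> I"
  have e: "d j * real_of_int (a j i) = d i * of_int (a i j)" by (rule d_sym[OF j i])
  have n: "arr i j ==> ~ arr j i" "arr i j | arr j i ==> j ~= i" using arr_adj[OF i j] by auto
  show "(if j ~= i & arr i j then d i * of_int (a i j) else 0) * ?x j + (if j ~= i & arr j i then d j * of_int (a j i) else 0) * ?y j
    = d i * (of_int (a i j) * (if arr i j then ?x j else if arr j i then ?y j else 0))"
   unfolding e using n by (cases "arr i j"; cases "arr j i") simp_all
 qed
 hence "d i * (?x i + ?y i + ?S) = d i * (of_bool (\<gamma> = (0, i)) + of_bool (prev \<gamma> = (0, i)))"
  using root_vec_euler[OF g i] euler_simple1[OF i, of arr ?x] euler_simple2[OF i, of arr ?y] by (simp add: algebra_simps)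
 thus ?thesis using d_pos[OF i] by (simp only: mult_cancel_left) linarith
qed

end

context seed_datum begin

definition frozen_side :: "(nat => int) => (nat => 'f) => 'f::comm_monoid_mult" where
 "frozen_side b x = (PROD r:{r\<in>{n+1..n+m}. b r > 0}. x r ^ nat (b r))"

definition neighbour_side :: "nat => nat => ratfun" where
 "neighbour_side t j = (PROD i:{i\<in>I. arr i j}. sweep_var n m Bt vs t i ^ nat (- a i j)) *
   (PROD i:{i\<in>I. arr j i}. sweep_var n m Bt vs (t - 1) i ^ nat (- a i j))"

lemma seedX_nonzero: "seedX ks i ~= 0"
proof
 assume z: "seedX ks i = 0"
 have one: "(1::real) > 0" by simp
 have "rvalue (%_. 1) (seedX ks i) (cvalue (%_. 1) ks i)" "cvalue (%_. 1) ks i > 0"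
  using cvalue[of "%_. 1" ks i, OF one] by auto
 moreover have "rvalue (%_. 1) 0 0"
  using value_at_const[of "%_. 1" 0] by (simp add: rconst_def fract_collapse)
 ultimately show False using rvalue_unique z by fastforce
qed

text \<open>At a source all mutable neighbours lie in one monomial, so the other one is purely
  frozen.\<close>

lemma exchange_relation_seed:
 assumes p: "src_path (ks @ [j])"
 shows "seedX ks j * seedX (ks @ [j]) j = frozen_side (%r. seedB ks r j) var
   + frozen_side (%r. - seedB ks r j) var * (PROD i:I - {j}. seedX ks i ^ nat (- a i j))"
proof -
 have sp: "src_path ks" and src: "is_source (arrows ks) j" using p src_path_snoc by auto
 have j: "j \<in> I" using src by (simp add: is_source_def)
 note ks = src_path_set[OF sp]
 have b: "seedB ks i j = (if i = j then 0 else a i j)" if i: "i \<in> I" for i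
 proof -
  have "~ arrows ks i j" "~ arrows ks j j" using src i j by (auto simp: is_source_def)
  thus ?thesis
   using seedB_arrows[OF sp i j] arrows_adj(1)[OF i j, of ks] by (auto simp: exchange_matrix_def)
 qed
 have fz: "seedX ks r = var r" if "r \<in> {n+1..n+m}" for r using seedX_frozen[OF ks] that by auto
 have neg: "seedB ks i j <= 0" if "i \<in> I" for i using b[OF that] a_nonpos[OF that j] by auto
 have "n < i" if "i \<in> {1..n+m}" "seedB ks i j > 0" for i
  using neg[of i] that by (cases "i <= n") simp_all
 hence "{i\<in>{1..n+m}. seedB ks i j > 0} = {r\<in>{n+1..n+m}. seedB ks r j > 0}" by (auto simp: Suc_le_eq)
 hence P: "bside (%i. seedB ks i j) (seedX ks) = frozen_side (%r. seedB ks r j) var"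
  unfolding bside_def frozen_side_def using fz by (intro prod.cong) auto
 have disj: "{i\<in>{1..n+m}. - seedB ks i j > 0} = {i\<in>I. - seedB ks i j > 0} \<union> {r\<in>{n+1..n+m}. - seedB ks r j > 0}"
  by auto
 have "bside (%i. - seedB ks i j) (seedX ks)
   = (PROD i:{i\<in>I. - seedB ks i j > 0}. seedX ks i ^ nat (- seedB ks i j))
    * (PROD i:{r\<in>{n+1..n+m}. - seedB ks r j > 0}. seedX ks i ^ nat (- seedB ks i j))"
  unfolding bside_def disj by (intro prod.union_disjoint) auto
 also have "(PROD i:{r\<in>{n+1..n+m}. - seedB ks r j > 0}. seedX ks i ^ nat (- seedB ks i j)) = frozen_side (%r. - seedB ks r j) var"
  unfolding frozen_side_def using fz by (intro prod.cong) auto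
 also have "(PROD i:{i\<in>I. - seedB ks i j > 0}. seedX ks i ^ nat (- seedB ks i j)) = (PROD i:I - {j}. seedX ks i ^ nat (- a i j))"
 proof (rule prod.mono_neutral_cong_left)
  show "{i\<in>I. - seedB ks i j > 0} \<subseteq> I - {j}" using b by (auto simp del: atLeastAtMost_iff)
  show "ALL i:I - {j} - {i\<in>I. - seedB ks i j > 0}. seedX ks i ^ nat (- a i j) = 1"
  proof
   fix i assume i: "i \<in> I - {j} - {i\<in>I. - seedB ks i j > 0}"
   hence "i \<in> I" by blast
   hence "nat (- a i j) = 0" using i b[of i] by (simp split: if_splits)
   thus "seedX ks i ^ nat (- a i j) = 1" by simp
  qed
  show "seedX ks i ^ nat (- seedB ks i j) = seedX ks i ^ nat (- a i j)" if "i \<in> {i\<in>I. - seedB ks i j > 0}" for i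
   using that b[of i] by (simp split: if_splits)
 qed simp
 finally have Q: "bside (%i. - seedB ks i j) (seedX ks)
   = frozen_side (%r. - seedB ks r j) var * (PROD i:I - {j}. seedX ks i ^ nat (- a i j))" by (simp add: mult.commute)
 show ?thesis using seedX_nonzero[of ks j] by (simp add: seedX_step P Q)
qed

lemma neighbour_side_seed:
 assumes p: "src_path (ks @ [j])"
 shows "(PROD i:I - {j}. seedX ks i ^ nat (- a i j)) = neighbour_side (Suc (cnt ks j)) j"
proof -
 have sp: "src_path ks" and src: "is_source (arrows ks) j" using p src_path_snoc by auto
 have j: "j \<in> I" using src by (simp add: is_source_def)
 have no: "~ arrows ks i j" if "i \<in> I" for i using src that by (simp add: is_source_def)
 have s: "(PROD i:I - {j}. seedX ks i ^ nat (- a i j)) = (PROD i:{i\<in>I. arr i j} \<union> {i\<in>I. arr j i}. seedX ks i ^ nat (- a i j))"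
 proof (rule prod.mono_neutral_right)
  show "finite (I - {j})" by simp
  show "{i\<in>I. arr i j} \<union> {i\<in>I. arr j i} \<subseteq> I - {j}" using arr_irrefl[OF j] by auto
  show "ALL i:I - {j} - ({i\<in>I. arr i j} \<union> {i\<in>I. arr j i}). seedX ks i ^ nat (- a i j) = 1"
  proof
   fix i assume "i \<in> I - {j} - ({i\<in>I. arr i j} \<union> {i\<in>I. arr j i})"
   hence "a i j = 0" using arr_adj(1)[OF _ j, of i] by auto
   thus "seedX ks i ^ nat (- a i j) = 1" by simp
  qed
 qed
 also have "... = (PROD i:{i\<in>I. arr i j}. seedX ks i ^ nat (- a i j)) * (PROD i:{i\<in>I. arr j i}. seedX ks i ^ nat (- a i j))"
  using arr_adj(2)[OF _ j] by (intro prod.union_disjoint) auto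
 also have "(PROD i:{i\<in>I. arr i j}. seedX ks i ^ nat (- a i j))
   = (PROD i:{i\<in>I. arr i j}. sweep_var n m Bt vs (Suc (cnt ks j)) i ^ nat (- a i j))"
 proof (intro prod.cong refl)
  fix i assume "i \<in> {i\<in>I. arr i j}"
  hence i: "i \<in> I" "arr i j" by auto
  have "cnt ks i = Suc (cnt ks j)" using arrows_count[OF sp i(1) j i(2)] no[OF i(1)] by blast
  thus "seedX ks i ^ nat (- a i j) = sweep_var n m Bt vs (Suc (cnt ks j)) i ^ nat (- a i j)"
   using seedX_sweep_var[OF sp i(1)] by simp
 qed
 also have "(PROD i:{i\<in>I. arr j i}. seedX ks i ^ nat (- a i j))
   = (PROD i:{i\<in>I. arr j i}. sweep_var n m Bt vs (Suc (cnt ks j) - 1) i ^ nat (- a i j))"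
 proof (intro prod.cong refl)
  fix i assume "i \<in> {i\<in>I. arr j i}"
  hence i: "i \<in> I" "arr j i" by auto
  have "cnt ks i = Suc (cnt ks j) - 1" using arrows_count[OF sp j i(1) i(2)] no[OF i(1)] by simp
  thus "seedX ks i ^ nat (- a i j) = sweep_var n m Bt vs (Suc (cnt ks j) - 1) i ^ nat (- a i j)"
   using seedX_sweep_var[OF sp i(1)] by simp
 qed
 finally show ?thesis unfolding neighbour_side_def .
qed

lemma exchange_relation:
 assumes p: "src_path (ks @ [j])"
 shows "sweep_var n m Bt vs (cnt ks j) j * sweep_var n m Bt vs (Suc (cnt ks j)) j
   = frozen_side (%r. seedB ks r j) var + frozen_side (%r. - seedB ks r j) var * neighbour_side (Suc (cnt ks j)) j"
proof -
 have sp: "src_path ks" and j: "j \<in> I" using p src_path_snoc by (auto simp: is_source_def)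
 show ?thesis
  using exchange_relation_seed[OF p] seedX_sweep_var[OF sp j] seedX_sweep_var[OF p j] neighbour_side_seed[OF p] by simp
qed

end

section \<open>Denominators and compatibility degrees\<close>

lemma Fract_one_mult: "Fract (p::mpoly) 1 * Fract q 1 = Fract (p * q) 1"
 and Fract_one_add: "Fract (p::mpoly) 1 + Fract q 1 = Fract (p + q) 1"
 and Fract_one_eq: "Fract (p::mpoly) 1 = Fract q 1 <-> p = q"
 by (simp_all add: eq_fract)

lemma Fract_one_power: "Fract (p::mpoly) 1 ^ k = Fract (p ^ k) 1"
 by (induction k) (simp_all add: One_fract_def)

lemma Fract_one_prod: "(PROD i:A. Fract (f i :: mpoly) 1) = Fract (PROD i:A. f i) 1"
 by (induction A rule: infinite_finite_induct) (simp_all add: One_fract_def)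

lemma pvar_nonzero: "pvar i ~= 0"
proof
 assume "pvar i = 0"
 hence "poly_at (%_. 1) (pvar i) = 0" by simp
 thus False by simp
qed

lemma var_nonzero: "var i ~= 0" unfolding var_def by (simp add: pvar_nonzero eq_fract Zero_fract_def)

text \<open>Test points for divisibility by \<open>pvar i\<close>: on the hyperplane
  \<open>x_i = 0\<close> and positive elsewhere if \<open>z\<close> is.\<close>

definition face :: "(nat => real) => nat => nat => complex" where
 "face z i k = complex_of_real ((z(i := 0)) k)"

lemma pvar_dvd_of_vanishing:
 fixes p :: mpoly
 assumes van: "!!z :: nat => real. (!!k. z k > 0) ==> poly_at (face z i) p = 0"
 shows "pvar i dvd p"
proof -
 define A where "A = {e \<in> keys p. lookup e i = 0}"
 define B where "B = {e \<in> keys p. lookup e i ~= 0}"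
 define m where "m e = single e (lookup p e)" for e
 have "p = (SUM e:keys p. m e)" unfolding m_def by (rule poly_mapping_sum_single)
 also have "keys p = A \<union> B" by (auto simp: A_def B_def)
 also have "(SUM e:A \<union> B. m e) = (SUM e:A. m e) + (SUM e:B. m e)"
  by (rule sum.union_disjoint) (auto simp: A_def B_def)
 finally have p: "p = (SUM e:A. m e) + (SUM e:B. m e)" .
 have B: "pvar i dvd m e" if "e \<in> B" for e
 proof -
  have "e = single i 1 + (e - single i 1)"
   using that by (intro poly_mapping_eqI) (auto simp: B_def lookup_add lookup_minus lookup_single when_def)
  hence "m e = pvar i * single (e - single i 1) (lookup p e)"
   unfolding m_def pvar_def mult_single by simp
  thus ?thesis by simp
 qed
 hence dB: "pvar i dvd (SUM e:B. m e)" by (rule dvd_sum)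
 then obtain q where q: "(SUM e:B. m e) = pvar i * q" by (elim dvdE)
 have "(SUM e:A. m e) = 0"
 proof (rule poly_at_zero)
  fix z :: "nat => real" assume z: "!!i. z i > 0"
  have "poly_at (face z i) (SUM e:B. m e) = 0" unfolding q by (simp add: face_def)
  hence y0: "poly_at (face z i) (SUM e:A. m e) = 0"
   using van[OF z] arg_cong[OF p, of "poly_at (face z i)"] by simp
  have "mvalue (face z i) e = mvalue (%k. complex_of_real (z k)) e" if "e \<in> A" for e
  proof -
   have "i \<notin> keys e" using that by (simp add: A_def in_keys_iff)
   thus ?thesis unfolding mvalue_def face_def by (intro prod.cong) auto
  qed
  hence "poly_at (face z i) (m e) = poly_at (%k. complex_of_real (z k)) (m e)" if "e \<in> A" for e
   using that unfolding m_def by simp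
  thus "poly_at (%k. complex_of_real (z k)) (SUM e:A. m e) = 0"
   using y0 unfolding poly_at.ev_sum by simp
 qed
 hence "p = (SUM e:B. m e)" using p by (metis add_0)
 thus ?thesis using dB by (rule ssubst)
qed

text \<open>With a larger exponent on the left, cancelling \<open>pvar i ^ v i\<close> and
  restricting to the hyperplane would force \<open>N'\<close> to vanish where it does not.\<close>

lemma exponent_le:
 fixes N N' :: mpoly
 assumes eq: "N * (PROD l:{1..n}. pvar l ^ u l) = N' * (PROD l:{1..n}. pvar l ^ v l)"
  and nd: "~ pvar i dvd N'" and i: "i \<in> {1..n}"
 shows "u i <= v i"
proof (rule ccontr)
 assume less: "~ u i <= v i"
 obtain z :: "nat => real" where z: "!!k. z k > 0" "poly_at (face z i) N' ~= 0"
  using pvar_dvd_of_vanishing nd by blast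
 have sp: "(PROD l:{1..n}. pvar l ^ w l) = pvar i ^ w i * (PROD l:{1..n} - {i}. pvar l ^ w l)" for w :: "nat => nat"
  using i by (simp add: prod.remove)
 have "pvar i ^ u i = pvar i ^ v i * pvar i ^ (u i - v i)" using less by (simp flip: power_add)
 hence "pvar i ^ v i * (N * pvar i ^ (u i - v i) * (PROD l:{1..n} - {i}. pvar l ^ u l))
   = pvar i ^ v i * (N' * (PROD l:{1..n} - {i}. pvar l ^ v l))"
  using eq unfolding sp by (simp add: algebra_simps)
 hence "N * pvar i ^ (u i - v i) * (PROD l:{1..n} - {i}. pvar l ^ u l) = N' * (PROD l:{1..n} - {i}. pvar l ^ v l)"
  using pvar_nonzero[of i] by simp
 note e = arg_cong[OF this, of "poly_at (face z i)"]
 have "face z i i = 0" by (simp add: face_def)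
 hence "poly_at (face z i) N' * (PROD l:{1..n} - {i}. face z i l ^ v l) = 0"
  using e zero_power[of "u i - v i", where 'a = complex] less by (simp add: poly_at.ev_prod del: mult_eq_0_iff)
 moreover have "face z i l ~= 0" if "l \<in> {1..n} - {i}" for l
  using z(1)[of l] that by (simp add: face_def)
 ultimately show False using z(2) by simp
qed

lemma has_denominator_unique:
 assumes d: "has_denominator n f d" and d': "has_denominator n f d'" and i: "i \<in> {1..n}"
 shows "d i = d' i"
proof -
 obtain N where N: "!!i. i \<in> {1..n} ==> ~ pvar i dvd N" "f = Fract N 1 / (PROD i:{1..n}. var i powi d i)"
  using d unfolding has_denominator_def by blast
 obtain N' where N': "!!i. i \<in> {1..n} ==> ~ pvar i dvd N'" "f = Fract N' 1 / (PROD i:{1..n}. var i powi d' i)"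
  using d' unfolding has_denominator_def by blast
 \<comment> \<open>A common bound for all exponents, so that one monomial clears both
   denominators.\<close>
 define K where "K = (SUM i:{1..n}. \<bar>d i\<bar> + \<bar>d' i\<bar>)"
 have K: "d i <= K" "d' i <= K" if "i \<in> {1..n}" for i
 proof -
  have "\<bar>d i\<bar> + \<bar>d' i\<bar> <= K" unfolding K_def by (rule member_le_sum) (use that in auto)
  thus "d i <= K" "d' i <= K" by auto
 qed
 have cl: "f * (PROD i:{1..n}. var i powi K) = Fract (M * (PROD i:{1..n}. pvar i ^ nat (K - e i))) 1"
  if f: "f = Fract M 1 / (PROD i:{1..n}. var i powi e i)" and e: "!!i. i \<in> {1..n} ==> e i <= K" for M e
 proof -
  have "(PROD i:{1..n}. var i powi K) = (PROD i:{1..n}. var i powi e i) * (PROD i:{1..n}. var i ^ nat (K - e i))"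
   unfolding prod.distrib[symmetric]
  proof (intro prod.cong refl)
   fix i assume "i \<in> {1..n}"
   hence "var i powi (K - e i) = var i ^ nat (K - e i)" using e by (simp add: power_int_def)
   thus "var i powi K = var i powi e i * var i ^ nat (K - e i)"
    using power_int_add[of "var i" "e i" "K - e i"] var_nonzero[of i] by simp
  qed
  moreover have "(PROD i:{1..n}. var i powi e i) ~= 0" using var_nonzero by simp
  ultimately have "f * (PROD i:{1..n}. var i powi K) = Fract M 1 * (PROD i:{1..n}. var i ^ nat (K - e i))" using f var_nonzero by simp
  thus ?thesis unfolding var_def Fract_one_power Fract_one_prod Fract_one_mult .
 qed
 have eq: "N * (PROD i:{1..n}. pvar i ^ nat (K - d i)) = N' * (PROD i:{1..n}. pvar i ^ nat (K - d' i))"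
  using cl[OF N(2) K(1)] cl[OF N'(2) K(2)] unfolding Fract_one_eq[symmetric] by simp
 show ?thesis
  using exponent_le[OF eq N'(1)[OF i] i] exponent_le[OF eq[symmetric] N(1)[OF i] i] K[OF i] by simp
qed

lemma denominator_exponent_eqI:
 assumes "has_denominator n f d" "i \<in> {1..n}"
 shows "denominator_exponent n f i = d i"
 unfolding denominator_exponent_def using assms has_denominator_unique by (intro the_equality) blast+

text \<open>Unlike mere non-divisibility, positivity on the hyperplane is inherited by sums, so it
  can be carried through an induction over exchange relations.\<close>

definition face_positive :: "mpoly => nat => bool" where
 "face_positive N l <-> (ALL z :: nat => real. (ALL k. z k > 0) --> (EX r>0. poly_at (face z l) N = complex_of_real r))"

lemma face_positive_not_dvd: "face_positive N l ==> ~ pvar l dvd N"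
proof
 assume f: "face_positive N l" and "pvar l dvd N"
 then obtain q where q: "N = pvar l * q" by (elim dvdE)
 have "EX r>0. poly_at (face (%_. 1) l) N = complex_of_real r"
  using f unfolding face_positive_def by (metis zero_less_one)
 thus False by (auto simp: q face_def)
qed

context sweep_datum begin

text \<open>At the first mutation of \<open>j\<close> the neighbours already mutated are those with
  an arrow into \<open>j\<close>, each of them once.\<close>

lemma first_root_recurrence:
 assumes g: "greens = ks @ j # us" "cnt ks j = 0"
 shows "root_at 1 j l = (if l = j then 1 else 0) + (SUM i:{i\<in>I. arr i j}. of_int (- a i j) * root_at 1 i l)"
proof -
 note p = greens_prefix[OF g(1)]
 have sp: "src_path ks" using green_src_path[OF p(1)] .
 have jk: "j \<notin> set ks" using g(2) by (simp add: count_list_0_iff)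
 have lr: "last_root ks j = - simple j"
 proof -
  have "j \<notin> set qs ==> last_root qs j = - simple j" for qs by (induction qs rule: rev_induct) auto
  thus ?thesis using jk by blast
 qed
 have cnt: "arrows ks j i & i \<in> set ks <-> arr i j" if i: "i \<in> I" for i
 proof -
  have no: "~ arrows ks i j" using p(2) i by (simp add: is_source_def)
  have ik: "i \<in> set ks <-> cnt ks i ~= 0" by (simp add: count_list_0_iff)
  have "arr i j ==> cnt ks i = 1 & arrows ks j i" using arrows_count[OF sp i p(3)] no g(2) by auto
  moreover have "arr j i ==> cnt ks i = 0" using arrows_count[OF sp p(3) i] g(2) by auto
  moreover have "arrows ks j i ==> arr i j | arr j i"
   using arrows_adj(1)[OF p(3) i, of ks] arr_adj(1)[OF p(3) i] by blast
  ultimately show ?thesis unfolding ik by auto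
 qed
 have ri: "last_root ks i = root_at 1 i" if i: "i \<in> I" "arr i j" for i
 proof -
  have "cnt ks i = 1"
   using arrows_count[OF sp i(1) p(3) i(2)] p(2) i(1) g(2) by (auto simp: is_source_def)
  then obtain ls ws where ls: "ks = ls @ i # ws" "cnt ls i = 0" using split_at_count[of 1 ks i] by auto
  hence "cnt ws i = 0" using `cnt ks i = 1` by simp
  hence iw: "i \<notin> set ws" by (simp add: count_list_0_iff)
  have "i \<notin> set ws ==> last_root (ls @ i # ws) i = word ls (simple i)" for ws
  proof (induction ws rule: rev_induct)
   case Nil
   show ?case using last_root_simps(2)[of ls i i] by simp
  next
   case (snoc w ws)
   thus ?case using last_root_simps(2)[of "ls @ i # ws" w i] by simp
  qed
  hence "last_root ks i = word ls (simple i)" using ls(1) iw by simp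
  moreover have "greens = ls @ i # (ws @ j # us)" using g(1) ls(1) by simp
  ultimately show ?thesis using root_at_eq ls(2) by fastforce
 qed
 have "word ks (simple j) l + last_root ks j l
   = (SUM i:I. (if arrows ks j i & i \<in> set ks then - of_int (a i j) else 0) *R last_root ks i) l"
  using last_root_recurrence[OF p(1,3)] by (metis plus_fun_apply)
 also have "... = (SUM i:I. if arr i j then of_int (- a i j) * root_at 1 i l else 0)"
  unfolding sum_fun_apply by (intro sum.cong refl) (simp add: cnt ri del: atLeastAtMost_iff)
 also have "... = (SUM i:{i\<in>I. arr i j}. of_int (- a i j) * root_at 1 i l)"
  by (rule sum.inter_filter[symmetric]) simp
 finally show ?thesis using root_at_eq[OF g(1)] g(2) by (simp add: lr simple_apply)
qed

lemma root_at_root: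
 assumes "1 <= t" "t <= len j"
 shows "root_at t j \<in> roots" "root_at t j l >= 0"
proof -
 obtain ks us where ks: "greens = ks @ j # us" "Suc (cnt ks j) = t"
  using split_at_count[of t greens j] assms unfolding len_def by auto
 note p = greens_prefix[OF ks(1)]
 have e: "root_at t j = word ks (simple j)" using root_at_eq[OF ks(1)] ks(2) by simp
 show r: "root_at t j \<in> roots" unfolding e by (rule word_root[OF p(4) simple_root[OF p(3)]])
 have "hgt (root_at t j) > 0" using p(5) unfolding e by (simp add: grn_path_snoc)
 thus "root_at t j l >= 0" using root_height(2)[OF r] by blast
qed

lemma first_root_support:
 assumes j: "j \<in> I" and l: "l \<in> I" "arr j l"
 shows "root_at 1 j l = 0"
proof -
 obtain ks us where ks: "greens = ks @ j # us" "cnt ks j = 0" using greens_first[OF j] .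
 note p = greens_prefix[OF ks(1)]
 have "~ arrows ks l j" using p(2) l(1) by (simp add: is_source_def)
 hence "cnt ks l = 0" using arrows_count[OF green_src_path[OF p(1)] j l] ks(2) by auto
 hence "l \<notin> set ks" by (simp add: count_list_0_iff)
 moreover have "j ~= l" using arr_irrefl[OF j] l by auto
 ultimately show ?thesis using unmutated_coordinate[OF p(1) _ j, of l] root_at_eq[OF ks(1)] ks(2) by simp
qed

text \<open>Natural numbers, so that the coordinates can be used as exponents.\<close>

definition first_root :: "nat => nat => nat" where
 "first_root j l = nat \<lfloor>root_at 1 j l\<rfloor>"

lemma first_root: 
 assumes "j \<in> I" "l \<in> I"
 shows "real (first_root j l) = root_at 1 j l"
proof -
 have "root_at 1 j l \<in> \<int>" using root_at_root(1)[of 1 j] len_pos[OF assms(1)] assms(2) by (simp add: roots_def)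
 then obtain z where "root_at 1 j l = of_int z" by (elim Ints_cases)
 thus ?thesis using root_at_root(2)[of 1 j l] len_pos[OF assms(1)] by (simp add: first_root_def)
qed

lemma first_root_rec:
 assumes j: "j \<in> I" and l: "l \<in> I"
 shows "first_root j l = (if l = j then 1 else 0) + (SUM i:{i\<in>I. arr i j}. nat (- a i j) * first_root i l)"
proof -
 obtain ks us where ks: "greens = ks @ j # us" "cnt ks j = 0" using greens_first[OF j] .
 have "real (first_root j l) = (if l = j then 1 else 0) + (SUM i:{i\<in>I. arr i j}. of_int (- a i j) * root_at 1 i l)"
  unfolding first_root[OF j l] by (rule first_root_recurrence[OF ks])
 also have "(SUM i:{i\<in>I. arr i j}. of_int (- a i j) * root_at 1 i l)
   = (SUM i:{i\<in>I. arr i j}. real (nat (- a i j)) * real (first_root i l))"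
 proof (intro sum.cong refl)
  fix i assume i: "i \<in> {i\<in>I. arr i j}"
  hence in': "i \<in> I" by blast
  have "i ~= j" using i arr_irrefl by auto
  hence "a i j <= 0" using a_nonpos[OF in' j] by blast
  thus "of_int (- a i j) * root_at 1 i l = real (nat (- a i j)) * real (first_root i l)"
   unfolding first_root[OF in' l] by simp
 qed
 finally have "real (first_root j l) = real ((if l = j then 1 else 0) + (SUM i:{i\<in>I. arr i j}. nat (- a i j) * first_root i l))"
  by simp
 thus ?thesis by (simp only: of_nat_eq_iff)
qed

text \<open>Along the vertex order the numerator is a sum of two products, one of which stays
  positive on \<open>x_l = 0\<close>: the first if \<open>M l = 0\<close>, and otherwise the second,
  whose initial factor does not contain \<open>x_l\<close> by
  \<open>first_root_support\<close>.\<close>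

lemma first_sweep_numerator:
 "p < n ==> EX N. free_var 1 (vs ! p) * (PROD l:I. var l ^ first_root (vs ! p) l) = Fract N 1
   & (ALL l:I. face_positive N l)"
proof (induction p rule: less_induct)
 case (less p)
 interpret y0: seed_datum n a d arr vs 0 "exchange_matrix a arr" by (rule coefficient_free)
 let ?X = free_var
 define j where "j = vs ! p"
 have j: "j \<in> I" using vs_nth less.prems by (simp add: j_def)
 define In where "In = {i\<in>I. arr i j}"
 define O' where "O' = {i\<in>I. arr j i}"
 have "EX N. ?X 1 i * (PROD l:I. var l ^ first_root i l) = Fract N 1 & (ALL l:I. face_positive N l)" if "i \<in> In" for i
 proof -
  have i: "i \<in> I" "arr i j" using that by (auto simp: In_def)
  obtain q where q: "q < n" "i = vs ! q" using i(1) vs length_vs by (metis in_set_conv_nth)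
  hence "q < p" using arr_vs[OF q(1) less.prems] i(2) by (simp add: j_def)
  thus ?thesis using less.IH[OF _ q(1)] q(2) by simp
 qed
 then obtain N where N: "!!i. i \<in> In ==> ?X 1 i * (PROD l:I. var l ^ first_root i l) = Fract (N i) 1"
  "!!i l. i \<in> In ==> l \<in> I ==> face_positive (N i) l" by metis
 define M where "M l = (SUM i:In. nat (- a i j) * first_root i l)" for l
 have fr: "first_root j l = (if l = j then 1 else 0) + M l" if "l \<in> I" for l
  using first_root_rec[OF j that] by (simp add: M_def In_def)
 obtain ks us where ks: "greens = ks @ j # us" "cnt ks j = 0" using greens_first[OF j] .
 have v0: "?X 0 i = var i" for i by (simp add: y0.sweep_var_seedX)
 have rel: "var j * ?X 1 j = 1 + (PROD i:In. ?X 1 i ^ nat (- a i j)) * (PROD i:O'. var i ^ nat (- a i j))"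
  using y0.exchange_relation[OF green_src_path[OF greens_prefix(5)[OF ks(1)]]] ks(2)
  by (simp add: v0 y0.frozen_side_def y0.neighbour_side_def In_def O'_def)
 have pw: "(PROD l:I. var l ^ M l) = (PROD i:In. (PROD l:I. var l ^ first_root i l) ^ nat (- a i j))"
 proof -
  have "(PROD l:I. var l ^ M l) = (PROD l:I. PROD i:In. (var l ^ first_root i l) ^ nat (- a i j))"
   unfolding M_def power_sum by (simp add: power_mult[symmetric] mult.commute)
  also have "... = (PROD i:In. PROD l:I. (var l ^ first_root i l) ^ nat (- a i j))" by (rule prod.swap)
  finally show ?thesis by (simp only: prod_power_distrib)
 qed
 define N' where "N' = (PROD l:I. pvar l ^ M l) + (PROD i:In. N i ^ nat (- a i j)) * (PROD i:O'. pvar i ^ nat (- a i j))"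
 have "(PROD l:I. var l ^ first_root j l) = var j * (PROD l:I. var l ^ M l)"
 proof -
  have "(PROD l:I. var l ^ first_root j l) = (PROD l:I. (if l = j then var j else 1) * var l ^ M l)"
   by (intro prod.cong refl) (simp add: fr)
  thus ?thesis using j by (simp add: prod.distrib)
 qed
 hence "?X 1 j * (PROD l:I. var l ^ first_root j l) = (var j * ?X 1 j) * (PROD l:I. var l ^ M l)" by simp
 also have "... = (PROD l:I. var l ^ M l)
   + (PROD i:In. (?X 1 i * (PROD l:I. var l ^ first_root i l)) ^ nat (- a i j)) * (PROD i:O'. var i ^ nat (- a i j))"
  unfolding rel power_mult_distrib prod.distrib pw[symmetric] by (simp add: algebra_simps)
 also have "(PROD i:In. (?X 1 i * (PROD l:I. var l ^ first_root i l)) ^ nat (- a i j)) = (PROD i:In. Fract (N i) 1 ^ nat (- a i j))"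
  by (intro prod.cong refl) (simp only: N(1))
 also have "(PROD l:I. var l ^ M l) + (PROD i:In. Fract (N i) 1 ^ nat (- a i j)) * (PROD i:O'. var i ^ nat (- a i j)) = Fract N' 1"
  unfolding N'_def var_def Fract_one_power Fract_one_prod Fract_one_mult Fract_one_add ..
 finally have e: "?X 1 j * (PROD l:I. var l ^ first_root j l) = Fract N' 1" .
 have "face_positive N' l" if l: "l \<in> I" for l unfolding face_positive_def
 proof (intro allI impI)
  fix z :: "nat => real" assume z: "ALL k. z k > 0"
  have "EX r>0. poly_at (face z l) (N i) = complex_of_real r" if "i \<in> In" for i
   using N(2)[OF that l] z unfolding face_positive_def by blast
  then obtain r where r: "!!i. i \<in> In ==> r i > 0 & poly_at (face z l) (N i) = complex_of_real (r i)" by metis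
  define A B C where "A = (PROD k:I. (z(l := 0)) k ^ M k)" and "B = (PROD i:In. r i ^ nat (- a i j))"
   and "C = (PROD i:O'. (z(l := 0)) i ^ nat (- a i j))"
  have "(PROD i:In. poly_at (face z l) (N i) ^ nat (- a i j)) = complex_of_real B"
   unfolding B_def of_real_prod of_real_power using r by (intro prod.cong) auto
  hence val: "poly_at (face z l) N' = complex_of_real (A + B * C)"
   unfolding N'_def A_def C_def by (simp add: poly_at.ev_prod) (simp add: face_def)
  have nn: "(z(l := 0)) k >= 0" for k using z by (auto intro: less_imp_le)
  have A0: "A >= 0" "C >= 0" unfolding A_def C_def by (intro prod_nonneg ballI zero_le_power nn)+
  have B: "B > 0" unfolding B_def using r by (intro prod_pos ballI zero_less_power) blast
  have "A > 0 | C > 0"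
  proof (cases "M l = 0")
   case True
   hence "(z(l := 0)) k ^ M k > 0" for k using z by (cases "k = l") auto
   thus ?thesis unfolding A_def by (simp add: prod_pos)
  next
   case False
   hence "first_root j l ~= 0" using fr[OF l] by simp
   hence "root_at 1 j l ~= 0" using first_root[OF j l] by auto
   hence "~ arr j l" using first_root_support[OF j l] by blast
   hence "(z(l := 0)) i ^ nat (- a i j) > 0" if "i \<in> O'" for i using z that by (auto simp: O'_def)
   thus ?thesis unfolding C_def by (simp add: prod_pos)
  qed
  hence "A + B * C > 0" using A0 B by (auto intro: add_pos_nonneg add_nonneg_pos)
  thus "EX r>0. poly_at (face z l) N' = complex_of_real r" using val by blast
 qed
 thus ?case using e by (auto simp: j_def)
qed

text \<open>Only this sweep is expanded; for later ones \<open>c_root_vec\<close> uses exchange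
  relations.\<close>

lemma denominator_first_sweep:
 assumes j: "j \<in> I" and i: "i \<in> I"
 shows "denominator_exponent n (free_var 1 j) i = int (first_root j i)"
proof -
 obtain q where q: "q < n" "j = vs ! q" using j vs length_vs by (metis in_set_conv_nth)
 obtain N where N: "free_var 1 j * (PROD l:I. var l ^ first_root j l) = Fract N 1"
  "!!l. l \<in> I ==> face_positive N l" using first_sweep_numerator[OF q(1)] q(2) by blast
 have "(PROD l:I. var l ^ first_root j l) ~= 0" using var_nonzero by simp
 hence "free_var 1 j = Fract N 1 / (PROD l:I. var l powi int (first_root j l))"
  using N(1) by (simp add: field_simps)
 hence "has_denominator n (free_var 1 j) (%l. int (first_root j l))"
  unfolding has_denominator_def using N(2) face_positive_not_dvd by blast
 thus ?thesis using denominator_exponent_eqI i by fastforce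
qed

lemma denominator_var:
 assumes j: "j \<in> I" and i: "i \<in> I"
 shows "denominator_exponent n (var j) i <= 0"
proof -
 have "face_positive 1 l" for l unfolding face_positive_def by (intro allI impI exI[of _ 1]) simp
 hence nd: "~ pvar l dvd 1" for l using face_positive_not_dvd by blast
 have "(PROD l:I. var l powi (if l = j then - 1 else 0)) = (PROD l:I. if l = j then inverse (var l) else 1)"
  by (intro prod.cong refl) (simp add: power_int_minus)
 hence "(PROD l:I. var l powi (if l = j then - 1 else 0)) = inverse (var j)" using j by simp
 hence "has_denominator n (var j) (%l. if l = j then - 1 else 0)"
  unfolding has_denominator_def using nd by (intro exI[of _ 1]) (simp add: divide_inverse One_fract_def[symmetric])
 thus ?thesis using denominator_exponent_eqI i by fastforce
qed

end

section \<open>Universal coefficients and compatibility degrees\<close>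

lemma frozen_power_two:
 fixes b :: "nat => int"
 assumes "finite A" "q \<in> A"
 shows "(PROD r:{r\<in>A. b r > 0}. (if r = q then 2 else 1) ^ nat (b r)) = (2::real) ^ nat (b q)"
proof -
 have "(PROD r:{r\<in>A. b r > 0}. (if r = q then 2 else 1) ^ nat (b r)) = (PROD r:A. if r = q then (2::real) ^ nat (b q) else 1)"
  using assms(1) by (intro prod.mono_neutral_cong_left) auto
 thus ?thesis using assms by simp
qed

locale universal_datum = sweep_datum n a d arr vs for n a d arr vs +
 fixes c :: "nat * nat => nat * nat => nat" and Bt :: "nat => nat => int" and idx :: "nat * nat => nat"
 assumes connected: "connected_diagram n a"
  and compat: "compatibility_degree n (exchange_matrix a arr) vs c"
  and univ: "universal_extension n a arr vs c Bt idx"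
begin

abbreviation "r \<equiv> card indices"

sublocale sd: seed_datum n a d arr vs r Bt
 using univ by unfold_locales (simp add: universal_extension_def Let_def)

definition xvar :: "nat * nat => ratfun" where
 "xvar u = (case u of (t, j) => sweep_var n r Bt vs t j)"

definition zvar :: "nat * nat => ratfun" where
 "zvar u = var (idx u)"

lemma idx_bij: "bij_betw idx indices {n+1..n+r}"
 using univ by (simp add: universal_extension_def Let_def Pi_index_eq)

lemma idx_in: "u \<in> indices ==> idx u \<in> {n+1..n+r}" using idx_bij by (auto simp: bij_betw_def)

lemma idx_eq_iff: "u \<in> indices ==> v \<in> indices ==> idx u = idx v <-> u = v"
 using idx_bij by (meson bij_betw_def inj_on_eq_iff)

definition xside :: "nat * nat => ratfun" where
 "xside u = (case u of (t, j) => (PROD i:{i\<in>I. arr i j}. xvar (t, i) ^ nat (- a i j)) *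
   (PROD i:{i\<in>I. arr j i}. xvar (prev (t, i)) ^ nat (- a i j)))"

lemma primitive_relation:
 assumes g: "u \<in> indices"
 shows "xvar (prev u) * xvar u = zvar u * xside u + (PROD w:indices. zvar w ^ c w u)"
proof -
 obtain t j where tj: "u = (t, j)" "j \<in> I" "t <= len j" using g by (cases u) auto
 have pv: "prev_var n r (exchange_matrix a arr) Bt vs t i = xvar (prev (t, i))" if "i \<in> I" for i
  unfolding prev_var_def tau_eq[OF that] xvar_def ..
 have "\<forall>(t, j)\<in>indices.
     prev_var n r (exchange_matrix a arr) Bt vs t j * sweep_var n r Bt vs t j =
      var (idx (t, j)) * (PROD i:{i\<in>I. arr i j}. sweep_var n r Bt vs t i ^ nat (- a i j)) *
       (PROD i:{i\<in>I. arr j i}. prev_var n r (exchange_matrix a arr) Bt vs t i ^ nat (- a i j)) +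
      (PROD w:indices. var (idx w) ^ c w (t, j))"
  using univ unfolding universal_extension_def Let_def Pi_index_eq by blast
 from bspec[OF this g[unfolded tj(1)]] have "prev_var n r (exchange_matrix a arr) Bt vs t j * sweep_var n r Bt vs t j =
      var (idx (t, j)) * (PROD i:{i\<in>I. arr i j}. sweep_var n r Bt vs t i ^ nat (- a i j)) *
       (PROD i:{i\<in>I. arr j i}. prev_var n r (exchange_matrix a arr) Bt vs t i ^ nat (- a i j)) +
      (PROD w:indices. var (idx w) ^ c w (t, j))" by simp
 moreover have "(PROD i:{i\<in>I. arr j i}. prev_var n r (exchange_matrix a arr) Bt vs t i ^ nat (- a i j))
   = (PROD i:{i\<in>I. arr j i}. xvar (prev (t, i)) ^ nat (- a i j))"
  by (intro prod.cong refl) (simp add: pv)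
 ultimately show ?thesis
  using pv[OF tj(2)] unfolding tj(1) xside_def zvar_def by (simp add: xvar_def mult.assoc)
qed

lemma xside_neighbour: "1 <= t ==> xside (t, j) = sd.neighbour_side t j"
 by (simp add: xside_def sd.neighbour_side_def xvar_def prev_def)

lemma c_invariant: "w \<in> indices ==> u \<in> indices ==> c (prev w) (prev u) = c w u"
proof -
 assume g: "w \<in> indices" "u \<in> indices"
 have "tau n (exchange_matrix a arr) vs v = prev v" if "v \<in> indices" for v
  using tau_eq that by (cases v) auto
 thus ?thesis using compat g unfolding compatibility_degree_def Pi_index_eq by metis
qed

lemma c_initial:
 assumes "i \<in> I" "(t, j) \<in> indices"
 shows "int (c (0, i) (t, j)) = max 0 (denominator_exponent n (free_var t j) i)"
 using compat assms unfolding compatibility_degree_def Pi_index_eq by blast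

lemma c_zero:
 assumes i: "i \<in> I" and j: "j \<in> I"
 shows "c (0, i) (0, j) = 0"
proof -
 interpret z: seed_datum n a d arr vs 0 "exchange_matrix a arr" by (rule coefficient_free)
 have "free_var 0 j = var j" by (simp add: z.sweep_var_seedX)
 thus ?thesis using c_initial[OF i, of 0 j] denominator_var[OF j i] j by simp
qed

lemma c_one:
 assumes i: "i \<in> I" and j: "j \<in> I"
 shows "real (c (0, i) (1, j)) = root_at 1 j i"
proof -
 have "(1, j) \<in> indices" using j len_pos[OF j] by simp
 hence "int (c (0, i) (1, j)) = int (first_root j i)"
  using c_initial[OF i] denominator_first_sweep[OF j i] by simp
 thus ?thesis using first_root[OF j i] by simp
qed

lemma c_self: "u \<in> indices ==> c u u = 0"
proof -
 have "(t, j) \<in> indices ==> c (t, j) (t, j) = 0" for t j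
 proof (induction t)
  case 0
  thus ?case using c_zero by simp
 next
  case (Suc t)
  thus ?case using c_invariant[OF Suc.prems Suc.prems] by (simp add: prev_simps)
 qed
 thus "u \<in> indices ==> c u u = 0" by (metis surj_pair)
qed

lemma has_neighbour:
 assumes n: "n >= 2" and j: "j \<in> I"
 shows "EX i:I. i ~= j & a i j ~= 0"
proof (rule ccontr)
 assume no: "~ (EX i:I. i ~= j & a i j ~= 0)"
 define R where "R = {(k, l). k \<in> I & l \<in> I & a k l ~= 0}"
 obtain i where i: "i \<in> I" "i ~= j" using n j by (metis One_nat_def Suc_1 atLeastAtMost_iff le_refl not_less_eq_eq le_trans one_le_numeral)
 have "(j, i) \<in> R\<^sup>*" using connected i(1) j unfolding connected_diagram_def R_def by blast
 hence "i = j"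
 proof (induction rule: rtrancl_induct)
  case (step y z)
  hence "z \<in> I" "a j z ~= 0" by (auto simp: R_def)
  thus ?case using no a_zero[OF j] by metis
 qed simp
 thus False using i(2) by simp
qed

lemma evaluation_exists:
 assumes "set ks \<subseteq> I" "!!k. y k > 0"
 shows "EX z. ALL k. rvalue z (sd.seedX ks k) (y k)"
proof -
 from sd.cvalue_surj[of ks y, OF assms]
 obtain z where z: "ALL k. z k > 0" "sd.cvalue z ks = y" by (elim exE conjE)
 hence "rvalue z (sd.seedX ks k) (y k)" for k using sd.cvalue(1)[of z ks k] by simp
 thus ?thesis by blast
qed

text \<open>The relation produced by mutation and the primitive one are evaluated with
  \<open>z_w = 2\<close> and the other frozen variables \<open>1\<close>, for two values of the
  neighbour term. Varying this term shows that \<open>z_w\<close> does not occur in its coefficient,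
  and the remaining equation yields the exponent of \<open>z_w\<close> in the other term. A
  neighbour that can be varied exists for \<open>n >= 2\<close>.\<close>

lemma compare_exponents:
 assumes n: "n >= 2" and g: "greens = ks @ j # us" and w: "w \<in> indices"
  and gm: "u = (Suc (cnt ks j), j)" "w ~= u"
 shows "sd.seedB ks (idx w) j = int (c w u)"
proof -
 note p = greens_prefix[OF g]
 let ?q = "idx w"
 define b where "b r' = sd.seedB ks r' j" for r'
 have sp: "src_path (ks @ [j])" by (rule green_src_path[OF p(5)])
 have "len j = cnt ks j + Suc (cnt us j)" using g by (simp add: len_def)
 hence gin: "u \<in> indices" using p(3) gm(1) by simp
 have q: "?q \<in> {n+1..n+r}" by (rule idx_in[OF w])
 define Nv where "Nv y = (PROD i:I - {j}. y i ^ nat (- a i j))" for y :: "nat => real"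
 have eq: "Nv y + 2 ^ c w u = 2 ^ nat (b ?q) + 2 ^ nat (- b ?q) * Nv y"
  if y: "!!k. y k > 0" "!!r'. r' \<in> {n+1..n+r} ==> y r' = (if r' = ?q then 2 else 1)" for y
 proof -
  from evaluation_exists[of ks y, OF p(4) y(1)]
  obtain z where rv: "!!k. rvalue z (sd.seedX ks k) (y k)" by blast
  have rf: "rvalue z (var r') (if r' = ?q then 2 else 1)" if "r' \<in> {n+1..n+r}" for r'
   using rv[of r'] sd.seedX_frozen[OF p(4), of r'] y(2)[OF that] that by simp
  have side: "rvalue z (xside u) (Nv y)"
  proof -
   have "xside u = (PROD i:I - {j}. sd.seedX ks i ^ nat (- a i j))"
    unfolding gm(1) using xside_neighbour[of "Suc (cnt ks j)" j] sd.neighbour_side_seed[OF sp] by simp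
   thus ?thesis unfolding Nv_def by (simp only:) (intro rvalue_prod rvalue_power rv)
  qed
  have fr: "rvalue z (sd.frozen_side e var) (2 ^ nat (e ?q))" for e
  proof -
   have "rvalue z (sd.frozen_side e var) (PROD r':{r'\<in>{n+1..n+r}. e r' > 0}. (if r' = ?q then 2 else 1) ^ nat (e r'))"
    unfolding sd.frozen_side_def by (intro rvalue_prod rvalue_power rf) blast
   thus ?thesis unfolding frozen_power_two[OF finite_atLeastAtMost q, of e] .
  qed
  have zw: "rvalue z (zvar v) (if v = w then 2 else 1)" if "v \<in> indices" for v
   unfolding zvar_def using rf[OF idx_in[OF that]] idx_eq_iff[OF that w] by simp
  have "rvalue z (PROD v:indices. zvar v ^ c v u) (PROD v:indices. (if v = w then 2 else 1) ^ c v u)"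
   by (intro rvalue_prod rvalue_power zw)
  also have "(PROD v:indices. (if v = w then 2 else 1) ^ c v u) = (PROD v:indices. if v = w then (2::real) ^ c w u else 1)"
   by (intro prod.cong refl) simp
  also have "... = 2 ^ c w u" using w finite_indices by simp
  finally have cz: "rvalue z (PROD v:indices. zvar v ^ c v u) (2 ^ c w u)" .
  have "rvalue z (zvar u) 1" using zw[OF gin] gm(2) by simp
  from rvalue_add[OF rvalue_mult[OF this side] cz]
  have l: "rvalue z (xvar (prev u) * xvar u) (1 * Nv y + 2 ^ c w u)"
   unfolding primitive_relation[OF gin] .
  have "xvar (prev u) * xvar u = sd.frozen_side b var + sd.frozen_side (%r'. - b r') var * xside u"
   using sd.exchange_relation[OF sp] xside_neighbour[of "Suc (cnt ks j)" j]
   by (simp add: gm(1) xvar_def prev_simps b_def[abs_def])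
  moreover have "rvalue z (sd.frozen_side b var + sd.frozen_side (%r'. - b r') var * xside u)
    (2 ^ nat (b ?q) + 2 ^ nat (- b ?q) * Nv y)"
   by (rule rvalue_add[OF fr[of b] rvalue_mult[OF fr[of "%r'. - b r'"] side]])
  ultimately show ?thesis using rvalue_unique[OF l] by simp
 qed
 obtain i where i: "i \<in> I" "i ~= j" "a i j ~= 0" using has_neighbour[OF n p(3)] by blast
 \<comment> \<open>Two test points: the neighbour term is \<open>1\<close> at \<open>y0\<close>, and
   at \<open>y1\<close> one neighbour is doubled as well.\<close>
 define y0 where "y0 k = (if k = ?q then 2 else 1 :: real)" for k
 define y1 where "y1 k = (if k = ?q | k = i then 2 else 1 :: real)" for k
 have N0: "Nv y0 = 1" unfolding Nv_def using q by (intro prod.neutral ballI) (auto simp: y0_def)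
 have ai: "nat (- a i j) > 0" using a_nonpos[OF i(1) p(3) i(2)] i(3) by simp
 have N1: "Nv y1 = 2 ^ nat (- a i j)"
 proof -
  have "Nv y1 = (PROD k:I - {j}. if k = i then 2 ^ nat (- a i j) else 1)"
   unfolding Nv_def using q by (intro prod.cong refl) (auto simp: y1_def)
  thus ?thesis using i by simp
 qed
 have e0: "1 + 2 ^ c w u = (2::real) ^ nat (b ?q) + 2 ^ nat (- b ?q)"
  using eq[of y0] N0 by (simp add: y0_def)
 have e1: "2 ^ nat (- a i j) + 2 ^ c w u = (2::real) ^ nat (b ?q) + 2 ^ nat (- b ?q) * 2 ^ nat (- a i j)"
  using eq[of y1] N1 i(1) by (simp add: y1_def)
 have "((2::real) ^ nat (- a i j) - 1) * (2 ^ nat (- b ?q) - 1) = 0" using e0 e1 by (simp add: algebra_simps)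
 moreover have "(2::real) ^ nat (- a i j) > 1" using ai by (simp add: one_less_power)
 ultimately have one: "(2::real) ^ nat (- b ?q) = 1" by simp
 have "nat (- b ?q) = 0"
 proof (rule ccontr)
  assume "nat (- b ?q) ~= 0"
  hence "(2::real) ^ nat (- b ?q) > 1" by (intro one_less_power) auto
  thus False using one by simp
 qed
 moreover have "(2::real) ^ c w u = 2 ^ nat (b ?q)" using e0 one by simp
 hence "c w u = nat (b ?q)" by simp
 ultimately show ?thesis by (simp add: b_def)
qed

text \<open>Along green sources the row of \<open>z_(0,i)\<close> changes like the
  \<open>i\<close>-th coordinates of the c-vectors. An initial difference at \<open>j\<close>
  persists until \<open>j\<close> is first mutated; at that moment \<open>compare_exponents\<close>
  and \<open>c_one\<close> identify the two entries, and from then on the difference is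
  zero.\<close>

lemma frozen_row:
 assumes n: "n >= 2" and i: "i \<in> I" and g: "greens = ks @ us"
 shows "ALL j:I. j \<in> set ks --> real_of_int (sd.seedB ks (idx (0, i)) j) = word ks (simple j) i"
  and "ALL j:I. real_of_int (sd.seedB ks (idx (0, i)) j) - word ks (simple j) i
    = (if j \<in> set ks then 0 else real_of_int (Bt (idx (0, i)) j) - simple j i)"
proof -
 let ?r = "idx (0, i)"
 have w: "(0, i) \<in> indices" using i by simp
 have "ALL j:I. real_of_int (sd.seedB ks ?r j) - word ks (simple j) i
    = (if j \<in> set ks then 0 else real_of_int (Bt ?r j) - simple j i)" using g
 proof (induction ks arbitrary: us rule: rev_induct)
  case Nil
  thus ?case by simp
 next
  case (snoc k ks)
  hence gk: "greens = ks @ k # us" by simp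
  note p = greens_prefix[OF gk]
  have sp: "src_path ks" by (rule green_src_path[OF p(1)])
  have IH: "real_of_int (sd.seedB ks ?r j) - word ks (simple j) i
    = (if j \<in> set ks then 0 else real_of_int (Bt ?r j) - simple j i)" if "j \<in> I" for j
   using snoc.IH[OF gk] that by blast
  have pos: "word ks (simple k) i >= 0"
  proof -
   have "hgt (word ks (simple k)) > 0" using p(5) by (simp add: grn_path_snoc)
   thus ?thesis using root_height(2)[OF word_root[OF p(4) simple_root[OF p(3)]]] by blast
  qed
  have bk: "real_of_int (sd.seedB ks ?r k) = word ks (simple k) i"
  proof (cases "k \<in> set ks")
   case True
   thus ?thesis using IH[OF p(3)] by simp
  next
   case False
   hence "cnt ks k = 0" by (simp add: count_list_0_iff)
   hence "sd.seedB ks ?r k = int (c (0, i) (1, k))" "root_at 1 k = word ks (simple k)"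
    using compare_exponents[OF n gk w refl] root_at_eq[OF gk] by simp_all
   thus ?thesis using c_one[OF i p(3)] by simp
  qed
  have rn: "?r \<notin> I" "?r ~= k" using idx_in[OF w] p(3) by auto
  show ?case
  proof
   fix j assume j: "j \<in> I"
   show "real_of_int (sd.seedB (ks @ [k]) ?r j) - word (ks @ [k]) (simple j) i
     = (if j \<in> set (ks @ [k]) then 0 else real_of_int (Bt ?r j) - simple j i)"
   proof (cases "j = k")
    case True
    have "word (ks @ [k]) (simple k) i = - word ks (simple k) i"
     using word_source[OF p(3), of ks] by simp
    thus ?thesis using True bk by (simp add: sd.seedB_snoc mutate_matrix_def)
   next
    case False
    have src: "~ arrows ks j k" using p(2) j by (simp add: is_source_def)
    have bkj: "sd.seedB ks k j = - a k j" "a k j <= 0"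
     using sd.seedB_arrows[OF sp p(3) j] src arrows_adj(1)[OF p(3) j, of ks] False
      a_nonpos[OF p(3) j] by (auto simp: exchange_matrix_def)
    have "sd.seedB ks ?r k >= 0" using bk pos by simp
    hence "sd.seedB (ks @ [k]) ?r j = sd.seedB ks ?r j - a k j * sd.seedB ks ?r k"
     using bkj rn(2) False by (simp add: sd.seedB_snoc mutate_matrix_def)
    hence "real_of_int (sd.seedB (ks @ [k]) ?r j) = real_of_int (sd.seedB ks ?r j) - of_int (a k j) * word ks (simple k) i"
     using bk by simp
    moreover have "word (ks @ [k]) (simple j) = word ks (simple j) - of_int (a k j) *R word ks (simple k)"
     by (rule word_other[OF p(3) j])
    ultimately show ?thesis using IH[OF j] False by simp
   qed
  qed
 qed
 thus "ALL j:I. real_of_int (sd.seedB ks ?r j) - word ks (simple j) i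
    = (if j \<in> set ks then 0 else real_of_int (Bt ?r j) - simple j i)"
  "ALL j:I. j \<in> set ks --> real_of_int (sd.seedB ks ?r j) = word ks (simple j) i" by auto
qed

text \<open>With a single vertex the second mutation would take place at \<open>- simple j\<close>,
  which is not green.\<close>

lemma len_one:
 assumes "n < 2" "j \<in> I"
 shows "len j = 1"
proof (rule ccontr)
 have n1: "n = 1" "j = 1" using assms by auto
 assume "len j ~= 1"
 hence l: "len j >= 2" using len_pos[OF assms(2)] by simp
 then obtain ks us where ks: "greens = ks @ j # us" "cnt ks j = 1"
  using split_at_count[of 2 greens j] unfolding len_def by auto
 then obtain ls ws where ls: "ks = ls @ j # ws" "cnt ls j = 0" using split_at_count[of 1 ks j] by auto
 note p = greens_prefix[OF ks(1)]
 have "cnt ws j = 0" using ks(2) ls by simp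
 hence "1 \<notin> set ls" "1 \<notin> set ws" using ls(2) n1 by (simp_all add: count_list_0_iff)
 moreover have "set ls \<subseteq> {1}" "set ws \<subseteq> {1}" using p(4) ls(1) n1 by auto
 ultimately have "set ls = {} & set ws = {}" using subset_singletonD[of "set ls" 1] subset_singletonD[of "set ws" 1] by auto
 hence "ks = [j]" using ls(1) by simp
 moreover have "hgt (word ks (simple j)) > 0" using p(5) by (simp add: grn_path_snoc)
 ultimately have "hgt (srefl j (simple j)) > 0" by simp
 thus False using srefl_simple[OF assms(2)] sd.height_simple[OF assms(2)] by (simp add: height_minus)
qed

theorem c_root_vec:
 assumes i: "i \<in> I" and g: "u \<in> indices"
 shows "real (c (0, i) u) = root_vec u i"
proof -
 obtain t j where tj: "u = (t, j)" "j \<in> I" "t <= len j" using g by (cases u) auto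
 show ?thesis
 proof (cases "t <= 1")
  case True
  then consider "t = 0" | "t = 1" by linarith
  thus ?thesis using c_zero[OF i tj(2)] c_one[OF i tj(2)] tj(1) by cases (auto simp: root_vec_def)
 next
  case False
  have n2: "n >= 2"
  proof (rule ccontr)
   assume "~ n >= 2"
   hence "len j = 1" using len_one[OF _ tj(2)] by simp
   thus False using False tj(3) by simp
  qed
  obtain ks us where ks: "greens = ks @ j # us" "Suc (cnt ks j) = t"
   using split_at_count[of t greens j] False tj(3) unfolding len_def by auto
  have "cnt ks j ~= 0" using ks(2) False by simp
  hence jk: "j \<in> set ks" by (simp add: count_list_0_iff)
  have "real_of_int (sd.seedB ks (idx (0, i)) j) = word ks (simple j) i"
   using frozen_row(1)[OF n2 i, of ks "j # us"] ks(1) tj(2) jk by blast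
  moreover have "sd.seedB ks (idx (0, i)) j = int (c (0, i) u)"
   by (rule compare_exponents[OF n2 ks(1)]) (use i tj ks(2) False in auto)
  moreover have "root_vec u = word ks (simple j)" using root_at_eq[OF ks(1)] ks(2) False tj(1) by (simp add: root_vec_def)
  ultimately show ?thesis by simp
 qed
qed

end

section \<open>The exponent identity\<close>

context sweep_datum begin

text \<open>The variable at \<open>k\<close> in the exchange relation of \<open>u\<close> lies in
  the same sweep if \<open>k\<close> is mutated before the vertex of \<open>u\<close>, and in the
  preceding one otherwise; a nonadjacent \<open>k\<close> always comes with exponent zero.\<close>

definition nbr :: "nat * nat => nat => nat * nat" where
 "nbr u k = (case u of (t, j) => if arr k j then (t, k) else prev (t, k))"

text \<open>The exponent of \<open>x_v\<close> in the monomial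
  \<open>N_w / (x_(prev w) x_w)\<close>.\<close>

definition expo :: "nat * nat => nat * nat => int" where
 "expo v w = (SUM k:I - {snd w}. of_bool (v = nbr w k) * (- a k (snd w)))
   - of_bool (v = w) - of_bool (v = prev w)"

definition nside :: "(nat * nat => 'f) => nat * nat => 'f::comm_monoid_mult" where
 "nside x w = (PROD k:I - {snd w}. x (nbr w k) ^ nat (- a k (snd w)))"

lemma adjacent_cases:
 assumes "j \<in> I" "k \<in> I - {j}"
 obtains "a k j = 0" "~ arr k j" "~ arr j k" | "arr k j" "~ arr j k" "a k j < 0" | "arr j k" "~ arr k j" "a k j < 0"
proof -
 have k: "k \<in> I" "k ~= j" using assms by auto
 show ?thesis using that arr_adj[OF k(1) assms(1)] a_nonpos[OF k(1) assms(1) k(2)] k(2) by force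
qed

lemma len_arr:
 assumes "i \<in> I" "j \<in> I" "arr i j"
 shows "len j <= len i" "len i <= Suc (len j)"
 using opp_arr[OF assms] by auto

text \<open>The lengths of adjacent vertices differ by at most one, in the direction given by the
  arrow, which keeps the neighbour within its range.\<close>

lemma nbr_in:
 assumes g: "(t, j) \<in> indices" and k: "k \<in> I - {j}" "a k j ~= 0"
 shows "nbr (t, j) k \<in> indices"
proof -
 have j: "j \<in> I" "t <= len j" and kn: "k \<in> I" using g k by auto
 show ?thesis
 proof (cases rule: adjacent_cases[OF j(1) k(1)])
  case 1
  thus ?thesis using k by simp
 next
  case 2
  thus ?thesis using len_arr(1)[OF kn j(1)] kn j(2) by (simp add: nbr_def)
 next
  case 3
  show ?thesis
  proof (cases t)
   case 0
   thus ?thesis using prev_in[of "(0, k)"] kn 3 by (simp add: nbr_def)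
  next
   case (Suc s)
   thus ?thesis using len_arr(2)[OF j(1) kn 3(1)] j(2) kn 3 by (simp add: nbr_def prev_simps)
  qed
 qed
qed

text \<open>Induction in the order of production: all other variables in the exchange relation of
  \<open>(Suc t, j)\<close> come earlier.\<close>

lemma indices_induct [consumes 1, case_names zero Suc]:
 assumes g: "u \<in> indices" and zero: "!!j. j \<in> I ==> Q (0, j)"
  and Suc: "!!t j. (Suc t, j) \<in> indices ==> Q (t, j) ==>
   (!!k. k \<in> I - {j} ==> a k j ~= 0 ==> Q (nbr (Suc t, j) k)) ==> Q (Suc t, j)" shows "Q u"
proof -
 have all: "ALL p<n. t <= len (vs ! p) --> Q (t, vs ! p)" for t
 proof (induction t)
  case 0
  show ?case using zero vs_nth by blast
 next
  case (Suc t)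
  have "p < n ==> Suc t <= len (vs ! p) ==> Q (Suc t, vs ! p)" for p
  proof (induction p rule: less_induct)
   case (less p)
   let ?j = "vs ! p" and ?g = "(Suc t, vs ! p)"
   have j: "?j \<in> I" using vs_nth less.prems by blast
   have g: "?g \<in> indices" using j less.prems by simp
   have "Q (nbr ?g k)" if k: "k \<in> I - {?j}" "a k ?j ~= 0" for k
   proof -
    have kn: "k \<in> I" using k by blast
    obtain q where q: "q < n" "k = vs ! q" using kn vs length_vs by (metis in_set_conv_nth)
    have nin: "nbr ?g k \<in> indices" by (rule nbr_in[OF g k])
    show ?thesis
    proof (cases "arr k ?j")
     case True
     hence e: "nbr ?g k = (Suc t, vs ! q)" using q by (simp add: nbr_def)
     have "q < p" using arr_vs[OF q(1) less.prems(1)] True q(2) by simp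
     thus ?thesis using less.IH[OF _ q(1)] nin unfolding e by simp
    next
     case False
     hence e: "nbr ?g k = (t, vs ! q)" using q by (simp add: nbr_def prev_simps)
     thus ?thesis using Suc.IH q(1) nin by simp
    qed
   qed
   moreover have "Q (t, ?j)" using Suc.IH less.prems by simp
   ultimately show ?case using assms(3)[OF g] by blast
  qed
  thus ?case by blast
 qed
 obtain t j where tj: "u = (t, j)" by (meson surj_pair)
 hence j: "j \<in> I" "t <= len j" using g by simp_all
 obtain q where q: "q < n" "j = vs ! q" using j(1) vs length_vs by (metis in_set_conv_nth)
 show ?thesis using all[of t] q j(2) unfolding tj by simp
qed

text \<open>The effect of \<open>prev\<close> on vertices; the passage through \<open>t = 0\<close>
  renames by \<open>opp\<close>.\<close>

definition shift_vertex :: "nat => nat => nat" where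
 "shift_vertex t k = (if t = 0 then opp k else k)"

lemma snd_prev: "snd (prev (t, j)) = shift_vertex t j"
 by (cases t) (simp_all add: prev_simps shift_vertex_def)

lemma shift_vertex_bij:
 assumes "j \<in> I"
 shows "bij_betw (shift_vertex t) (I - {j}) (I - {shift_vertex t j})"
proof (cases "t = 0")
 case True
 hence "shift_vertex t = opp" by (simp add: fun_eq_iff shift_vertex_def)
 moreover have "bij_betw opp (I - {j}) (I - {opp j})"
 proof (intro bij_betw_byWitness[where f' = opp] ballI)
  show "opp (opp k) = k" if "k \<in> I - {j}" for k using opp_opp that by blast
  show "opp (opp k) = k" if "k \<in> I - {opp j}" for k using opp_opp that by blast
  show "opp ` (I - {j}) \<subseteq> I - {opp j}"
  proof (rule image_subsetI)
   fix k assume k: "k \<in> I - {j}"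
   hence "opp (opp k) ~= opp (opp j)" using opp_opp[of k] opp_opp[OF assms] by simp
   thus "opp k \<in> I - {opp j}" using opp(1)[of k] k by auto
  qed
  show "opp ` (I - {opp j}) \<subseteq> I - {j}"
  proof (rule image_subsetI)
   fix k assume k: "k \<in> I - {opp j}"
   hence "opp k ~= j" using opp_opp[of k] by auto
   thus "opp k \<in> I - {j}" using opp(1)[of k] k by simp
  qed
 qed
 ultimately show ?thesis by simp
next
 case False
 hence "shift_vertex t = id" by (simp add: fun_eq_iff shift_vertex_def)
 thus ?thesis by simp
qed

lemma shift_vertex_a: "j \<in> I ==> k \<in> I ==> a (shift_vertex t k) (shift_vertex t j) = a k j"
 using opp_a by (simp add: shift_vertex_def)

text \<open>Only the passage through \<open>t = 0\<close> needs an argument: there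
  \<open>opp_arr\<close> decides in which of two adjacent sweeps the neighbour lies.\<close>

lemma nbr_prev:
 assumes g: "(t, j) \<in> indices" and k: "k \<in> I - {j}" "a k j ~= 0"
 shows "nbr (prev (t, j)) (shift_vertex t k) = prev (nbr (t, j) k)"
proof -
 have j: "j \<in> I" "t <= len j" and kn: "k \<in> I" using g k by auto
 show ?thesis
 proof (cases t)
  case (Suc s)
  thus ?thesis by (simp add: nbr_def prev_simps shift_vertex_def)
 next
  case 0
  note o = opp(1)[OF j(1)] opp(1)[OF kn]
  have kj: "opp k \<in> I - {opp j}" using o opp_opp[OF j(1)] opp_opp[OF kn] k(1) by force
  have oa: "a (opp k) (opp j) ~= 0" using opp_a[OF kn j(1)] k(2) by simp
  have S: "nbr (prev (t, j)) (shift_vertex t k) = nbr (len (opp j), opp j) (opp k)"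
   using 0 by (simp add: prev_simps shift_vertex_def)
  have lk: "len (opp k) >= 1" using len_pos[OF o(2)] .
  show ?thesis
  proof (cases rule: adjacent_cases[OF o(1) kj])
   case 1
   thus ?thesis using oa by simp
  next
   case 2
   from opp_arr[OF o(2,1) 2(1)] opp_opp[OF j(1)] opp_opp[OF kn]
   consider "len (opp k) = len (opp j)" "arr k j" | "len (opp k) = Suc (len (opp j))" "arr j k" by auto
   thus ?thesis
   proof cases
    case a: 1
    thus ?thesis unfolding S using 2 0 by (simp add: nbr_def prev_simps)
   next
    case b: 2
    hence "~ arr k j" using arr_adj(2)[OF kn j(1)] by blast
    thus ?thesis unfolding S using 2 0 b by (simp add: nbr_def prev_simps)
   qed
  next
   case 3
   from opp_arr[OF o(1,2) 3(1)] opp_opp[OF j(1)] opp_opp[OF kn]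
   consider "len (opp j) = len (opp k)" "arr j k" | "len (opp j) = Suc (len (opp k))" "arr k j" by auto
   thus ?thesis
   proof cases
    case a: 1
    hence "~ arr k j" using arr_adj(2)[OF kn j(1)] by blast
    thus ?thesis unfolding S using 3 0 a by (simp add: nbr_def prev_simps)
   next
    case b: 2
    thus ?thesis unfolding S using 3 0 by (simp add: nbr_def prev_simps)
   qed
  qed
 qed
qed

lemma expo_prev:
 assumes d: "v \<in> indices" and w: "w \<in> indices"
 shows "expo (prev v) (prev w) = expo v w"
proof -
 obtain t j where tj: "w = (t, j)" by (meson surj_pair)
 have j: "j \<in> I" using w tj by simp
 let ?f = "%k. of_bool (prev v = nbr (prev w) k) * (- a k (snd (prev w)))"
 have "(SUM k:I - {snd (prev w)}. ?f k) = (SUM k:I - {j}. ?f (shift_vertex t k))"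
  unfolding tj snd_prev by (rule sum.reindex_bij_betw[OF shift_vertex_bij[OF j], symmetric])
 also have "... = (SUM k:I - {j}. of_bool (v = nbr w k) * (- a k j))"
 proof (intro sum.cong refl)
  fix k assume k: "k \<in> I - {j}"
  have e: "a (shift_vertex t k) (snd (prev w)) = a k j" unfolding tj snd_prev using shift_vertex_a[OF j] k by blast
  show "?f (shift_vertex t k) = of_bool (v = nbr w k) * (- a k j)"
  proof (cases "a k j = 0")
   case True
   thus ?thesis unfolding e by simp
  next
   case False
   have "nbr w k \<in> indices" using nbr_in[OF w[unfolded tj] k False] tj by simp
   hence "prev v = prev (nbr w k) <-> v = nbr w k" by (rule prev_eq_iff[OF d])
   thus ?thesis unfolding e using nbr_prev[OF w[unfolded tj] k False] tj by simp
  qed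
 qed
 finally show ?thesis
  using prev_eq_iff[OF d w] prev_eq_iff[OF d prev_in[OF w]] tj by (simp add: expo_def)
qed

lemma expo_initial:
 assumes i: "i \<in> I" and w: "w \<in> indices"
 shows "expo (0, i) w = (SUM j:I. of_bool (w = (0, j)) * (if arr i j then - a i j else 0)
   + of_bool (w = (1, j)) * (if arr j i then - a i j else 0)) - of_bool (w = (0, i)) - of_bool (w = (1, i))"
proof -
 obtain t j where tj: "w = (t, j)" by (meson surj_pair)
 have j: "j \<in> I" using w tj by simp
 have pv: "prev (t, k) = (0, i) <-> t = 1 & k = i" if "k \<in> I" for k
 proof (cases t)
  case 0
  thus ?thesis using len_pos[OF opp(1)[OF that]] by (simp add: prev_simps)
 qed (simp add: prev_simps)
 define g where "g = of_bool (t = 0) * (if arr i j then - a i j else 0) + of_bool (t = 1) * (if arr j i then - a i j else 0)"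
 have "(SUM k:I - {j}. of_bool ((0, i) = nbr w k) * (- a k j)) = (SUM k:I - {j}. if k = i then g else 0)"
 proof (intro sum.cong refl)
  fix k assume k: "k \<in> I - {j}"
  hence kn: "k \<in> I" by blast
  show "of_bool ((0, i) = nbr w k) * (- a k j) = (if k = i then g else 0)"
  proof (cases rule: adjacent_cases[OF j k])
   case 1
   thus ?thesis by (auto simp: g_def)
  next
   case 2
   thus ?thesis unfolding tj by (auto simp: nbr_def g_def)
  next
   case 3
   have "(0, i) = nbr w k <-> t = 1 & k = i" unfolding tj using 3 pv[OF kn] by (auto simp: nbr_def)
   thus ?thesis using 3 by (auto simp: g_def)
  qed
 qed
 also have "... = g" using arr_irrefl[OF j] i by (auto simp: g_def)
 also have "g = (SUM l:I. if l = j then g else 0)" using j by simp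
 also have "... = (SUM l:I. of_bool (w = (0, l)) * (if arr i l then - a i l else 0)
   + of_bool (w = (1, l)) * (if arr l i then - a i l else 0))"
  unfolding tj by (intro sum.cong refl) (auto simp: g_def)
 finally have s: "(SUM k:I - {j}. of_bool ((0, i) = nbr w k) * (- a k j)) = (SUM l:I. of_bool (w = (0, l)) * (if arr i l then - a i l else 0)
   + of_bool (w = (1, l)) * (if arr l i then - a i l else 0))" .
 have "(0, i) = prev w <-> w = (1, i)" unfolding tj using pv[OF j] by auto
 thus ?thesis unfolding expo_def using s tj by auto
qed

lemma powi_sum: "(y :: 'f::field) ~= 0 ==> y powi (SUM k:A. f k) = (PROD k:A. y powi f k)"
 by (induction A rule: infinite_finite_induct) (simp_all add: power_int_add)

lemma prod_powi_delta:
 fixes x :: "nat * nat => 'f::field"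
 assumes "u \<in> indices"
 shows "(PROD v:indices. x v powi (of_bool (v = u) * m)) = x u powi m"
proof -
 have "(PROD v:indices. x v powi (of_bool (v = u) * m)) = (PROD v:indices. if v = u then x u powi m else 1)"
  by (intro prod.cong refl) simp
 thus ?thesis using assms finite_indices by simp
qed

lemma nside_expo:
 fixes x :: "nat * nat => 'f::field"
 assumes x: "!!u. u \<in> indices ==> x u ~= 0" and w: "w \<in> indices"
 shows "nside x w / (x (prev w) * x w) = (PROD v:indices. x v powi expo v w)"
proof -
 obtain t j where tj: "w = (t, j)" by (meson surj_pair)
 have j: "j \<in> I" using w tj by simp
 have "(PROD v:indices. x v powi expo v w)
   = (PROD v:indices. (PROD k:I - {j}. x v powi (of_bool (v = nbr w k) * (- a k j)))
     * x v powi (of_bool (v = w) * (- 1)) * x v powi (of_bool (v = prev w) * (- 1)))"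
 proof (intro prod.cong refl)
  fix v assume d: "v \<in> indices"
  have e: "expo v w = (SUM k:I - {j}. of_bool (v = nbr w k) * (- a k j)) + of_bool (v = w) * (- 1) + of_bool (v = prev w) * (- 1)"
   by (simp add: expo_def tj)
  have pa: "x v powi (p + q) = x v powi p * x v powi q" for p q
   by (rule power_int_add) (use x[OF d] in blast)
  show "x v powi expo v w = (PROD k:I - {j}. x v powi (of_bool (v = nbr w k) * (- a k j)))
     * x v powi (of_bool (v = w) * (- 1)) * x v powi (of_bool (v = prev w) * (- 1))"
   unfolding e pa powi_sum[OF x[OF d]] ..
 qed
 also have "... = (PROD k:I - {j}. PROD v:indices. x v powi (of_bool (v = nbr w k) * (- a k j)))
   * x w powi (- 1) * x (prev w) powi (- 1)"
  unfolding prod.distrib prod_powi_delta[OF w] prod_powi_delta[OF prev_in[OF w]] by (subst prod.swap) (rule refl)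
 also have "(PROD k:I - {j}. PROD v:indices. x v powi (of_bool (v = nbr w k) * (- a k j))) = nside x w"
  unfolding nside_def
 proof (intro prod.cong)
  fix k assume "k \<in> I - {snd w}"
  hence k: "k \<in> I - {j}" using tj by simp
  show "(PROD v:indices. x v powi (of_bool (v = nbr w k) * (- a k j))) = x (nbr w k) ^ nat (- a k (snd w))"
  proof (cases "a k j = 0")
   case True
   thus ?thesis using tj by simp
  next
   case False
   have "a k j <= 0" using a_nonpos[of k j] k j by blast
   hence "x (nbr w k) powi (- a k j) = x (nbr w k) ^ nat (- a k (snd w))" by (simp add: power_int_def tj)
   moreover have "nbr w k \<in> indices" using nbr_in[OF w[unfolded tj] k False] tj by simp
   ultimately show ?thesis using prod_powi_delta[of "nbr w k" x "- a k j"] by argo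
  qed
 qed (simp add: tj)
 finally show ?thesis by (simp add: divide_inverse power_int_minus mult_ac)
qed

end

context universal_datum begin

lemma c_recurrence:
 assumes g: "u \<in> indices" and i: "i \<in> I"
 shows "int (c (0, i) u) + int (c (0, i) (prev u))
   + (SUM j:I. a i j * (if arr i j then int (c (0, j) u) else if arr j i then int (c (0, j) (prev u)) else 0))
   = of_bool (u = (0, i)) + of_bool (prev u = (0, i))" (is "?l = ?r")
proof -
 have "real_of_int ?l = root_vec u i + root_vec (prev u) i
   + (SUM j:I. of_int (a i j) * (if arr i j then root_vec u j else if arr j i then root_vec (prev u) j else 0))"
  using c_root_vec[OF i g] c_root_vec[OF i prev_in[OF g]] c_root_vec[OF _ g] c_root_vec[OF _ prev_in[OF g]]
  by (simp del: atLeastAtMost_iff) (intro sum.cong refl, simp del: atLeastAtMost_iff)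
 also have "... = real_of_int ?r" using root_vec_recurrence[OF g i] by simp
 finally show ?thesis by (simp only: of_int_eq_iff)
qed

text \<open>Both factors are invariant under \<open>prev\<close>, so it suffices to take
  \<open>v = (0, i)\<close>. Then only indices with \<open>t <= 1\<close> contribute, and as
  \<open>c (1, j) u = c (0, j) (prev u)\<close> the sum becomes the recurrence for root
  coordinates.\<close>

lemma expo_sum:
 assumes "v \<in> indices" "u \<in> indices"
 shows "(SUM w:indices. expo v w * int (c w u)) = - of_bool (v = u) - of_bool (v = prev u)"
proof -
 have "(s, i) \<in> indices ==> u \<in> indices ==>
   (SUM w:indices. expo (s, i) w * int (c w u)) = - of_bool ((s, i) = u) - of_bool ((s, i) = prev u)" for s i u
 proof (induction s arbitrary: u)
  case 0
  have i: "i \<in> I" using 0 by simp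
  have delta: "(SUM w:indices. of_bool (w = \<epsilon>) * m * int (c w u)) = m * int (c \<epsilon> u)" if "\<epsilon> \<in> indices" for \<epsilon> m
  proof -
   have "(SUM w:indices. of_bool (w = \<epsilon>) * m * int (c w u)) = (SUM w:indices. if w = \<epsilon> then m * int (c \<epsilon> u) else 0)"
    by (intro sum.cong refl) simp
   thus ?thesis using that finite_indices by simp
  qed
  have in_ix: "(0, j) \<in> indices" "(1, j) \<in> indices" if "j \<in> I" for j
   using that len_pos[OF that] by simp_all
  have one: "c (1, j) u = c (0, j) (prev u)" if "j \<in> I" for j
   using c_invariant[OF in_ix(2)[OF that] 0(2)] by (simp add: prev_def)
  have "(SUM w:indices. expo (0, i) w * int (c w u))
    = (SUM w:indices. (SUM j:I. of_bool (w = (0, j)) * (if arr i j then - a i j else 0) * int (c w u)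
      + of_bool (w = (1, j)) * (if arr j i then - a i j else 0) * int (c w u))
     - of_bool (w = (0, i)) * 1 * int (c w u) - of_bool (w = (1, i)) * 1 * int (c w u))"
   by (intro sum.cong refl) (simp only: expo_initial[OF i] sum_distrib_right distrib_right left_diff_distrib mult_1_right)
  also have "... = (SUM j:I. (if arr i j then - a i j else 0) * int (c (0, j) u) + (if arr j i then - a i j else 0) * int (c (1, j) u))
     - 1 * int (c (0, i) u) - 1 * int (c (1, i) u)"
   unfolding sum_subtractf delta[OF in_ix(1)[OF i]] delta[OF in_ix(2)[OF i]]
   by (subst sum.swap) (simp only: sum.distrib delta[OF in_ix(1)] delta[OF in_ix(2)] cong: sum.cong)
  also have "(SUM j:I. (if arr i j then - a i j else 0) * int (c (0, j) u) + (if arr j i then - a i j else 0) * int (c (1, j) u))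
    = - (SUM j:I. a i j * (if arr i j then int (c (0, j) u) else if arr j i then int (c (0, j) (prev u)) else 0))"
   unfolding sum_negf[symmetric]
  proof (intro sum.cong refl)
   fix j assume j: "j \<in> I"
   show "(if arr i j then - a i j else 0) * int (c (0, j) u) + (if arr j i then - a i j else 0) * int (c (1, j) u)
     = - (a i j * (if arr i j then int (c (0, j) u) else if arr j i then int (c (0, j) (prev u)) else 0))"
    using arr_adj(2)[OF i j] one[OF j] by auto
  qed
  finally have "(SUM w:indices. expo (0, i) w * int (c w u)) = - (of_bool (u = (0, i)) + of_bool (prev u = (0, i)))"
   using c_recurrence[OF 0(2) i] one[OF i] by simp
  thus ?case by (simp add: eq_commute)
 next
  case (Suc s)
  have d: "(Suc s, i) \<in> indices" "(s, i) \<in> indices" "prev (Suc s, i) = (s, i)" using Suc.prems by (simp_all add: prev_simps)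
  note pg = prev_in[OF Suc.prems(2)]
  have "(SUM w:indices. expo (Suc s, i) w * int (c w u))
    = (SUM w:indices. expo (s, i) (prev w) * int (c (prev w) (prev u)))"
   using expo_prev[OF d(1)] c_invariant[OF _ Suc.prems(2)] d(3) by (intro sum.cong refl) simp
  also have "... = (SUM w:indices. expo (s, i) w * int (c w (prev u)))"
   by (rule sum.reindex_bij_betw[OF prev_bij])
  also have "... = - of_bool ((s, i) = prev u) - of_bool ((s, i) = prev (prev u))"
   by (rule Suc.IH[OF d(2) pg])
  also have "(s, i) = prev u <-> (Suc s, i) = u" using prev_eq_iff[OF d(1) Suc.prems(2)] d(3) by simp
  also have "(s, i) = prev (prev u) <-> (Suc s, i) = prev u" using prev_eq_iff[OF d(1) pg] d(3) by simp
  finally show ?case .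
 qed
 from this[of "fst v" "snd v" u] show ?thesis using assms by simp
qed

text \<open>Comparing exponents reduces the product to \<open>expo_sum\<close>. It is needed in
  arbitrary fields because it is applied both to the cluster variables and to the scalars of torus
  elements.\<close>

theorem nside_identity:
 fixes x :: "nat * nat => 'f::field"
 assumes x: "!!u. u \<in> indices ==> x u ~= 0" and g: "u \<in> indices"
 shows "(PROD w:indices. (nside x w / (x (prev w) * x w)) ^ c w u) = inverse (x (prev u) * x u)"
proof -
 have "(PROD w:indices. (nside x w / (x (prev w) * x w)) ^ c w u)
   = (PROD w:indices. PROD v:indices. x v powi (expo v w * int (c w u)))"
 proof (intro prod.cong refl)
  fix w assume w: "w \<in> indices"
  have e: "nside x w / (x (prev w) * x w) = (PROD v:indices. x v powi expo v w)"
   by (rule nside_expo[OF _ w]) (rule x)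
  show "(nside x w / (x (prev w) * x w)) ^ c w u = (PROD v:indices. x v powi (expo v w * int (c w u)))"
   unfolding e prod_power_distrib power_int_mult by simp
 qed
 also have "... = (PROD v:indices. x v powi (SUM w:indices. expo v w * int (c w u)))"
  by (subst prod.swap) (simp add: powi_sum x)
 also have "... = (PROD v:indices. x v powi (of_bool (v = u) * - 1) * x v powi (of_bool (v = prev u) * - 1))"
 proof (intro prod.cong refl)
  fix v assume d: "v \<in> indices"
  show "x v powi (SUM w:indices. expo v w * int (c w u)) = x v powi (of_bool (v = u) * - 1) * x v powi (of_bool (v = prev u) * - 1)"
   unfolding expo_sum[OF d g] by (simp add: power_int_diff power_int_minus x[OF d] field_simps)
 qed
 also have "... = inverse (x (prev u) * x u)"
  unfolding prod.distrib prod_powi_delta[OF g] prod_powi_delta[OF prev_in[OF g]] by (simp add: power_int_minus)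
 finally show ?thesis .
qed

lemma xside_nside: 
 assumes g: "u \<in> indices"
 shows "xside u = nside xvar u"
proof -
 obtain t j where tj: "u = (t, j)" by (meson surj_pair)
 have j: "j \<in> I" using g tj by simp
 have "nside xvar u = (PROD i:{i\<in>I. arr i j} \<union> {i\<in>I. arr j i}. xvar (nbr (t, j) i) ^ nat (- a i j))"
  unfolding nside_def tj snd_conv
 proof (rule prod.mono_neutral_right)
  show "{i\<in>I. arr i j} \<union> {i\<in>I. arr j i} \<subseteq> I - {j}" using arr_irrefl[OF j] by auto
  show "ALL i:I - {j} - ({i\<in>I. arr i j} \<union> {i\<in>I. arr j i}). xvar (nbr (t, j) i) ^ nat (- a i j) = 1"
  proof
   fix i assume "i \<in> I - {j} - ({i\<in>I. arr i j} \<union> {i\<in>I. arr j i})"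
   hence "a i j = 0" using arr_adj(1)[OF _ j, of i] by auto
   thus "xvar (nbr (t, j) i) ^ nat (- a i j) = 1" by simp
  qed
 qed simp
 also have "... = (PROD i:{i\<in>I. arr i j}. xvar (nbr (t, j) i) ^ nat (- a i j)) * (PROD i:{i\<in>I. arr j i}. xvar (nbr (t, j) i) ^ nat (- a i j))"
  using arr_adj(2)[OF _ j] by (intro prod.union_disjoint) auto
 also have "(PROD i:{i\<in>I. arr j i}. xvar (nbr (t, j) i) ^ nat (- a i j)) = (PROD i:{i\<in>I. arr j i}. xvar (prev (t, i)) ^ nat (- a i j))"
  using arr_adj(2)[OF _ j] by (intro prod.cong refl) (auto simp: nbr_def)
 also have "(PROD i:{i\<in>I. arr i j}. xvar (nbr (t, j) i) ^ nat (- a i j)) = (PROD i:{i\<in>I. arr i j}. xvar (t, i) ^ nat (- a i j))"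
  by (intro prod.cong refl) (simp add: nbr_def)
 finally show ?thesis by (simp add: xside_def tj)
qed

end

section \<open>The configuration ring and the invariants\<close>

lemma ring_on_simps [simp]:
 "carrier (ring_on A) = A" "x \<otimes>\<^bsub>ring_on A\<^esub> y = x * y" "x \<oplus>\<^bsub>ring_on A\<^esub> y = x + y"
 "\<one>\<^bsub>ring_on A\<^esub> = 1" "\<zero>\<^bsub>ring_on A\<^esub> = 0" by (simp_all add: ring_on_def)

lemma cring_ring_on:
 assumes "1 \<in> A" "!!x y. x \<in> A ==> y \<in> A ==> x + y \<in> A" "!!x y. x \<in> A ==> y \<in> A ==> x * y \<in> A"
  "!!x. x \<in> A ==> - x \<in> A" shows "cring (ring_on A)"
proof (rule cringI)
 have z: "0 \<in> A" using assms(2)[OF assms(1) assms(4)[OF assms(1)]] by simp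
 show "abelian_group (ring_on A)"
 proof (rule abelian_groupI)
  show "EX y:carrier (ring_on A). y \<oplus>\<^bsub>ring_on A\<^esub> x = \<zero>\<^bsub>ring_on A\<^esub>" if "x \<in> carrier (ring_on A)" for x
   using that assms(4)[of x] by (intro bexI[of _ "- x"]) simp_all
 qed (use assms z in "auto simp: algebra_simps")
 show "Group.comm_monoid (ring_on A)"
  by (rule Group.comm_monoidI) (use assms in "auto simp: algebra_simps")
qed (auto simp: algebra_simps)

lemma ideal_ring_on:
 assumes A: "cring (ring_on A)" and I: "I \<subseteq> A" "0 \<in> I" "!!x y. x \<in> I ==> y \<in> I ==> x + y \<in> I"
  "!!x y. x \<in> I ==> y \<in> A ==> x * y \<in> I" and m: "- 1 \<in> A" shows "ideal I (ring_on A)"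
proof (rule idealI)
 interpret cring "ring_on A" by (rule A)
 show "ring (ring_on A)" by (rule ring_axioms)
 show "subgroup I (add_monoid (ring_on A))"
 proof (rule add.subgroupI)
  fix x assume x: "x \<in> I"
  have "- x \<in> I" using I(4)[OF x m] by simp
  moreover have "\<ominus>\<^bsub>ring_on A\<^esub> x = - x" using x I(1) I(4)[OF x m] by (intro minus_equality) auto
  ultimately show "\<ominus>\<^bsub>ring_on A\<^esub> x \<in> I" by simp
 qed (use I in "auto simp: ring_on_def")
qed (use I(4) in "auto simp: mult.commute")

lemma quotient_iso:
 assumes R: "cring (ring_on A)" and S: "ring S" and h: "h \<in> ring_hom (ring_on A) S"
  and surj: "h ` A = carrier S" and ker: "!!x. x \<in> A ==> h x = \<zero>\<^bsub>S\<^esub> <-> x \<in> I" and I: "I \<subseteq> A"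
 shows "\<exists>\<phi> \<in> ring_iso (ring_on A Quot I) S. ALL x:A. \<phi> (I +>\<^bsub>ring_on A\<^esub> x) = h x"
proof -
 interpret R: cring "ring_on A" by (rule R)
 interpret ring_hom_ring "ring_on A" S h by (rule ring_hom_ringI2[OF R.ring_axioms S h])
 have k: "a_kernel (ring_on A) S h = I" unfolding a_kernel_def' ring_on_simps using ker I by blast
 show ?thesis
 proof (rule bexI)
  show "(%X. the_elem (h ` X)) \<in> ring_iso (ring_on A Quot I) S"
   using FactRing_iso_set surj unfolding k ring_on_simps by blast
  show "ALL x:A. the_elem (h ` (I +>\<^bsub>ring_on A\<^esub> x)) = h x"
   using the_elem_simp unfolding k ring_on_simps by blast
 qed
qed

lemma rconst_zero [simp]: "rconst 0 = 0" and rconst_one [simp]: "rconst 1 = 1"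
 and rconst_add: "rconst (c + c') = rconst c + rconst c'"
 and rconst_mult: "rconst (c * c') = rconst c * rconst c'"
proof -
 show "rconst 0 = 0" by (simp add: rconst_def fract_collapse)
 show "rconst 1 = 1" by (simp add: rconst_def One_fract_def single_one)
 show "rconst (c + c') = rconst c + rconst c'" by (simp add: rconst_def single_add)
 show "rconst (c * c') = rconst c * rconst c'" by (simp add: rconst_def mult_single)
qed

lemma rconst_uminus: "rconst (- c) = - rconst c"
 using rconst_add[of c "- c"] by (simp add: eq_neg_iff_add_eq_0 add.commute)

lemma rconst_diff: "rconst (c - c') = rconst c - rconst c'"
 using rconst_add[of c "- c'"] by (simp add: rconst_uminus)

lemma rconst_eq_iff: "rconst c = rconst c' <-> c = c'"
 using value_at_unique[OF value_at_const[of "%_. 0" c], of c'] value_at_const[of "%_. 0" c'] by auto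

lemma rconst_inverse: "rconst (inverse c) = inverse (rconst c)"
proof (cases "c = 0")
 case False
 hence "rconst (inverse c) * rconst c = 1" by (simp add: rconst_mult[symmetric])
 thus ?thesis by (metis inverse_unique mult.commute inverse_inverse_eq)
qed simp

lemma rconst_power: "rconst (c ^ k) = rconst c ^ k" by (induction k) (simp_all add: rconst_mult)

lemma rconst_prod: "rconst (PROD i:A. f i) = (PROD i:A. rconst (f i))"
 by (induction A rule: infinite_finite_induct) (simp_all add: rconst_mult)

lemma rconst_powi: "rconst (c powi m) = rconst c powi m"
 by (simp add: power_int_def rconst_power rconst_inverse)

lemma generated_one: "1 \<in> generated_calg G" using generated_calg.const[of 1] by simp

lemma generated_zero: "0 \<in> generated_calg G" using generated_calg.const[of 0] by simp

lemma generated_uminus: "f \<in> generated_calg G ==> - f \<in> generated_calg G"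
 using generated_calg.mult[OF generated_calg.const[of "- 1"], of f] by (simp add: rconst_uminus)

lemma generated_power: "f \<in> generated_calg G ==> f ^ k \<in> generated_calg G"
 by (induction k) (auto intro: generated_one generated_calg.mult)

lemma generated_prod: "(!!i. i \<in> A ==> f i \<in> generated_calg G) ==> (PROD i:A. f i) \<in> generated_calg G"
 by (induction A rule: infinite_finite_induct) (auto intro: generated_one generated_calg.mult)

lemma generated_powi: "f \<in> generated_calg G ==> inverse f \<in> generated_calg G ==> f powi m \<in> generated_calg G"
 by (simp add: power_int_def generated_power)

lemma cring_generated: "cring (ring_on (generated_calg G))"
 by (rule cring_ring_on) (auto intro: generated_one generated_uminus generated_calg.add generated_calg.mult)

lemma generated_mono: "G \<subseteq> H ==> generated_calg G \<subseteq> generated_calg H"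
proof
 fix f assume GH: "G \<subseteq> H" and "f \<in> generated_calg G"
 from this(2) show "f \<in> generated_calg H"
  by (induction rule: generated_calg.induct) (use GH in "auto intro: generated_calg.intros")
qed

definition lmon :: "(nat * nat) set => (nat * nat => 'f::field) => ((nat * nat) \<Rightarrow>\<^sub>0 int) => 'f" where
 "lmon P f e = (PROD u:P. f u powi lookup e u)"

lemma lmon_zero [simp]: "lmon P f 0 = 1" by (simp add: lmon_def)

lemma lmon_add: "(!!u. u \<in> P ==> f u ~= 0) ==> lmon P f (e + e') = lmon P f e * lmon P f e'"
 by (simp add: lmon_def lookup_add power_int_add prod.distrib)

lemma lmon_single: "finite P ==> u \<in> P ==> lmon P f (single u m) = f u powi m"
proof -
 assume P: "finite P" "u \<in> P"
 have "lmon P f (single u m) = (PROD v:P. if v = u then f u powi m else 1)"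
  unfolding lmon_def by (intro prod.cong refl) (simp add: lookup_single when_def)
 thus ?thesis using P by simp
qed

definition lev :: "(nat * nat) set => (nat * nat => ratfun) => laurent => ratfun" where
 "lev P f = pm_eval (lmon P f) rconst"

lemma lev_evaluation: "(!!u. u \<in> P ==> f u ~= 0) ==> evaluation (lmon P f) rconst"
 by unfold_locales (simp_all add: lmon_add rconst_add rconst_mult)

lemma lev_hom:
 assumes "!!u. u \<in> P ==> f u ~= 0"
 shows "lev P f (p + q) = lev P f p + lev P f q" "lev P f (p * q) = lev P f p * lev P f q" "lev P f 1 = 1" "lev P f 0 = 0"
  "lev P f (p - q) = lev P f p - lev P f q" "lev P f (p ^ k) = lev P f p ^ k" "lev P f (PROD i:A. g i) = (PROD i:A. lev P f (g i))"
  "lev P f (single e c) = rconst c * lmon P f e" "lev P f (SUM i:B. h i) = (SUM i:B. lev P f (h i))"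
proof -
 interpret evaluation "lmon P f" rconst by (rule lev_evaluation[OF assms])
 show "lev P f (p + q) = lev P f p + lev P f q" "lev P f (p * q) = lev P f p * lev P f q" "lev P f 1 = 1" "lev P f 0 = 0"
  "lev P f (p - q) = lev P f p - lev P f q" "lev P f (p ^ k) = lev P f p ^ k" "lev P f (PROD i:A. g i) = (PROD i:A. lev P f (g i))"
  "lev P f (single e c) = rconst c * lmon P f e" "lev P f (SUM i:B. h i) = (SUM i:B. lev P f (h i))"
  by (simp_all add: lev_def ev_prod ev_sum)
qed

lemma lev_lconst: "(!!u. u \<in> P ==> f u ~= 0) ==> lev P f (lconst c) = rconst c"
 by (simp add: lconst_def lev_hom)

lemma lev_lvar: "finite P ==> (!!u. u \<in> P ==> f u ~= 0) ==> u \<in> P ==> lev P f (lvar u) = f u"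
 by (simp add: lvar_def lev_hom lmon_single)

definition laurents :: "(nat * nat) set => laurent set" where
 "laurents P = {p. ALL e:keys p. keys e \<subseteq> P}"

lemma laurent_ring_eq: "laurent_ring P = ring_on (laurents P)"
 by (simp add: laurent_ring_def laurents_def)

lemma laurents_single: "keys e \<subseteq> P ==> single e c \<in> laurents P"
 by (auto simp: laurents_def split: if_splits)

lemma laurents_one: "1 \<in> laurents P" using laurents_single[of 0 P 1] by (simp add: single_one)

lemma laurents_lconst: "lconst c \<in> laurents P" unfolding lconst_def by (rule laurents_single) simp

lemma laurents_lvar: "u \<in> P ==> lvar u \<in> laurents P" unfolding lvar_def by (rule laurents_single) simp

lemma laurents_add: "p \<in> laurents P ==> q \<in> laurents P ==> p + q \<in> laurents P"
 unfolding laurents_def using keys_add[of p q] by blast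

lemma laurents_mult: "p \<in> laurents P ==> q \<in> laurents P ==> p * q \<in> laurents P"
proof -
 assume pq: "p \<in> laurents P" "q \<in> laurents P"
 show ?thesis unfolding laurents_def
 proof (intro CollectI ballI)
  fix e assume "e \<in> keys (p * q)"
  then obtain e1 e2 where "e = e1 + e2" "e1 \<in> keys p" "e2 \<in> keys q" using keys_mult[of p q] by blast
  thus "keys e \<subseteq> P" using pq keys_add[of e1 e2] unfolding laurents_def by blast
 qed
qed

lemma laurents_uminus: "p \<in> laurents P ==> - p \<in> laurents P" by (simp add: laurents_def)

lemma laurents_diff: "p \<in> laurents P ==> q \<in> laurents P ==> p - q \<in> laurents P"
 using laurents_add[of p P "- q"] laurents_uminus[of q P] by simp

lemma laurents_zero: "0 \<in> laurents P" using laurents_diff[OF laurents_one laurents_one] by simp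

lemma laurents_power: "p \<in> laurents P ==> p ^ k \<in> laurents P"
 by (induction k) (auto intro: laurents_one laurents_mult)

lemma laurents_prod: "(!!i. i \<in> A ==> f i \<in> laurents P) ==> (PROD i:A. f i) \<in> laurents P"
 by (induction A rule: infinite_finite_induct) (auto intro: laurents_one laurents_mult)

lemma laurents_sum: "(!!i. i \<in> A ==> f i \<in> laurents P) ==> (SUM i:A. f i) \<in> laurents P"
 by (induction A rule: infinite_finite_induct) (auto intro: laurents_zero laurents_add)

lemma cring_laurents: "cring (ring_on (laurents P))"
 by (rule cring_ring_on) (auto intro: laurents_one laurents_add laurents_mult laurents_uminus)

lemma laurent_monomial:
 assumes P: "finite P" "keys e \<subseteq> P"
 shows "single e (1::complex) = (PROD u:P. single (single u (lookup e u)) 1)"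
proof -
 have "(PROD u:A. single (single u (lookup e u)) (1::complex))
   = single (SUM u:A. single u (lookup e u)) 1" if "finite A" for A
  using that by (induction A rule: finite_induct) (simp_all add: mult_single single_one)
 moreover have "(SUM u:P. single u (lookup e u)) = e"
 proof -
  have "(SUM u:P. single u (lookup e u)) = (SUM u:keys e. single u (lookup e u))"
   using P by (intro sum.mono_neutral_right) (auto simp: in_keys_iff)
  thus ?thesis using poly_mapping_sum_single[of e] by simp
 qed
 ultimately show ?thesis using P(1) by simp
qed

section \<open>Automorphisms rescaling the variables\<close>

definition scale_poly :: "(nat => complex) => mpoly => mpoly" where
 "scale_poly sg = pm_eval (mvalue (%i. single 0 (sg i) * pvar i)) (single 0)"

interpretation scale_poly: evaluation "mvalue (%i. single 0 (sg i) * pvar i)" "single 0"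
 rewrites "pm_eval (mvalue (%i. single 0 (sg i) * pvar i)) (single 0) = scale_poly sg"
proof -
 show "evaluation (mvalue (%i. single 0 (sg i) * pvar i)) (single 0)"
  by (rule evaluation_monomial) (simp_all add: single_one single_add mult_single)
qed (simp add: scale_poly_def)

lemma monomial_pvar: "mvalue pvar e = single e 1"
proof -
 have p: "pvar i ^ k = single (single i k) 1" for i k
  by (induction k) (simp_all add: pvar_def mult_single single_one flip: single_add)
 have "(PROD i:A. pvar i ^ lookup e i) = single (SUM i:A. single i (lookup e i)) 1" if "finite A" for A
  using that by (induction A rule: finite_induct) (simp_all add: p mult_single single_one)
 thus ?thesis unfolding mvalue_def using poly_mapping_sum_single[of e] by simp
qed

lemma mvalue_const: "mvalue (%i. single 0 (sg i)) e = (single 0 (mvalue sg e) :: mpoly)"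
proof -
 have p: "single 0 c ^ k = (single 0 (c ^ k) :: mpoly)" for c :: complex and k
  by (induction k) (simp_all add: mult_single single_one)
 have "(PROD i:A. single 0 (sg i) ^ lookup e i)
   = (single 0 (PROD i:A. sg i ^ lookup e i) :: mpoly)" if "finite A" for A
  using that by (induction A rule: finite_induct) (simp_all add: p mult_single single_one)
 thus ?thesis by (simp add: mvalue_def)
qed

lemma scale_poly_single: "scale_poly sg (single e c) = single e (c * mvalue sg e)"
proof -
 have "mvalue (%i. single 0 (sg i) * pvar i) e
   = mvalue (%i. single 0 (sg i)) e * mvalue pvar e"
  by (simp add: mvalue_def power_mult_distrib prod.distrib)
 thus ?thesis by (simp add: monomial_pvar mvalue_const mult_single)
qed

lemma scale_poly_inverse:
 assumes "!!i. sg i ~= 0"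
 shows "scale_poly (%i. inverse (sg i)) (scale_poly sg p) = p"
proof -
 have m: "mvalue sg e * mvalue (%i. inverse (sg i)) e = 1" for e
  unfolding mvalue_def prod.distrib[symmetric] using assms
  by (intro prod.neutral ballI) (simp flip: power_mult_distrib)
 have "scale_poly (%i. inverse (sg i)) (scale_poly sg (SUM e:keys p. single e (lookup p e)))
   = (SUM e:keys p. single e (lookup p e))"
  by (simp add: scale_poly.ev_sum scale_poly_single m mult.assoc del: scale_poly.ev_single)
 thus ?thesis using poly_mapping_sum_single[of p] by simp
qed

text \<open>Independent of the representation, since rescaling is invertible on polynomials and
  keeps denominators nonzero.\<close>

definition scale :: "(nat => complex) => ratfun => ratfun" where
 "scale sg f = (THE g. EX p q. q ~= 0 & f = Fract p q & g = Fract (scale_poly sg p) (scale_poly sg q))"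

context
 fixes sg :: "nat => complex" assumes sg: "!!i. sg i ~= 0"
begin

lemma scale_poly_nonzero: "q ~= 0 ==> scale_poly sg q ~= 0"
 using scale_poly_inverse[of sg q, OF sg] by auto

lemma scale_Fract: "q ~= 0 ==> scale sg (Fract p q) = Fract (scale_poly sg p) (scale_poly sg q)"
 unfolding scale_def
proof (rule the_equality)
 assume q: "q ~= 0"
 thus "EX p' q'. q' ~= 0 & Fract p q = Fract p' q' & Fract (scale_poly sg p) (scale_poly sg q) = Fract (scale_poly sg p') (scale_poly sg q')"
  by blast
 fix g assume "EX p' q'. q' ~= 0 & Fract p q = Fract p' q' & g = Fract (scale_poly sg p') (scale_poly sg q')"
 then obtain p' q' where g: "q' ~= 0" "Fract p q = Fract p' q'" "g = Fract (scale_poly sg p') (scale_poly sg q')" by blast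
 have "p * q' = p' * q" using g(1,2) q by (simp add: eq_fract)
 hence "scale_poly sg p * scale_poly sg q' = scale_poly sg p' * scale_poly sg q" by (metis scale_poly.ev_mult)
 thus "g = Fract (scale_poly sg p) (scale_poly sg q)"
  using g(1,3) q scale_poly_nonzero by (simp add: eq_fract)
qed

lemma scale_add: "scale sg (f + g) = scale sg f + scale sg g"
 by (cases f; cases g) (simp add: scale_Fract scale_poly_nonzero)

lemma scale_mult: "scale sg (f * g) = scale sg f * scale sg g"
 by (cases f; cases g) (simp add: scale_Fract scale_poly_nonzero)

lemma scale_rconst: "scale sg (rconst c) = rconst c"
 by (simp add: rconst_def scale_Fract scale_poly_single mvalue_def)

lemma scale_one: "scale sg 1 = 1" using scale_rconst[of 1] by simp

lemma scale_inverse: "scale sg (inverse f) = inverse (scale sg f)"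
proof (cases f)
 case (Fract p q)
 show ?thesis
 proof (cases "p = 0")
  case True
  thus ?thesis using Fract scale_rconst[of 0] by (simp add: fract_collapse)
 next
  case False
  thus ?thesis using Fract by (simp add: scale_Fract)
 qed
qed

lemma scale_power: "scale sg (f ^ k) = scale sg f ^ k"
 by (induction k) (simp_all add: scale_one scale_mult)

lemma scale_powi: "scale sg (f powi k) = scale sg f powi k"
 by (simp add: power_int_def scale_power scale_inverse)

lemma scale_prod: "scale sg (PROD i:A. f i) = (PROD i:A. scale sg (f i))"
 by (induction A rule: infinite_finite_induct) (simp_all add: scale_one scale_mult)

lemma scale_var: "scale sg (var i) = rconst (sg i) * var i"
 unfolding var_def rconst_def by (simp add: scale_Fract pvar_def scale_poly_single mult_single mvalue_def scale_poly.ev_one del: scale_poly.ev_single)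

end

lemma scale_scale:
 assumes "!!i. sg i ~= 0"
 shows "scale (%i. inverse (sg i)) (scale sg f) = f"
proof (cases f)
 case (Fract p q)
 have "inverse (sg i) ~= 0" for i using assms by simp
 thus ?thesis
  using Fract scale_Fract[OF assms] scale_poly_nonzero[OF assms] scale_Fract[of "%i. inverse (sg i)"]
  by (simp add: scale_poly_inverse[OF assms])
qed

lemma scale_calg_iso:
 assumes sg: "!!i. sg i ~= 0" and G: "!!g. g \<in> G ==> EX s. s ~= 0 & scale sg g = rconst s * g"
 shows "scale sg \<in> calg_iso (ring_on (generated_calg G)) rconst (ring_on (generated_calg G)) rconst"
proof -
 define \<tau> where "\<tau> i = inverse (sg i)" for i
 have \<tau>: "\<tau> i ~= 0" for i using sg by (simp add: \<tau>_def)
 have inv1: "scale \<tau> (scale sg f) = f" for f using scale_scale[OF sg] by (simp add: \<tau>_def[abs_def])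
 have inv2: "scale sg (scale \<tau> f) = f" for f using scale_scale[OF \<tau>] by (simp add: \<tau>_def[abs_def])
 have G': "EX s. s ~= 0 & scale \<tau> g = rconst s * g" if g: "g \<in> G" for g
 proof -
  obtain s where s: "s ~= 0" "scale sg g = rconst s * g" using G[OF g] by blast
  have "g = rconst s * scale \<tau> g" using inv1[of g] unfolding s(2) scale_mult[OF \<tau>] scale_rconst[OF \<tau>] by simp
  hence "rconst (inverse s) * g = rconst (inverse s * s) * scale \<tau> g" by (metis mult.assoc rconst_mult)
  hence "scale \<tau> g = rconst (inverse s) * g" using s(1) by simp
  thus ?thesis using s(1) by (intro exI[of _ "inverse s"]) simp
 qed
 have cl: "scale \<rho> f \<in> generated_calg G"
  if \<rho>: "!!i. \<rho> i ~= 0" and G: "!!g. g \<in> G ==> EX s. s ~= 0 & scale \<rho> g = rconst s * g" and f: "f \<in> generated_calg G" for \<rho> f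
  using f
 proof (induction rule: generated_calg.induct)
  case (const c)
  thus ?case using scale_rconst[OF \<rho>] generated_calg.const by simp
 next
  case (gen g)
  then obtain s where "scale \<rho> g = rconst s * g" using G by blast
  thus ?case using generated_calg.mult[OF generated_calg.const generated_calg.gen[OF gen]] by simp
 qed (auto simp: scale_add[OF \<rho>] scale_mult[OF \<rho>] intro: generated_calg.add generated_calg.mult)
 have c1: "scale sg f \<in> generated_calg G" if "f \<in> generated_calg G" for f by (rule cl[OF sg G that])
 have c2: "scale \<tau> f \<in> generated_calg G" if "f \<in> generated_calg G" for f by (rule cl[OF \<tau> G' that])
 have "bij_betw (scale sg) (generated_calg G) (generated_calg G)"
  by (rule bij_betw_byWitness[where f' = "scale \<tau>"]) (use inv1 inv2 c1 c2 in auto)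
 thus ?thesis using c1 scale_add[OF sg] scale_mult[OF sg] scale_one[OF sg] scale_rconst[OF sg]
  by (simp add: calg_iso_def ring_iso_def ring_hom_def)
qed

lemma lvar_power: "lvar u ^ k = single (single u (int k)) 1"
 by (induction k) (simp_all add: lvar_def mult_single single_one add.commute flip: single_add)

lemma lvar_inverse_power: "single (single u (- 1)) 1 ^ k = (single (single u (- int k)) 1 :: laurent)"
 by (induction k) (simp_all add: mult_single single_one flip: single_add)

lemma lconst_hom: "lconst 0 = 0" "lconst 1 = 1" "lconst (x + y) = lconst x + lconst y" "lconst (x * y) = lconst x * lconst y"
 by (simp_all add: lconst_def single_one single_add mult_single)

section \<open>Functions satisfying the configuration relations\<close>

context universal_datum begin

lemma xvar_nonzero: "xvar u ~= 0"
 using sd.seedX_nonzero by (simp add: xvar_def sd.sweep_var_seedX split: prod.split)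

lemma zvar_nonzero: "zvar u ~= 0" by (simp add: zvar_def var_nonzero)

lemma nside_nonzero:
 fixes x :: "nat * nat => 'f::field"
 assumes "!!u. u \<in> indices ==> x u ~= 0" "u \<in> indices"
 shows "nside x u ~= 0"
proof -
 obtain t j where tj: "u = (t, j)" by (meson surj_pair)
 have "x (nbr u k) ^ nat (- a k (snd u)) ~= 0" if "k \<in> I - {snd u}" for k
 proof (cases "a k j = 0")
  case False
  have "nbr u k \<in> indices" using nbr_in[of t j k] assms(2) that False tj by simp
  thus ?thesis using assms(1) by simp
 qed (simp add: tj)
 thus ?thesis unfolding nside_def by (meson finite_atLeastAtMost finite_Diff prod_zero_iff)
qed

definition uvar :: "nat * nat => ratfun" where
 "uvar u = zvar u * nside xvar u / (xvar (prev u) * xvar u)"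

lemma uvar_nonzero: "u \<in> indices ==> uvar u ~= 0"
 using nside_nonzero[of xvar] xvar_nonzero zvar_nonzero by (simp add: uvar_def)

lemma relation: "u \<in> indices ==>
  xvar (prev u) * xvar u = zvar u * nside xvar u + (PROD w:indices. zvar w ^ c w u)"
 using primitive_relation xside_nside by simp

text \<open>By \<open>nside_identity\<close> the product of the \<open>uvar\<close> is the
  coefficient term of the exchange relation divided by \<open>x_(prev u) x_u\<close>; the claim is
  the relation divided by its left side.\<close>

lemma uvar_relation:
 assumes g: "u \<in> indices"
 shows "uvar u + (PROD w:indices. uvar w ^ c w u) = 1"
proof -
 have "(PROD w:indices. uvar w ^ c w u)
   = (PROD w:indices. zvar w ^ c w u * (nside xvar w / (xvar (prev w) * xvar w)) ^ c w u)"
  by (intro prod.cong refl) (simp add: uvar_def power_mult_distrib[symmetric])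
 also have "... = (PROD w:indices. zvar w ^ c w u) * inverse (xvar (prev u) * xvar u)"
  unfolding prod.distrib nside_identity[of xvar, OF xvar_nonzero g] ..
 finally have e: "(PROD w:indices. uvar w ^ c w u)
   = (PROD w:indices. zvar w ^ c w u) * inverse (xvar (prev u) * xvar u)" .
 have "uvar u + (PROD w:indices. uvar w ^ c w u)
   = (zvar u * nside xvar u + (PROD w:indices. zvar w ^ c w u)) / (xvar (prev u) * xvar u)"
  unfolding e by (simp add: uvar_def[of u] distrib_right divide_inverse)
 also have "... = 1" unfolding relation[OF g, symmetric] using xvar_nonzero by simp
 finally show ?thesis .
qed

abbreviation "lring \<equiv> laurents indices"
abbreviation "cideal \<equiv> config_ideal indices c"

definition crel :: "nat * nat => laurent" where
 "crel u = lvar u + (PROD w:indices. lvar w ^ c w u) - 1"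

lemma crel_in: "u \<in> indices ==> crel u \<in> lring" unfolding crel_def
 by (intro laurents_diff laurents_add laurents_lvar laurents_one laurents_prod laurents_power)

lemma cideal_eq: "cideal = genideal (ring_on lring) (crel ` indices)"
 unfolding config_ideal_def laurent_ring_eq crel_def[abs_def] ..

lemma cideal_ideal: "ideal cideal (ring_on lring)"
proof -
 interpret cring "ring_on lring" by (rule cring_laurents)
 show ?thesis unfolding cideal_eq by (rule genideal_ideal) (auto simp: crel_in)
qed

lemma crel_in_cideal: "u \<in> indices ==> crel u \<in> cideal"
proof -
 interpret cring "ring_on lring" by (rule cring_laurents)
 have "crel ` indices \<subseteq> cideal" unfolding cideal_eq by (rule genideal_self) (auto simp: crel_in)
 thus "u \<in> indices ==> crel u \<in> cideal" by blast
qed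

lemma cideal_sub: "cideal \<subseteq> lring" using ideal.Icarr[OF cideal_ideal] by auto

lemma cideal_zero: "0 \<in> cideal"
 using additive_subgroup.zero_closed[OF ideal.axioms(1)[OF cideal_ideal]] by simp

lemma cideal_add: "x \<in> cideal ==> y \<in> cideal ==> x + y \<in> cideal"
 using additive_subgroup.a_closed[OF ideal.axioms(1)[OF cideal_ideal]] by simp

lemma cideal_mult: "x \<in> cideal ==> y \<in> lring ==> x * y \<in> cideal"
 using ideal.I_r_closed[OF cideal_ideal, of x y] by simp

lemma cideal_uminus: "x \<in> cideal ==> - x \<in> cideal"
 using cideal_mult[OF _ laurents_uminus[OF laurents_one], of x] by simp

lemma cideal_diff: "x \<in> cideal ==> y \<in> cideal ==> x - y \<in> cideal"
 using cideal_add[of x "- y"] cideal_uminus[of y] by simp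

text \<open>Stated modulo an ideal \<open>J\<close> to serve both for exact relations, with
  \<open>J = {0}\<close>, and for the ideal of the unit locus.\<close>

lemma lev_cideal:
 assumes nz: "!!u. u \<in> indices ==> f u ~= 0"
  and J: "ideal J (ring_on B)" "cring (ring_on B)" "!!p. p \<in> lring ==> lev indices f p \<in> B"
  and rel: "!!u. u \<in> indices ==> f u + (PROD w:indices. f w ^ c w u) - 1 \<in> J" and p: "p \<in> cideal"
 shows "lev indices f p \<in> J"
proof -
 interpret R: cring "ring_on lring" by (rule cring_laurents)
 interpret B: cring "ring_on B" by (rule J(2))
 have h: "ring_hom_ring (ring_on lring) (ring_on B) (lev indices f)"
  by (rule ring_hom_ringI[OF R.ring_axioms B.ring_axioms]) (simp_all add: J(3) lev_hom[OF nz])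
 have "ideal {x \<in> carrier (ring_on lring). lev indices f x \<in> J} (ring_on lring)"
  by (rule ring_hom_ring.ideal_vimage[OF h J(1)])
 moreover have "crel ` indices \<subseteq> {x \<in> carrier (ring_on lring). lev indices f x \<in> J}"
  using rel crel_in finite_indices
  by (auto simp: crel_def[abs_def] lev_hom[OF nz] lev_lvar[OF finite_indices nz] cong: prod.cong)
 ultimately have "cideal \<subseteq> {x \<in> carrier (ring_on lring). lev indices f x \<in> J}"
  unfolding cideal_eq by (rule R.genideal_minimal)
 thus ?thesis using p by blast
qed

lemma lev_cideal_zero:
 assumes nz: "!!u. u \<in> indices ==> f u ~= 0"
  and rel: "!!u. u \<in> indices ==> f u + (PROD w:indices. f w ^ c w u) = 1" and p: "p \<in> cideal"
 shows "lev indices f p = 0"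
proof -
 have U: "cring (ring_on (UNIV :: ratfun set))" by (rule cring_ring_on) auto
 have "ideal {0} (ring_on (UNIV :: ratfun set))" by (rule ideal_ring_on[OF U]) auto
 from lev_cideal[of f, OF nz this U _ _ p] rel show ?thesis by simp
qed

text \<open>Setting the initial cluster variables to \<open>1\<close> and each frozen variable to the corresponding
 variable of the configuration ring is possible only for fractions whose denominator becomes invertible
 modulo \<open>cideal\<close>; therefore \<open>special\<close> is a relation.\<close>

definition special_var :: "nat => laurent" where
 "special_var i = (if i \<in> idx ` indices then lvar (the_inv_into indices idx i) else 1)"

definition spoly :: "mpoly => laurent" where
 "spoly = pm_eval (mvalue special_var) lconst"

lemma spoly_hom: "spoly (p + q) = spoly p + spoly q" "spoly (p * q) = spoly p * spoly q"
 "spoly 0 = 0" "spoly 1 = 1" "spoly (single e k) = lconst k * mvalue special_var e"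
proof -
 interpret evaluation "mvalue special_var" lconst by (rule evaluation_monomial) (simp_all add: lconst_hom)
 show "spoly (p + q) = spoly p + spoly q" "spoly (p * q) = spoly p * spoly q"
  "spoly 0 = 0" "spoly 1 = 1" "spoly (single e k) = lconst k * mvalue special_var e"
  by (simp_all add: spoly_def)
qed

lemma spoly_in: "spoly p \<in> lring"
proof -
 have "the_inv_into indices idx i \<in> indices" if "i \<in> idx ` indices" for i
  using the_inv_into_into[OF _ that subset_refl] idx_bij by (simp add: bij_betw_def)
 hence "special_var i \<in> lring" for i by (simp add: special_var_def laurents_one laurents_lvar)
 hence "mvalue special_var e \<in> lring" for e unfolding mvalue_def by (intro laurents_prod laurents_power)
 thus ?thesis unfolding spoly_def pm_eval_def by (intro laurents_sum laurents_mult laurents_lconst)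
qed

definition special :: "ratfun => laurent => bool" where
 "special f l <-> l \<in> lring & (EX p q s. q ~= 0 & f = Fract p q & s \<in> lring &
   spoly q * s - 1 \<in> cideal & l - spoly p * s \<in> cideal)"

text \<open>Every representation of zero has numerator zero. This is how relations between functions
  are pulled back to the configuration ring.\<close>

lemma special_zero: "special 0 l ==> l \<in> cideal"
proof -
 assume "special 0 l"
 then obtain p q s where pq: "q ~= 0" "0 = Fract p q" "l - spoly p * s \<in> cideal" unfolding special_def by blast
 hence "p = 0" by (simp add: Zero_fract_def eq_fract)
 thus ?thesis using pq by (simp add: spoly_hom)
qed

lemma special_cong: "special f l ==> l' \<in> lring ==> l' - l \<in> cideal ==> special f l'"
proof -
 assume f: "special f l" and l': "l' \<in> lring" "l' - l \<in> cideal"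
 obtain p q s where pq: "q ~= 0" "f = Fract p q" "s \<in> lring" "spoly q * s - 1 \<in> cideal" "l - spoly p * s \<in> cideal"
  using f unfolding special_def by blast
 have "l' - spoly p * s \<in> cideal" using cideal_add[OF l'(2) pq(5)] by simp
 thus ?thesis using pq l'(1) unfolding special_def by blast
qed

lemma special_Fract_one:
 assumes "l - spoly p \<in> cideal" "l \<in> lring"
 shows "special (Fract p 1) l"
 unfolding special_def using assms cideal_zero laurents_one
 by (intro conjI exI[of _ p] exI[of _ 1]) (simp_all add: spoly_hom)

lemma special_rconst: "special (rconst k) (lconst k)" unfolding rconst_def
 by (rule special_Fract_one) (simp_all add: spoly_hom mvalue_def cideal_zero laurents_lconst)

lemma special_one: "special 1 1" using special_rconst[of 1] by (simp add: lconst_hom)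

lemma special_var_rel: "special (var i) (special_var i)"
proof -
 have "spoly (pvar i) = special_var i" by (simp add: pvar_def spoly_hom lconst_hom mvalue_def)
 thus ?thesis
  unfolding var_def using spoly_in[of "pvar i"] by (intro special_Fract_one) (simp_all add: cideal_zero)
qed

lemma special_add:
 assumes "special f l" "special g l'"
 shows "special (f + g) (l + l')"
proof -
 obtain p q s where f: "l \<in> lring" "q ~= 0" "f = Fract p q" "s \<in> lring" "spoly q * s - 1 \<in> cideal" "l - spoly p * s \<in> cideal"
  using assms(1) unfolding special_def by blast
 obtain p' q' s' where g: "l' \<in> lring" "q' ~= 0" "g = Fract p' q'" "s' \<in> lring" "spoly q' * s' - 1 \<in> cideal" "l' - spoly p' * s' \<in> cideal"
  using assms(2) unfolding special_def by blast
 let ?A = "spoly q * s - 1" and ?A' = "spoly q' * s' - 1"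
  and ?B = "l - spoly p * s" and ?B' = "l' - spoly p' * s'"
 have e: "spoly (q * q') * (s * s') - 1 = ?A * (spoly q' * s') + ?A'"
  by (simp add: spoly_hom algebra_simps)
 have d: "spoly (q * q') * (s * s') - 1 \<in> cideal"
  unfolding e by (intro cideal_add cideal_mult f g laurents_mult spoly_in)
 have e': "(l + l') - spoly (p * q' + p' * q) * (s * s')
   = ?B + ?B' - ?A' * (spoly p * s) - ?A * (spoly p' * s')" by (simp add: spoly_hom algebra_simps)
 have "(l + l') - spoly (p * q' + p' * q) * (s * s') \<in> cideal"
  unfolding e' by (intro cideal_diff cideal_add cideal_mult f g laurents_mult spoly_in)
 thus ?thesis unfolding special_def using d f g laurents_add[OF f(1) g(1)] laurents_mult[OF f(4) g(4)]
  by (intro conjI exI[of _ "p * q' + p' * q"] exI[of _ "q * q'"] exI[of _ "s * s'"]) simp_all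
qed

lemma special_mult:
 assumes "special f l" "special g l'"
 shows "special (f * g) (l * l')"
proof -
 obtain p q s where f: "l \<in> lring" "q ~= 0" "f = Fract p q" "s \<in> lring" "spoly q * s - 1 \<in> cideal" "l - spoly p * s \<in> cideal"
  using assms(1) unfolding special_def by blast
 obtain p' q' s' where g: "l' \<in> lring" "q' ~= 0" "g = Fract p' q'" "s' \<in> lring" "spoly q' * s' - 1 \<in> cideal" "l' - spoly p' * s' \<in> cideal"
  using assms(2) unfolding special_def by blast
 let ?A = "spoly q * s - 1" and ?A' = "spoly q' * s' - 1"
  and ?B = "l - spoly p * s" and ?B' = "l' - spoly p' * s'"
 have e: "spoly (q * q') * (s * s') - 1 = ?A * (spoly q' * s') + ?A'"
  by (simp add: spoly_hom algebra_simps)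
 have d: "spoly (q * q') * (s * s') - 1 \<in> cideal"
  unfolding e by (intro cideal_add cideal_mult f g laurents_mult spoly_in)
 have e': "l * l' - spoly (p * p') * (s * s') = ?B * l' + ?B' * (spoly p * s)"
  by (simp add: spoly_hom algebra_simps)
 have "l * l' - spoly (p * p') * (s * s') \<in> cideal"
  unfolding e' by (intro cideal_add cideal_mult f g laurents_mult spoly_in)
 thus ?thesis unfolding special_def using d f g laurents_mult[OF f(1) g(1)] laurents_mult[OF f(4) g(4)]
  by (intro conjI exI[of _ "p * p'"] exI[of _ "q * q'"] exI[of _ "s * s'"]) simp_all
qed

lemma special_inverse:
 assumes "special f l" "f ~= 0" "k \<in> lring" "l * k - 1 \<in> cideal"
 shows "special (inverse f) k"
proof -
 obtain p q s where f: "l \<in> lring" "q ~= 0" "f = Fract p q" "s \<in> lring" "spoly q * s - 1 \<in> cideal" "l - spoly p * s \<in> cideal"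
  using assms(1) unfolding special_def by blast
 have p: "p ~= 0" using assms(2) f(3) by (auto simp: fract_collapse)
 have e: "spoly p * (s * k) - 1 = (l * k - 1) - (l - spoly p * s) * k" by (simp add: algebra_simps)
 have d: "spoly p * (s * k) - 1 \<in> cideal" unfolding e by (intro cideal_diff cideal_mult assms f)
 have e': "k - spoly q * (s * k) = - ((spoly q * s - 1) * k)" by (simp add: algebra_simps)
 have "k - spoly q * (s * k) \<in> cideal" unfolding e' by (intro cideal_uminus cideal_mult assms f)
 thus ?thesis unfolding special_def using d f p assms(3) laurents_mult[OF f(4) assms(3)]
  by (intro conjI exI[of _ q] exI[of _ p] exI[of _ "s * k"]) simp_all
qed

lemma special_power: "special f l ==> special (f ^ k) (l ^ k)"
 by (induction k) (simp_all add: special_one special_mult)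

lemma special_prod: "(!!i. i \<in> A ==> special (f i) (l i)) ==> special (PROD i:A. f i) (PROD i:A. l i)"
 by (induction A rule: infinite_finite_induct) (simp_all add: special_one special_mult)

lemma special_sum: "(!!i. i \<in> A ==> special (f i) (l i)) ==> special (SUM i:A. f i) (SUM i:A. l i)"
proof (induction A rule: infinite_finite_induct)
 case (infinite A)
 thus ?case using special_rconst[of 0] by (simp add: lconst_hom)
next
 case empty
 thus ?case using special_rconst[of 0] by (simp add: lconst_hom)
qed (simp_all add: special_add)

lemma special_zvar: "u \<in> indices ==> special (zvar u) (lvar u)"
 using special_var_rel[of "idx u"] idx_bij by (simp add: zvar_def special_var_def bij_betw_def the_inv_into_f_f)

lemma special_nside:
 assumes "!!k. k \<in> I - {j} ==> a k j ~= 0 ==> special (xvar (nbr (t, j) k)) 1"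
 shows "special (nside xvar (t, j)) 1"
proof -
 have "special (xvar (nbr (t, j) k) ^ nat (- a k j)) 1" if "k \<in> I - {j}" for k
  using special_power[OF assms[OF that], of "nat (- a k j)"] special_one by (cases "a k j = 0") simp_all
 from special_prod[OF this, of "I - {j}" "%k. k"] show ?thesis by (simp add: nside_def)
qed

text \<open>Once all earlier variables are sent to \<open>1\<close>, the right side of the exchange
  relation becomes \<open>lvar u\<close> plus its complementary product, which is \<open>1\<close>
  modulo \<open>cideal\<close>.\<close>

lemma special_xvar: "u \<in> indices ==> special (xvar u) 1"
proof (induction rule: indices_induct)
 case (zero j)
 hence "j \<notin> idx ` indices" using idx_bij by (auto simp: bij_betw_def)
 thus ?case using special_var_rel[of j] by (simp add: xvar_def sd.sweep_var_seedX special_var_def)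
next
 case (Suc t j)
 let ?g = "(Suc t, j)"
 note g = Suc.hyps
 have N: "special (nside xvar ?g) 1" by (rule special_nside) (rule Suc.IH)
 have "special (zvar ?g * nside xvar ?g + (PROD w:indices. zvar w ^ c w ?g)) (lvar ?g * 1 + (PROD w:indices. lvar w ^ c w ?g))"
  by (intro special_add special_mult special_prod special_power special_zvar g N)
 moreover have "1 - (lvar ?g * 1 + (PROD w:indices. lvar w ^ c w ?g)) \<in> cideal"
  using cideal_uminus[OF crel_in_cideal[OF g]] by (simp add: crel_def algebra_simps)
 ultimately have "special (xvar (prev ?g) * xvar ?g) 1"
  unfolding relation[OF g] by (rule special_cong[OF _ laurents_one])
 moreover have "special (inverse (xvar (prev ?g))) 1"
  using Suc.IH(1) xvar_nonzero by (intro special_inverse[of _ 1]) (simp_all add: prev_simps laurents_one cideal_zero)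
 ultimately have "special (xvar (prev ?g) * xvar ?g * inverse (xvar (prev ?g))) (1 * 1)" by (rule special_mult)
 thus ?case using xvar_nonzero by (simp add: field_simps)
qed

lemma special_uvar:
 assumes g: "u \<in> indices"
 shows "special (uvar u) (lvar u)"
proof -
 obtain t j where tj: "u = (t, j)" by (meson surj_pair)
 have "special (nside xvar u) 1"
  unfolding tj by (rule special_nside) (use nbr_in special_xvar g tj in blast)
 moreover have "special (inverse (xvar (prev u) * xvar u)) 1"
  using special_mult[OF special_xvar[OF prev_in[OF g]] special_xvar[OF g]] xvar_nonzero
  by (intro special_inverse[of _ 1]) (simp_all add: laurents_one cideal_zero)
 ultimately have "special (zvar u * nside xvar u * inverse (xvar (prev u) * xvar u)) (lvar u * 1 * 1)"
  by (intro special_mult special_zvar g)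
 thus ?thesis by (simp add: uvar_def divide_inverse)
qed

lemma special_powi:
 assumes f: "special f (lvar u)" "f ~= 0" and g: "u \<in> indices"
 shows "special (f powi m) (single (single u m) 1)"
proof (cases "m >= 0")
 case True
 thus ?thesis using special_power[OF f(1), of "nat m"] by (simp add: power_int_def lvar_power)
next
 case False
 let ?k = "single (single u (- 1)) (1::complex)"
 have k: "?k \<in> lring" by (rule laurents_single) (use g in auto)
 have "lvar u * ?k = 1" by (simp add: lvar_def mult_single single_one flip: single_add)
 hence "special (inverse f) ?k" by (intro special_inverse[OF f k]) (simp add: cideal_zero)
 thus ?thesis using special_power[of "inverse f" ?k "nat (- m)"] False by (simp add: power_int_def lvar_inverse_power)
qed

lemma special_lev:
 assumes f: "!!u. u \<in> indices ==> special (f u) (lvar u)" "!!u. u \<in> indices ==> f u ~= 0" and p: "p \<in> lring"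
 shows "special (lev indices f p) p"
proof -
 have mon: "special (lmon indices f e) (single e 1)" if "keys e \<subseteq> indices" for e
  unfolding laurent_monomial[OF finite_indices that] lmon_def by (intro special_prod special_powi f)
 have "special (rconst (lookup p e) * lmon indices f e) (single e (lookup p e))" if "e \<in> keys p" for e
 proof -
  have "keys e \<subseteq> indices" using p that by (simp add: laurents_def)
  from special_mult[OF special_rconst mon[OF this], of "lookup p e"] show ?thesis
   by (simp add: lconst_def mult_single)
 qed
 from special_sum[OF this, of "keys p" "%e. e"] show ?thesis
  using poly_mapping_sum_single[of p] by (simp add: lev_def pm_eval_def)
qed

text \<open>Each \<open>uvar u\<close> specialises to \<open>lvar u\<close>, so a Laurent polynomial
  evaluated at the \<open>uvar\<close> specialises back to itself; if the evaluation is zero, it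
  lies in the ideal.\<close>

theorem lev_uvar_kernel:
 assumes p: "p \<in> lring"
 shows "lev indices uvar p = 0 <-> p \<in> cideal"
 using special_lev[of uvar, OF special_uvar uvar_nonzero p] special_zero lev_cideal_zero[of uvar, OF uvar_nonzero uvar_relation]
 by metis

lemma uvar_prev_relation:
 assumes g: "u \<in> indices"
 shows "uvar (prev u) + (PROD w:indices. uvar (prev w) ^ c w u) = 1"
proof -
 have "(PROD w:indices. uvar (prev w) ^ c w u) = (PROD w:indices. uvar (prev w) ^ c (prev w) (prev u))"
  by (intro prod.cong refl) (simp add: c_invariant[OF _ g])
 also have "... = (PROD w:indices. uvar w ^ c w (prev u))" by (rule prod.reindex_bij_betw[OF prev_bij])
 finally show ?thesis using uvar_relation[OF prev_in[OF g]] by simp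
qed

text \<open>At the seed where \<open>x_u\<close> is about to be produced, set \<open>z_u = s\<close>
  and everything else to \<open>1\<close>. As \<open>c u u = 0\<close>, the function takes the value
  \<open>s / (s + 1)\<close>.\<close>

lemma uvar_nonconstant_later:
 assumes g: "greens = ks @ j # us" and gm: "u = (Suc (cnt ks j), j)"
 shows "uvar u ~= rconst k"
proof
 assume eq: "uvar u = rconst k"
 note p = greens_prefix[OF g]
 have sp: "src_path (ks @ [j])" by (rule green_src_path[OF p(5)])
 have "len j = cnt ks j + Suc (cnt us j)" using g by (simp add: len_def)
 hence gin: "u \<in> indices" using p(3) gm by simp
 have val: "k = complex_of_real (s / (s + 1))" if s: "s > 0" for s
 proof -
  define y where "y i = (if i = idx u then s else 1)" for i
  have ypos: "y i > 0" for i using s by (simp add: y_def)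
  from evaluation_exists[of ks y, OF p(4) ypos]
  obtain z where rv: "!!i. rvalue z (sd.seedX ks i) (y i)" by blast
  have zv: "rvalue z (zvar v) (if v = u then s else 1)" if d: "v \<in> indices" for v
   using rv[of "idx v"] sd.seedX_frozen[OF p(4), of "idx v"] idx_in[OF d] idx_eq_iff[OF d gin]
   by (simp add: zvar_def y_def)
  have N0: "rvalue z (PROD i:I - {j}. sd.seedX ks i ^ nat (- a i j)) (PROD i:I - {j}. y i ^ nat (- a i j))"
   by (intro rvalue_prod rvalue_power rv)
  have N1: "(PROD i:I - {j}. y i ^ nat (- a i j)) = 1"
   using idx_in[OF gin] by (intro prod.neutral ballI) (auto simp: y_def)
  have N2: "nside xvar u = (PROD i:I - {j}. sd.seedX ks i ^ nat (- a i j))"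
   using xside_nside[OF gin] xside_neighbour[of "Suc (cnt ks j)" j] sd.neighbour_side_seed[OF sp] by (simp add: gm)
  have N: "rvalue z (nside xvar u) 1" using N0 unfolding N1 N2[symmetric] .
  have W0: "rvalue z (PROD v:indices. zvar v ^ c v u) (PROD v:indices. (if v = u then s else 1) ^ c v u)"
   by (intro rvalue_prod rvalue_power zv)
  have W1: "(PROD v:indices. (if v = u then s else 1) ^ c v u) = 1"
   using c_self[OF gin] by (intro prod.neutral ballI) simp
  have W: "rvalue z (PROD v:indices. zvar v ^ c v u) 1" using W0 unfolding W1 .
  have zg: "rvalue z (zvar u) s" using zv[OF gin] by simp
  have u: "rvalue z (zvar u * nside xvar u) (s * 1)" by (rule rvalue_mult[OF zg N])
  have "rvalue z (uvar u) (s * 1 / (s * 1 + 1))"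
   unfolding uvar_def relation[OF gin] using s by (intro rvalue_divide u rvalue_add W) simp
  thus ?thesis using value_at_unique[OF value_at_const] unfolding eq by fastforce
 qed
 have "complex_of_real (1 / (1 + 1)) = complex_of_real (2 / (2 + 1))" using val[of 1] val[of 2] by simp
 thus False by (simp only: of_real_eq_iff) simp
qed

text \<open>Indices with \<open>t >= 1\<close> arise from a mutation in \<open>greens\<close>. For
  \<open>t = 0\<close> a constant value would be an element of \<open>cideal\<close>; the relations
  are invariant under \<open>prev\<close>, which leads to an index of the first kind.\<close>

lemma uvar_nonconstant:
 assumes g: "u \<in> indices"
 shows "uvar u ~= rconst k"
proof -
 have later: "uvar (t, j) ~= rconst k" if "(t, j) \<in> indices" "1 <= t" for t j
 proof -
  have "t <= cnt greens j" using that(1) by (simp add: len_def)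
  from split_at_count[OF that(2) this]
  obtain ks us where "greens = ks @ j # us" "Suc (cnt ks j) = t" by blast
  thus ?thesis using uvar_nonconstant_later by blast
 qed
 obtain t j where tj: "u = (t, j)" by (meson surj_pair)
 show ?thesis
 proof (cases "t = 0")
  case False
  thus ?thesis using later g tj by simp
 next
  case True
  show ?thesis
  proof
   assume e: "uvar u = rconst k"
   have pin: "lvar u - lconst k \<in> lring" by (intro laurents_diff laurents_lvar laurents_lconst g)
   have "lev indices uvar (lvar u - lconst k) = 0"
    using e by (simp add: lev_hom[OF uvar_nonzero] lev_lvar[OF finite_indices uvar_nonzero g] lev_lconst[OF uvar_nonzero])
   hence I: "lvar u - lconst k \<in> cideal" using lev_uvar_kernel[OF pin] by simp
   define f where "f v = uvar (prev v)" for v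
   have nz: "f v ~= 0" if "v \<in> indices" for v using uvar_nonzero[OF prev_in[OF that]] by (simp add: f_def)
   have "lev indices f (lvar u - lconst k) = 0"
    by (rule lev_cideal_zero[OF nz _ I]) (simp_all add: f_def uvar_prev_relation)
   hence "f u = rconst k"
    by (simp add: lev_hom[OF nz] lev_lvar[OF finite_indices nz g] lev_lconst[OF nz])
   hence "uvar (prev u) = rconst k" by (simp add: f_def)
   moreover have "opp j \<in> I" using opp(1) g tj by simp
   moreover from this have "len (opp j) >= 1" by (rule len_pos)
   ultimately show False using later[of "len (opp j)" "opp j"] tj True by (simp add: prev_simps)
  qed
 qed
qed

end

lemma generated_generated: "generated_calg (generated_calg G \<union> H) = generated_calg (G \<union> H)"
proof
 show "generated_calg (generated_calg G \<union> H) \<subseteq> generated_calg (G \<union> H)"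
 proof
  fix f assume "f \<in> generated_calg (generated_calg G \<union> H)"
  thus "f \<in> generated_calg (G \<union> H)" by (induction rule: generated_calg.induct)
    (use generated_mono[of G "G \<union> H"] in "auto intro: generated_calg.intros")
 qed
 show "generated_calg (G \<union> H) \<subseteq> generated_calg (generated_calg G \<union> H)"
  by (intro generated_mono) (auto intro: generated_calg.gen)
qed

lemma coset_ring_on:
 fixes x :: "'a::comm_ring_1"
 shows "I +>\<^bsub>ring_on A\<^esub> x = (%h. h + x) ` I"
 by (auto simp: a_r_coset_def')

lemma coset_ring_on_eq_iff:
 fixes x y :: "'a::comm_ring_1"
 assumes I: "ideal I (ring_on A)" and A: "!!x. x \<in> I ==> - x \<in> I"
 shows "I +>\<^bsub>ring_on A\<^esub> x = I +>\<^bsub>ring_on A\<^esub> y <-> x - y \<in> I"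
proof -
 have z: "0 \<in> I" using additive_subgroup.zero_closed[OF ideal.axioms(1)[OF I]] by simp
 have add: "u + v \<in> I" if "u \<in> I" "v \<in> I" for u v
  using additive_subgroup.a_closed[OF ideal.axioms(1)[OF I] that] by simp
 show ?thesis unfolding coset_ring_on
 proof
  assume "(%h. h + x) ` I = (%h. h + y) ` I"
  hence "0 + x \<in> (%h. h + y) ` I" using z by blast
  thus "x - y \<in> I" by auto
 next
  assume xy: "x - y \<in> I"
  show "(%h. h + x) ` I = (%h. h + y) ` I"
  proof
   show "(%h. h + x) ` I \<subseteq> (%h. h + y) ` I"
   proof (rule image_subsetI)
    fix h assume "h \<in> I"
    hence "h + (x - y) \<in> I" by (rule add[OF _ xy])
    thus "h + x \<in> (%h. h + y) ` I" by (rule rev_image_eqI) simp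
   qed
   show "(%h. h + y) ` I \<subseteq> (%h. h + x) ` I"
   proof (rule image_subsetI)
    fix h assume "h \<in> I"
    hence "h + - (x - y) \<in> I" using add A[OF xy] by blast
    thus "h + y \<in> (%h. h + x) ` I" by (rule rev_image_eqI) simp
   qed
  qed
 qed
qed

lemma two_powi_ne_one: "m ~= 0 ==> (2::complex) powi m ~= 1"
proof -
 have pw: "(2::complex) ^ k ~= 1" if "k > 0" for k
 proof
  assume "(2::complex) ^ k = 1"
  hence "norm ((2::complex) ^ k) = 1" by simp
  thus False using one_less_power[of "2::real" k] that by (simp add: norm_power)
 qed
 have "(2::complex) powi m ~= 1" if "m > 0" for m using pw[of "nat m"] that by (simp add: power_int_def)
 thus "m ~= 0 ==> (2::complex) powi m ~= 1"
  by (metis inverse_eq_1_iff linorder_neqE_linordered_idom neg_0_less_iff_less power_int_minus)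
qed

section \<open>Torus invariants on the open locus\<close>

context universal_datum begin

lemma cluster_variables_eq: "cluster_variables n r Bt = xvar ` indices"
proof
 show "cluster_variables n r Bt \<subseteq> xvar ` indices"
 proof
  fix f assume "f \<in> cluster_variables n r Bt"
  then obtain t j where "j \<in> I" "t <= len j" "f = sweep_var n r Bt vs t j"
   unfolding sd.cluster_variables_sweep by blast
  thus "f \<in> xvar ` indices" by (intro rev_image_eqI[of "(t, j)"]) (simp_all add: indices_def xvar_def)
 qed
 show "xvar ` indices \<subseteq> cluster_variables n r Bt"
 proof (rule image_subsetI)
  fix u assume "u \<in> indices"
  then obtain t j where "u = (t, j)" "j \<in> I" "t <= len j" by (auto simp: indices_def)
  thus "xvar u \<in> cluster_variables n r Bt" unfolding sd.cluster_variables_sweep by (simp add: xvar_def) blast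
 qed
qed

lemma frozen_variables_eq: "frozen_variables n r = zvar ` indices"
proof -
 have "{n+1..n+r} = idx ` indices" using idx_bij by (simp add: bij_betw_def)
 thus ?thesis unfolding frozen_variables_def zvar_def[abs_def] by (simp only: image_image)
qed

definition base_gens :: "ratfun set" where
 "base_gens = xvar ` indices \<union> zvar ` indices \<union> inverse ` zvar ` indices"

abbreviation "calg \<equiv> generated_calg base_gens"

definition local_gens :: "ratfun set" where
 "local_gens = base_gens \<union> inverse ` xvar ` indices"

abbreviation "local_calg \<equiv> generated_calg local_gens"

lemma cluster_algebra_eq: "cluster_algebra n r Bt = ring_on calg"
 by (simp add: cluster_algebra_def cluster_variables_eq frozen_variables_eq base_gens_def)

lemma open_locus_ring_eq: "open_locus_ring n r Bt = ring_on local_calg"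
 by (simp add: open_locus_ring_def cluster_algebra_eq cluster_variables_eq generated_generated local_gens_def)

lemma calg_sub: "calg \<subseteq> local_calg" by (intro generated_mono) (simp add: local_gens_def)

lemma gens_in:
 assumes "u \<in> indices"
 shows "xvar u \<in> calg" "zvar u \<in> calg" "inverse (zvar u) \<in> calg" "inverse (xvar u) \<in> local_calg"
 using assms by (auto intro!: generated_calg.gen simp: base_gens_def local_gens_def)

definition units :: "ratfun set" where
 "units = {f \<in> local_calg. inverse f \<in> local_calg}"

lemma units_mult: "f \<in> units ==> g \<in> units ==> f * g \<in> units"
 by (simp add: units_def generated_calg.mult)

lemma units_inverse: "f \<in> units ==> inverse f \<in> units" by (simp add: units_def)

lemma units_one: "1 \<in> units" by (simp add: units_def generated_one)

lemma units_xvar: "u \<in> indices ==> xvar u \<in> units" and units_zvar: "u \<in> indices ==> zvar u \<in> units"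
 unfolding units_def using gens_in[of u] calg_sub by blast+

text \<open>Of \<open>M\<close> only closure under products is asked, so that the lemma applies to
  units, to eigenvectors of torus elements, to spans and to residue classes.\<close>

lemma nside_closed:
 assumes g: "u \<in> indices" and one: "(1::ratfun) \<in> M"
  and mult: "!!f h. f \<in> M ==> h \<in> M ==> f * h \<in> M" and x: "!!v. v \<in> indices ==> xvar v \<in> M"
 shows "nside xvar u \<in> M"
proof -
 obtain t j where tj: "u = (t, j)" by (meson surj_pair)
 have pw: "f ^ k \<in> M" if "f \<in> M" for f k using that one mult by (induction k) simp_all
 have fac: "xvar (nbr u k) ^ nat (- a k (snd u)) \<in> M" if "k \<in> I - {snd u}" for k
 proof (cases "a k j = 0")
  case False
  have "nbr u k \<in> indices" using nbr_in[of t j k] g that False tj by simp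
  thus ?thesis using pw x by simp
 qed (simp add: tj one)
 have pr: "(!!k. k \<in> A ==> h k \<in> M) ==> (PROD k:A. h k) \<in> M" for A :: "nat set" and h
  using one mult by (induction A rule: infinite_finite_induct) simp_all
 show ?thesis unfolding nside_def by (rule pr, rule fac)
qed

lemma units_nside: "u \<in> indices ==> nside xvar u \<in> units"
 by (rule nside_closed) (auto intro: units_one units_mult units_xvar)

lemma units_uvar: "u \<in> indices ==> uvar u \<in> units"
 unfolding uvar_def divide_inverse by (intro units_mult units_inverse units_nside units_zvar units_xvar prev_in)

text \<open>The monomials \<open>X\<close>, \<open>U\<close>, \<open>W\<close> of the relation
  \<open>X = U + W\<close> are eigenvectors. If the eigenvalues of \<open>X\<close> and
  \<open>U\<close> differed, the relation would make \<open>U / X = uvar u\<close> constant; so they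
  agree and the quotient is fixed.\<close>

lemma torus_fixes_uvar:
 assumes \<phi>: "\<phi> \<in> torus n r Bt" and \<psi>: "\<psi> \<in> calg_iso (ring_on local_calg) rconst (ring_on local_calg) rconst"
  and ext: "!!h. h \<in> calg ==> \<psi> h = \<phi> h" and g: "u \<in> indices"
 shows "\<psi> (uvar u) = uvar u"
proof -
 have hom: "\<psi> (f * h) = \<psi> f * \<psi> h" "\<psi> (f + h) = \<psi> f + \<psi> h" if "f \<in> local_calg" "h \<in> local_calg" for f h
  using \<psi> that by (auto simp: calg_iso_def ring_iso_def ring_hom_def)
 have con: "\<psi> (rconst k) = rconst k" for k using \<psi> by (simp add: calg_iso_def)
 define eig where "eig k f <-> f \<in> local_calg & \<psi> f = rconst k * f" for k f
 have eig_one: "eig 1 1" using con[of 1] by (simp add: eig_def generated_one)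
 have eig_mult: "eig (k * k') (f * f')" if "eig k f" "eig k' f'" for k k' f f'
  using that hom by (simp add: eig_def generated_calg.mult rconst_mult mult_ac)
 have eig_power: "eig (k ^ e) (f ^ e)" if "eig k f" for k f e
  using that by (induction e) (simp_all add: eig_one eig_mult)
 have eig_prod: "(!!i. i \<in> A ==> eig (k i) (f i)) ==> eig (PROD i:A. k i) (PROD i:A. f i)" for A :: "(nat * nat) set" and k f
 proof (induction A rule: infinite_finite_induct)
  case (insert i A)
  hence "eig (k i * (PROD i:A. k i)) (f i * (PROD i:A. f i))" by (intro eig_mult) blast+
  thus ?case using insert.hyps by simp
 qed (simp_all add: eig_one)
 have sc: "EX k. k ~= 0 & eig k f" if "f \<in> xvar ` indices \<union> zvar ` indices" for f
 proof -
  have fc: "f \<in> calg" using that gens_in(1,2) by blast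
  have "ALL g:xvar ` indices \<union> zvar ` indices. EX k. k ~= 0 & \<phi> g = rconst k * g"
   using \<phi> unfolding torus_def cluster_variables_eq frozen_variables_eq by blast
  from bspec[OF this that] obtain k where "k ~= 0" "\<phi> f = rconst k * f" by (elim exE conjE)
  thus ?thesis using ext[OF fc] subsetD[OF calg_sub fc] unfolding eig_def by (intro exI[of _ k]) simp
 qed
 obtain l where l: "!!v. v \<in> indices ==> l v ~= 0 & eig (l v) (xvar v)"
  by (rule that, rule someI_ex, rule sc[OF UnI1[OF imageI]])
 obtain m where m: "!!v. v \<in> indices ==> m v ~= 0 & eig (m v) (zvar v)"
  by (rule that, rule someI_ex, rule sc[OF UnI2[OF imageI]])
 define U W X where "U = zvar u * nside xvar u" and "W = (PROD w:indices. zvar w ^ c w u)" and "X = xvar (prev u) * xvar u"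
 define \<alpha> where "\<alpha> = l (prev u) * l u"
 have \<alpha>: "\<alpha> ~= 0" "eig \<alpha> X"
  unfolding X_def \<alpha>_def using l[OF g] l[OF prev_in[OF g]] by (simp_all add: eig_mult)
 have "nside xvar u \<in> {f. EX k. eig k f}"
  by (rule nside_closed[OF g]) (use eig_one eig_mult l in blast)+
 then obtain \<beta> where \<beta>: "eig \<beta> U" unfolding U_def using eig_mult m[OF g] by blast
 define v where "v = (PROD w:indices. m w ^ c w u)"
 have v: "eig v W" unfolding W_def v_def by (rule eig_prod, rule eig_power) (use m in blast)
 have rel: "X = U + W" unfolding X_def U_def W_def by (rule relation[OF g])
 have e1: "rconst \<alpha> * X = rconst \<beta> * U + rconst v * W"
  using \<alpha>(2) \<beta> v hom(2)[of U W] unfolding rel eig_def by simp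
 have X0: "X ~= 0" using xvar_nonzero by (simp add: X_def)
 have u: "uvar u = U / X" by (simp add: uvar_def U_def X_def)
 have ab: "\<alpha> = \<beta>"
 proof (rule ccontr)
  assume ne: "\<alpha> ~= \<beta>"
  have e2: "rconst (v - \<beta>) * U = rconst (v - \<alpha>) * X" using e1 rel by (simp add: rconst_diff algebra_simps)
  show False
  proof (cases "v = \<beta>")
   case True
   hence "rconst (v - \<alpha>) = 0" using e2 X0 by simp
   hence "v - \<alpha> = 0" using rconst_eq_iff[of "v - \<alpha>" 0] by simp
   thus False using ne True by simp
  next
   case False
   hence nz: "rconst (v - \<beta>) ~= 0" using rconst_eq_iff[of "v - \<beta>" 0] by simp
   hence "U / X = rconst (v - \<alpha>) * inverse (rconst (v - \<beta>))" using e2 X0 by (simp add: field_simps)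
   hence "uvar u = rconst ((v - \<alpha>) * inverse (v - \<beta>))" by (simp add: u rconst_mult rconst_inverse)
   thus False using uvar_nonconstant[OF g] by blast
  qed
 qed
 have uX: "uvar u * X = U" using u X0 by simp
 have uin: "uvar u \<in> local_calg" "X \<in> local_calg" using units_uvar[OF g] \<alpha>(2) by (auto simp: units_def eig_def)
 have "\<psi> (uvar u) * (rconst \<alpha> * X) = rconst \<alpha> * U"
  using hom(1)[OF uin] uX \<alpha>(2) \<beta> ab by (simp add: eig_def)
 moreover have "rconst \<alpha> ~= 0" using \<alpha>(1) rconst_eq_iff[of \<alpha> 0] by simp
 ultimately have "\<psi> (uvar u) * X = uvar u * X" using uX by simp
 thus ?thesis using X0 by (rule mult_right_cancel[THEN iffD1, rotated])
qed

definition image_alg :: "ratfun set" where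
 "image_alg = lev indices uvar ` lring"

lemma torus_fixes_image:
 assumes \<phi>: "\<phi> \<in> torus n r Bt" and \<psi>: "\<psi> \<in> calg_iso (ring_on local_calg) rconst (ring_on local_calg) rconst"
  and ext: "!!h. h \<in> calg ==> \<psi> h = \<phi> h" and f: "f \<in> image_alg"
 shows "\<psi> f = f"
proof -
 define F where "F = {f \<in> local_calg. \<psi> f = f}"
 have hom: "\<psi> (f * h) = \<psi> f * \<psi> h" "\<psi> (f + h) = \<psi> f + \<psi> h" if "f \<in> local_calg" "h \<in> local_calg" for f h
  using \<psi> that by (auto simp: calg_iso_def ring_iso_def ring_hom_def)
 have con: "rconst k \<in> F" for k using \<psi> by (simp add: calg_iso_def F_def generated_calg.const)
 have add: "f + h \<in> F" if "f \<in> F" "h \<in> F" for f h using that hom by (simp add: F_def generated_calg.add)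
 have mult: "f * h \<in> F" if "f \<in> F" "h \<in> F" for f h using that hom by (simp add: F_def generated_calg.mult)
 have pw: "f ^ k \<in> F" if "f \<in> F" for f k using that con[of 1] mult by (induction k) simp_all
 have inv: "inverse (uvar u) \<in> F" if g: "u \<in> indices" for u
 proof -
  have i: "uvar u \<in> local_calg" "inverse (uvar u) \<in> local_calg" using units_uvar[OF g] by (auto simp: units_def)
  have "\<psi> (uvar u) * \<psi> (inverse (uvar u)) = 1"
   using hom(1)[OF i] con[of 1] uvar_nonzero[OF g] by (simp add: F_def)
  hence "\<psi> (inverse (uvar u)) = inverse (uvar u)"
   using torus_fixes_uvar[OF \<phi> \<psi> ext g] by (metis inverse_unique)
  thus ?thesis using i by (simp add: F_def)
 qed
 have u: "uvar u \<in> F" if "u \<in> indices" for u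
  using torus_fixes_uvar[OF \<phi> \<psi> ext that] units_uvar[OF that] by (simp add: F_def units_def)
 have powi: "uvar u powi k \<in> F" if "u \<in> indices" for u k
  using pw[OF u[OF that]] pw[OF inv[OF that]] by (simp add: power_int_def)
 have prod: "(!!i. i \<in> A ==> h i \<in> F) ==> (PROD i:A. h i) \<in> F" for A :: "(nat * nat) set" and h
  using con[of 1] mult by (induction A rule: infinite_finite_induct) simp_all
 have sum: "(!!i. i \<in> A ==> h i \<in> F) ==> (SUM i:A. h i) \<in> F" for A :: "((nat * nat) \<Rightarrow>\<^sub>0 int) set" and h
  using con[of 0] add by (induction A rule: infinite_finite_induct) simp_all
 have "lev indices uvar p \<in> F" for p
  unfolding lev_def pm_eval_def lmon_def by (intro sum mult con prod powi)
 thus ?thesis using f by (auto simp: image_alg_def F_def)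
qed

lemma image_alg_sub: "image_alg \<subseteq> local_calg"
proof
 fix f assume "f \<in> image_alg"
 have powi: "uvar u powi k \<in> local_calg" if "u \<in> indices" for u k
  using units_uvar[OF that] by (simp add: units_def generated_powi)
 have sum: "(!!i. i \<in> A ==> h i \<in> local_calg) ==> (SUM i:A. h i) \<in> local_calg" for A :: "((nat * nat) \<Rightarrow>\<^sub>0 int) set" and h
  by (induction A rule: infinite_finite_induct) (simp_all add: generated_zero generated_calg.add)
 have "lev indices uvar p \<in> local_calg" for p
  unfolding lev_def pm_eval_def lmon_def by (intro sum generated_calg.mult generated_calg.const generated_prod powi)
 thus "f \<in> local_calg" using `f \<in> image_alg` by (auto simp: image_alg_def)
qed

lemma image_alg_mult: "f \<in> image_alg ==> g \<in> image_alg ==> f * g \<in> image_alg"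
 and image_alg_add: "f \<in> image_alg ==> g \<in> image_alg ==> f + g \<in> image_alg"
 unfolding image_alg_def
 by (auto simp: lev_hom(1,2)[OF uvar_nonzero, symmetric] intro!: imageI laurents_mult laurents_add)

lemma image_alg_rconst: "rconst k \<in> image_alg"
 unfolding image_alg_def using imageI[OF laurents_lconst, of "lev indices uvar" k indices] by (simp add: lev_lconst[OF uvar_nonzero])

lemma image_alg_one: "1 \<in> image_alg" using image_alg_rconst[of 1] by simp

lemma image_alg_uminus: "f \<in> image_alg ==> - f \<in> image_alg"
 using image_alg_mult[OF image_alg_rconst[of "- 1"], of f] by (simp add: rconst_uminus)

lemma image_alg_powi: "u \<in> indices ==> uvar u powi k \<in> image_alg"
proof -
 assume g: "u \<in> indices"
 have "lev indices uvar (single (single u k) 1) = uvar u powi k"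
  by (simp add: lev_hom[OF uvar_nonzero] lmon_single[OF finite_indices g])
 moreover have "single (single u k) 1 \<in> lring" by (rule laurents_single) (use g in auto)
 ultimately show ?thesis unfolding image_alg_def by (metis imageI)
qed

text \<open>Since \<open>zvar\<close> is a multiple of \<open>uvar\<close> by a Laurent monomial in the cluster variables, these
 monomials span the coordinate ring of the open locus over the image of the configuration ring.\<close>

definition spanned :: "(ratfun \<times> ((nat * nat) \<Rightarrow>\<^sub>0 int)) list => ratfun" where
 "spanned L = (\<Sum>(k, e)\<leftarrow>L. k * lmon indices xvar e)"

lemma spanned_simps [simp]: "spanned [] = 0" "spanned ((k, e) # L) = k * lmon indices xvar e + spanned L"
 "spanned (L @ L') = spanned L + spanned L'" by (simp_all add: spanned_def)

abbreviation "coeffs_in L \<equiv> \<forall>(k, e)\<in>set L. k \<in> image_alg"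

definition span_alg :: "ratfun set" where
 "span_alg = {spanned L | L. coeffs_in L}"

lemma span_add: "f \<in> span_alg ==> g \<in> span_alg ==> f + g \<in> span_alg"
proof -
 assume "f \<in> span_alg" "g \<in> span_alg"
 then obtain L L' where L: "f = spanned L" "coeffs_in L" "g = spanned L'" "coeffs_in L'" by (auto simp: span_alg_def)
 hence "f + g = spanned (L @ L')" "coeffs_in (L @ L')" by auto
 thus ?thesis unfolding span_alg_def by blast
qed

lemma span_single: "k \<in> image_alg ==> k * lmon indices xvar e \<in> span_alg"
 unfolding span_alg_def by (intro CollectI exI[of _ "[(k, e)]"]) simp

lemma span_mult: "f \<in> span_alg ==> g \<in> span_alg ==> f * g \<in> span_alg"
proof -
 assume "f \<in> span_alg" "g \<in> span_alg"
 then obtain L L' where L: "f = spanned L" "coeffs_in L" "g = spanned L'" "coeffs_in L'" by (auto simp: span_alg_def)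
 have z: "0 \<in> span_alg" unfolding span_alg_def by (intro CollectI exI[of _ "[]"]) simp
 have one: "k * lmon indices xvar e * spanned L' \<in> span_alg" if k: "k \<in> image_alg" and L': "coeffs_in L'" for k e L'
  using L'
 proof (induction L')
  case Nil
  thus ?case using z by simp
 next
  case (Cons p L')
  obtain k' e' where p: "p = (k', e')" by (meson surj_pair)
  have "k * lmon indices xvar e * spanned (p # L')
    = (k * k') * lmon indices xvar (e + e') + k * lmon indices xvar e * spanned L'"
   by (simp add: p lmon_add[OF xvar_nonzero] algebra_simps)
  thus ?case using Cons p k by (auto intro!: span_add span_single image_alg_mult)
 qed
 have "spanned L * spanned L' \<in> span_alg" using L(2)
 proof (induction L)
  case Nil
  thus ?case using z by simp
 next
  case (Cons p L)
  thus ?case using one[OF _ L(4)] by (cases p) (auto simp: distrib_right intro!: span_add)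
 qed
 thus ?thesis using L by simp
qed

lemma span_image: "k \<in> image_alg ==> k \<in> span_alg" using span_single[of k 0] by simp

lemma span_monomial: "lmon indices xvar e \<in> span_alg" using span_single[OF image_alg_one, of e] by simp

lemma local_calg_spanned: "local_calg \<subseteq> span_alg"
proof
 fix f assume "f \<in> local_calg"
 have x: "xvar u powi k \<in> span_alg" if "u \<in> indices" for u k
  using span_monomial[of "single u k"] lmon_single[OF finite_indices that, of xvar k] by simp
 have one: "1 \<in> span_alg" using span_image[OF image_alg_one] .
 have N: "nside xvar u \<in> span_alg" if "u \<in> indices" for u
  by (rule nside_closed[OF that one]) (use span_mult x[of _ 1] in auto)
 have N': "inverse (nside xvar u) \<in> span_alg" if g: "u \<in> indices" for u
 proof -
  have "nside xvar u \<in> {f. inverse f \<in> span_alg}"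
  proof (rule nside_closed[OF g])
   show "xvar v \<in> {f. inverse f \<in> span_alg}" if "v \<in> indices" for v using x[OF that, of "- 1"] by (simp add: power_int_minus)
  qed (use one span_mult in auto)
  thus ?thesis by simp
 qed
 show "f \<in> span_alg" using `f \<in> local_calg`
 proof (induction rule: generated_calg.induct)
  case (const k)
  show ?case using span_image[OF image_alg_rconst] .
 next
  case (gen f)
  then consider u where "u \<in> indices" "f = xvar u" | u where "u \<in> indices" "f = zvar u"
   | u where "u \<in> indices" "f = inverse (zvar u)" | u where "u \<in> indices" "f = inverse (xvar u)"
   by (auto simp: local_gens_def base_gens_def)
  thus ?case
  proof cases
   case (1 u)
   thus ?thesis using x[of u 1] by simp
  next
   case (2 u)
   have "zvar u = (uvar u powi 1) * (xvar (prev u) powi 1 * xvar u powi 1) * inverse (nside xvar u)"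
    using nside_nonzero[of xvar, OF xvar_nonzero 2(1)] xvar_nonzero by (simp add: uvar_def)
   thus ?thesis unfolding 2(2) using 2(1) prev_in by (simp only:) (intro span_mult x N' span_image image_alg_powi)
  next
   case (3 u)
   have "inverse (zvar u) = (uvar u powi (- 1)) * (xvar (prev u) powi (- 1) * xvar u powi (- 1)) * nside xvar u"
    using nside_nonzero[of xvar, OF xvar_nonzero 3(1)] xvar_nonzero zvar_nonzero
    by (simp add: uvar_def power_int_minus field_simps)
   thus ?thesis unfolding 3(2) using 3(1) prev_in by (simp only:) (intro span_mult x N span_image image_alg_powi)
  next
   case (4 u)
   thus ?thesis using x[of u "- 1"] by (simp add: power_int_minus)
  qed
 qed (auto intro: span_add span_mult)
qed

text \<open>Arbitrary scalars \<open>l u\<close> for all cluster variables at once are realised: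
  initial variables are scaled directly, and \<open>z_u\<close> by the factor for which its term of
  the exchange relation scales like \<open>x_(prev u) x_u\<close>.\<close>

definition weight :: "(nat * nat => complex) => nat => complex" where
 "weight l i = (if i \<in> I then l (0, i)
   else if i \<in> idx ` indices then (let u = the_inv_into indices idx i in l (prev u) * l u / nside l u)
   else 1)"

context
 fixes l :: "nat * nat => complex" assumes l: "!!u. l u ~= 0"
begin

lemma nside_l: "nside l u ~= 0" by (simp add: nside_def l)

lemma weight_nonzero: "weight l i ~= 0" using l nside_l by (simp add: weight_def Let_def)

lemma weight_idx:
 assumes g: "u \<in> indices"
 shows "weight l (idx u) = l (prev u) * l u / nside l u"
proof -
 have "the_inv_into indices idx (idx u) = u" using idx_bij g by (simp add: bij_betw_def the_inv_into_f_f)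
 thus ?thesis using idx_in[OF g] g by (simp add: weight_def Let_def)
qed

lemma scale_zvar: "u \<in> indices ==> scale (weight l) (zvar u) = rconst (l (prev u) * l u / nside l u) * zvar u"
 unfolding zvar_def using scale_var[OF weight_nonzero] weight_idx by simp

lemma scale_nside:
 assumes "!!k. k \<in> I - {j} ==> a k j ~= 0 ==> scale (weight l) (xvar (nbr (t, j) k)) = rconst (l (nbr (t, j) k)) * xvar (nbr (t, j) k)"
 shows "scale (weight l) (nside xvar (t, j)) = rconst (nside l (t, j)) * nside xvar (t, j)"
proof -
 have "scale (weight l) (xvar (nbr (t, j) k) ^ nat (- a k j)) = rconst (l (nbr (t, j) k)) ^ nat (- a k j) * xvar (nbr (t, j) k) ^ nat (- a k j)"
  if "k \<in> I - {j}" for k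
  using assms[OF that] by (cases "a k j = 0") (simp_all add: scale_power[OF weight_nonzero] scale_one[OF weight_nonzero] power_mult_distrib)
 thus ?thesis
  unfolding nside_def snd_conv scale_prod[OF weight_nonzero] rconst_prod rconst_power prod.distrib[symmetric]
  by (intro prod.cong refl) blast
qed

text \<open>The coefficient term scales by the same factor, by \<open>nside_identity\<close> for the
  family \<open>l\<close>.\<close>

lemma scale_zprod:
 assumes g: "u \<in> indices"
 shows "scale (weight l) (PROD w:indices. zvar w ^ c w u) = rconst (l (prev u) * l u) * (PROD w:indices. zvar w ^ c w u)"
proof -
 have "(PROD w:indices. (l (prev w) * l w / nside l w) ^ c w u)
   = inverse (PROD w:indices. (nside l w / (l (prev w) * l w)) ^ c w u)"
  unfolding prod_inversef[symmetric] o_def by (intro prod.cong refl) (simp add: power_inverse[symmetric])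
 also have "... = l (prev u) * l u" using nside_identity[of l, OF l g] by simp
 finally have w: "(PROD w:indices. (l (prev w) * l w / nside l w) ^ c w u) = l (prev u) * l u" .
 show ?thesis
  unfolding w[symmetric] rconst_prod rconst_power scale_prod[OF weight_nonzero] scale_power[OF weight_nonzero] prod.distrib[symmetric]
  by (intro prod.cong refl) (simp add: scale_zvar power_mult_distrib)
qed

lemma scale_xvar: "u \<in> indices ==> scale (weight l) (xvar u) = rconst (l u) * xvar u"
proof (induction rule: indices_induct)
 case (zero j)
 hence "weight l j = l (0, j)" by (simp add: weight_def)
 moreover have "xvar (0, j) = var j" using zero by (simp add: xvar_def sd.sweep_var_seedX)
 ultimately show ?case by (simp add: scale_var[OF weight_nonzero])
next
 case (Suc t j)
 let ?g = "(Suc t, j)"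
 note g = Suc.hyps
 have N: "scale (weight l) (nside xvar ?g) = rconst (nside l ?g) * nside xvar ?g"
  by (rule scale_nside) (rule Suc.IH)
 have "scale (weight l) (zvar ?g * nside xvar ?g) = rconst (l (prev ?g) * l ?g / nside l ?g * nside l ?g) * (zvar ?g * nside xvar ?g)"
  unfolding scale_mult[OF weight_nonzero] N scale_zvar[OF g] rconst_mult by (simp only: mult_ac)
 also have "l (prev ?g) * l ?g / nside l ?g * nside l ?g = l (prev ?g) * l ?g" using nside_l by simp
 finally have "scale (weight l) (xvar (prev ?g) * xvar ?g) = rconst (l (prev ?g) * l ?g) * (xvar (prev ?g) * xvar ?g)"
  unfolding relation[OF g] scale_add[OF weight_nonzero] scale_zprod[OF g] by (simp only: distrib_left)
 moreover have p: "prev ?g = (t, j)" by (simp add: prev_simps)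
 ultimately have "rconst (l (t, j)) * xvar (t, j) * scale (weight l) (xvar ?g) = rconst (l (t, j)) * rconst (l ?g) * (xvar (t, j) * xvar ?g)"
  unfolding scale_mult[OF weight_nonzero] p Suc.IH(1) rconst_mult by simp
 moreover have "rconst (l (t, j)) ~= 0" using l rconst_eq_iff[of _ 0] by simp
 ultimately show ?case using xvar_nonzero[of "(t, j)"] by simp
qed

lemma scale_gens: "f \<in> local_gens ==> EX s. s ~= 0 & scale (weight l) f = rconst s * f"
proof -
 have nz: "l (prev u) * l u / nside l u ~= 0" for u using l nside_l by simp
 have inv: "EX s. s ~= 0 & scale (weight l) (inverse f) = rconst s * inverse f" if "s ~= 0" "scale (weight l) f = rconst s * f" for s f
  using that by (intro exI[of _ "inverse s"]) (simp add: scale_inverse[OF weight_nonzero] rconst_inverse)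
 assume "f \<in> local_gens"
 then consider u where "u \<in> indices" "f = xvar u" | u where "u \<in> indices" "f = zvar u"
   | u where "u \<in> indices" "f = inverse (zvar u)" | u where "u \<in> indices" "f = inverse (xvar u)"
   by (auto simp: local_gens_def base_gens_def)
 thus ?thesis
 proof cases
  case 1
  thus ?thesis using scale_xvar l by blast
 next
  case 2
  thus ?thesis using scale_zvar nz by blast
 next
  case 3
  thus ?thesis using inv[OF nz scale_zvar] by blast
 next
  case 4
  thus ?thesis using inv[OF l scale_xvar] by blast
 qed
qed

lemma scale_torus: "scale (weight l) \<in> torus n r Bt"
proof -
 have nz: "l (prev u) * l u / nside l u ~= 0" for u using l nside_l by simp
 have "scale (weight l) \<in> calg_iso (ring_on calg) rconst (ring_on calg) rconst"
  by (rule scale_calg_iso[OF weight_nonzero]) (use scale_gens in "auto simp: local_gens_def")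
 thus ?thesis unfolding torus_def cluster_algebra_eq cluster_variables_eq frozen_variables_eq
  using scale_xvar scale_zvar l nz by blast
qed

lemma scale_local: "scale (weight l) \<in> calg_iso (ring_on local_calg) rconst (ring_on local_calg) rconst"
 by (rule scale_calg_iso[OF weight_nonzero scale_gens])

lemma scale_image: "f \<in> image_alg ==> scale (weight l) f = f"
 by (rule torus_fixes_image[OF scale_torus scale_local refl])

lemma scale_monomial: "scale (weight l) (lmon indices xvar e) = rconst (lmon indices l e) * lmon indices xvar e"
 unfolding lmon_def scale_prod[OF weight_nonzero] rconst_prod rconst_powi prod.distrib[symmetric]
 by (intro prod.cong refl) (simp add: scale_powi[OF weight_nonzero] scale_xvar power_int_mult_distrib)

end

definition invariants :: "ratfun set" where
 "invariants = {f \<in> local_calg. \<forall>\<phi> \<in> torus n r Bt.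
   \<forall>\<psi> \<in> calg_iso (ring_on local_calg) rconst (ring_on local_calg) rconst.
    (ALL h:calg. \<psi> h = \<phi> h) --> \<psi> f = f}"

text \<open>A term with a nontrivial monomial is moved by a torus element that scales one cluster
  variable by \<open>2\<close>. Combining the invariant with its image so that this term cancels
  gives a shorter expression, whose coefficients still lie in \<open>image_alg\<close>.\<close>

lemma invariant_spanned: "f \<in> invariants ==> f = spanned L ==> coeffs_in L ==> f \<in> image_alg"
proof (induction "length L" arbitrary: L rule: less_induct)
 case less
 show ?case
 proof (cases "EX k e u. (k, e) \<in> set L & u \<in> indices & lookup e u ~= 0")
  case False
  have "spanned L' \<in> image_alg" if "set L' \<subseteq> set L" for L' using that
  proof (induction L')
   case Nil
   thus ?case using image_alg_rconst[of 0] by simp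
  next
   case (Cons p L')
   obtain k e where p: "p = (k, e)" by (meson surj_pair)
   have "lmon indices xvar e = 1" unfolding lmon_def using False Cons.prems p by (intro prod.neutral ballI) auto
   moreover have "k \<in> image_alg" using less.prems(3) Cons.prems p by auto
   ultimately show ?case using Cons p by (simp add: image_alg_add)
  qed
  thus ?thesis using less.prems(2) by simp
 next
  case True
  then obtain k0 e0 u where e0: "(k0, e0) \<in> set L" "u \<in> indices" "lookup e0 u ~= 0" by blast
  obtain L1 L2 where L: "L = L1 @ (k0, e0) # L2" using e0(1) by (meson split_list)
  define l :: "nat * nat => complex" where "l v = (if v = u then 2 else 1)" for v
  have l0: "l v ~= 0" for v by (simp add: l_def)
  note w0 = weight_nonzero[of l, OF l0]
  define \<chi> where "\<chi> e = lmon indices l e" for e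
  have \<chi>0: "\<chi> e0 ~= 1"
  proof -
   have "\<chi> e0 = (PROD v:indices. if v = u then 2 powi lookup e0 u else 1)"
    unfolding \<chi>_def lmon_def by (intro prod.cong refl) (simp add: l_def)
   thus ?thesis using e0(2) finite_indices two_powi_ne_one[OF e0(3)] by simp
  qed
  have "\<forall>\<phi>\<in>torus n r Bt. \<forall>\<psi>\<in>calg_iso (ring_on local_calg) rconst (ring_on local_calg) rconst. (ALL h:calg. \<psi> h = \<phi> h) --> \<psi> f = f"
   using less.prems(1) unfolding invariants_def by blast
  from bspec[OF bspec[OF this scale_torus[of l, OF l0]] scale_local[of l, OF l0]]
  have inv: "scale (weight l) f = f" by blast
  have sc: "scale (weight l) (spanned M) = spanned (map (%(k, e). (rconst (\<chi> e) * k, e)) M)" if "coeffs_in M" for M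
   using that
  proof (induction M)
   case Nil
   thus ?case using scale_rconst[of "weight l", OF w0, of 0] by simp
  next
   case (Cons p M)
   obtain k e where p: "p = (k, e)" by (meson surj_pair)
   have "k \<in> image_alg" using Cons.prems p by simp
   thus ?case using Cons p scale_image[of l, OF l0] scale_monomial[of l, OF l0]
    by (simp add: scale_add[of "weight l", OF w0] scale_mult[of "weight l", OF w0] \<chi>_def mult_ac)
  qed
  have f1: "f = spanned (map (%(k, e). (rconst (\<chi> e) * k, e)) L)"
   using sc[OF less.prems(3)] unfolding less.prems(2)[symmetric] inv .
  \<comment> \<open>Obtained by dividing
    \<open>\<chi> e0 * f - scale (weight l) f = (\<chi> e0 - 1) * f\<close> by
    \<open>\<chi> e0 - 1\<close>; the factor is zero at \<open>e0\<close>.\<close>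
  define t where "t e = (\<chi> e0 - \<chi> e) / (\<chi> e0 - 1)" for e
  have comb: "rconst (\<chi> e0) * spanned M - spanned (map (%(k, e). (rconst (\<chi> e) * k, e)) M)
    = rconst (\<chi> e0 - 1) * spanned (map (%(k, e). (rconst (t e) * k, e)) M)" for M
  proof (induction M)
   case (Cons p M)
   obtain k e where p: "p = (k, e)" by (meson surj_pair)
   have "rconst (\<chi> e0 - 1) * rconst (t e) = rconst (\<chi> e0) - rconst (\<chi> e)"
    using \<chi>0 by (simp add: t_def rconst_mult[symmetric] rconst_diff[symmetric])
   hence "rconst (\<chi> e0) * (k * lmon indices xvar e) - rconst (\<chi> e) * k * lmon indices xvar e
     = rconst (\<chi> e0 - 1) * (rconst (t e) * k * lmon indices xvar e)"
    by (simp add: mult.assoc[symmetric] left_diff_distrib)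
   thus ?case using Cons by (simp add: p algebra_simps)
  qed simp
  have "rconst (\<chi> e0) * f - f = rconst (\<chi> e0 - 1) * spanned (map (%(k, e). (rconst (t e) * k, e)) L)"
   using comb[of L] unfolding f1[symmetric] less.prems(2)[symmetric] .
  hence "rconst (\<chi> e0 - 1) * f = rconst (\<chi> e0 - 1) * spanned (map (%(k, e). (rconst (t e) * k, e)) L)"
   by (simp add: rconst_diff algebra_simps)
  moreover have "rconst (\<chi> e0 - 1) ~= 0" using \<chi>0 rconst_eq_iff[of "\<chi> e0 - 1" 0] by simp
  ultimately have "f = spanned (map (%(k, e). (rconst (t e) * k, e)) L)" by simp
  moreover have "t e0 = 0" by (simp add: t_def)
  ultimately have f2: "f = spanned (map (%(k, e). (rconst (t e) * k, e)) (L1 @ L2))" by (simp add: L)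
  have len: "length (map (%(k, e). (rconst (t e) * k, e)) (L1 @ L2)) < length L" by (simp add: L)
  have ci: "coeffs_in (map (%(k, e). (rconst (t e) * k, e)) (L1 @ L2))"
   using less.prems(3) L by (auto intro!: image_alg_mult image_alg_rconst)
  show ?thesis by (rule less.hyps[OF len less.prems(1) f2 ci])
 qed
qed

lemma invariants_eq: "invariants = image_alg"
proof
 show "invariants \<subseteq> image_alg"
 proof
  fix f assume f: "f \<in> invariants"
  hence "f \<in> span_alg" using local_calg_spanned by (auto simp: invariants_def)
  thus "f \<in> image_alg" using invariant_spanned[OF f] by (auto simp: span_alg_def)
 qed
 show "image_alg \<subseteq> invariants" using image_alg_sub torus_fixes_image unfolding invariants_def by blast
qed

lemma invariant_ring_eq: "invariant_ring n r Bt = ring_on image_alg"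
 unfolding invariants_eq[symmetric] invariant_ring_def invariants_def open_locus_ring_eq cluster_algebra_eq ring_on_simps ..

theorem config_invariant_iso:
 "\<exists>\<phi>. \<phi> \<in> calg_iso (config_ring indices c) (%k. config_class indices c (lconst k)) (invariant_ring n r Bt) rconst"
proof -
 have S: "cring (ring_on image_alg)"
  by (rule cring_ring_on) (auto intro: image_alg_one image_alg_add image_alg_mult image_alg_uminus)
 have h: "lev indices uvar \<in> ring_hom (ring_on lring) (ring_on image_alg)"
  by (auto simp: ring_hom_def lev_hom[OF uvar_nonzero] image_alg_def)
 have "\<exists>\<phi> \<in> ring_iso (ring_on lring Quot cideal) (ring_on image_alg). ALL x:lring. \<phi> (cideal +>\<^bsub>ring_on lring\<^esub> x) = lev indices uvar x"
  by (rule quotient_iso[OF cring_laurents cring.axioms(1)[OF S] h])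
   (simp_all add: image_alg_def lev_uvar_kernel cideal_sub)
 then obtain \<phi> where \<phi>: "\<phi> \<in> ring_iso (ring_on lring Quot cideal) (ring_on image_alg)"
  "!!x. x \<in> lring ==> \<phi> (cideal +>\<^bsub>ring_on lring\<^esub> x) = lev indices uvar x" by blast
 have iso: "\<phi> \<in> calg_iso (config_ring indices c) (%k. config_class indices c (lconst k)) (invariant_ring n r Bt) rconst"
  using \<phi>(1) \<phi>(2)[OF laurents_lconst] lev_lconst[of indices uvar, OF uvar_nonzero]
  by (simp add: calg_iso_def config_ring_def config_class_def laurent_ring_eq invariant_ring_eq)
 show ?thesis by (rule exI[of _ \<phi>]) (rule iso)
qed

section \<open>The locus where all cluster variables are one\<close>

definition uideal :: "ratfun set" where
 "uideal = genideal (ring_on calg) ((%f. f - 1) ` xvar ` indices)"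

lemma calg_diff: "f \<in> calg ==> g \<in> calg ==> f - g \<in> calg"
 using generated_calg.add[of f base_gens "- g"] generated_uminus[of g base_gens] by simp

lemma uideal: "ideal uideal (ring_on calg)" "u \<in> indices ==> xvar u - 1 \<in> uideal"
proof -
 interpret cring "ring_on calg" by (rule cring_generated)
 have S: "(%f. f - 1) ` xvar ` indices \<subseteq> carrier (ring_on calg)" using gens_in(1) calg_diff[OF _ generated_one] by (simp only: ring_on_simps) blast
 show "ideal uideal (ring_on calg)" unfolding uideal_def by (rule genideal_ideal[OF S])
 show "u \<in> indices ==> xvar u - 1 \<in> uideal" unfolding uideal_def using genideal_self[OF S] by blast
qed

lemma uideal_closed: shows "0 \<in> uideal" "f \<in> uideal ==> g \<in> uideal ==> f + g \<in> uideal"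
  "f \<in> uideal ==> h \<in> calg ==> f * h \<in> uideal" "f \<in> uideal ==> - f \<in> uideal"
proof -
 note I = uideal(1)
 show "0 \<in> uideal" using additive_subgroup.zero_closed[OF ideal.axioms(1)[OF I]] by simp
 show "f \<in> uideal ==> g \<in> uideal ==> f + g \<in> uideal"
  using additive_subgroup.a_closed[OF ideal.axioms(1)[OF I], of f g] by simp
 show m: "f \<in> uideal ==> h \<in> calg ==> f * h \<in> uideal" for f h
  using ideal.I_r_closed[OF I, of f h] by simp
 show "f \<in> uideal ==> - f \<in> uideal" using m[of f "- 1"] generated_uminus[OF generated_one] by simp
qed

lemma uideal_mult:
 assumes "f - 1 \<in> uideal" "g - 1 \<in> uideal" "g \<in> calg"
 shows "f * g - 1 \<in> uideal"
proof -
 have e: "f * g - 1 = (f - 1) * g + (g - 1)" by (simp add: algebra_simps)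
 show ?thesis unfolding e by (rule uideal_closed(2)[OF uideal_closed(3)[OF assms(1,3)] assms(2)])
qed

lemma uideal_nside: "u \<in> indices ==> nside xvar u \<in> {f \<in> calg. f - 1 \<in> uideal}" by (rule nside_closed)
  (use generated_one uideal_closed(1) gens_in(1) uideal(2) in "auto intro: generated_calg.mult uideal_mult simp del: split_paired_All")

text \<open>Modulo the ideal both \<open>x_(prev u) x_u\<close> and the monomial
  \<open>nside xvar u\<close> become \<open>1\<close> in the exchange relation.\<close>

lemma uideal_relation:
 assumes g: "u \<in> indices"
 shows "zvar u + (PROD w:indices. zvar w ^ c w u) - 1 \<in> uideal"
proof -
 have X: "xvar (prev u) * xvar u - 1 \<in> uideal" by (intro uideal_mult uideal(2) prev_in gens_in g)
 have N: "nside xvar u - 1 \<in> uideal" using uideal_nside[OF g] by blast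
 have e: "zvar u + (PROD w:indices. zvar w ^ c w u) - 1 = (xvar (prev u) * xvar u - 1) + - ((nside xvar u - 1) * zvar u)"
  unfolding relation[OF g] by (simp add: algebra_simps)
 show ?thesis unfolding e by (intro uideal_closed X N gens_in g)
qed

lemma special_uminus: "special f p ==> special (- f) (- p)"
 using special_mult[OF special_rconst[of "- 1"], of f p]
 by (simp add: rconst_uminus lconst_def single_uminus single_one)

lemma special_diff: "special f p ==> special g q ==> special (f - g) (p - q)"
 using special_add[OF _ special_uminus, of f p g q] by simp

lemma special_calg: "f \<in> calg ==> EX p. special f p"
proof (induction rule: generated_calg.induct)
 case (gen f)
 then consider u where "u \<in> indices" "f = xvar u" | u where "u \<in> indices" "f = zvar u"
   | u where "u \<in> indices" "f = inverse (zvar u)" by (auto simp: base_gens_def)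
 thus ?case
 proof cases
  case 1
  thus ?thesis using special_xvar by blast
 next
  case 2
  thus ?thesis using special_zvar by blast
 next
  case (3 u)
  have "special (zvar u powi (- 1)) (single (single u (- 1)) 1)"
   by (intro special_powi special_zvar zvar_nonzero 3)
  thus ?thesis unfolding 3(2) by (auto simp: power_int_minus)
 qed
qed (use special_rconst special_add special_mult in blast)+

text \<open>The functions specialising to \<open>0\<close> form an ideal, because every element of
  the cluster algebra has some specialisation, and it contains the generators
  \<open>x_u - 1\<close>.\<close>

lemma special_uideal: "f \<in> uideal ==> special f 0"
proof -
 interpret cring "ring_on calg" by (rule cring_generated)
 have z: "special 0 0" using special_rconst[of 0] by (simp add: lconst_hom)
 have "ideal {f \<in> calg. special f 0} (ring_on calg)"
 proof (rule ideal_ring_on[OF cring_generated])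
  show "f * g \<in> {f \<in> calg. special f 0}" if "f \<in> {f \<in> calg. special f 0}" "g \<in> calg" for f g
  proof -
   from special_calg[OF that(2)] obtain p where "special g p" by blast
   thus ?thesis using that special_mult[of f 0 g p] by (auto intro: generated_calg.mult)
  qed
  show "f + g \<in> {f \<in> calg. special f 0}" if "f \<in> {f \<in> calg. special f 0}" "g \<in> {f \<in> calg. special f 0}" for f g
   using that special_add[of f 0 g 0] by (auto intro: generated_calg.add)
 qed (auto simp: z generated_zero intro: generated_uminus generated_one)
 moreover have "(%f. f - 1) ` xvar ` indices \<subseteq> {f \<in> calg. special f 0}"
  using special_diff[OF special_xvar special_one] calg_diff[OF gens_in(1) generated_one]
  by (simp only: image_subset_iff ball_simps mem_Collect_eq diff_self) blast
 ultimately have "uideal \<subseteq> {f \<in> calg. special f 0}" unfolding uideal_def by (rule genideal_minimal)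
 thus "f \<in> uideal ==> special f 0" by blast
qed

lemma lev_zvar_in: "lev indices zvar p \<in> calg"
proof -
 have sum: "(!!i. i \<in> A ==> h i \<in> calg) ==> (SUM i:A. h i) \<in> calg" for A :: "((nat * nat) \<Rightarrow>\<^sub>0 int) set" and h
  by (induction A rule: infinite_finite_induct) (simp_all add: generated_zero generated_calg.add)
 show ?thesis unfolding lev_def pm_eval_def lmon_def
  by (intro sum generated_calg.mult generated_calg.const generated_prod generated_powi gens_in)
qed

text \<open>Evaluated at the \<open>zvar\<close>, a Laurent polynomial specialises to itself; if the
  evaluation lies in the ideal of the locus, it also specialises to zero.\<close>

lemma lev_zvar_kernel:
 assumes p: "p \<in> lring"
 shows "lev indices zvar p \<in> uideal <-> p \<in> cideal"
proof
 assume "lev indices zvar p \<in> uideal"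
 hence "special (lev indices zvar p - lev indices zvar p) (p - 0)"
  using special_diff[OF special_lev[of zvar, OF special_zvar zvar_nonzero p] special_uideal] by blast
 thus "p \<in> cideal" using special_zero by simp
next
 assume "p \<in> cideal"
 thus "lev indices zvar p \<in> uideal"
  by (intro lev_cideal[OF zvar_nonzero uideal(1) cring_generated lev_zvar_in uideal_relation])
qed

lemma lev_zvar_surj: "f \<in> calg ==> EX p:lring. lev indices zvar p - f \<in> uideal"
proof (induction rule: generated_calg.induct)
 case (const k)
 show ?case using lev_lconst[of indices zvar k, OF zvar_nonzero] uideal_closed(1) by (intro bexI[of _ "lconst k"]) (simp_all add: laurents_lconst)
next
 case (gen f)
 then consider u where "u \<in> indices" "f = xvar u" | u where "u \<in> indices" "f = zvar u"
   | u where "u \<in> indices" "f = inverse (zvar u)" by (auto simp: base_gens_def)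
 thus ?case
 proof cases
  case (1 u)
  thus ?thesis using uideal_closed(4)[OF uideal(2)[OF 1(1)]]
   by (intro bexI[of _ 1]) (simp_all add: lev_hom[OF zvar_nonzero] laurents_one)
 next
  case (2 u)
  thus ?thesis using uideal_closed(1) lev_lvar[OF finite_indices zvar_nonzero 2(1)]
   by (intro bexI[of _ "lvar u"]) (simp_all add: laurents_lvar)
 next
  case (3 u)
  have "single (single u (- 1)) 1 \<in> lring" by (rule laurents_single) (use 3 in auto)
  thus ?thesis using uideal_closed(1) 3 by (intro bexI[of _ "single (single u (- 1)) 1"])
    (simp_all add: lev_hom[OF zvar_nonzero] lmon_single[OF finite_indices 3(1)] power_int_minus)
 qed
next
 case (add f g)
 then obtain p q where pq: "p \<in> lring" "q \<in> lring" "lev indices zvar p - f \<in> uideal" "lev indices zvar q - g \<in> uideal" by blast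
 have "lev indices zvar (p + q) - (f + g) = (lev indices zvar p - f) + (lev indices zvar q - g)"
  by (simp add: lev_hom[OF zvar_nonzero])
 thus ?case using uideal_closed(2)[OF pq(3,4)] laurents_add[OF pq(1,2)] by metis
next
 case (mult f g)
 then obtain p q where pq: "p \<in> lring" "q \<in> lring" "lev indices zvar p - f \<in> uideal" "lev indices zvar q - g \<in> uideal" by blast
 have e: "lev indices zvar (p * q) - f * g = (lev indices zvar p - f) * g + (lev indices zvar q - g) * lev indices zvar p"
  by (simp add: lev_hom[OF zvar_nonzero] algebra_simps)
 have "lev indices zvar (p * q) - f * g \<in> uideal"
  unfolding e by (intro uideal_closed pq mult.hyps lev_zvar_in)
 thus ?case using laurents_mult[OF pq(1,2)] by blast
qed

theorem config_unit_iso: "\<exists>\<psi> \<in> calg_iso (config_ring indices c) (%k. config_class indices c (lconst k))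
    (unit_locus_ring n r Bt) (%k. unit_locus_class n r Bt (rconst k)).
   ALL u:indices. \<psi> (config_class indices c (lvar u)) = unit_locus_class n r Bt (var (idx u))"
proof -
 have J: "unit_locus_ideal n r Bt = uideal"
  by (simp add: unit_locus_ideal_def uideal_def cluster_algebra_eq cluster_variables_eq)
 have ring: "unit_locus_ring n r Bt = ring_on calg Quot uideal"
  by (simp add: unit_locus_ring_def J cluster_algebra_eq)
 have cls: "unit_locus_class n r Bt f = uideal +>\<^bsub>ring_on calg\<^esub> f" for f
  by (simp add: unit_locus_class_def J cluster_algebra_eq)
 have coset: "uideal +>\<^bsub>ring_on calg\<^esub> x = uideal +>\<^bsub>ring_on calg\<^esub> y <-> x - y \<in> uideal" for x y
  by (rule coset_ring_on_eq_iff[OF uideal(1)]) (rule uideal_closed(4))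
 define h where "h p = uideal +>\<^bsub>ring_on calg\<^esub> lev indices zvar p" for p
 have lh: "lev indices zvar \<in> ring_hom (ring_on lring) (ring_on calg)"
  by (auto simp: ring_hom_def lev_hom[OF zvar_nonzero] lev_zvar_in)
 have h: "h \<in> ring_hom (ring_on lring) (ring_on calg Quot uideal)"
  using ring_hom_trans[OF lh ideal.rcos_ring_hom[OF uideal(1)]] by (simp add: h_def[abs_def] comp_def)
 have S: "ring (ring_on calg Quot uideal)" by (rule ideal.quotient_is_ring[OF uideal(1)])
 have carr: "carrier (ring_on calg Quot uideal) = (%f. uideal +>\<^bsub>ring_on calg\<^esub> f) ` calg"
  by (auto simp: FactRing_def A_RCOSETS_def')
 have surj: "h ` lring = carrier (ring_on calg Quot uideal)"
 proof
  show "h ` lring \<subseteq> carrier (ring_on calg Quot uideal)" using lev_zvar_in by (auto simp: carr h_def)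
  show "carrier (ring_on calg Quot uideal) \<subseteq> h ` lring" unfolding carr
  proof (rule image_subsetI)
   fix f assume "f \<in> calg"
   then obtain p where "p \<in> lring" "lev indices zvar p - f \<in> uideal" using lev_zvar_surj by blast
   thus "uideal +>\<^bsub>ring_on calg\<^esub> f \<in> h ` lring" using coset by (force simp: h_def)
  qed
 qed
 have zero: "\<zero>\<^bsub>ring_on calg Quot uideal\<^esub> = uideal +>\<^bsub>ring_on calg\<^esub> 0"
  by (simp add: FactRing_def coset_ring_on)
 have ker: "h x = \<zero>\<^bsub>ring_on calg Quot uideal\<^esub> <-> x \<in> cideal" if "x \<in> lring" for x
  unfolding zero h_def coset using lev_zvar_kernel[OF that] by simp
 obtain \<psi> where \<psi>: "\<psi> \<in> ring_iso (ring_on lring Quot cideal) (ring_on calg Quot uideal)"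
  "!!x. x \<in> lring ==> \<psi> (cideal +>\<^bsub>ring_on lring\<^esub> x) = h x"
  using quotient_iso[OF cring_laurents S h surj ker cideal_sub] by blast
 show ?thesis
 proof (intro bexI ballI)
  show "\<psi> (config_class indices c (lvar u)) = unit_locus_class n r Bt (var (idx u))" if "u \<in> indices" for u
   using \<psi>(2)[OF laurents_lvar[OF that]] lev_lvar[OF finite_indices zvar_nonzero that]
   by (simp add: config_class_def laurent_ring_eq cls h_def zvar_def)
  show "\<psi> \<in> calg_iso (config_ring indices c) (%k. config_class indices c (lconst k))
    (unit_locus_ring n r Bt) (%k. unit_locus_class n r Bt (rconst k))"
   using \<psi>(1) \<psi>(2)[OF laurents_lconst] lev_lconst[of indices zvar, OF zvar_nonzero]
   by (simp add: calg_iso_def config_ring_def config_class_def laurent_ring_eq ring cls h_def)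
 qed
qed

end

text \<open>Mutation at a source only changes signs in its own row and column, so the arrows among
  the vertices still to come stay as they were, and none of these vertices has an arrow into the
  source.\<close>

lemma source_sequence_order:
 assumes "source_sequence n b ks" "distinct ks" "set ks \<subseteq> {1..n}"
  and "!!i j. i \<in> {1..n} ==> j \<in> {1..n} ==> b i j > 0 <-> b j i < 0" and "q < p" "p < length ks"
 shows "~ b (ks ! p) (ks ! q) > 0"
 using assms
proof (induction ks arbitrary: b p q)
 case Nil
 thus ?case by simp
next
 case (Cons k ks)
 have k: "k \<in> {1..n}" "!!j. j \<in> {1..n} ==> ~ b j k > 0" using Cons.prems by auto
 have ksn: "set ks \<subseteq> {1..n}" "k \<notin> set ks" "distinct ks" using Cons.prems by auto
 obtain p' where p: "p = Suc p'" "p' < length ks" using Cons.prems by (cases p) auto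
 have pk: "ks ! p' \<in> {1..n}" using ksn(1) p(2) nth_mem by blast
 show ?case
 proof (cases q)
  case 0
  thus ?thesis using k(2)[OF pk] p by simp
 next
  case (Suc q')
  have skew: "b i j > 0 <-> b j i < 0" if "i \<in> {1..n}" "j \<in> {1..n}" for i j using Cons.prems(4) that by blast
  have m: "mutate_matrix k b i j = (if i = k | j = k then - b i j else b i j)" if ij: "i \<in> {1..n}" "j \<in> {1..n}" for i j
  proof -
   have "b i k <= 0" "b j k <= 0" using k(2) ij by (auto simp: not_less)
   moreover have "b k j >= 0" using skew[OF ij(2) k(1)] `b j k <= 0` by (simp add: not_less[symmetric])
   ultimately show ?thesis by (simp add: mutate_matrix_def)
  qed
  have "~ mutate_matrix k b (ks ! p') (ks ! q') > 0"
  proof (rule Cons.IH)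
   show "source_sequence n (mutate_matrix k b) ks" using Cons.prems(1) by simp
   show "mutate_matrix k b i j > 0 <-> mutate_matrix k b j i < 0" if "i \<in> {1..n}" "j \<in> {1..n}" for i j
    using skew[OF that] skew[OF that(2,1)] unfolding m[OF that] m[OF that(2,1)] by auto
   show "q' < p'" using Cons.prems(5) p(1) Suc by simp
  qed (use ksn p in auto)
  moreover have qk: "ks ! q' \<in> {1..n}" using ksn(1) p Suc Cons.prems(5) by (meson Suc_less_eq less_trans nth_mem subsetD)
  moreover have "ks ! p' ~= k" "ks ! q' ~= k" using ksn(2) p Suc Cons.prems(5) by (metis Suc_less_eq less_trans nth_mem)+
  ultimately show ?thesis using m[OF pk qk] p Suc by simp
 qed
qed

theorem theorem4p4:
  fixes n :: nat
    and a :: "nat \<Rightarrow> nat \<Rightarrow> int"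
    and arr :: "nat \<Rightarrow> nat \<Rightarrow> bool"
    and B Buniv :: "nat \<Rightarrow> nat \<Rightarrow> int"
    and vs :: "nat list"
    and P :: "(nat \<times> nat) set"
    and c :: "nat \<times> nat \<Rightarrow> nat \<times> nat \<Rightarrow> nat"
    and idx :: "nat \<times> nat \<Rightarrow> nat"
    and r :: nat
  assumes "finite_type_cartan n a"
    and "connected_diagram n a"
    and "orientation n a arr"
    and "B = exchange_matrix a arr"
    and "source_sweep n B vs"
    and "P = Pi_index n B vs"
    and "r = card P"
    and "compatibility_degree n B vs c"
    and "universal_extension n a arr vs c Buniv idx"
  shows
    "(\<exists>\<phi>. \<phi> \<in> calg_iso
        (config_ring P c) (\<lambda>k. config_class P c (lconst k))
        (invariant_ring n r Buniv) rconst) \<and>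
     (\<exists>\<psi> \<in> calg_iso
        (config_ring P c) (\<lambda>k. config_class P c (lconst k))
        (unit_locus_ring n r Buniv) (\<lambda>k. unit_locus_class n r Buniv (rconst k)).
        \<forall>\<gamma>\<in>P. \<psi> (config_class P c (lvar \<gamma>)) = unit_locus_class n r Buniv (var (idx \<gamma>)))"
proof -
 obtain d :: "nat => real" where d: "ALL i:{1..n}. d i > 0"
  "ALL i:{1..n}. ALL j:{1..n}. d i * of_int (a i j) = d j * of_int (a j i)"
  "ALL v. (EX i:{1..n}. v i ~= 0) --> (SUM i:{1..n}. SUM j:{1..n}. d i * of_int (a i j) * v i * v j) > 0"
  using assms(1) unfolding finite_type_cartan_def by blast
 have a: "ALL i:{1..n}. a i i = 2" "ALL i:{1..n}. ALL j:{1..n}. i ~= j --> a i j <= 0"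
  "ALL i:{1..n}. ALL j:{1..n}. a i j = 0 <-> a j i = 0"
  using assms(1) unfolding finite_type_cartan_def by blast+
 interpret cartan_datum n a d by unfold_locales (use a d in blast)+
 have vs: "distinct vs" "set vs = {1..n}" "source_sequence n B vs" using assms(5) unfolding source_sweep_def by blast+
 have n: "n >= 1" using assms(2) by (simp add: connected_diagram_def)
 have len: "length vs = n" using vs(1,2) distinct_card[of vs] by simp
 have nz: "a i j < 0" "a j i < 0" "i ~= j" "~ arr j i" if "i \<in> {1..n}" "j \<in> {1..n}" "arr i j" for i j
 proof -
  have ij: "i ~= j" "a i j ~= 0" "~ arr j i" using assms(3) that unfolding orientation_def by blast+
  thus "i ~= j" "~ arr j i" "a i j < 0" "a j i < 0"
   using a_nonpos[OF that(1,2)] a_nonpos[OF that(2,1)] a_zero[OF that(1,2)] by auto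
 qed
 have skew: "B i j > 0 <-> B j i < 0" if "i \<in> {1..n}" "j \<in> {1..n}" for i j
  using nz[OF that] nz[OF that(2,1)] unfolding assms(4) exchange_matrix_def by (cases "arr i j"; cases "arr j i") auto
 \<comment> \<open>The sweep condition speaks of signs of \<open>B\<close>; in terms of arrows it
   says that \<open>vs\<close> lists the vertices compatibly with the orientation.\<close>
 have order: "p < q" if pq: "p < n" "q < n" "arr (vs ! p) (vs ! q)" for p q
 proof (rule ccontr)
  assume "~ p < q"
  have v: "vs ! p \<in> {1..n}" "vs ! q \<in> {1..n}" using pq len vs(2) nth_mem by blast+
  have "p ~= q" using nz(3)[OF v pq(3)] by blast
  hence "q < p" using `~ p < q` by simp
  hence "~ B (vs ! p) (vs ! q) > 0"
   using source_sequence_order[OF vs(3,1) _ skew, of q p] vs(2) pq(1) len by simp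
  thus False using nz(1)[OF v pq(3)] pq(3) by (simp add: assms(4) exchange_matrix_def)
 qed
 interpret sweep_datum n a d arr vs by unfold_locales (use assms(3) vs n order in auto)
 interpret universal_datum n a d arr vs c Buniv idx by unfold_locales (use assms in auto)
 have "P = indices" using assms(4,6) Pi_index_eq by simp
 thus ?thesis using config_invariant_iso config_unit_iso assms(7) by blast
qed

end
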